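(* Assume that conditions (A1) and (A2) of the context hold. Let $K$ be a compact subset of $H$. Let $r>0$, $\delta>0$ and $\gamma>0$. There exists $\epsilon_0\in(0,1]$ such that for all $x\in K$ and for all $\epsilon\in(0,\epsilon_0]$ $$P\{X^\epsilon_x\notin B_{C([0,1];H)}(\{\mathcal{I}_x\le r\},\delta)\}\le\exp\left(\frac{-r+\gamma}{\epsilon}\right).$$
   Context: Setting. $(H,\langle\cdot,\cdot\rangle,|\cdot|)$ and $(U,\langle\cdot,\cdot\rangle_U,|\cdot|_U)$ are separable Hilbert spaces; $L(H,H)$ denotes the bounded operators on $H$ and $L_2(U,H)$ the Hilbert–Schmidt operators from $U$ to $H$. $(S(t))_{t\ge0}$ is a strongly continuous semigroup of bounded linear operators on $H$ with generator $A$. $F:[0,1]\times H\to H$ is Borel measurable and $G:H\to L_2(U,H)$; there are $\nu\in L^2([0,1];\mathbb{R})$ and a constant $\Lambda\in(0,\infty)$ such that for all $t\in[0,1]$, $x,y\in H$: $|F(t,x)-F(t,y)|\le\nu(t)|x-y|$, $|F(t,x)|\le\nu(t)(1+|x|)$, $\|G(x)-G(y)\|_{L_2(U,H)}\le\Lambda|x-y|$, $\|G(x)\|_{L_2(U,H)}\le\Lambda(1+|x|)$. $(\Omega,\mathcal{F},P)$ is a probability space with a right continuous filtration $(\mathcal{F}_t)_{t\ge0}$ such that $\mathcal{F}_0$ contains all $P$-null sets of $\mathcal{F}$. $(g_k)$ is an orthonormal basis of $U$, $(\beta_k)$ is an independent sequence of real $(\mathcal{F}_t)$-Brownian motions, and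 $W(t)=\sum_k\beta_k(t)g_k$ is the associated cylindrical Wiener process on $U$. For $\epsilon\in(0,1]$ and $x\in H$, $(X^\epsilon_x(t))_{t\in[0,1]}$ is the (unique) continuous $(\mathcal{F}_t)$-predictable $H$-valued process satisfying, $P$-a.e. for each $t\in[0,1]$, $$X^\epsilon_x(t)=S(\epsilon t)x+\epsilon\int_0^tS(\epsilon(t-u))F(\epsilon u,X^\epsilon_x(u))\,du+\epsilon^{1/2}\int_0^tS(\epsilon(t-u))G(X^\epsilon_x(u))\,dW(u),$$ and $X^\epsilon_x:\Omega\to C([0,1];H)$ is the corresponding trajectory-valued random variable. For $\phi\in L^2([0,1];U)$ and $x\in H$, $z^\phi_x$ is the unique function in $C([0,1];H)$ with $z^\phi_x(t)=x+\int_0^tG(z^\phi_x(s))\phi(s)\,ds$ for all $t\in[0,1]$. For $u\in C([0,1];H)$, $$\mathcal{I}_x(u):=\tfrac12\inf\left\{\int_0^1|\psi(s)|_U^2\,ds:\psi\in L^2([0,1];U),\ u=z^\psi_x\right\},\qquad\inf\emptyset=\infty,$$ and $\{\mathcal{I}_x\le r\}:=\{u\in C([0,1];H):\mathcal{I}_x(u)\le r\}$. For a subset $D$ of a Banach space $E$ and $\delta>0$, $B_E(D,\delta):=\bigcup_{d\in D}\{e\in E:\|e-d\|_E<\delta\}$; $C([0,1];H)$ has the supremum norm. $\Pi_n:U\to U$ is the orthogonal projection onto the span of $\{g_1,\dots,g_n\}$ and $I_U$ is the identity on $U$. (A1): for each $r\in(0,\infty)$, $\sup_{h\in H,|h|<r}\|G(h)(I_U-\Pi_n)\|_{L_2(U,H)}\to0$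 as $n\to\infty$. (A2): for each $a\in(0,1]$ the family of functions $\{t\in[a,1]\mapsto S(\epsilon t)\in L(H,H):\epsilon\in(0,1]\}$ is uniformly equicontinuous, where $L(H,H)$ has the operator norm topology. *)

theory Defs
  imports "HOL-Probability.Probability"
begin

section \<open>Orthonormal bases and Hilbert--Schmidt operators\<close>

text \<open>
  Bases are indexed by a set \<open>J\<close> of natural numbers, so that finite-dimensional spaces are covered
  as well: \<open>J = UNIV\<close> in the infinite-dimensional case, \<open>J = {..<d}\<close> in dimension \<open>d\<close>.
\<close>

definition orthonormal_basis :: "nat set \<Rightarrow> (nat \<Rightarrow> 'u::real_inner) \<Rightarrow> bool" where
  "orthonormal_basis J g \<longleftrightarrow>
     (\<forall>j\<in>J. \<forall>k\<in>J. g j \<bullet> g k = (if j = k then 1 else 0)) \<and> closure (span (g ` J)) = UNIV"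

text \<open>
  For an orthonormal basis \<open>g\<close> the next two notions do not depend on the choice of \<open>g\<close>.
  \<open>hs_norm\<close> is meaningful only for operators satisfying \<open>hilbert_schmidt\<close>.
\<close>

definition hilbert_schmidt ::
    "nat set \<Rightarrow> (nat \<Rightarrow> 'u::real_inner) \<Rightarrow> ('u \<Rightarrow>\<^sub>L 'h::real_inner) \<Rightarrow> bool" where
  "hilbert_schmidt J g T \<longleftrightarrow> (\<lambda>k. (norm (T (g k)))\<^sup>2) summable_on J"

definition hs_norm ::
    "nat set \<Rightarrow> (nat \<Rightarrow> 'u::real_inner) \<Rightarrow> ('u \<Rightarrow>\<^sub>L 'h::real_inner) \<Rightarrow> real" where
  "hs_norm J g T = sqrt (\<Sum>\<^sub>\<infinity>k\<in>J. (norm (T (g k)))\<^sup>2)"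

definition rank_one :: "'h::real_inner \<Rightarrow> 'u::real_inner \<Rightarrow> 'u \<Rightarrow>\<^sub>L 'h" where
  "rank_one h e = blinfun_scaleR_left h o\<^sub>L blinfun_inner_right e"

lemma rank_one_apply [simp]: "rank_one h e u = (e \<bullet> u) *\<^sub>R h"
  by (simp add: rank_one_def)

text \<open>
  Indices start at \<open>0\<close>, so this is the orthogonal projection onto the span of the
  first \<open>n\<close> basis vectors \<open>g 0, \<dots>, g (n - 1)\<close>; see the two lemmas below.
\<close>

definition basis_projection :: "nat set \<Rightarrow> (nat \<Rightarrow> 'u::real_inner) \<Rightarrow> nat \<Rightarrow> 'u \<Rightarrow>\<^sub>L 'u" where
  "basis_projection J g n = (\<Sum>k\<in>J \<inter> {..<n}. rank_one (g k) (g k))"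

lemma basis_projection_apply:
  "basis_projection J g n u = (\<Sum>k\<in>J \<inter> {..<n}. (g k \<bullet> u) *\<^sub>R g k)"
  by (simp add: basis_projection_def blinfun.sum_left)

lemma basis_projection_in_span: "basis_projection J g n u \<in> span (g ` (J \<inter> {..<n}))"
  unfolding basis_projection_apply
  by (intro span_sum span_mul) (auto intro: span_base)

lemma basis_projection_orthogonal:
  assumes "orthonormal_basis J g" "v \<in> span (g ` (J \<inter> {..<n}))"
  shows "(u - basis_projection J g n u) \<bullet> v = 0"
  using assms(2)
proof (induction rule: span_induct_alt)
  case base
  show ?case by simp
next
  case (step c x y)
  then obtain i where i: "i \<in> J \<inter> {..<n}" "x = g i" by auto
  have "basis_projection J g n u \<bullet> g i = (\<Sum>k\<in>J \<inter> {..<n}. (g k \<bullet> u) * (g k \<bullet> g i))"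
    by (simp add: basis_projection_apply inner_sum_left)
  also have "\<dots> = (\<Sum>k\<in>J \<inter> {..<n}. if k = i then g i \<bullet> u else 0)"
    using assms(1) i by (intro sum.cong) (auto simp: orthonormal_basis_def)
  also have "\<dots> = g i \<bullet> u"
    using i by simp
  finally have "(u - basis_projection J g n u) \<bullet> x = 0"
    by (simp add: i(2) inner_diff_left inner_commute[of u "g i"])
  then show ?case
    using step by (simp add: inner_add_right)
qed

section \<open>Semigroups, equicontinuity and function spaces\<close>

definition strongly_continuous_semigroup :: "(real \<Rightarrow> 'h::real_normed_vector \<Rightarrow>\<^sub>L 'h) \<Rightarrow> bool" where
  "strongly_continuous_semigroup S \<longleftrightarrow>
     S 0 = id_blinfun \<and>
     (\<forall>s\<ge>0. \<forall>t\<ge>0. S (s + t) = S s o\<^sub>L S t) \<and>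
     (\<forall>x. continuous_on {0..} (\<lambda>t. S t x))"

definition uniformly_equicontinuous_on ::
    "'a::metric_space set \<Rightarrow> ('a \<Rightarrow> 'b::metric_space) set \<Rightarrow> bool" where
  "uniformly_equicontinuous_on A \<F> \<longleftrightarrow>
     (\<forall>e>0. \<exists>d>0. \<forall>f\<in>\<F>. \<forall>s\<in>A. \<forall>t\<in>A. dist s t < d \<longrightarrow> dist (f s) (f t) < e)"

definition L2_unit_interval :: "(real \<Rightarrow> 'b::{real_normed_vector, second_countable_topology}) set" where
  "L2_unit_interval =
     {f \<in> borel_measurable (lebesgue_on {0..1}). integrable (lebesgue_on {0..1}) (\<lambda>t. (norm (f t))\<^sup>2)}"

text \<open>
  The space \<open>C([0,1]; H)\<close> with the supremum metric; its points are functions that are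
  \<open>undefined\<close> outside the unit interval.
\<close>

abbreviation path_space :: "(real \<Rightarrow> 'h::metric_space) metric" where
  "path_space \<equiv> cfunspace (top_of_set {0..1}) euclidean_metric"

definition neighbourhood_of :: "'b metric \<Rightarrow> 'b set \<Rightarrow> real \<Rightarrow> 'b set" where
  "neighbourhood_of m D \<delta> = (\<Union>d\<in>D. mball_of m d \<delta>)"

section \<open>Filtrations, Brownian motions and stochastic integrals\<close>

definition usual_filtration :: "'a measure \<Rightarrow> (real \<Rightarrow> 'a measure) \<Rightarrow> bool" where
  "usual_filtration M Fil \<longleftrightarrow>
     (\<forall>t\<ge>0. subalgebra M (Fil t)) \<and>
     (\<forall>s\<ge>0. \<forall>t\<ge>s. sets (Fil s) \<subseteq> sets (Fil t)) \<and>
     (\<forall>t\<ge>0. sets (Fil t) = (\<Inter>s\<in>{t<..}. sets (Fil s))) \<and>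
     null_sets M \<subseteq> sets (Fil 0)"

definition brownian_motion_wrt ::
    "'a measure \<Rightarrow> (real \<Rightarrow> 'a measure) \<Rightarrow> (real \<Rightarrow> 'a \<Rightarrow> real) \<Rightarrow> bool" where
  "brownian_motion_wrt M Fil b \<longleftrightarrow>
     (\<forall>t\<ge>0. b t \<in> borel_measurable (Fil t)) \<and>
     (AE \<omega> in M. b 0 \<omega> = 0) \<and>
     (AE \<omega> in M. continuous_on {0..} (\<lambda>t. b t \<omega>)) \<and>
     (\<forall>s\<ge>0. \<forall>t>s.
        distributed M lborel (\<lambda>\<omega>. b t \<omega> - b s \<omega>) (normal_density 0 (sqrt (t - s))) \<and>
        prob_space.indep_set M (sets (Fil s))
          (sets (vimage_algebra (space M) (\<lambda>\<omega>. b t \<omega> - b s \<omega>) borel)))"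

text \<open>The coordinates of a cylindrical Wiener process \<open>\<Sum>k\<in>J. \<beta>\<^sub>k(t) g\<^sub>k\<close>.\<close>

definition independent_brownian_motions ::
    "'a measure \<Rightarrow> (real \<Rightarrow> 'a measure) \<Rightarrow> nat set \<Rightarrow> (nat \<Rightarrow> real \<Rightarrow> 'a \<Rightarrow> real) \<Rightarrow> bool" where
  "independent_brownian_motions M Fil J \<beta> \<longleftrightarrow>
     (\<forall>k\<in>J. brownian_motion_wrt M Fil (\<beta> k)) \<and>
     prob_space.indep_vars M (\<lambda>_. PiM {0..} (\<lambda>_. borel)) (\<lambda>k \<omega>. \<lambda>t\<in>{0..}. \<beta> k t \<omega>) J"

definition predictable_sigma :: "'a measure \<Rightarrow> (real \<Rightarrow> 'a measure) \<Rightarrow> real \<Rightarrow> (real \<times> 'a) measure" where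
  "predictable_sigma M Fil T = sigma ({0..T} \<times> space M)
     ({{0} \<times> A |A. A \<in> sets (Fil 0)} \<union>
      {{s<..t} \<times> A |s t A. 0 \<le> s \<and> s < t \<and> t \<le> T \<and> A \<in> sets (Fil s)})"

definition predictable ::
    "'a measure \<Rightarrow> (real \<Rightarrow> 'a measure) \<Rightarrow> real \<Rightarrow> (real \<Rightarrow> 'a \<Rightarrow> 'b::topological_space) \<Rightarrow> bool" where
  "predictable M Fil T Y \<longleftrightarrow> (\<lambda>(t, \<omega>). Y t \<omega>) \<in> borel_measurable (predictable_sigma M Fil T)"

text \<open>
  A list entry \<open>(a, b, A, k, h)\<close> stands for the elementary integrand
  \<open>(s, \<omega>) \<mapsto> 1\<^bsub>(a,b]\<^esub>(s) 1\<^bsub>A\<^esub>(\<omega>) h \<otimes> g\<^sub>k\<close>, where \<open>h \<otimes> g\<^sub>k\<close> maps \<open>u\<close> to \<open>\<langle>g\<^sub>k, u\<rangle> h\<close>;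
  its integral against the cylindrical Wiener process is \<open>1\<^bsub>A\<^esub> (\<beta>\<^sub>k(b) - \<beta>\<^sub>k(a)) h\<close>.
\<close>

type_synonym ('a, 'h) elementary = "(real \<times> real \<times> 'a set \<times> nat \<times> 'h) list"

definition is_elementary ::
    "(real \<Rightarrow> 'a measure) \<Rightarrow> nat set \<Rightarrow> real \<Rightarrow> ('a, 'h) elementary \<Rightarrow> bool" where
  "is_elementary Fil J T es \<longleftrightarrow>
     (\<forall>(a, b, A, k, h)\<in>set es. 0 \<le> a \<and> a \<le> b \<and> b \<le> T \<and> A \<in> sets (Fil a) \<and> k \<in> J)"

definition elementary_process ::
    "(nat \<Rightarrow> 'u::real_inner) \<Rightarrow> ('a, 'h::real_inner) elementary \<Rightarrow> real \<Rightarrow> 'a \<Rightarrow> 'u \<Rightarrow>\<^sub>L 'h" where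
  "elementary_process g es s \<omega> =
     (\<Sum>(a, b, A, k, h)\<leftarrow>es. (indicator {a<..b} s * indicator A \<omega>) *\<^sub>R rank_one h (g k))"

definition elementary_integral ::
    "(nat \<Rightarrow> real \<Rightarrow> 'a \<Rightarrow> real) \<Rightarrow> ('a, 'h::real_vector) elementary \<Rightarrow> 'a \<Rightarrow> 'h" where
  "elementary_integral \<beta> es \<omega> =
     (\<Sum>(a, b, A, k, h)\<leftarrow>es. (indicator A \<omega> * (\<beta> k b \<omega> - \<beta> k a \<omega>)) *\<^sub>R h)"

text \<open>
  \<open>I\<close> is a version of the Ito integral of \<open>\<Phi>\<close> over \<open>[0,T]\<close> with respect to the cylindrical Wiener
  process with coordinates \<open>\<beta>\<close>. The integrand is predictable, Hilbert--Schmidt valued and almost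
  surely square integrable in time; the integral is the limit in probability of the integrals of
  elementary integrands \<open>\<Phi>\<^sub>n\<close> with \<open>\<integral>\<^sub>0\<^sup>T \<parallel>\<Phi> - \<Phi>\<^sub>n\<parallel>\<^sup>2 ds \<rightarrow> 0\<close> in probability, the
  norm being the Hilbert--Schmidt norm. It is determined up to null sets.
\<close>

definition has_ito_integral ::
    "'a measure \<Rightarrow> (real \<Rightarrow> 'a measure) \<Rightarrow> nat set \<Rightarrow> (nat \<Rightarrow> 'u::real_inner) \<Rightarrow>
     (nat \<Rightarrow> real \<Rightarrow> 'a \<Rightarrow> real) \<Rightarrow> real \<Rightarrow>
     (real \<Rightarrow> 'a \<Rightarrow> 'u \<Rightarrow>\<^sub>L 'h::{real_inner, second_countable_topology}) \<Rightarrow> ('a \<Rightarrow> 'h) \<Rightarrow> bool" where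
  "has_ito_integral M Fil J g \<beta> T \<Phi> I \<longleftrightarrow>
     (\<forall>k\<in>J. predictable M Fil T (\<lambda>s \<omega>. \<Phi> s \<omega> (g k))) \<and>
     (\<forall>s\<in>{0..T}. \<forall>\<omega>\<in>space M. hilbert_schmidt J g (\<Phi> s \<omega>)) \<and>
     (AE \<omega> in M. (\<integral>\<^sup>+s\<in>{0..T}. ennreal ((hs_norm J g (\<Phi> s \<omega>))\<^sup>2) \<partial>lborel) < \<infinity>) \<and>
     I \<in> borel_measurable M \<and>
     (\<exists>es. (\<forall>n. is_elementary Fil J T (es n)) \<and>
        (\<forall>\<eta>>0. (\<lambda>n. measure M {\<omega>\<in>space M.
            (\<integral>\<^sup>+s\<in>{0..T}. ennreal ((hs_norm J g (\<Phi> s \<omega> - elementary_process g (es n) s \<omega>))\<^sup>2) \<partial>lborel)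
              > ennreal \<eta>}) \<longlonglongrightarrow> 0) \<and>
        (\<forall>\<eta>>0. (\<lambda>n. measure M {\<omega>\<in>space M.
            norm (I \<omega> - elementary_integral \<beta> (es n) \<omega>) > \<eta>}) \<longlonglongrightarrow> 0))"

section \<open>The mild equation and the rate function\<close>

definition small_time_mild_solution ::
    "'a measure \<Rightarrow> (real \<Rightarrow> 'a measure) \<Rightarrow> nat set \<Rightarrow> (nat \<Rightarrow> 'u::real_inner) \<Rightarrow>
     (nat \<Rightarrow> real \<Rightarrow> 'a \<Rightarrow> real) \<Rightarrow> (real \<Rightarrow> 'h \<Rightarrow>\<^sub>L 'h) \<Rightarrow> (real \<Rightarrow> 'h \<Rightarrow> 'h) \<Rightarrow> ('h \<Rightarrow> 'u \<Rightarrow>\<^sub>L 'h) \<Rightarrow>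
     real \<Rightarrow> 'h::{real_inner, banach, second_countable_topology} \<Rightarrow> (real \<Rightarrow> 'a \<Rightarrow> 'h) \<Rightarrow> bool" where
  "small_time_mild_solution M Fil J g \<beta> S F G \<epsilon> x X \<longleftrightarrow>
     predictable M Fil 1 X \<and>
     (\<forall>\<omega>\<in>space M. continuous_on {0..1} (\<lambda>t. X t \<omega>)) \<and>
     (\<forall>t\<in>{0..1}. \<exists>I.
        has_ito_integral M Fil J g \<beta> t (\<lambda>u \<omega>. S (\<epsilon> * (t - u)) o\<^sub>L G (X u \<omega>)) I \<and>
        (AE \<omega> in M. X t \<omega> = S (\<epsilon> * t) x
           + \<epsilon> *\<^sub>R (LINT u:{0..t}|lborel. S (\<epsilon> * (t - u)) (F (\<epsilon> * u) (X u \<omega>)))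
           + sqrt \<epsilon> *\<^sub>R I \<omega>))"

text \<open>\<open>is_skeleton G x \<phi> z\<close> says that \<open>z\<close> is the path \<open>z\<^sub>x\<^sup>\<phi>\<close> controlled by \<open>\<phi>\<close>.\<close>

definition is_skeleton ::
    "('h \<Rightarrow> 'u::real_normed_vector \<Rightarrow>\<^sub>L 'h) \<Rightarrow> 'h::{real_normed_vector, banach, second_countable_topology} \<Rightarrow>
     (real \<Rightarrow> 'u) \<Rightarrow> (real \<Rightarrow> 'h) \<Rightarrow> bool" where
  "is_skeleton G x \<phi> z \<longleftrightarrow>
     z \<in> mspace path_space \<and>
     (\<forall>t\<in>{0..1}. z t = x + (LINT s:{0..t}|lebesgue. G (z s) (\<phi> s)))"

definition rate_function ::
    "('h \<Rightarrow> 'u::{real_inner, second_countable_topology} \<Rightarrow>\<^sub>L 'h) \<Rightarrow>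
     'h::{real_inner, banach, second_countable_topology} \<Rightarrow> (real \<Rightarrow> 'h) \<Rightarrow> ereal" where
  "rate_function G x u = ereal (1/2) *
     Inf {ereal (LINT s|lebesgue_on {0..1}. (norm (\<psi> s))\<^sup>2) |\<psi>.
            \<psi> \<in> L2_unit_interval \<and> is_skeleton G x \<psi> u}"

definition rate_sublevel ::
    "('h \<Rightarrow> 'u::{real_inner, second_countable_topology} \<Rightarrow>\<^sub>L 'h) \<Rightarrow>
     'h::{real_inner, banach, second_countable_topology} \<Rightarrow> real \<Rightarrow> (real \<Rightarrow> 'h) set" where
  "rate_sublevel G x r = {u \<in> mspace path_space. rate_function G x u \<le> ereal r}"

end

theory Submission
  imports Defs
begin

text \<open>
  The idea is to compare the solution on the dyadic grid of mesh \<open>1/m\<close> with the skeleton path driven by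
  the piecewise constant control whose integral over each grid interval is the increment of the first \<open>n\<close>
  coordinates of \<open>\<surd>\<epsilon> W\<close>. Half the energy of this control is \<open>\<epsilon>/2\<close> times a chi-square variable with
  finitely many degrees of freedom, so it exceeds \<open>r\<close> with probability about \<open>exp (- r/\<epsilon>)\<close>. The remaining
  errors are controlled by a Gaussian tail bound for stochastic integrals with values in a Hilbert space:
  the integral exceeds \<open>l\<close> while its energy stays below \<open>\<kappa>\<close> with probability at most
  \<open>2 exp (- l\<^sup>2/(4 \<kappa>))\<close>. It follows from the method of mixtures, that is, by integrating the exponential
  supermartingale over a Gaussian direction. By (A2) and the semigroup law,
  \<open>\<parallel>S(\<tau> + \<sigma>) - S \<tau>\<parallel>\<^sup>2 \<le> C \<surd>(\<sigma>/\<tau>)\<close>, which makes the energy of the increments of the stochastic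
  convolution Hoelder continuous, so that chaining over dyadic times bounds its modulus of continuity.
\<close>

text \<open>Uniformity in \<epsilon> and the weak form of the hypotheses shape the proof. As
  \<epsilon> tends to 0, \<open>S (\<epsilon> * t)\<close> tends to the identity in general only
  strongly, so it can be replaced by the identity only on a compact set fixed before \<epsilon>;
  this is why the control has finitely many coordinates on a fixed grid and why an Euler scheme with
  values in a compact set stands between solution and skeleton. The energy estimates depend on
  ratios of times, in which \<epsilon> cancels, so every error event gets a bound with exponent
  \<open>- r / \<epsilon>\<close> and a prefactor free of \<epsilon>; \<gamma> pays for the
  prefactors and for the loss in the chi-square tail. On the probabilistic side each Brownian motion
  is independent of the past only by itself, and the coordinates are independent of each other only
  unconditionally, so the joint exponential supermartingale has to be built from moments. The
  solution is not bounded a priori: each energy bound assumes that it has stayed in a ball so far,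
  and a first exit argument along each fixed path removes this.\<close>

section \<open>Comparison of measures and elementary inequalities\<close>

text \<open>Stands in for the statement that the conditional expectation of \<open>f\<close> is at
  most \<open>c\<close>. The hypothesis compares two measures on \<open>F\<close>, the density
  \<open>f\<close> restricted to \<open>F\<close> and \<open>c\<close> times the restriction of
  \<open>M\<close>, and the integral of \<open>Y\<close> is monotone in the measure. It is the
  conditioning step of the exponential bounds below.\<close>

lemma nn_integral_subalgebra_le:
  assumes sub: "subalgebra M F" and f[measurable]: "f \<in> borel_measurable M"
    and le: "\<And>A. A \<in> sets F \<Longrightarrow> (\<integral>\<^sup>+\<omega>. f \<omega> * indicator A \<omega> \<partial>M) \<le> c * emeasure M A"
    and Y: "Y \<in> borel_measurable F"
  shows "(\<integral>\<^sup>+\<omega>. f \<omega> * Y \<omega> \<partial>M) \<le> c * (\<integral>\<^sup>+\<omega>. Y \<omega> \<partial>M)"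
proof -
  have YM[measurable]: "Y \<in> borel_measurable M" using measurable_from_subalg[OF sub Y] .
  have sub': "subalgebra (density M f) F" using sub by (auto simp: subalgebra_def)
  have Y': "Y \<in> borel_measurable (restr_to_subalg M F)" by (rule measurable_in_subalg[OF sub Y])
  have "restr_to_subalg (density M f) F \<le> scale_measure c (restr_to_subalg M F)"
  proof (subst le_measure)
    show "sets (restr_to_subalg (density M f) F) = sets (scale_measure c (restr_to_subalg M F))"
      using sub sub' by (simp add: sets_restr_to_subalg)
    show "\<forall>A\<in>sets (restr_to_subalg (density M f) F).
        emeasure (restr_to_subalg (density M f) F) A \<le> emeasure (scale_measure c (restr_to_subalg M F)) A"
    proof
      fix A assume "A \<in> sets (restr_to_subalg (density M f) F)"
      then have A: "A \<in> sets F" by (simp add: sets_restr_to_subalg[OF sub'])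
      then have "A \<in> sets M" using sub by (auto simp: subalgebra_def)
      then show "emeasure (restr_to_subalg (density M f) F) A \<le> emeasure (scale_measure c (restr_to_subalg M F)) A"
        using le[OF A] A sub sub' by (simp add: emeasure_restr_to_subalg emeasure_density)
    qed
  qed
  then have "(\<integral>\<^sup>+\<omega>. Y \<omega> \<partial>restr_to_subalg (density M f) F) \<le> (\<integral>\<^sup>+\<omega>. Y \<omega> \<partial>scale_measure c (restr_to_subalg M F))"
    using sub sub' by (intro nn_integral_mono_measure) (simp add: sets_restr_to_subalg)
  also have "\<dots> = c * (\<integral>\<^sup>+\<omega>. Y \<omega> \<partial>restr_to_subalg M F)"
    by (rule nn_integral_scale_measure[OF Y'])
  also have "(\<integral>\<^sup>+\<omega>. Y \<omega> \<partial>restr_to_subalg (density M f) F) = (\<integral>\<^sup>+\<omega>. Y \<omega> \<partial>density M f)"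
    using Y by (intro nn_integral_subalgebra2[OF sub'])
  also have "(\<integral>\<^sup>+\<omega>. Y \<omega> \<partial>restr_to_subalg M F) = (\<integral>\<^sup>+\<omega>. Y \<omega> \<partial>M)"
    using Y by (intro nn_integral_subalgebra2[OF sub])
  finally show ?thesis by (simp add: nn_integral_density)
qed

text \<open>The mixed terms vanish, so the second moment grows like the number of summands and not
  like its square. This makes the variance of a discrete quadratic covariation vanish with the
  mesh.\<close>

lemma integral_square_orthogonal_sum:
  fixes W :: "'i \<Rightarrow> 'a \<Rightarrow> real" and v :: real
  assumes "finite I" "\<And>i j. i \<in> I \<Longrightarrow> j \<in> I \<Longrightarrow> integrable M (\<lambda>\<omega>. W i \<omega> * W j \<omega>)"
    and "\<And>i j. i \<in> I \<Longrightarrow> j \<in> I \<Longrightarrow> i \<noteq> j \<Longrightarrow> (\<integral>\<omega>. W i \<omega> * W j \<omega> \<partial>M) = 0"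
    and "\<And>i. i \<in> I \<Longrightarrow> (\<integral>\<omega>. (W i \<omega>)\<^sup>2 \<partial>M) \<le> v"
  shows "integrable M (\<lambda>\<omega>. (\<Sum>i\<in>I. W i \<omega>)\<^sup>2)" "(\<integral>\<omega>. (\<Sum>i\<in>I. W i \<omega>)\<^sup>2 \<partial>M) \<le> card I * v"
proof -
  have eq: "(\<Sum>i\<in>I. W i \<omega>)\<^sup>2 = (\<Sum>i\<in>I. \<Sum>j\<in>I. W i \<omega> * W j \<omega>)" for \<omega>
    by (simp add: power2_eq_square sum_product)
  show "integrable M (\<lambda>\<omega>. (\<Sum>i\<in>I. W i \<omega>)\<^sup>2)"
    unfolding eq using assms(2) by (intro Bochner_Integration.integrable_sum)
  have "(\<integral>\<omega>. (\<Sum>i\<in>I. W i \<omega>)\<^sup>2 \<partial>M) = (\<Sum>i\<in>I. \<Sum>j\<in>I. \<integral>\<omega>. W i \<omega> * W j \<omega> \<partial>M)"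
    unfolding eq using assms(2)
    by (subst Bochner_Integration.integral_sum; (intro Bochner_Integration.integrable_sum)?)
      (auto intro!: sum.cong Bochner_Integration.integral_sum)
  also have "\<dots> = (\<Sum>i\<in>I. \<Sum>j\<in>I. if j = i then (\<integral>\<omega>. (W i \<omega>)\<^sup>2 \<partial>M) else 0)"
    using assms(3) by (intro sum.cong refl) (auto simp: power2_eq_square)
  also have "\<dots> = (\<Sum>i\<in>I. \<integral>\<omega>. (W i \<omega>)\<^sup>2 \<partial>M)" using assms(1) by simp
  also have "\<dots> \<le> card I * v" using sum_mono[of I, OF assms(4)] by simp
  finally show "(\<integral>\<omega>. (\<Sum>i\<in>I. W i \<omega>)\<^sup>2 \<partial>M) \<le> card I * v" .
qed

text \<open>The factors \<open>1 + x\<close> of a discrete exponential may be negative. Taking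
  absolute values costs a fourth power only, since for \<open>x < -1\<close> the deficit
  \<open>-2 (1 + x)\<close> is at most \<open>2 x^4\<close>. The right-hand side has no quadratic
  term, which would bring in mixed products of coordinates.\<close>

lemma abs_one_plus_le:
  fixes x :: real
  shows "\<bar>1 + x\<bar> \<le> 1 + x + 2 * x ^ 4"
proof (cases "x \<ge> -1")
  case False
  then have "1 \<le> x\<^sup>2" "-x \<le> x\<^sup>2"
    using mult_mono[of 1 "-x" 1 "-x"] mult_mono[of 1 "-x" "-x" "-x"] by (auto simp: power2_eq_square)
  moreover have "x\<^sup>2 * 1 \<le> x\<^sup>2 * x\<^sup>2" using \<open>1 \<le> x\<^sup>2\<close> by (intro mult_left_mono) auto
  ultimately have "-x \<le> x ^ 4" by (simp flip: power_add)
  then show ?thesis using False by simp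
qed simp

text \<open>The difference of the two sides is monotone on each side of 0. The remainder carries an
  absolute value, so the two signs of \<open>x\<close> are treated separately.\<close>

lemma ln_one_plus_ge_cubic:
  fixes x :: real
  assumes "\<bar>x\<bar> \<le> 1/2"
  shows "x - x\<^sup>2 / 2 - \<bar>x\<bar> ^ 3 \<le> ln (1 + x)"
proof (cases "x \<ge> 0")
  case True
  define f where "f = (\<lambda>x::real. ln (1 + x) - x + x\<^sup>2 / 2 + x ^ 3)"
  have "f 0 \<le> f x"
  proof (rule DERIV_nonneg_imp_nondecreasing[OF True])
    fix y assume y: "0 \<le> y" "y \<le> x"
    have "(f has_real_derivative 1 / (1 + y) - 1 + y + 3 * y\<^sup>2) (at y)"
      unfolding f_def using y by (auto intro!: derivative_eq_intros simp: power2_eq_square)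
    moreover have "1 / (1 + y) - 1 + y + 3 * y\<^sup>2 = (4 * y\<^sup>2 + 3 * y^3) / (1 + y)"
      using y by (simp add: field_simps power2_eq_square power3_eq_cube)
    moreover have "0 \<le> (4 * y\<^sup>2 + 3 * y^3) / (1 + y)" using y by simp
    ultimately show "\<exists>d. (f has_real_derivative d) (at y) \<and> 0 \<le> d" by metis
  qed
  then show ?thesis using True by (simp add: f_def)
next
  case False
  define f where "f = (\<lambda>x::real. ln (1 + x) - x + x\<^sup>2 / 2 - x ^ 3)"
  have "f x \<ge> f 0"
  proof (rule DERIV_nonpos_imp_nonincreasing[where a = x and b = 0])
    fix y assume y: "x \<le> y" "y \<le> 0"
    have y2: "-1/2 \<le> y" using y assms by linarith
    have "(f has_real_derivative 1 / (1 + y) - 1 + y - 3 * y\<^sup>2) (at y)"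
      unfolding f_def using y2 by (auto intro!: derivative_eq_intros simp: power2_eq_square)
    moreover have "1 / (1 + y) - 1 + y - 3 * y\<^sup>2 = y\<^sup>2 * (- 2 - 3 * y) / (1 + y)"
      using y2 by (simp add: field_simps power2_eq_square)
    moreover have "y\<^sup>2 * (- 2 - 3 * y) / (1 + y) \<le> 0" using y2
      by (intro divide_nonpos_pos mult_nonneg_nonpos) auto
    ultimately show "\<exists>d. (f has_real_derivative d) (at y) \<and> d \<le> 0" by metis
  qed (use False in auto)
  moreover have "\<bar>x\<bar> ^ 3 = - (x ^ 3)" using False by (simp add: power3_eq_cube)
  ultimately show ?thesis by (simp add: f_def)
qed

text \<open>Cauchy--Schwarz twice, for the sum and then for the sum of squares.\<close>

lemma sum_power4_le:
  fixes f :: "'i \<Rightarrow> real"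
  shows "(\<Sum>i\<in>I. f i) ^ 4 \<le> real (card I) ^ 3 * (\<Sum>i\<in>I. f i ^ 4)"
proof -
  have e: "y ^ 4 = (y\<^sup>2)\<^sup>2" for y :: real by (simp add: power4_eq_xxxx power2_eq_square)
  have "(\<Sum>i\<in>I. f i) ^ 4 \<le> ((\<Sum>i\<in>I. (f i)\<^sup>2) * card I)\<^sup>2"
    unfolding e by (rule power_mono[OF sum_squared_le_sum_of_squares]) simp
  also have "\<dots> = (\<Sum>i\<in>I. (f i)\<^sup>2)\<^sup>2 * (real (card I))\<^sup>2" by (simp add: power_mult_distrib)
  also have "\<dots> \<le> ((\<Sum>i\<in>I. ((f i)\<^sup>2)\<^sup>2) * card I) * (real (card I))\<^sup>2"
    by (rule mult_right_mono[OF sum_squared_le_sum_of_squares]) simp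
  also have "\<dots> = real (card I) ^ 3 * (\<Sum>i\<in>I. f i ^ 4)"
    unfolding e by (simp only: power2_eq_square power3_eq_cube mult_ac)
  finally show ?thesis .
qed

section \<open>Brownian increments relative to the filtration\<close>

locale wiener_filtration = prob_space M for M :: "'a measure" +
  fixes Fil :: "real \<Rightarrow> 'a measure" and J :: "nat set" and \<beta> :: "nat \<Rightarrow> real \<Rightarrow> 'a \<Rightarrow> real"
  assumes filtration: "usual_filtration M Fil"
    and noise: "independent_brownian_motions M Fil J \<beta>"
begin

lemma subalg: "0 \<le> t \<Longrightarrow> subalgebra M (Fil t)"
  using filtration unfolding usual_filtration_def by blast

lemma sets_Fil: "0 \<le> t \<Longrightarrow> A \<in> sets (Fil t) \<Longrightarrow> A \<in> sets M"
  using subalg by (auto simp: subalgebra_def)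

lemma space_Fil: "0 \<le> t \<Longrightarrow> space (Fil t) = space M"
  using subalg by (auto simp: subalgebra_def)

lemma sets_Fil_mono: "0 \<le> s \<Longrightarrow> s \<le> t \<Longrightarrow> A \<in> sets (Fil s) \<Longrightarrow> A \<in> sets (Fil t)"
  using filtration unfolding usual_filtration_def by blast

lemma subalg_Fil: "0 \<le> s \<Longrightarrow> s \<le> t \<Longrightarrow> subalgebra (Fil t) (Fil s)"
  using sets_Fil_mono space_Fil[of s] space_Fil[of t] by (auto simp: subalgebra_def)

lemma measurable_Fil_mono: "0 \<le> s \<Longrightarrow> s \<le> t \<Longrightarrow> f \<in> measurable (Fil s) N \<Longrightarrow> f \<in> measurable (Fil t) N"
  using measurable_from_subalg subalg_Fil by blast

lemma measurable_Fil_M: "0 \<le> t \<Longrightarrow> f \<in> measurable (Fil t) N \<Longrightarrow> f \<in> measurable M N"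
  using measurable_from_subalg subalg by blast

lemma beta_Fil: "k \<in> J \<Longrightarrow> 0 \<le> t \<Longrightarrow> \<beta> k t \<in> borel_measurable (Fil t)"
  using noise unfolding independent_brownian_motions_def brownian_motion_wrt_def by blast

lemma beta_measurable: "k \<in> J \<Longrightarrow> 0 \<le> t \<Longrightarrow> \<beta> k t \<in> borel_measurable M"
  using beta_Fil measurable_Fil_M by blast

lemma increment_Fil:
  assumes "k \<in> J" "0 \<le> s" "0 \<le> t" "s \<le> u" "t \<le> u"
  shows "(\<lambda>\<omega>. \<beta> k t \<omega> - \<beta> k s \<omega>) \<in> borel_measurable (Fil u)"
proof -
  have "\<beta> k t \<in> borel_measurable (Fil u)" "\<beta> k s \<in> borel_measurable (Fil u)"
    using assms by (auto intro: measurable_Fil_mono[OF _ _ beta_Fil])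
  then show ?thesis by simp
qed

lemma increment_indep:
  assumes k: "k \<in> J" and s: "0 \<le> s" "s < t" and X: "X \<in> borel_measurable (Fil s)"
  shows "indep_var borel X borel (\<lambda>\<omega>. \<beta> k t \<omega> - \<beta> k s \<omega>)"
proof -
  let ?d = "\<lambda>\<omega>. \<beta> k t \<omega> - \<beta> k s \<omega>"
  have d: "?d \<in> borel_measurable M" using k s by (intro borel_measurable_diff beta_measurable) auto
  have XM: "X \<in> borel_measurable M" using X s measurable_Fil_M by blast
  have "indep_set (sets (Fil s)) (sets (vimage_algebra (space M) ?d borel))"
    using noise k s unfolding independent_brownian_motions_def brownian_motion_wrt_def by blast
  moreover have "sigma_sets (space M) {X -` A \<inter> space M |A. A \<in> sets borel} \<subseteq> sets (Fil s)"
    unfolding space_Fil[OF s(1), symmetric]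
    by (rule sets.sigma_sets_subset) (auto intro: measurable_sets[OF X])
  moreover have "sigma_sets (space M) {?d -` A \<inter> space M |A. A \<in> sets borel}
      \<subseteq> sets (vimage_algebra (space M) ?d borel)"
    by (simp add: sets_vimage_algebra sigma_sets_mono)
  ultimately have "indep_set (sigma_sets (space M) {X -` A \<inter> space M |A. A \<in> sets borel})
      (sigma_sets (space M) {?d -` A \<inter> space M |A. A \<in> sets borel})"
    unfolding indep_set_def by - (erule indep_sets_mono_sets, auto split: bool.split)
  then show ?thesis using XM d by (simp add: indep_var_eq)
qed

lemma increment_distributed:
  "k \<in> J \<Longrightarrow> 0 \<le> s \<Longrightarrow> s < t \<Longrightarrow>
    distributed M lborel (\<lambda>\<omega>. \<beta> k t \<omega> - \<beta> k s \<omega>) (normal_density 0 (sqrt (t - s)))"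
  using noise unfolding independent_brownian_motions_def brownian_motion_wrt_def by blast

lemma increment_moments:
  assumes "k \<in> J" "0 \<le> s" "s < t"
  defines "d \<equiv> \<lambda>\<omega>. \<beta> k t \<omega> - \<beta> k s \<omega>"
  shows "integrable M (\<lambda>\<omega>. d \<omega> ^ p)" "expectation d = 0" "expectation (\<lambda>\<omega>. (d \<omega>)\<^sup>2) = t - s"
    "expectation (\<lambda>\<omega>. d \<omega> ^ 4) = 3 * (t - s)\<^sup>2"
proof -
  note D = increment_distributed[OF assms(1-3), folded d_def]
  have s: "sqrt (t - s) > 0" using assms by simp
  have *: "(\<integral>\<omega>. d \<omega> ^ p \<partial>M) = (\<integral>x. normal_density 0 (sqrt (t - s)) x * x ^ p \<partial>lborel)" for p
    using distributed_integral[OF D, of "\<lambda>x. x ^ p"] by simp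
  show "integrable M (\<lambda>\<omega>. d \<omega> ^ p)"
    using distributed_integrable[OF D, of "\<lambda>x. x ^ p"] integrable_normal_moment[OF s, of 0 p] by simp
  show "expectation d = 0"
    using *[of 1] integral_normal_moment_odd[OF s, of 0 0] by simp
  show "expectation (\<lambda>\<omega>. (d \<omega>)\<^sup>2) = t - s"
    using *[of 2] integral_normal_moment_even[OF s, of 0 1] assms by (simp add: fact_numeral)
  show "expectation (\<lambda>\<omega>. d \<omega> ^ 4) = 3 * (t - s)\<^sup>2"
    using *[of 4] integral_normal_moment_even[OF s, of 0 2] assms
    by (simp add: fact_numeral power_divide power2_eq_square)
qed

text \<open>Projects the independent family of paths to two coordinates. This is independence
  between whole processes, with no conditioning on the filtration.\<close>

lemma processes_indep:
  assumes "k \<in> J" "l \<in> J" "k \<noteq> l"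
    and f: "f \<in> borel_measurable (PiM {0..} (\<lambda>_. borel))" and h: "h \<in> borel_measurable (PiM {0..} (\<lambda>_. borel))"
  shows "indep_var borel (\<lambda>\<omega>. f (\<lambda>t\<in>{0..}. \<beta> k t \<omega>)) borel (\<lambda>\<omega>. h (\<lambda>t\<in>{0..}. \<beta> l t \<omega>))"
proof -
  let ?P = "\<lambda>_::nat. PiM {0::real..} (\<lambda>_. borel :: real measure)"
  let ?X = "\<lambda>k \<omega>. \<lambda>t\<in>{0..}. \<beta> k t \<omega>"
  have "indep_vars ?P ?X J" using noise by (simp add: independent_brownian_motions_def)
  then have *: "indep_var (PiM {k} ?P) (\<lambda>\<omega>. restrict (\<lambda>i. ?X i \<omega>) {k}) (PiM {l} ?P) (\<lambda>\<omega>. restrict (\<lambda>i. ?X i \<omega>) {l})"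
    by (rule indep_var_restrict) (use assms(1-3) in simp_all)
  have f': "(\<lambda>p. f (p k)) \<in> borel_measurable (PiM {k} ?P)"
    using measurable_compose[OF measurable_component_singleton[of k "{k}" ?P] f] by simp
  have h': "(\<lambda>p. h (p l)) \<in> borel_measurable (PiM {l} ?P)"
    using measurable_compose[OF measurable_component_singleton[of l "{l}" ?P] h] by simp
  show ?thesis
    using indep_var_compose[OF * f' h'] by (simp add: comp_def)
qed

context
  fixes s h :: real
  assumes s: "0 \<le> s" and h: "0 < h"
begin

definition D :: "nat \<Rightarrow> nat \<Rightarrow> 'a \<Rightarrow> real" where
  "D k i \<omega> = \<beta> k (s + real (Suc i) * h) \<omega> - \<beta> k (s + real i * h) \<omega>"

lemma grid_nonneg: "0 \<le> s + real i * h" using s h by simp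

lemma grid_less: "i < j \<Longrightarrow> s + real (Suc i) * h \<le> s + real j * h" using h by simp

lemma D_Fil: "k \<in> J \<Longrightarrow> i < j \<Longrightarrow> D k i \<in> borel_measurable (Fil (s + real j * h))"
  unfolding D_def using grid_nonneg grid_less[of i j] h
  by (intro increment_Fil) (auto simp: algebra_simps simp del: of_nat_Suc)

lemma D_measurable[measurable]: "k \<in> J \<Longrightarrow> D k i \<in> borel_measurable M"
  using measurable_Fil_M[OF grid_nonneg D_Fil[of k i "Suc i"]] by simp

lemma D_moments:
  assumes "k \<in> J"
  shows "integrable M (\<lambda>\<omega>. D k i \<omega> ^ p)" "expectation (D k i) = 0" "expectation (\<lambda>\<omega>. (D k i \<omega>)\<^sup>2) = h"
    "expectation (\<lambda>\<omega>. D k i \<omega> ^ 4) = 3 * h\<^sup>2"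
proof -
  have eq: "D k i = (\<lambda>\<omega>. \<beta> k (s + real (Suc i) * h) \<omega> - \<beta> k (s + real i * h) \<omega>)" by (auto simp: D_def)
  have lt: "s + real i * h < s + real (Suc i) * h" and d: "s + real (Suc i) * h - (s + real i * h) = h"
    using h by (auto simp: algebra_simps)
  show "integrable M (\<lambda>\<omega>. D k i \<omega> ^ p)" "expectation (D k i) = 0" "expectation (\<lambda>\<omega>. (D k i \<omega>)\<^sup>2) = h"
    "expectation (\<lambda>\<omega>. D k i \<omega> ^ 4) = 3 * h\<^sup>2"
    using increment_moments[OF assms grid_nonneg lt] unfolding eq d by blast+
qed

lemma D_indep:
  assumes "k \<in> J" "X \<in> borel_measurable (Fil (s + real i * h))"
  shows "indep_var borel X borel (D k i)"
proof -
  have eq: "D k i = (\<lambda>\<omega>. \<beta> k (s + real (Suc i) * h) \<omega> - \<beta> k (s + real i * h) \<omega>)" by (auto simp: D_def)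
  show ?thesis unfolding eq using assms h by (intro increment_indep grid_nonneg) (auto simp: algebra_simps)
qed

lemma D_compose_indep:
  fixes X :: "'a \<Rightarrow> real" and f :: "real \<Rightarrow> real"
  assumes "k \<in> J" "X \<in> borel_measurable (Fil (s + real i * h))" and f: "f \<in> borel_measurable borel"
  shows "indep_var borel X borel (\<lambda>\<omega>. f (D k i \<omega>))"
  using indep_var_compose[OF D_indep[OF assms(1,2)] measurable_ident f] by (simp add: comp_def)

lemma D_orthogonal:
  assumes "k \<in> J"
  shows "integrable M (\<lambda>\<omega>. D k i \<omega> * D k j \<omega>)"
    "expectation (\<lambda>\<omega>. D k i \<omega> * D k j \<omega>) = (if i = j then h else 0)"
proof -
  have *: "integrable M (\<lambda>\<omega>. D k i \<omega> * D k j \<omega>) \<and> expectation (\<lambda>\<omega>. D k i \<omega> * D k j \<omega>) = 0" if "i < j" for i j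
    using indep_var_integrable[OF D_indep[OF assms D_Fil[OF assms that]]]
      indep_var_lebesgue_integral[OF D_indep[OF assms D_Fil[OF assms that]]]
      D_moments[OF assms, of i] D_moments[OF assms, of j]
      D_moments(1)[OF assms, of i 1] D_moments(1)[OF assms, of j 1] by simp
  show "integrable M (\<lambda>\<omega>. D k i \<omega> * D k j \<omega>)"
    "expectation (\<lambda>\<omega>. D k i \<omega> * D k j \<omega>) = (if i = j then h else 0)"
    using *[of i j] *[of j i] D_moments(1)[OF assms, of i 2] D_moments(3)[OF assms, of i]
    by (cases i j rule: linorder_cases; simp add: mult.commute power2_eq_square)+
qed

text \<open>With \<open>m * h\<close> fixed the bound is of order \<open>1/m\<close>, so the
  discrete covariations converge in L2 to those of independent Brownian motions. For different
  indices this rests on the independence of the two processes, for equal ones on the independence of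
  an increment from the past.\<close>

lemma D_covariation:
  fixes m :: nat
  assumes k: "k \<in> J" and l: "l \<in> J"
  defines "V \<equiv> \<lambda>\<omega>. \<Sum>i<m. (D k i \<omega> * D l i \<omega> - (if k = l then h else 0))"
  shows "integrable M (\<lambda>\<omega>. (V \<omega>)\<^sup>2)" "expectation (\<lambda>\<omega>. (V \<omega>)\<^sup>2) \<le> m * (2 * h\<^sup>2)"
proof -
  define W where "W i \<omega> = D k i \<omega> * D l i \<omega> - (if k = l then h else 0)" for i \<omega>
  have W: "integrable M (\<lambda>\<omega>. W i \<omega> * W j \<omega>)" "i \<noteq> j \<Longrightarrow> expectation (\<lambda>\<omega>. W i \<omega> * W j \<omega>) = 0"
    "expectation (\<lambda>\<omega>. (W i \<omega>)\<^sup>2) \<le> 2 * h\<^sup>2" for i j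
  proof (atomize (full), cases "k = l")
    case False
    \<comment> \<open>Grouping by coordinate instead of by time lets the independence of
      \<open>\<beta> k\<close> and \<open>\<beta> l\<close> factor the expectation.\<close>
    have eq: "W i \<omega> * W j \<omega> = (D k i \<omega> * D k j \<omega>) * (D l i \<omega> * D l j \<omega>)" for i j \<omega>
      using False by (simp add: W_def)
    have ind: "indep_var borel (\<lambda>\<omega>. D k i \<omega> * D k j \<omega>) borel (\<lambda>\<omega>. D l i \<omega> * D l j \<omega>)" for i j
    proof -
      let ?f = "\<lambda>p :: real \<Rightarrow> real. (p (s + real (Suc i) * h) - p (s + real i * h)) * (p (s + real (Suc j) * h) - p (s + real j * h))"
      have comp: "(\<lambda>p. p (s + real i * h)) \<in> borel_measurable (PiM {0..} (\<lambda>_. borel :: real measure))" for i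
        using grid_nonneg by (intro measurable_component_singleton) auto
      have "?f \<in> borel_measurable (PiM {0..} (\<lambda>_. borel))"
        by (intro borel_measurable_times borel_measurable_diff comp)
      from processes_indep[OF k l False this this] show ?thesis
        using grid_nonneg by (simp add: D_def del: of_nat_Suc)
    qed
    have "integrable M (\<lambda>\<omega>. W i \<omega> * W j \<omega>)" for i j
      unfolding eq by (intro indep_var_integrable[OF ind] D_orthogonal k l)
    moreover have "expectation (\<lambda>\<omega>. W i \<omega> * W j \<omega>) = (if i = j then h * h else 0)" for i j
      unfolding eq using indep_var_lebesgue_integral[OF ind, of i j] D_orthogonal[OF k, of i j] D_orthogonal[OF l, of i j]
      by simp
    ultimately show "integrable M (\<lambda>\<omega>. W i \<omega> * W j \<omega>) \<and> (i \<noteq> j \<longrightarrow> expectation (\<lambda>\<omega>. W i \<omega> * W j \<omega>) = 0) \<and>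
        expectation (\<lambda>\<omega>. (W i \<omega>)\<^sup>2) \<le> 2 * h\<^sup>2"
      by (simp add: power2_eq_square)
  next
    case True
    have Wi: "W i = (\<lambda>\<omega>. (D k i \<omega>)\<^sup>2 - h)" for i
      using True by (auto simp: W_def power2_eq_square)
    have int: "integrable M (W i)" "expectation (W i) = 0" for i
      using D_moments(1)[OF k, of i 2] D_moments(3)[OF k, of i] by (simp_all add: Wi prob_space)
    have sq: "(W i \<omega>)\<^sup>2 = D k i \<omega> ^ 4 - 2 * h * (D k i \<omega>)\<^sup>2 + h\<^sup>2" for i \<omega>
      unfolding Wi by (simp add: power2_diff flip: power_mult)
    have intsq: "integrable M (\<lambda>\<omega>. (W i \<omega>)\<^sup>2)" "expectation (\<lambda>\<omega>. (W i \<omega>)\<^sup>2) = 2 * h\<^sup>2" for i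
    proof -
      note m = D_moments(1)[OF k, of i 4] D_moments(1)[OF k, of i 2]
      then have m': "integrable M (\<lambda>\<omega>. D k i \<omega> ^ 4 - 2 * h * (D k i \<omega>)\<^sup>2)" by simp
      then show "integrable M (\<lambda>\<omega>. (W i \<omega>)\<^sup>2)" unfolding sq by simp
      have "expectation (\<lambda>\<omega>. (W i \<omega>)\<^sup>2) = 3 * h\<^sup>2 - 2 * h * h + h\<^sup>2"
        unfolding sq using m m' D_moments(3,4)[OF k, of i] by (simp add: prob_space)
      then show "expectation (\<lambda>\<omega>. (W i \<omega>)\<^sup>2) = 2 * h\<^sup>2" by (simp add: power2_eq_square)
    qed
    have less: "integrable M (\<lambda>\<omega>. W i \<omega> * W j \<omega>) \<and> expectation (\<lambda>\<omega>. W i \<omega> * W j \<omega>) = 0" if "i < j" for i j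
    proof -
      have "W i \<in> borel_measurable (Fil (s + real j * h))" unfolding Wi using D_Fil[OF k that] by simp
      then have "indep_var borel (W i) borel (\<lambda>\<omega>. (\<lambda>x. x\<^sup>2 - h) (D k j \<omega>))"
        by (intro D_compose_indep k) auto
      then have "indep_var borel (W i) borel (W j)" by (simp add: Wi)
      from indep_var_integrable[OF this int(1) int(1)] indep_var_lebesgue_integral[OF this int(1) int(1)]
      show ?thesis using int by simp
    qed
    show "integrable M (\<lambda>\<omega>. W i \<omega> * W j \<omega>) \<and> (i \<noteq> j \<longrightarrow> expectation (\<lambda>\<omega>. W i \<omega> * W j \<omega>) = 0) \<and>
        expectation (\<lambda>\<omega>. (W i \<omega>)\<^sup>2) \<le> 2 * h\<^sup>2"
      using less[of i j] less[of j i] intsq[of i]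
      by (cases i j rule: linorder_cases) (simp_all add: mult.commute power2_eq_square)
  qed
  have "V = (\<lambda>\<omega>. \<Sum>i<m. W i \<omega>)" by (simp add: V_def W_def)
  then show "integrable M (\<lambda>\<omega>. (V \<omega>)\<^sup>2)" "expectation (\<lambda>\<omega>. (V \<omega>)\<^sup>2) \<le> m * (2 * h\<^sup>2)"
    using integral_square_orthogonal_sum[where I = "{..<m}" and M = M and W = W and v = "2 * h\<^sup>2"] W by simp_all
qed


section \<open>Exponential moments of joint increments by discretisation\<close>

context
  fixes N :: "nat set" and a :: "nat \<Rightarrow> real"
  assumes N: "finite N" "N \<subseteq> J"
begin

definition lin_incr :: "nat \<Rightarrow> 'a \<Rightarrow> real" where
  "lin_incr i \<omega> = (\<Sum>k\<in>N. a k * D k i \<omega>)"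

text \<open>\<open>quartic_const * h^2\<close> bounds the fourth moment of \<open>lin_incr\<close>:
  the 3 is the Gaussian fourth moment, the cube of the cardinality comes from
  \<open>sum_power4_le\<close>.\<close>

definition quartic_const :: real where
  "quartic_const = 3 * real (card N) ^ 3 * (\<Sum>k\<in>N. a k ^ 4)"

lemma quartic_const_nonneg: "0 \<le> quartic_const"
  unfolding quartic_const_def by (intro mult_nonneg_nonneg sum_nonneg) auto

lemma lin_incr_Fil: "i < j \<Longrightarrow> lin_incr i \<in> borel_measurable (Fil (s + real j * h))"
  unfolding lin_incr_def using N D_Fil by (intro borel_measurable_sum borel_measurable_times) auto

lemma lin_incr_measurable[measurable]: "lin_incr i \<in> borel_measurable M"
  unfolding lin_incr_def using N by (intro borel_measurable_sum borel_measurable_times) auto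

lemma lin_incr_power4: "lin_incr i \<omega> ^ 4 \<le> real (card N) ^ 3 * (\<Sum>k\<in>N. a k ^ 4 * D k i \<omega> ^ 4)"
  unfolding lin_incr_def using sum_power4_le[of "\<lambda>k. a k * D k i \<omega>" N] by (simp add: power_mult_distrib)

text \<open>\<open>sum_power4_le\<close> reduces the fourth power to single increments, each of
  which is independent of the past event \<open>A\<close>.\<close>

lemma lin_incr_fourth_moment:
  assumes "A \<in> sets (Fil (s + real i * h))"
  shows "integrable M (\<lambda>\<omega>. indicator A \<omega> * lin_incr i \<omega> ^ 4)"
    "expectation (\<lambda>\<omega>. indicator A \<omega> * lin_incr i \<omega> ^ 4) \<le> prob A * (quartic_const * h\<^sup>2)"
proof -
  have A[measurable]: "A \<in> sets M" using sets_Fil grid_nonneg assms by blast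
  have iA: "integrable M (indicat_real A)" by (simp add: less_top[symmetric])
  have ind: "indep_var borel (indicator A) borel (\<lambda>\<omega>. D k i \<omega> ^ 4)" if "k \<in> N" for k
    using that N assms by (intro D_compose_indep[where f = "\<lambda>x. x ^ 4"]) auto
  have intk: "integrable M (\<lambda>\<omega>. indicator A \<omega> * D k i \<omega> ^ 4)" "expectation (\<lambda>\<omega>. indicator A \<omega> * D k i \<omega> ^ 4) = prob A * (3 * h\<^sup>2)"
    if "k \<in> N" for k
  proof -
    have kJ: "k \<in> J" using that N by auto
    note m = D_moments(1)[OF kJ, of i 4] D_moments(4)[OF kJ, of i]
    show "integrable M (\<lambda>\<omega>. indicator A \<omega> * D k i \<omega> ^ 4)" by (rule indep_var_integrable[OF ind[OF that] iA m(1)])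
    show "expectation (\<lambda>\<omega>. indicator A \<omega> * D k i \<omega> ^ 4) = prob A * (3 * h\<^sup>2)"
      using indep_var_lebesgue_integral[OF ind[OF that] iA m(1)] m(2) by simp
  qed
  define R where "R \<omega> = real (card N) ^ 3 * (\<Sum>k\<in>N. a k ^ 4 * (indicator A \<omega> * D k i \<omega> ^ 4))" for \<omega>
  have R: "integrable M R" unfolding R_def using intk by (intro integrable_mult_right Bochner_Integration.integrable_sum) auto
  have le: "indicator A \<omega> * lin_incr i \<omega> ^ 4 \<le> R \<omega>" for \<omega>
    using lin_incr_power4[of i \<omega>] by (auto simp: R_def indicator_def)
  show int: "integrable M (\<lambda>\<omega>. indicator A \<omega> * lin_incr i \<omega> ^ 4)"
    by (rule Bochner_Integration.integrable_bound[OF R]) (use le in \<open>auto simp: abs_le_iff intro: order_trans[OF _ abs_ge_self]\<close>)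
  have "expectation (\<lambda>\<omega>. indicator A \<omega> * lin_incr i \<omega> ^ 4) \<le> expectation R"
    by (rule integral_mono[OF int R le])
  also have "expectation R = real (card N) ^ 3 * (\<Sum>k\<in>N. a k ^ 4 * (prob A * (3 * h\<^sup>2)))"
    unfolding R_def using intk by (simp add: Bochner_Integration.integral_sum)
  also have "\<dots> = prob A * (quartic_const * h\<^sup>2)"
    by (simp add: quartic_const_def sum_distrib_left sum_distrib_right mult_ac)
  finally show "expectation (\<lambda>\<omega>. indicator A \<omega> * lin_incr i \<omega> ^ 4) \<le> prob A * (quartic_const * h\<^sup>2)" .
qed

text \<open>The linear term drops out because each single increment is centred and independent of
  the past, and the fourth power reduces to single coordinates. No conditional expectation of a
  mixed product \<open>D k i * D l i\<close> enters; the hypotheses give no direct access to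
  it.\<close>

lemma lin_incr_step:
  assumes A: "A \<in> sets (Fil (s + real i * h))"
  shows "(\<integral>\<^sup>+\<omega>. ennreal \<bar>1 + lin_incr i \<omega>\<bar> * indicator A \<omega> \<partial>M) \<le> ennreal (1 + 2 * quartic_const * h\<^sup>2) * emeasure M A"
proof -
  have AM[measurable]: "A \<in> sets M" using sets_Fil grid_nonneg A by blast
  have iA: "integrable M (indicat_real A)" by (simp add: less_top[symmetric])
  have ind: "indep_var borel (indicator A) borel (D k i)" if "k \<in> N" for k
    using that N A by (intro D_indep) auto
  have intk: "integrable M (\<lambda>\<omega>. indicator A \<omega> * D k i \<omega>)" "expectation (\<lambda>\<omega>. indicator A \<omega> * D k i \<omega>) = 0"
    if "k \<in> N" for k
  proof -
    have kJ: "k \<in> J" using that N by auto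
    have m: "integrable M (D k i)" using D_moments(1)[OF kJ, of i 1] by simp
    show "integrable M (\<lambda>\<omega>. indicator A \<omega> * D k i \<omega>)" by (rule indep_var_integrable[OF ind[OF that] iA m])
    show "expectation (\<lambda>\<omega>. indicator A \<omega> * D k i \<omega>) = 0"
      using indep_var_lebesgue_integral[OF ind[OF that] iA m] D_moments(2)[OF kJ, of i] by simp
  qed
  have lin: "integrable M (\<lambda>\<omega>. indicator A \<omega> * lin_incr i \<omega>)" "expectation (\<lambda>\<omega>. indicator A \<omega> * lin_incr i \<omega>) = 0"
  proof -
    have eq: "indicator A \<omega> * lin_incr i \<omega> = (\<Sum>k\<in>N. a k * (indicator A \<omega> * D k i \<omega>))" for \<omega>
      by (simp add: lin_incr_def sum_distrib_left mult_ac)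
    show "integrable M (\<lambda>\<omega>. indicator A \<omega> * lin_incr i \<omega>)" "expectation (\<lambda>\<omega>. indicator A \<omega> * lin_incr i \<omega>) = 0"
      unfolding eq using intk by (simp_all add: Bochner_Integration.integral_sum)
  qed
  define B where "B \<omega> = indicator A \<omega> + indicator A \<omega> * lin_incr i \<omega> + 2 * (indicator A \<omega> * lin_incr i \<omega> ^ 4)" for \<omega>
  note q = lin_incr_fourth_moment[OF A]
  have BI: "integrable M B" unfolding B_def using lin(1) q(1) iA by (intro Bochner_Integration.integrable_add integrable_mult_right)
  have le: "\<bar>1 + lin_incr i \<omega>\<bar> * indicator A \<omega> \<le> B \<omega>" for \<omega>
    using abs_one_plus_le[of "lin_incr i \<omega>"] by (simp add: B_def indicator_def)
  have "(\<integral>\<^sup>+\<omega>. ennreal \<bar>1 + lin_incr i \<omega>\<bar> * indicator A \<omega> \<partial>M) \<le> (\<integral>\<^sup>+\<omega>. ennreal (B \<omega>) \<partial>M)"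
  proof (rule nn_integral_mono)
    fix \<omega>
    have "ennreal \<bar>1 + lin_incr i \<omega>\<bar> * indicator A \<omega> = ennreal (\<bar>1 + lin_incr i \<omega>\<bar> * indicator A \<omega>)"
      by (cases "\<omega> \<in> A") simp_all
    then show "ennreal \<bar>1 + lin_incr i \<omega>\<bar> * indicator A \<omega> \<le> ennreal (B \<omega>)" using ennreal_leI[OF le[of \<omega>]] by simp
  qed
  also have "\<dots> = ennreal (expectation B)"
  proof (rule nn_integral_eq_integral[OF BI])
    have "0 \<le> B \<omega>" for \<omega> using le[of \<omega>] by (rule order_trans[rotated]) simp
    then show "AE \<omega> in M. 0 \<le> B \<omega>" by simp
  qed
  also have "expectation B = prob A + 2 * expectation (\<lambda>\<omega>. indicator A \<omega> * lin_incr i \<omega> ^ 4)"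
    unfolding B_def using lin q(1) iA by simp
  also have "ennreal \<dots> \<le> ennreal ((1 + 2 * quartic_const * h\<^sup>2) * prob A)"
    using q(2) by (intro ennreal_leI) (simp add: algebra_simps)
  also have "\<dots> = ennreal (1 + 2 * quartic_const * h\<^sup>2) * emeasure M A"
    using quartic_const_nonneg by (simp add: ennreal_mult emeasure_eq_measure)
  finally show ?thesis .
qed

text \<open>Peels off the last factor with \<open>nn_integral_subalgebra_le\<close>. As
  \<open>m * h\<close> is the length of the time interval, the constant tends to 1 with the mesh:
  the absolute values do not spoil the martingale property in the limit.\<close>

lemma lin_incr_prod:
  assumes A: "A \<in> sets (Fil s)"
  shows "(\<integral>\<^sup>+\<omega>. indicator A \<omega> * ennreal (\<Prod>i<m. \<bar>1 + lin_incr i \<omega>\<bar>) \<partial>M)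
    \<le> ennreal ((1 + 2 * quartic_const * h\<^sup>2) ^ m) * emeasure M A"
proof (induction m)
  case 0
  have "A \<in> sets M" using A s sets_Fil by blast
  then show ?case by simp
next
  case (Suc m)
  let ?Y = "\<lambda>\<omega>. indicator A \<omega> * ennreal (\<Prod>i<m. \<bar>1 + lin_incr i \<omega>\<bar>)"
  let ?t = "s + real m * h"
  have "A \<in> sets (Fil ?t)" using A s h sets_Fil_mono[of s ?t] by simp
  moreover have "(\<lambda>\<omega>. \<Prod>i<m. \<bar>1 + lin_incr i \<omega>\<bar>) \<in> borel_measurable (Fil ?t)"
    using lin_incr_Fil by (intro borel_measurable_prod borel_measurable_abs borel_measurable_add) auto
  ultimately have Y: "?Y \<in> borel_measurable (Fil ?t)" by simp
  have "(\<integral>\<^sup>+\<omega>. indicator A \<omega> * ennreal (\<Prod>i<Suc m. \<bar>1 + lin_incr i \<omega>\<bar>) \<partial>M) = (\<integral>\<^sup>+\<omega>. ennreal \<bar>1 + lin_incr m \<omega>\<bar> * ?Y \<omega> \<partial>M)"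
    by (intro nn_integral_cong) (simp add: ennreal_mult prod_nonneg mult_ac)
  also have "\<dots> \<le> ennreal (1 + 2 * quartic_const * h\<^sup>2) * (\<integral>\<^sup>+\<omega>. ?Y \<omega> \<partial>M)"
    using lin_incr_step Y by (intro nn_integral_subalgebra_le[OF subalg[OF grid_nonneg]]) auto
  also have "\<dots> \<le> ennreal (1 + 2 * quartic_const * h\<^sup>2) * (ennreal ((1 + 2 * quartic_const * h\<^sup>2) ^ m) * emeasure M A)"
    by (intro mult_left_mono Suc.IH) simp
  also have "\<dots> = ennreal ((1 + 2 * quartic_const * h\<^sup>2) ^ Suc m) * emeasure M A"
    using quartic_const_nonneg by (simp add: ennreal_mult mult.assoc)
  finally show ?case .
qed

text \<open>Expanding the squares turns the deviation into a combination of the covariations of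
  \<open>D_covariation\<close>. Cauchy--Schwarz over the pairs of indices then suffices, at the
  price of the square of \<open>card N\<close>.\<close>

lemma lin_incr_sq_deviation:
  fixes m :: nat
  defines "Z \<equiv> \<lambda>\<omega>. (\<Sum>i<m. (lin_incr i \<omega>)\<^sup>2) - (\<Sum>k\<in>N. (a k)\<^sup>2) * (m * h)"
  shows "integrable M (\<lambda>\<omega>. (Z \<omega>)\<^sup>2)"
    "expectation (\<lambda>\<omega>. (Z \<omega>)\<^sup>2) \<le> (real (card N))\<^sup>2 * (\<Sum>k\<in>N. \<Sum>l\<in>N. (a k * a l)\<^sup>2) * (m * (2 * h\<^sup>2))"
proof -
  define V where "V k l \<omega> = (\<Sum>i<m. (D k i \<omega> * D l i \<omega> - (if k = l then h else 0)))" for k l \<omega>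
  have V: "integrable M (\<lambda>\<omega>. (V k l \<omega>)\<^sup>2)" "expectation (\<lambda>\<omega>. (V k l \<omega>)\<^sup>2) \<le> m * (2 * h\<^sup>2)"
    if "k \<in> N" "l \<in> N" for k l
  proof -
    have "k \<in> J" "l \<in> J" using that N by auto
    from D_covariation[OF this, of m] show "integrable M (\<lambda>\<omega>. (V k l \<omega>)\<^sup>2)"
      "expectation (\<lambda>\<omega>. (V k l \<omega>)\<^sup>2) \<le> m * (2 * h\<^sup>2)" unfolding V_def by blast+
  qed
  have Z: "Z \<omega> = (\<Sum>p\<in>N \<times> N. a (fst p) * a (snd p) * V (fst p) (snd p) \<omega>)" for \<omega>
  proof -
    have "(\<Sum>p\<in>N \<times> N. a (fst p) * a (snd p) * V (fst p) (snd p) \<omega>) = (\<Sum>k\<in>N. \<Sum>l\<in>N. a k * a l * V k l \<omega>)"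
      by (simp add: sum.cartesian_product case_prod_beta)
    also have "\<dots> = (\<Sum>k\<in>N. \<Sum>l\<in>N. \<Sum>i<m. a k * D k i \<omega> * (a l * D l i \<omega>)) - (\<Sum>k\<in>N. \<Sum>l\<in>N. if k = l then (a k)\<^sup>2 * (m * h) else 0)"
      unfolding sum_subtractf[symmetric] V_def
      by (intro sum.cong refl) (auto simp: sum_subtractf sum_distrib_left algebra_simps power2_eq_square)
    also have "(\<Sum>k\<in>N. \<Sum>l\<in>N. \<Sum>i<m. a k * D k i \<omega> * (a l * D l i \<omega>)) = (\<Sum>i<m. (lin_incr i \<omega>)\<^sup>2)"
    proof -
      have "(\<Sum>k\<in>N. \<Sum>l\<in>N. \<Sum>i<m. a k * D k i \<omega> * (a l * D l i \<omega>)) = (\<Sum>k\<in>N. \<Sum>i<m. \<Sum>l\<in>N. a k * D k i \<omega> * (a l * D l i \<omega>))"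
        by (intro sum.cong refl sum.swap)
      also have "\<dots> = (\<Sum>i<m. \<Sum>k\<in>N. \<Sum>l\<in>N. a k * D k i \<omega> * (a l * D l i \<omega>))" by (rule sum.swap)
      finally show ?thesis by (simp add: lin_incr_def power2_eq_square sum_product)
    qed
    also have "(\<Sum>k\<in>N. \<Sum>l\<in>N. if k = l then (a k)\<^sup>2 * (m * h) else 0) = (\<Sum>k\<in>N. (a k)\<^sup>2) * (m * h)"
      using N(1) by (simp add: sum_distrib_right)
    finally show ?thesis by (simp add: Z_def)
  qed
  define R where "R \<omega> = (\<Sum>k\<in>N. \<Sum>l\<in>N. (a k * a l)\<^sup>2 * (V k l \<omega>)\<^sup>2) * (real (card N))\<^sup>2" for \<omega>
  have RI: "integrable M R" unfolding R_def using V
    by (intro integrable_mult_left Bochner_Integration.integrable_sum integrable_mult_right) auto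
  have le: "(Z \<omega>)\<^sup>2 \<le> R \<omega>" for \<omega>
  proof -
    have "(Z \<omega>)\<^sup>2 \<le> (\<Sum>p\<in>N \<times> N. (a (fst p) * a (snd p) * V (fst p) (snd p) \<omega>)\<^sup>2) * card (N \<times> N)"
      unfolding Z by (rule sum_squared_le_sum_of_squares)
    also have "\<dots> = R \<omega>"
      by (simp add: R_def sum.cartesian_product case_prod_beta power_mult_distrib card_cartesian_product power2_eq_square mult_ac)
    finally show ?thesis .
  qed
  show ZI: "integrable M (\<lambda>\<omega>. (Z \<omega>)\<^sup>2)"
    by (rule Bochner_Integration.integrable_bound[OF RI])
      (use le in \<open>auto simp: Z_def abs_le_iff intro: order_trans[OF _ abs_ge_self]\<close>)
  have "expectation (\<lambda>\<omega>. (Z \<omega>)\<^sup>2) \<le> expectation R" by (rule integral_mono[OF ZI RI le])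
  also have "\<dots> = (\<Sum>k\<in>N. \<Sum>l\<in>N. (a k * a l)\<^sup>2 * expectation (\<lambda>\<omega>. (V k l \<omega>)\<^sup>2)) * (real (card N))\<^sup>2"
    unfolding R_def using V by (simp add: Bochner_Integration.integral_sum Bochner_Integration.integrable_sum)
  also have "\<dots> \<le> (\<Sum>k\<in>N. \<Sum>l\<in>N. (a k * a l)\<^sup>2 * (m * (2 * h\<^sup>2))) * (real (card N))\<^sup>2"
    using V(2) by (intro mult_right_mono sum_mono mult_left_mono) auto
  also have "\<dots> = (real (card N))\<^sup>2 * (\<Sum>k\<in>N. \<Sum>l\<in>N. (a k * a l)\<^sup>2) * (m * (2 * h\<^sup>2))"
    by (simp only: sum_distrib_right[symmetric]) (simp only: mult_ac)
  finally show "expectation (\<lambda>\<omega>. (Z \<omega>)\<^sup>2) \<le> (real (card N))\<^sup>2 * (\<Sum>k\<in>N. \<Sum>l\<in>N. (a k * a l)\<^sup>2) * (m * (2 * h\<^sup>2))" .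
qed

text \<open>On the event that the discrete quadratic variation is close to its limit and the fourth powers
  are negligible, the product of the factors \<open>1 + x\<close> is comparable with the exponential.\<close>
lemma exp_le_prod_lin_incr:
  assumes \<eta>: "0 < \<eta>" "\<eta> \<le> 1/4"
    and q: "(\<Sum>i<m. (lin_incr i \<omega>)\<^sup>2) \<le> q" "(\<Sum>i<m. lin_incr i \<omega> ^ 4) \<le> \<eta>\<^sup>2"
  shows "exp (\<Sum>i<m. lin_incr i \<omega>) \<le> exp ((1/2 + \<eta>) * q + \<eta>) * (\<Prod>i<m. \<bar>1 + lin_incr i \<omega>\<bar>)"
proof -
  \<comment> \<open>\<open>x^4 \<le> \<eta>^2 \<le> (1/4)^2 = (1/2)^4\<close>. Hence every factor
    \<open>1 + x\<close> is at least 1/2 and its logarithm can be expanded.\<close>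
  have small: "\<bar>lin_incr i \<omega>\<bar> \<le> 1/2" if "i < m" for i
  proof -
    have "lin_incr i \<omega> ^ 4 \<le> (\<Sum>i<m. lin_incr i \<omega> ^ 4)" using that by (intro member_le_sum) auto
    also have "\<dots> \<le> \<eta>\<^sup>2" by fact
    also have "\<dots> \<le> (1/4)\<^sup>2" using \<eta> by (intro power_mono) auto
    finally have "\<bar>lin_incr i \<omega>\<bar> ^ 4 \<le> (1/2) ^ 4" by (simp add: power_even_abs power_divide)
    then show ?thesis by (intro power_le_imp_le_base[of "\<bar>lin_incr i \<omega>\<bar>" 3]) (simp_all add: eval_nat_numeral)
  qed
  have pt: "exp (lin_incr i \<omega> - (1/2 + \<eta>) * (lin_incr i \<omega>)\<^sup>2 - lin_incr i \<omega> ^ 4 / \<eta>) \<le> \<bar>1 + lin_incr i \<omega>\<bar>" if "i < m" for i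
  proof -
    define x where "x = lin_incr i \<omega>"
    have x: "\<bar>x\<bar> \<le> 1/2" using small[OF that] by (simp add: x_def)
    \<comment> \<open>Young's inequality, in order to split the cubic remainder into a small
      multiple of the square and a fourth power.\<close>
    have "\<bar>x\<bar> \<le> \<eta> + x\<^sup>2 / \<eta>"
    proof -
      have "0 \<le> (\<bar>x\<bar> - \<eta>)\<^sup>2" by simp
      then have "2 * \<bar>x\<bar> * \<eta> \<le> \<eta>\<^sup>2 + x\<^sup>2" by (simp add: power2_diff)
      moreover have "0 \<le> \<bar>x\<bar> * \<eta>" using \<eta> by simp
      ultimately have "\<bar>x\<bar> * \<eta> \<le> \<eta>\<^sup>2 + x\<^sup>2" by linarith
      then show ?thesis using \<eta> by (simp add: field_simps power2_eq_square)
    qed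
    then have "x\<^sup>2 * \<bar>x\<bar> \<le> x\<^sup>2 * (\<eta> + x\<^sup>2 / \<eta>)" by (intro mult_left_mono) auto
    then have "\<bar>x\<bar> ^ 3 \<le> \<eta> * x\<^sup>2 + x ^ 4 / \<eta>"
      by (simp add: power2_eq_square power3_eq_cube power4_eq_xxxx algebra_simps)
    then have "x - (1/2 + \<eta>) * x\<^sup>2 - x ^ 4 / \<eta> \<le> ln (1 + x)"
      using ln_one_plus_ge_cubic[OF x] by (simp add: algebra_simps)
    then have "exp (x - (1/2 + \<eta>) * x\<^sup>2 - x ^ 4 / \<eta>) \<le> exp (ln (1 + x))" by simp
    also have "\<dots> = \<bar>1 + x\<bar>" using x by simp
    finally show ?thesis by (simp add: x_def)
  qed
  define P where "P = (\<Prod>i<m. \<bar>1 + lin_incr i \<omega>\<bar>)"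
  have "exp ((\<Sum>i<m. lin_incr i \<omega>) - (1/2 + \<eta>) * (\<Sum>i<m. (lin_incr i \<omega>)\<^sup>2) - (\<Sum>i<m. lin_incr i \<omega> ^ 4) / \<eta>)
      = (\<Prod>i<m. exp (lin_incr i \<omega> - (1/2 + \<eta>) * (lin_incr i \<omega>)\<^sup>2 - lin_incr i \<omega> ^ 4 / \<eta>))"
    by (simp add: exp_sum[symmetric] sum_subtractf sum_distrib_left sum_divide_distrib)
  also have "\<dots> \<le> P" unfolding P_def using pt by (intro prod_mono) auto
  finally have "exp ((1/2 + \<eta>) * (\<Sum>i<m. (lin_incr i \<omega>)\<^sup>2) + (\<Sum>i<m. lin_incr i \<omega> ^ 4) / \<eta>) *
      exp ((\<Sum>i<m. lin_incr i \<omega>) - (1/2 + \<eta>) * (\<Sum>i<m. (lin_incr i \<omega>)\<^sup>2) - (\<Sum>i<m. lin_incr i \<omega> ^ 4) / \<eta>) \<le>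
      exp ((1/2 + \<eta>) * (\<Sum>i<m. (lin_incr i \<omega>)\<^sup>2) + (\<Sum>i<m. lin_incr i \<omega> ^ 4) / \<eta>) * P"
    by (intro mult_left_mono) auto
  then have "exp (\<Sum>i<m. lin_incr i \<omega>) \<le>
      exp ((1/2 + \<eta>) * (\<Sum>i<m. (lin_incr i \<omega>)\<^sup>2) + (\<Sum>i<m. lin_incr i \<omega> ^ 4) / \<eta>) * P"
    unfolding exp_add[symmetric] by (simp only: add_diff_eq add_diff_cancel diff_diff_eq diff_add_cancel add.commute)
  also have "\<dots> \<le> exp ((1/2 + \<eta>) * q + \<eta>) * P"
  proof (intro mult_right_mono)
    have "(\<Sum>i<m. lin_incr i \<omega> ^ 4) / \<eta> \<le> \<eta>" using q(2) \<eta> by (simp add: divide_le_eq power2_eq_square)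
    moreover have "(1/2 + \<eta>) * (\<Sum>i<m. (lin_incr i \<omega>)\<^sup>2) \<le> (1/2 + \<eta>) * q" using q(1) \<eta> by (intro mult_left_mono) auto
    ultimately show "exp ((1/2 + \<eta>) * (\<Sum>i<m. (lin_incr i \<omega>)\<^sup>2) + (\<Sum>i<m. lin_incr i \<omega> ^ 4) / \<eta>) \<le> exp ((1/2 + \<eta>) * q + \<eta>)" by simp
    show "0 \<le> P" by (simp add: P_def prod_nonneg)
  qed
  finally show ?thesis by (simp add: P_def)
qed


text \<open>Chebyshev for the squares and Markov for the fourth powers. Both bounds are multiples of
  \<open>m * h^2\<close>, the squared length of the time interval divided by
  \<open>m\<close>.\<close>

lemma bad_event_bound:
  fixes m :: nat
  assumes \<eta>: "0 < \<eta>"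
  defines "q \<equiv> (\<Sum>k\<in>N. (a k)\<^sup>2) * (m * h)"
  shows "prob {\<omega>\<in>space M. \<not> ((\<Sum>i<m. (lin_incr i \<omega>)\<^sup>2) \<le> q + \<eta> \<and> (\<Sum>i<m. lin_incr i \<omega> ^ 4) \<le> \<eta>\<^sup>2)}
    \<le> (2 * (real (card N))\<^sup>2 * (\<Sum>k\<in>N. \<Sum>l\<in>N. (a k * a l)\<^sup>2) + quartic_const) / \<eta>\<^sup>2 * (m * h\<^sup>2)"
proof -
  define Z where "Z \<omega> = (\<Sum>i<m. (lin_incr i \<omega>)\<^sup>2) - q" for \<omega>
  define Q where "Q \<omega> = (\<Sum>i<m. lin_incr i \<omega> ^ 4)" for \<omega>
  define c where "c = (real (card N))\<^sup>2 * (\<Sum>k\<in>N. \<Sum>l\<in>N. (a k * a l)\<^sup>2)"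
  have [measurable]: "Z \<in> borel_measurable M" "Q \<in> borel_measurable M" unfolding Z_def Q_def by measurable
  note Z = lin_incr_sq_deviation[of m, folded q_def, folded Z_def c_def]
  have four: "integrable M (\<lambda>\<omega>. lin_incr i \<omega> ^ 4)" "expectation (\<lambda>\<omega>. lin_incr i \<omega> ^ 4) \<le> quartic_const * h\<^sup>2" for i
  proof -
    have sp: "space M \<in> sets (Fil (s + real i * h))" using space_Fil[OF grid_nonneg, of i] by (metis sets.top)
    have eq: "\<omega> \<in> space M \<Longrightarrow> indicator (space M) \<omega> * lin_incr i \<omega> ^ 4 = lin_incr i \<omega> ^ 4" for \<omega> by simp
    show "integrable M (\<lambda>\<omega>. lin_incr i \<omega> ^ 4)"
      by (rule Bochner_Integration.integrable_cong[THEN iffD1, OF refl eq lin_incr_fourth_moment(1)[OF sp]])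
    show "expectation (\<lambda>\<omega>. lin_incr i \<omega> ^ 4) \<le> quartic_const * h\<^sup>2"
    proof -
      have "expectation (\<lambda>\<omega>. indicator (space M) \<omega> * lin_incr i \<omega> ^ 4) = expectation (\<lambda>\<omega>. lin_incr i \<omega> ^ 4)"
        by (rule Bochner_Integration.integral_cong[OF refl eq])
      then show ?thesis using lin_incr_fourth_moment(2)[OF sp] by (simp add: prob_space)
    qed
  qed
  have QI: "integrable M Q" unfolding Q_def using four by (intro Bochner_Integration.integrable_sum)
  have QE: "expectation Q \<le> m * (quartic_const * h\<^sup>2)"
  proof -
    have "(\<Sum>i<m. expectation (\<lambda>\<omega>. lin_incr i \<omega> ^ 4)) \<le> (\<Sum>i<m. quartic_const * h\<^sup>2)" by (intro sum_mono four(2))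
    then show ?thesis unfolding Q_def using four(1) by (simp add: Bochner_Integration.integral_sum)
  qed
  have b1: "prob {\<omega>\<in>space M. (Z \<omega>)\<^sup>2 \<ge> \<eta>\<^sup>2} \<le> expectation (\<lambda>\<omega>. (Z \<omega>)\<^sup>2) / \<eta>\<^sup>2"
    using \<eta> Z(1) by (intro integral_Markov_inequality_measure[where A = "{}"]) auto
  have b2: "prob {\<omega>\<in>space M. Q \<omega> \<ge> \<eta>\<^sup>2} \<le> expectation Q / \<eta>\<^sup>2"
    
  proof -
    have "0 \<le> Q \<omega>" for \<omega> by (simp add: Q_def sum_nonneg)
    then show ?thesis using \<eta> QI by (intro integral_Markov_inequality_measure[where A = "{}"]) auto
  qed
  have "prob {\<omega>\<in>space M. \<not> ((\<Sum>i<m. (lin_incr i \<omega>)\<^sup>2) \<le> q + \<eta> \<and> (\<Sum>i<m. lin_incr i \<omega> ^ 4) \<le> \<eta>\<^sup>2)}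
      \<le> prob ({\<omega>\<in>space M. (Z \<omega>)\<^sup>2 \<ge> \<eta>\<^sup>2} \<union> {\<omega>\<in>space M. Q \<omega> \<ge> \<eta>\<^sup>2})"
  proof (intro finite_measure_mono subsetI)
    fix \<omega> assume "\<omega> \<in> {\<omega>\<in>space M. \<not> ((\<Sum>i<m. (lin_incr i \<omega>)\<^sup>2) \<le> q + \<eta> \<and> (\<Sum>i<m. lin_incr i \<omega> ^ 4) \<le> \<eta>\<^sup>2)}"
    then have "\<omega> \<in> space M" "Z \<omega> > \<eta> \<or> Q \<omega> > \<eta>\<^sup>2" by (auto simp: Z_def Q_def)
    moreover have "Z \<omega> > \<eta> \<Longrightarrow> (Z \<omega>)\<^sup>2 \<ge> \<eta>\<^sup>2" using \<eta> by (intro power_mono) auto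
    ultimately show "\<omega> \<in> {\<omega>\<in>space M. (Z \<omega>)\<^sup>2 \<ge> \<eta>\<^sup>2} \<union> {\<omega>\<in>space M. Q \<omega> \<ge> \<eta>\<^sup>2}" by auto
  qed measurable
  also have "\<dots> \<le> expectation (\<lambda>\<omega>. (Z \<omega>)\<^sup>2) / \<eta>\<^sup>2 + expectation Q / \<eta>\<^sup>2"
    by (intro order_trans[OF measure_Un_le] add_mono b1 b2) measurable
  also have "\<dots> \<le> c * (m * (2 * h\<^sup>2)) / \<eta>\<^sup>2 + m * (quartic_const * h\<^sup>2) / \<eta>\<^sup>2"
    using Z(2) QE by (intro add_mono divide_right_mono) auto
  also have "\<dots> = (2 * c + quartic_const) / \<eta>\<^sup>2 * (m * h\<^sup>2)"
    by (simp add: add_divide_distrib algebra_simps)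
  finally show ?thesis by (simp add: c_def mult.assoc)
qed

text \<open>Off the exceptional event the exponential is dominated by the product of the
  \<open>\<bar>1 + x\<bar>\<close>, on it by the truncation level \<open>K\<close>. The truncation
  allows the exceptional event to be discarded through its probability alone.\<close>

lemma truncated_exp_bound:
  fixes m :: nat
  assumes A: "A \<in> sets (Fil s)" and \<eta>: "0 < \<eta>" "\<eta> \<le> 1/4" and K: "0 \<le> K"
  defines "q \<equiv> (\<Sum>k\<in>N. (a k)\<^sup>2) * (m * h)"
  shows "expectation (\<lambda>\<omega>. indicator A \<omega> * min K (exp (\<Sum>k\<in>N. a k * (\<beta> k (s + real m * h) \<omega> - \<beta> k s \<omega>))))
    \<le> exp ((1/2 + \<eta>) * (q + \<eta>) + \<eta>) * exp (2 * quartic_const * (m * h\<^sup>2)) * prob A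
      + K * ((2 * (real (card N))\<^sup>2 * (\<Sum>k\<in>N. \<Sum>l\<in>N. (a k * a l)\<^sup>2) + quartic_const) / \<eta>\<^sup>2 * (m * h\<^sup>2))"
proof -
  have AM[measurable]: "A \<in> sets M" using sets_Fil s A by blast
  define Y where "Y \<omega> = (\<Sum>i<m. lin_incr i \<omega>)" for \<omega>
  define P where "P \<omega> = (\<Prod>i<m. \<bar>1 + lin_incr i \<omega>\<bar>)" for \<omega>
  define c where "c = exp ((1/2 + \<eta>) * (q + \<eta>) + \<eta>)"
  define E where "E = {\<omega>\<in>space M. \<not> ((\<Sum>i<m. (lin_incr i \<omega>)\<^sup>2) \<le> q + \<eta> \<and> (\<Sum>i<m. lin_incr i \<omega> ^ 4) \<le> \<eta>\<^sup>2)}"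
  have [measurable]: "Y \<in> borel_measurable M" "P \<in> borel_measurable M" unfolding Y_def P_def by measurable
  have EM[measurable]: "E \<in> sets M" unfolding E_def by measurable
  have Yeq: "(\<Sum>k\<in>N. a k * (\<beta> k (s + real m * h) \<omega> - \<beta> k s \<omega>)) = Y \<omega>" for \<omega>
  proof -
    have "(\<Sum>i<m. D k i \<omega>) = \<beta> k (s + real m * h) \<omega> - \<beta> k s \<omega>" for k
      unfolding D_def by (subst sum_lessThan_telescope[where f = "\<lambda>i. \<beta> k (s + real i * h) \<omega>"]) simp
    then show ?thesis
      unfolding Y_def lin_incr_def by (subst sum.swap) (simp add: sum_distrib_left[symmetric])
  qed
  have P0: "0 \<le> P \<omega>" for \<omega> by (simp add: P_def prod_nonneg)
  have PI_nn: "(\<integral>\<^sup>+\<omega>. ennreal (indicator A \<omega> * P \<omega>) \<partial>M) \<le> ennreal ((1 + 2 * quartic_const * h\<^sup>2) ^ m * prob A)"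
  proof -
    have "(\<integral>\<^sup>+\<omega>. ennreal (indicator A \<omega> * P \<omega>) \<partial>M) = (\<integral>\<^sup>+\<omega>. indicator A \<omega> * ennreal (P \<omega>) \<partial>M)"
      by (intro nn_integral_cong) (simp add: indicator_def)
    also have "\<dots> \<le> ennreal ((1 + 2 * quartic_const * h\<^sup>2) ^ m) * emeasure M A"
      unfolding P_def by (rule lin_incr_prod[OF A])
    finally show ?thesis using quartic_const_nonneg by (simp add: ennreal_mult emeasure_eq_measure)
  qed
  have PI: "integrable M (\<lambda>\<omega>. indicator A \<omega> * P \<omega>)"
    using PI_nn P0 by (intro integrableI_nonneg) (auto intro: le_less_trans)
  have PE: "expectation (\<lambda>\<omega>. indicator A \<omega> * P \<omega>) \<le> exp (2 * quartic_const * (m * h\<^sup>2)) * prob A"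
  proof -
    have "ennreal (expectation (\<lambda>\<omega>. indicator A \<omega> * P \<omega>)) \<le> ennreal ((1 + 2 * quartic_const * h\<^sup>2) ^ m * prob A)"
      using PI_nn P0 by (subst nn_integral_eq_integral[OF PI, symmetric]) auto
    then have "expectation (\<lambda>\<omega>. indicator A \<omega> * P \<omega>) \<le> (1 + 2 * quartic_const * h\<^sup>2) ^ m * prob A"
      using quartic_const_nonneg by (subst (asm) ennreal_le_iff) auto
    also have "\<dots> \<le> exp (2 * quartic_const * h\<^sup>2) ^ m * prob A"
      using quartic_const_nonneg by (intro mult_right_mono power_mono exp_ge_add_one_self) auto
    also have "exp (2 * quartic_const * h\<^sup>2) ^ m = exp (2 * quartic_const * (m * h\<^sup>2))"
      by (simp add: exp_of_nat_mult[symmetric] mult_ac)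
    finally show ?thesis .
  qed
  have le: "indicator A \<omega> * min K (exp (Y \<omega>)) \<le> c * (indicator A \<omega> * P \<omega>) + K * indicator E \<omega>" if "\<omega> \<in> space M" for \<omega>
  proof (cases "\<omega> \<in> E")
    case True
    have "indicator A \<omega> * min K (exp (Y \<omega>)) \<le> 1 * K" using K by (intro mult_mono) (auto simp: indicator_def)
    moreover have "0 \<le> c * (indicator A \<omega> * P \<omega>)" using P0 by (simp add: c_def)
    ultimately show ?thesis using True by simp
  next
    case False
    then have "exp (Y \<omega>) \<le> c * P \<omega>"
      using that exp_le_prod_lin_incr[OF \<eta>, where m = m and \<omega> = \<omega> and q = "q + \<eta>"] by (simp add: E_def Y_def P_def c_def)
    then have "min K (exp (Y \<omega>)) \<le> c * P \<omega>" by simp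
    then have "indicator A \<omega> * min K (exp (Y \<omega>)) \<le> indicator A \<omega> * (c * P \<omega>)" by (intro mult_left_mono) auto
    then show ?thesis using False by (simp add: mult_ac)
  qed
  have "expectation (\<lambda>\<omega>. indicator A \<omega> * min K (exp (Y \<omega>))) \<le> expectation (\<lambda>\<omega>. c * (indicator A \<omega> * P \<omega>) + K * indicator E \<omega>)"
  proof (rule integral_mono_AE)
    show "integrable M (\<lambda>\<omega>. indicator A \<omega> * min K (exp (Y \<omega>)))"
      using K by (intro integrable_const_bound[where B = K]) (auto simp: indicator_def abs_mult)
    show "integrable M (\<lambda>\<omega>. c * (indicator A \<omega> * P \<omega>) + K * indicator E \<omega>)"
      using PI by (intro Bochner_Integration.integrable_add integrable_mult_right) (auto simp: less_top[symmetric])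
    show "AE \<omega> in M. indicator A \<omega> * min K (exp (Y \<omega>)) \<le> c * (indicator A \<omega> * P \<omega>) + K * indicator E \<omega>"
      using le by (intro AE_I2)
  qed
  also have "\<dots> = c * expectation (\<lambda>\<omega>. indicator A \<omega> * P \<omega>) + K * prob E"
    using PI by (subst Bochner_Integration.integral_add) (auto simp: less_top[symmetric])
  also have "\<dots> \<le> c * (exp (2 * quartic_const * (m * h\<^sup>2)) * prob A)
     + K * ((2 * (real (card N))\<^sup>2 * (\<Sum>k\<in>N. \<Sum>l\<in>N. (a k * a l)\<^sup>2) + quartic_const) / \<eta>\<^sup>2 * (m * h\<^sup>2))"
    using PE bad_event_bound[OF \<eta>(1), of m] K
    by (intro add_mono mult_left_mono) (auto simp: c_def E_def q_def)
  finally show ?thesis by (simp add: Yeq c_def mult.assoc)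
qed

end

end

text \<open>
  Each coordinate is only assumed to have increments independent of the past individually; the joint
  statement below is what Levy's characterisation provides.
\<close>
lemma joint_increment_exponential:
  fixes a :: "nat \<Rightarrow> real"
  assumes N: "finite N" "N \<subseteq> J" and s: "0 \<le> s" "s < t" and A: "A \<in> sets (Fil s)"
  shows "(\<integral>\<^sup>+\<omega>. ennreal (exp (\<Sum>k\<in>N. a k * (\<beta> k t \<omega> - \<beta> k s \<omega>))) * indicator A \<omega> \<partial>M)
    \<le> ennreal (exp ((\<Sum>k\<in>N. (a k)\<^sup>2) * (t - s) / 2)) * emeasure M A"
proof -
  define T where "T = t - s"
  have T: "T > 0" using s by (simp add: T_def)
  define Y where "Y \<omega> = exp (\<Sum>k\<in>N. a k * (\<beta> k t \<omega> - \<beta> k s \<omega>))" for \<omega>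
  have AM[measurable]: "A \<in> sets M" using sets_Fil s A by blast
  have [measurable]: "Y \<in> borel_measurable M"
    unfolding Y_def using N s by (intro borel_measurable_exp[THEN measurable_compose[rotated]] borel_measurable_sum borel_measurable_times borel_measurable_diff beta_measurable) auto
  have Y0: "0 \<le> Y \<omega>" for \<omega> by (simp add: Y_def)
  define q where "q = (\<Sum>k\<in>N. (a k)\<^sup>2) * T"
  define \<kappa> where "\<kappa> = 3 * real (card N) ^ 3 * (\<Sum>k\<in>N. a k ^ 4)"
  define b where "b = 2 * (real (card N))\<^sup>2 * (\<Sum>k\<in>N. \<Sum>l\<in>N. (a k * a l)\<^sup>2) + \<kappa>"
  \<comment> \<open>Three limits follow in this order: the mesh tends to 0 for fixed
    \<open>\<eta>\<close> and \<open>K\<close>, which removes the exceptional event; then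
    \<open>\<eta>\<close> tends to 0; then the truncation is lifted by Fatou's lemma.\<close>
  have tr: "expectation (\<lambda>\<omega>. indicator A \<omega> * min K (Y \<omega>)) \<le> exp ((1/2 + \<eta>) * (q + \<eta>) + \<eta>) * prob A"
    if \<eta>: "0 < \<eta>" "\<eta> \<le> 1/4" and K: "0 \<le> K" for \<eta> K
  proof (rule LIMSEQ_le_const)
    let ?R = "\<lambda>n. exp ((1/2 + \<eta>) * (q + \<eta>) + \<eta>) * exp (2 * \<kappa> * (T\<^sup>2 * inverse (real (Suc n)))) * prob A
      + K * (b / \<eta>\<^sup>2 * (T\<^sup>2 * inverse (real (Suc n))))"
    have "?R \<longlonglongrightarrow> exp ((1/2 + \<eta>) * (q + \<eta>) + \<eta>) * exp (2 * \<kappa> * (T\<^sup>2 * 0)) * prob A + K * (b / \<eta>\<^sup>2 * (T\<^sup>2 * 0))"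
      by (intro tendsto_intros LIMSEQ_inverse_real_of_nat)
    then show "?R \<longlonglongrightarrow> exp ((1/2 + \<eta>) * (q + \<eta>) + \<eta>) * prob A" by simp
    show "\<exists>n0. \<forall>n\<ge>n0. expectation (\<lambda>\<omega>. indicator A \<omega> * min K (Y \<omega>)) \<le> ?R n"
    proof (intro exI allI impI)
      fix n :: nat
      define h where "h = T / real (Suc n)"
      have h: "h > 0" using T by (simp add: h_def)
      have mh: "real (Suc n) * h = T" by (simp add: h_def)
      have mh2: "real (Suc n) * h\<^sup>2 = T\<^sup>2 * inverse (real (Suc n))"
        
      proof -
        have "c * (T / c)\<^sup>2 = T\<^sup>2 * inverse c" if "c \<noteq> 0" for c :: real
          using that by (simp add: power2_eq_square field_simps)
        then show ?thesis by (simp only: h_def of_nat_0_eq_iff nat.distinct not_False_eq_True of_nat_eq_0_iff)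
      qed
      have st: "s + T = t" by (simp add: T_def)
      show "expectation (\<lambda>\<omega>. indicator A \<omega> * min K (Y \<omega>)) \<le> ?R n"
        using truncated_exp_bound[OF s(1) h N A \<eta> K, of a "Suc n", unfolded mh mh2 st quartic_const_def[OF s(1) h N, of a]]
        unfolding Y_def q_def b_def \<kappa>_def by simp
    qed
  qed
  have tr': "expectation (\<lambda>\<omega>. indicator A \<omega> * min K (Y \<omega>)) \<le> exp (q / 2) * prob A" if K: "0 \<le> K" for K
  proof (rule LIMSEQ_le_const)
    let ?e = "\<lambda>n. inverse (real (Suc n))"
    have "(\<lambda>n. exp ((1/2 + ?e n) * (q + ?e n) + ?e n) * prob A) \<longlonglongrightarrow> exp ((1/2 + 0) * (q + 0) + 0) * prob A"
      by (intro tendsto_intros LIMSEQ_inverse_real_of_nat)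
    then show "(\<lambda>n. exp ((1/2 + ?e n) * (q + ?e n) + ?e n) * prob A) \<longlonglongrightarrow> exp (q / 2) * prob A" by simp
    show "\<exists>n0. \<forall>n\<ge>n0. expectation (\<lambda>\<omega>. indicator A \<omega> * min K (Y \<omega>)) \<le> exp ((1/2 + ?e n) * (q + ?e n) + ?e n) * prob A"
    proof (intro exI[of _ 3] allI impI)
      fix n :: nat assume "3 \<le> n"
      then have "?e n \<le> 1/4" by (simp add: field_simps)
      then show "expectation (\<lambda>\<omega>. indicator A \<omega> * min K (Y \<omega>)) \<le> exp ((1/2 + ?e n) * (q + ?e n) + ?e n) * prob A"
        by (intro tr K) auto
    qed
  qed
  have lim: "(\<integral>\<^sup>+\<omega>. ennreal (indicator A \<omega> * min (real n) (Y \<omega>)) \<partial>M) \<le> ennreal (exp (q / 2) * prob A)" for n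
  proof (subst nn_integral_eq_integral)
    show "integrable M (\<lambda>\<omega>. indicator A \<omega> * min (real n) (Y \<omega>))"
    proof (rule integrable_const_bound[where B = "real n"])
      have "norm (indicator A \<omega> * min (real n) (Y \<omega>)) \<le> real n" for \<omega>
        using Y0[of \<omega>] by (cases "\<omega> \<in> A") auto
      then show "AE \<omega> in M. norm (indicator A \<omega> * min (real n) (Y \<omega>)) \<le> real n" by simp
    qed measurable
    show "AE \<omega> in M. 0 \<le> indicator A \<omega> * min (real n) (Y \<omega>)" using Y0 by auto
    show "ennreal (expectation (\<lambda>\<omega>. indicator A \<omega> * min (real n) (Y \<omega>))) \<le> ennreal (exp (q / 2) * prob A)"
      by (intro ennreal_leI tr') simp
  qed
  have "(\<integral>\<^sup>+\<omega>. ennreal (Y \<omega>) * indicator A \<omega> \<partial>M) \<le> (\<integral>\<^sup>+\<omega>. liminf (\<lambda>n. ennreal (indicator A \<omega> * min (real n) (Y \<omega>))) \<partial>M)"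
  proof (intro nn_integral_mono)
    fix \<omega>
    have "eventually (\<lambda>n. ennreal (indicator A \<omega> * min (real n) (Y \<omega>)) = ennreal (indicator A \<omega> * Y \<omega>)) sequentially"
      using eventually_ge_at_top[of "nat \<lceil>Y \<omega>\<rceil>"] by eventually_elim (simp add: min_absorb2 nat_ceiling_le_eq)
    then have "liminf (\<lambda>n. ennreal (indicator A \<omega> * min (real n) (Y \<omega>))) = ennreal (indicator A \<omega> * Y \<omega>)"
      by (intro lim_imp_Liminf tendsto_eventually) auto
    then show "ennreal (Y \<omega>) * indicator A \<omega> \<le> liminf (\<lambda>n. ennreal (indicator A \<omega> * min (real n) (Y \<omega>)))"
      by (simp add: indicator_def)
  qed
  also have "\<dots> \<le> liminf (\<lambda>n. \<integral>\<^sup>+\<omega>. ennreal (indicator A \<omega> * min (real n) (Y \<omega>)) \<partial>M)"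
    by (intro nn_integral_liminf) measurable
  also have "\<dots> \<le> ennreal (exp (q / 2) * prob A)"
    using lim by (intro Liminf_le always_eventually) auto
  finally show ?thesis by (simp add: Y_def q_def T_def ennreal_mult emeasure_eq_measure)
qed

end

section \<open>Semigroup estimates\<close>

text \<open>Uniform boundedness through Baire: the closed sets \<open>T n\<close> exhaust the space
  because orbits are continuous on a compact interval, and a ball inside one \<open>T n\<close>
  bounds all the operators by differences of two of its points.\<close>

lemma semigroup_bounded_unit_interval:
  fixes S :: "real \<Rightarrow> 'h::banach \<Rightarrow>\<^sub>L 'h"
  assumes "strongly_continuous_semigroup S"
  obtains C where "C \<ge> 1" "\<And>t. 0 \<le> t \<Longrightarrow> t \<le> 1 \<Longrightarrow> norm (S t) \<le> C"
proof -
  define T where "T n = (\<Inter>t\<in>{0..1}. {x. norm (S t x) \<le> real n})" for n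
  have cl: "closed (T n)" for n
    unfolding T_def by (intro closed_INT ballI closed_Collect_le continuous_intros)
  have "x \<in> \<Union>(range T)" for x
  proof -
    from assms have "continuous_on {0..} (\<lambda>t. S t x)" by (simp add: strongly_continuous_semigroup_def)
    then have "continuous_on {0..1} (\<lambda>t. S t x)" by (rule continuous_on_subset) auto
    then have "bounded ((\<lambda>t. S t x) ` {0..1})"
      by (intro compact_imp_bounded compact_continuous_image) auto
    then obtain b where "\<forall>t\<in>{0..1}. norm (S t x) \<le> b" by (auto simp: bounded_iff)
    moreover obtain n where "b \<le> real n" using real_arch_simple by blast
    ultimately have "x \<in> T n" by (force simp: T_def)
    then show ?thesis by auto
  qed
  then have U: "\<Union>(range T) = UNIV" by auto
  have "\<exists>n. interior (T n) \<noteq> {}"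
  proof (rule ccontr)
    assume "\<not> ?thesis"
    then have "euclidean interior_of \<Union>(range T) = {}"
      by (intro Baire_category_alt disjI1 completely_metrizable_space_euclidean)
        (use cl in \<open>auto simp: interior_of_def interior_def\<close>)
    then show False by (simp add: U)
  qed
  then obtain n x0 e where e: "e > 0" "cball x0 e \<subseteq> T n"
    by (metis all_not_in_conv mem_interior_cball)
  have "norm (S t) \<le> 2 * real n / e" if "0 \<le> t" "t \<le> 1" for t
  proof (rule norm_blinfun_bound)
    show "0 \<le> 2 * real n / e" using e by simp
    fix y
    show "norm (S t y) \<le> 2 * real n / e * norm y"
    proof (cases "y = 0")
      case False
      define z where "z = (e / norm y) *\<^sub>R y"
      have "x0 + z \<in> T n" "x0 \<in> T n"
        using e False by (auto simp: z_def dist_norm intro!: set_mp[OF e(2)])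
      then have "norm (S t (x0 + z)) \<le> n" "norm (S t x0) \<le> n" using that by (auto simp: T_def)
      then have "norm (S t z) \<le> 2 * real n"
        using norm_triangle_ineq4[of "S t (x0 + z)" "S t x0"] by (simp add: blinfun.add_right)
      then show ?thesis using e False by (simp add: z_def blinfun.scaleR_right field_simps)
    qed simp
  qed
  then show ?thesis
    by (intro that[of "max 1 (2 * real n / e)"]) (auto simp: le_max_iff_disj)
qed

lemma semigroup_add:
  assumes "strongly_continuous_semigroup S" "0 \<le> s" "0 \<le> t"
  shows "S (s + t) = S s o\<^sub>L S t"
  using assms by (auto simp: strongly_continuous_semigroup_def)

text \<open>Strong continuity gives the convergence on a finite net, and the common operator bound
  \<open>C\<close> carries it over to the points nearby. In operator norm \<open>S s\<close> need
  not approach the identity at all.\<close>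

lemma semigroup_uniform_on_compact:
  fixes S :: "real \<Rightarrow> 'h::banach \<Rightarrow>\<^sub>L 'h"
  assumes S: "strongly_continuous_semigroup S" and K: "compact K" and e: "e > 0"
  obtains d where "d > 0" "d \<le> 1" "\<And>s x. 0 \<le> s \<Longrightarrow> s \<le> d \<Longrightarrow> x \<in> K \<Longrightarrow> norm (S s x - x) < e"
proof -
  obtain C where C: "C \<ge> 1" "\<And>t. 0 \<le> t \<Longrightarrow> t \<le> 1 \<Longrightarrow> norm (S t) \<le> C"
    using semigroup_bounded_unit_interval[OF S] by blast
  define r where "r = e / (3 * C)"
  have r: "r > 0" using C e by (simp add: r_def)
  obtain P where P: "finite P" "K \<subseteq> (\<Union>p\<in>P. ball p r)"
    using seq_compact_imp_totally_bounded[OF compact_imp_seq_compact[OF K]] r by blast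
  have "\<forall>p\<in>P. \<exists>d>0. \<forall>s. 0 \<le> s \<longrightarrow> s \<le> d \<longrightarrow> norm (S s p - p) < e / 3"
  proof
    fix p
    have "continuous_on {0..} (\<lambda>t. S t p)" using S by (auto simp: strongly_continuous_semigroup_def)
    then obtain d where "d > 0" "\<forall>s\<in>{0..}. dist s 0 < d \<longrightarrow> dist (S s p) (S 0 p) < e / 3"
      using e unfolding continuous_on_iff by (metis atLeast_iff divide_pos_pos order_refl zero_less_numeral)
    then show "\<exists>d>0. \<forall>s. 0 \<le> s \<longrightarrow> s \<le> d \<longrightarrow> norm (S s p - p) < e / 3"
      using S by (intro exI[of _ "d/2"]) (auto simp: dist_norm strongly_continuous_semigroup_def)
  qed
  then obtain d where d: "\<And>p. p \<in> P \<Longrightarrow> d p > 0"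
    "\<And>p s. p \<in> P \<Longrightarrow> 0 \<le> s \<Longrightarrow> s \<le> d p \<Longrightarrow> norm (S s p - p) < e / 3" by metis
  define D where "D = Min (insert 1 (d ` P))"
  have D: "D > 0" "D \<le> 1" "\<And>p. p \<in> P \<Longrightarrow> D \<le> d p" using P d by (auto simp: D_def)
  show ?thesis
  proof (rule that[OF D(1,2)])
    fix s x assume s: "0 \<le> s" "s \<le> D" "x \<in> K"
    then obtain p where p: "p \<in> P" "norm (x - p) < r"
      using P(2) by (auto simp: dist_norm norm_minus_commute)
    have "norm (S s (x - p)) \<le> C * r"
      using norm_blinfun[of "S s" "x - p"] C(2)[of s] s D p(2) C(1)
      by (smt (verit) mult_mono norm_ge_zero)
    moreover have "norm (S s p - p) < e / 3" using d(2)[of p s] D(3)[of p] p s by auto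
    moreover have "C * r = e / 3" "r \<le> e / 3" using C e by (auto simp: r_def field_simps)
    moreover have "S s x - x = S s (x - p) + (S s p - p) + (p - x)" by (simp add: blinfun.diff_right)
    ultimately show "norm (S s x - x) < e"
      using p(2) norm_triangle_ineq[of "S s (x - p) + (S s p - p)" "p - x"]
        norm_triangle_ineq[of "S s (x - p)" "S s p - p"] by (simp add: norm_minus_commute)
  qed
qed

text \<open>With \<open>P = S (\<tau>/2 + \<sigma>)\<close> and \<open>Q = S (\<tau>/2)\<close>,
  which commute, this is \<open>(P - Q)^2 = S (\<tau> + 2 * \<sigma>) - 2 S (\<tau> + \<sigma>) + S
  \<tau>\<close> solved for the increment.\<close>

lemma semigroup_increment_sum:
  fixes S :: "real \<Rightarrow> 'h::banach \<Rightarrow>\<^sub>L 'h"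
  assumes S: "strongly_continuous_semigroup S" and "0 \<le> \<tau>" "0 \<le> \<sigma>"
  shows "S (\<tau> + \<sigma>) - S \<tau> = (1/2) *\<^sub>R (S (\<tau> + 2 * \<sigma>) - S \<tau>)
     - (1/2) *\<^sub>R ((S (\<tau>/2 + \<sigma>) - S (\<tau>/2)) o\<^sub>L (S (\<tau>/2 + \<sigma>) - S (\<tau>/2)))"
proof -
  have *: "S a (S b x) = S (a + b) x" if "0 \<le> a" "0 \<le> b" for a b x
    using semigroup_add[OF S that] by simp
  show ?thesis
  proof (rule blinfun_eqI)
    fix x
    have "S (\<tau>/2 + \<sigma>) (S (\<tau>/2 + \<sigma>) x) = S (\<tau> + 2 * \<sigma>) x" "S (\<tau>/2 + \<sigma>) (S (\<tau>/2) x) = S (\<tau> + \<sigma>) x"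
      "S (\<tau>/2) (S (\<tau>/2 + \<sigma>) x) = S (\<tau> + \<sigma>) x" "S (\<tau>/2) (S (\<tau>/2) x) = S \<tau> x"
      using assms(2,3) by (subst *; auto intro!: arg_cong[where f = "\<lambda>t. blinfun_apply (S t) x"])+
    note eqs = this
    have half: "y = (1/2) *\<^sub>R (p - q) - (1/2) *\<^sub>R (p - (y + q) - (y + q - q))" if "y = y" for y p q :: 'h
      by (simp add: algebra_simps flip: scaleR_add_left)
    show "(S (\<tau> + \<sigma>) - S \<tau>) x = ((1/2) *\<^sub>R (S (\<tau> + 2 * \<sigma>) - S \<tau>)
     - (1/2) *\<^sub>R ((S (\<tau>/2 + \<sigma>) - S (\<tau>/2)) o\<^sub>L (S (\<tau>/2 + \<sigma>) - S (\<tau>/2)))) x"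
      using half[OF refl, of "S (\<tau> + \<sigma>) x - S \<tau> x" "S (\<tau> + 2 * \<sigma>) x" "S \<tau> x"]
      by (simp add: blinfun.diff_left blinfun.scaleR_left blinfun.diff_right eqs)
  qed
qed

text \<open>
  The hypothesis only says that the increment is eventually smaller than \<open>1/2\<close> relative to the
  scale \<open>\<sigma>/\<tau>\<close>; the previous identity bootstraps it to a power of \<open>\<sigma>/\<tau>\<close>: if \<open>\<omega>(\<theta>)\<close> bounds the
  increments with \<open>\<sigma> \<le> \<theta> \<tau>\<close>, then \<open>\<omega>(\<theta>) \<le> \<omega>(2\<theta>) (1 + \<omega>(2\<theta>)) / 2\<close>.
\<close>
lemma semigroup_increment_bound:
  fixes S :: "real \<Rightarrow> 'h::banach \<Rightarrow>\<^sub>L 'h"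
  assumes S: "strongly_continuous_semigroup S"
    and A2: "\<forall>a\<in>{0<..1}. uniformly_equicontinuous_on {a..1} {\<lambda>t. S (\<epsilon> * t) |\<epsilon>. \<epsilon> \<in> {0<..1}}"
  obtains C1 where "C1 > 0"
    "\<And>\<tau> \<sigma>. 0 < \<tau> \<Longrightarrow> 0 \<le> \<sigma> \<Longrightarrow> \<tau> + \<sigma> \<le> 1 \<Longrightarrow> (norm (S (\<tau> + \<sigma>) - S \<tau>))\<^sup>2 \<le> C1 * sqrt (\<sigma> / \<tau>)"
proof -
  obtain C where C: "C \<ge> 1" "\<And>t. 0 \<le> t \<Longrightarrow> t \<le> 1 \<Longrightarrow> norm (S t) \<le> C"
    using semigroup_bounded_unit_interval[OF S] by blast
  obtain d where d: "d > 0" "\<And>\<epsilon> s t. \<epsilon> \<in> {0<..1} \<Longrightarrow> s \<in> {1/2..1} \<Longrightarrow> t \<in> {1/2..1} \<Longrightarrow> dist s t < d \<Longrightarrow>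
      dist (S (\<epsilon> * s)) (S (\<epsilon> * t)) < 1/2"
  proof -
    have "(1/2::real) \<in> {0<..1}" "(1/2::real) > 0" by auto
    from A2[rule_format, OF this(1), unfolded uniformly_equicontinuous_on_def, rule_format, OF this(2)]
    obtain d where d: "d > 0" and *: "\<forall>f\<in>{\<lambda>t. S (\<epsilon> * t) |\<epsilon>. \<epsilon> \<in> {0<..1}}. \<forall>s\<in>{1/2..1}. \<forall>t\<in>{1/2..1}.
       dist s t < d \<longrightarrow> dist (f s) (f t) < 1/2" by (elim exE conjE) (rule that)
    have "dist (S (\<epsilon> * s)) (S (\<epsilon> * t)) < 1/2"
      if "\<epsilon> \<in> {0<..1}" "s \<in> {1/2..1}" "t \<in> {1/2..1}" "dist s t < d" for \<epsilon> s t
    proof -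
      have "(\<lambda>t. S (\<epsilon> * t)) \<in> {\<lambda>t. S (\<epsilon> * t) |\<epsilon>. \<epsilon> \<in> {0<..1}}" using that(1) by blast
      from *[rule_format, OF this that(2-4)] show ?thesis .
    qed
    then show thesis by (rule that[OF d])
  qed
  define \<theta> where "\<theta> = min (d/2) 1"
  have \<theta>: "\<theta> > 0" "\<theta> \<le> 1" "\<theta> < d" using d(1) by (auto simp: \<theta>_def)
  \<comment> \<open>(A2) is applied on [1/2, 1] to the times 1 and
    \<open>\<tau> / (\<tau> + \<sigma>)\<close>, with \<open>\<tau> + \<sigma>\<close> in the role
    of \<open>\<epsilon>\<close>. Uniformity in the scale turns it into a condition on the ratio of
    \<open>\<sigma>\<close> and \<open>\<tau>\<close>.\<close>
  have base: "norm (S (\<tau> + \<sigma>) - S \<tau>) \<le> 1/2" if "0 < \<tau>" "0 \<le> \<sigma>" "\<tau> + \<sigma> \<le> 1" "\<sigma> \<le> \<theta> * \<tau>" for \<tau> \<sigma>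
  proof -
    have "\<sigma> \<le> \<tau>" using that(1,4) \<theta>(1,2) mult_left_le_one_le[of \<tau> \<theta>] by linarith
    then have 1: "\<tau> / (\<tau> + \<sigma>) \<in> {1/2..1}" using that(1,2) by (simp add: field_simps)
    have "1 - \<tau> / (\<tau> + \<sigma>) = \<sigma> / (\<tau> + \<sigma>)" using that(1,2) by (simp add: field_simps)
    also have "\<dots> \<le> \<theta>"
    proof -
      have "0 \<le> \<theta> * \<sigma>" using that \<theta> by simp
      then have "\<sigma> \<le> \<theta> * (\<tau> + \<sigma>)" using that(4) by (simp add: distrib_left)
      then show ?thesis using that(1,2) by (simp add: pos_divide_le_eq)
    qed
    finally have "dist 1 (\<tau> / (\<tau> + \<sigma>)) < d" using 1 \<theta> by (simp add: dist_real_def)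
    then have "dist (S ((\<tau> + \<sigma>) * 1)) (S ((\<tau> + \<sigma>) * (\<tau> / (\<tau> + \<sigma>)))) < 1/2"
      using that(1-3) 1 by (intro d(2)) simp_all
    moreover have "(\<tau> + \<sigma>) * 1 = \<tau> + \<sigma>" "(\<tau> + \<sigma>) * (\<tau> / (\<tau> + \<sigma>)) = \<tau>" using that(1,2) by simp_all
    ultimately show ?thesis by (simp only: dist_norm less_imp_le)
  qed
  \<comment> \<open>If both increments on the right of \<open>semigroup_increment_sum\<close> are at
    most \<open>b \<le> 1/2\<close>, the one on the left is at most
    \<open>b/2 + b^2/2 \<le> 3b/4\<close>; each halving of the ratio gains this factor. The
    restriction \<open>\<tau> \<le> 1/2\<close> keeps all times at most 1.\<close>
  have step: "norm (S (\<tau> + \<sigma>) - S \<tau>) \<le> 1/2 * (3/4)^k"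
    if "0 < \<tau>" "\<tau> \<le> 1/2" "0 \<le> \<sigma>" "\<sigma> \<le> \<theta> * \<tau> / 2^k" for \<tau> \<sigma> k
    using that
  proof (induction k arbitrary: \<tau> \<sigma>)
    case 0
    have "\<sigma> \<le> \<theta> * \<tau>" using 0 by simp
    moreover have "\<theta> * \<tau> \<le> \<tau>" using 0 \<theta>(1,2) by (intro mult_left_le_one_le) auto
    ultimately have "\<sigma> \<le> \<tau>" by simp
    then show ?case using base[of \<tau> \<sigma>] 0 by simp
  next
    case (Suc k)
    define n1 where "n1 = norm (S (\<tau> + 2 * \<sigma>) - S \<tau>)"
    define n2 where "n2 = norm (S (\<tau>/2 + \<sigma>) - S (\<tau>/2))"
    have b: "n1 \<le> 1/2 * (3/4)^k" "n2 \<le> 1/2 * (3/4)^k"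
    proof -
      have "2 * \<sigma> \<le> \<theta> * \<tau> / 2^k" "\<sigma> \<le> \<theta> * (\<tau>/2) / 2^k"
        using Suc.prems(4) by (simp_all add: divide_simps mult_ac)
      moreover have "\<tau>/2 \<le> 1/2" "0 < \<tau>/2" "0 \<le> 2 * \<sigma>" using Suc.prems(1-3) by simp_all
      ultimately show "n1 \<le> 1/2 * (3/4)^k" "n2 \<le> 1/2 * (3/4)^k"
        unfolding n1_def n2_def using Suc.prems(1-3) by (blast intro: Suc.IH)+
    qed
    have "(3/4::real)^k \<le> 1" by (simp add: power_le_one)
    then have "n2 * n2 \<le> 1/2 * (3/4)^k * (1/2)" using b(2)
      by (intro mult_mono) (auto simp: n2_def)
    moreover have "norm (S (\<tau> + \<sigma>) - S \<tau>) \<le> 1/2 * n1 + 1/2 * (n2 * n2)"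
    proof -
      define P where "P = S (\<tau> + 2 * \<sigma>) - S \<tau>"
      define Q where "Q = S (\<tau>/2 + \<sigma>) - S (\<tau>/2)"
      have "norm (S (\<tau> + \<sigma>) - S \<tau>) = norm ((1/2) *\<^sub>R P - (1/2) *\<^sub>R (Q o\<^sub>L Q))"
        unfolding P_def Q_def
        by (rule arg_cong[where f = norm], rule semigroup_increment_sum[OF S less_imp_le[OF Suc.prems(1)] Suc.prems(3)])
      also have "\<dots> \<le> 1/2 * norm P + 1/2 * norm (Q o\<^sub>L Q)"
        by (rule order_trans[OF norm_triangle_ineq4]) simp
      also have "\<dots> \<le> 1/2 * norm P + 1/2 * (norm Q * norm Q)"
        using norm_blinfun_compose[of Q Q] by simp
      finally show ?thesis by (simp only: P_def Q_def n1_def n2_def)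
    qed
    moreover have "1/2 * (3/4)^Suc k = 3/8 * (3/4::real)^k" by simp
    ultimately show ?case using b(1) by linarith
  qed
  \<comment> \<open>Factoring out \<open>S (\<tau>/2)\<close> frees \<open>\<tau>\<close> from the
    restriction to \<open>\<tau> \<le> 1/2\<close>, at the price of \<open>C\<close> and of one more
    halving.\<close>
  have gain: "norm (S (\<tau> + \<sigma>) - S \<tau>) \<le> C * (1/2 * (3/4)^k)"
    if "0 < \<tau>" "0 \<le> \<sigma>" "\<tau> + \<sigma> \<le> 1" "\<sigma> \<le> \<theta> * (\<tau>/2) / 2^k" for \<tau> \<sigma> k
  proof -
    have "S (\<tau> + \<sigma>) - S \<tau> = S (\<tau>/2) o\<^sub>L (S (\<tau>/2 + \<sigma>) - S (\<tau>/2))"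
    proof -
      have "\<tau>/2 + (\<tau>/2 + \<sigma>) = \<tau> + \<sigma>" "\<tau>/2 + \<tau>/2 = \<tau>" by simp_all
      then have "S (\<tau> + \<sigma>) = S (\<tau>/2) o\<^sub>L S (\<tau>/2 + \<sigma>)" "S \<tau> = S (\<tau>/2) o\<^sub>L S (\<tau>/2)"
        using that(1,2) semigroup_add[OF S, of "\<tau>/2" "\<tau>/2 + \<sigma>"] semigroup_add[OF S, of "\<tau>/2" "\<tau>/2"]
        by simp_all
      then show ?thesis by (metis bounded_bilinear.diff_right[OF bounded_bilinear_blinfun_compose])
    qed
    also have "norm \<dots> \<le> C * (1/2 * (3/4)^k)"
      by (rule order_trans[OF norm_blinfun_compose], rule mult_mono)
        (use step[of "\<tau>/2" \<sigma> k] that C(1) in \<open>auto intro!: C(2)\<close>)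
    finally show ?thesis .
  qed
  define C1 where "C1 = 16 * C\<^sup>2 / sqrt (\<theta>/2)"
  show ?thesis
  proof (rule that[of C1])
    show "C1 > 0" using C \<theta> by (simp add: C1_def)
    fix \<tau> \<sigma> :: real assume a: "0 < \<tau>" "0 \<le> \<sigma>" "\<tau> + \<sigma> \<le> 1"
    \<comment> \<open>\<open>R\<close> is the ratio in units of \<open>\<theta>/2\<close>. Below 1
      it is at most \<open>(1/2)^l\<close> and more than half of it, for some \<open>l\<close>. The
      square of the gain contributes \<open>(9/16)^l\<close>, and \<open>(9/16)^2 \<le> 1/2\<close>
      turns this into the square root of \<open>R\<close>.\<close>
    define R where "R = \<sigma> / \<tau> / (\<theta> / 2)"
    have C1R: "C1 * sqrt (\<sigma> / \<tau>) = 16 * C\<^sup>2 * sqrt R"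
      by (simp add: C1_def R_def real_sqrt_divide real_sqrt_mult mult_ac)
    have "\<sigma> = 0 \<or> R > 0" using a(1,2) \<theta>(1) by (simp add: R_def less_le)
    then have "\<sigma> = 0 \<or> R \<ge> 1 \<or> 0 < R \<and> R < 1" by linarith
    then consider "\<sigma> = 0" | "R \<ge> 1" | "0 < R" "R < 1" by blast
    then show "(norm (S (\<tau> + \<sigma>) - S \<tau>))\<^sup>2 \<le> C1 * sqrt (\<sigma> / \<tau>)"
    proof cases
      case 1 then show ?thesis by simp
    next
      case 2
      have "norm (S (\<tau> + \<sigma>) - S \<tau>) \<le> 2 * C"
        using norm_triangle_ineq4[of "S (\<tau> + \<sigma>)" "S \<tau>"] C(2)[of "\<tau> + \<sigma>"] C(2)[of \<tau>] a by linarith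
      then have "(norm (S (\<tau> + \<sigma>) - S \<tau>))\<^sup>2 \<le> (2 * C)\<^sup>2" by (intro power_mono) auto
      also have "\<dots> \<le> 16 * C\<^sup>2 * 1" by (simp add: power_mult_distrib)
      also have "\<dots> \<le> 16 * C\<^sup>2 * sqrt R" using 2 by (intro mult_left_mono) auto
      finally show ?thesis using C1R by simp
    next
      case 3
      have "\<exists>k. (1/2::real)^k < R" using 3 real_arch_pow_inv[of R "1/2"] by auto
      define k where "k = (LEAST k. (1/2::real)^k < R)"
      have k: "(1/2::real)^k < R" unfolding k_def by (rule LeastI_ex) fact
      have "k \<noteq> 0" using k 3 by (metis less_asym power_0)
      then obtain l where l: "k = Suc l" by (cases k) auto
      have "\<not> (1/2::real)^l < R" using not_less_Least[of l "\<lambda>k. (1/2::real)^k < R"] l k_def by auto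
      then have Rl: "R \<le> (1/2)^l" "(1/2)^l < 2 * R" using k l by auto
      have "\<sigma> \<le> \<theta> * (\<tau>/2) / 2^l" using Rl(1) a \<theta> by (simp add: R_def field_simps power_divide)
      then have "norm (S (\<tau> + \<sigma>) - S \<tau>) \<le> C * (1/2 * (3/4)^l)" using gain a by blast
      then have "(norm (S (\<tau> + \<sigma>) - S \<tau>))\<^sup>2 \<le> (C * (1/2 * (3/4)^l))\<^sup>2" by (intro power_mono) auto
      also have "\<dots> = C\<^sup>2 * (1/4) * (9/16)^l"
      proof -
        have "((3/4::real)^l)\<^sup>2 = ((3/4)\<^sup>2)^l" by (metis mult.commute power_mult)
        then show ?thesis by (simp add: power_mult_distrib power2_eq_square)
      qed
      also have "\<dots> \<le> C\<^sup>2 * (1/4) * sqrt ((1/2)^l)"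
      proof -
        have "((9/16::real)^l)\<^sup>2 = ((9/16)\<^sup>2)^l" by (metis mult.commute power_mult)
        also have "\<dots> \<le> (1/2)^l" by (intro power_mono) (auto simp: power2_eq_square)
        finally show ?thesis by (intro mult_left_mono real_le_rsqrt) auto
      qed
      also have "\<dots> \<le> C\<^sup>2 * (1/4) * sqrt (4 * R)" using Rl 3 by (intro mult_left_mono) auto
      also have "\<dots> \<le> 16 * C\<^sup>2 * sqrt R" using 3 by (simp add: real_sqrt_mult)
      finally show ?thesis using C1R by simp
    qed
  qed
qed

section \<open>Gaussian measures and the method of mixtures\<close>

text \<open>Serves to recentre a product Gaussian coordinate by coordinate. The two measures agree
  on boxes, where the integral factors.\<close>

lemma PiM_density:
  assumes I: "finite I" and N: "\<And>i. prob_space (N i)" and f[measurable]: "\<And>i. f i \<in> borel_measurable (N i)"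
    and D: "\<And>i. prob_space (density (N i) (f i))"
  shows "PiM I (\<lambda>i. density (N i) (f i)) = density (PiM I N) (\<lambda>x. \<Prod>i\<in>I. f i (x i))"
proof -
  interpret N: product_prob_space N by (intro product_prob_spaceI N)
  interpret D: product_sigma_finite "\<lambda>i. density (N i) (f i)"
    unfolding product_sigma_finite_def using prob_space_imp_sigma_finite[OF D] by blast
  have m: "(\<lambda>x. \<Prod>i\<in>I. f i (x i)) \<in> borel_measurable (PiM I N)" by measurable
  show ?thesis
  proof (rule D.PiM_eqI[OF I, symmetric])
    show "sets (density (PiM I N) (\<lambda>x. \<Prod>i\<in>I. f i (x i))) = sets (PiM I (\<lambda>i. density (N i) (f i)))"
      by (simp, rule sets_PiM_cong) simp_all
    fix A assume A: "\<And>i. i \<in> I \<Longrightarrow> A i \<in> sets (density (N i) (f i))"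
    then have A'[measurable]: "i \<in> I \<Longrightarrow> A i \<in> sets (N i)" for i by simp
    have E: "PiE I A \<in> sets (PiM I N)" using I A' by (intro sets_PiM_I_finite) auto
    have "emeasure (density (PiM I N) (\<lambda>x. \<Prod>i\<in>I. f i (x i))) (PiE I A)
        = (\<integral>\<^sup>+x. (\<Prod>i\<in>I. f i (x i)) * indicator (PiE I A) x \<partial>PiM I N)"
      by (rule emeasure_density[OF m E])
    also have "\<dots> = (\<integral>\<^sup>+x. (\<Prod>i\<in>I. f i (x i) * indicator (A i) (x i)) \<partial>PiM I N)"
    proof (intro nn_integral_cong)
      fix x assume "x \<in> space (PiM I N)"
      then have ext: "x \<in> extensional I" by (auto simp: space_PiM PiE_def)
      have "indicator (PiE I A) x = (\<Prod>i\<in>I. indicator (A i) (x i) :: ennreal)"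
      proof (cases "\<forall>i\<in>I. x i \<in> A i")
        case True
        then show ?thesis using ext by (simp add: PiE_def Pi_def)
      next
        case False
        then obtain i where i: "i \<in> I" "x i \<notin> A i" by blast
        then have "(\<Prod>i\<in>I. indicator (A i) (x i) :: ennreal) = 0" using I i by (intro prod_zero bexI[OF _ i(1)]) auto
        then show ?thesis using i by (simp add: PiE_def Pi_def indicator_def)
      qed
      then show "(\<Prod>i\<in>I. f i (x i)) * indicator (PiE I A) x = (\<Prod>i\<in>I. f i (x i) * indicator (A i) (x i))"
        by (simp add: prod.distrib)
    qed
    also have "\<dots> = (\<Prod>i\<in>I. \<integral>\<^sup>+x. f i x * indicator (A i) x \<partial>N i)"
      by (rule N.product_nn_integral_prod[OF I]) measurable
    also have "\<dots> = (\<Prod>i\<in>I. emeasure (density (N i) (f i)) (A i))"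
      using A' by (intro prod.cong refl) (simp add: emeasure_density)
    finally show "emeasure (density (PiM I N) (\<lambda>x. \<Prod>i\<in>I. f i (x i))) (PiE I A)
        = (\<Prod>i\<in>I. emeasure (density (N i) (f i)) (A i))" .
  qed
qed

text \<open>Integrates the tangent line of \<open>exp\<close> at the mean. The right-hand side lives
  in \<open>[0, \<infinity>]\<close>, so the case of a non-integrable exponential is
  included.\<close>

lemma (in prob_space) jensen_exp_nn_integral:
  fixes f :: "'a \<Rightarrow> real"
  assumes f: "integrable M f"
  shows "ennreal (exp (expectation f)) \<le> (\<integral>\<^sup>+x. ennreal (exp (f x)) \<partial>M)"
proof (cases "(\<integral>\<^sup>+x. ennreal (exp (f x)) \<partial>M) = \<infinity>")
  case False
  have [measurable]: "f \<in> borel_measurable M" using f by simp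
  have int: "integrable M (\<lambda>x. exp (f x))"
    using False by (intro integrableI_nonneg) (auto simp: top.not_eq_extremum)
  define m where "m = expectation f"
  have "exp m = expectation (\<lambda>x. exp m * (1 + (f x - m)))"
    using f by (simp add: m_def prob_space)
  also have "\<dots> \<le> expectation (\<lambda>x. exp (f x))"
  proof (rule integral_mono)
    show "integrable M (\<lambda>x. exp m * (1 + (f x - m)))" using f by simp
    fix x
    have "exp m * (1 + (f x - m)) \<le> exp m * exp (f x - m)"
      by (intro mult_left_mono exp_ge_add_one_self) auto
    also have "\<dots> = exp (f x)" by (simp add: exp_diff)
    finally show "exp m * (1 + (f x - m)) \<le> exp (f x)" .
  qed (rule int)
  finally have "ennreal (exp m) \<le> ennreal (expectation (\<lambda>x. exp (f x)))" by (rule ennreal_leI)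
  also have "\<dots> = (\<integral>\<^sup>+x. ennreal (exp (f x)) \<partial>M)" by (rule nn_integral_eq_integral[OF int, symmetric]) simp
  finally show ?thesis by (simp add: m_def)
qed simp

abbreviation gaussian :: "real \<Rightarrow> real measure" where
  "gaussian w \<equiv> density lborel (normal_density w 1)"

lemma prob_space_gaussian: "prob_space (gaussian w)"
  by (rule prob_space_normal_density) simp

lemma gaussian_moments:
  "integrable (gaussian w) (\<lambda>x. x)" "integral\<^sup>L (gaussian w) (\<lambda>x. x) = w"
  "integrable (gaussian w) (\<lambda>x. x\<^sup>2)" "integral\<^sup>L (gaussian w) (\<lambda>x. x\<^sup>2) = w\<^sup>2 + 1"
proof -
  have n: "(1::real) > 0" by simp
  have d: "integrable (gaussian w) f \<longleftrightarrow> integrable lborel (\<lambda>x. normal_density w 1 x * f x)"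
    "integral\<^sup>L (gaussian w) f = (\<integral>x. normal_density w 1 x * f x \<partial>lborel)"
    if "f \<in> borel_measurable borel" for f :: "real \<Rightarrow> real"
    using that by (simp_all add: integrable_density integral_density)
  show 1: "integrable (gaussian w) (\<lambda>x. x)" "integral\<^sup>L (gaussian w) (\<lambda>x. x) = w"
    using integral_normal_moment_nz_1[OF n, of w] integrable_normal_moment_nz_1[OF n, of w] by (simp_all add: d)
  have 2: "integrable (gaussian w) (\<lambda>x. (x - w)\<^sup>2)" "integral\<^sup>L (gaussian w) (\<lambda>x. (x - w)\<^sup>2) = 1"
    using integral_normal_moment_even[OF n, of w 1] integrable_normal_moment[OF n, of w 2]
    by (simp_all add: d fact_numeral)
  interpret prob_space "gaussian w" by (rule prob_space_gaussian)
  have eq: "x\<^sup>2 = (x - w)\<^sup>2 + (2 * w * x - w\<^sup>2)" for x by (simp add: power2_eq_square algebra_simps)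
  have 3: "integrable (gaussian w) (\<lambda>x. 2 * w * x - w\<^sup>2)" "integral\<^sup>L (gaussian w) (\<lambda>x. 2 * w * x - w\<^sup>2) = w\<^sup>2"
    using 1 prob_space by (simp_all add: power2_eq_square)
  show "integrable (gaussian w) (\<lambda>x. x\<^sup>2)" "integral\<^sup>L (gaussian w) (\<lambda>x. x\<^sup>2) = w\<^sup>2 + 1"
  proof -
    have sq: "(\<lambda>x. x\<^sup>2) = (\<lambda>x. (x - w)\<^sup>2 + (2 * w * x - w\<^sup>2))" using eq by (rule ext)
    show "integrable (gaussian w) (\<lambda>x. x\<^sup>2)" by (subst sq) (rule Bochner_Integration.integrable_add[OF 2(1) 3(1)])
    show "integral\<^sup>L (gaussian w) (\<lambda>x. x\<^sup>2) = w\<^sup>2 + 1"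
      by (subst sq) (simp only: Bochner_Integration.integral_add[OF 2(1) 3(1)] 2(2) 3(2) add.commute)
  qed
qed

lemma product_gaussian_moments:
  fixes w :: "'i \<Rightarrow> real"
  assumes I: "finite I" and i: "i \<in> I" "j \<in> I"
  defines "P \<equiv> PiM I (\<lambda>i. gaussian (w i))"
  shows "integrable P (\<lambda>x. x i)" "integral\<^sup>L P (\<lambda>x. x i) = w i"
    "integrable P (\<lambda>x. x i * x j)" "integral\<^sup>L P (\<lambda>x. x i * x j) = w i * w j + (if i = j then 1 else 0)"
proof -
  interpret product_prob_space "\<lambda>i. gaussian (w i)"
    by (intro product_prob_spaceI prob_space_gaussian)
  have g1: "integrable (gaussian v) (\<lambda>x. 1 :: real)" "integral\<^sup>L (gaussian v) (\<lambda>x. 1 :: real) = 1" for v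
  proof -
    interpret prob_space "gaussian v" by (rule prob_space_gaussian)
    show "integrable (gaussian v) (\<lambda>x. 1 :: real)" "integral\<^sup>L (gaussian v) (\<lambda>x. 1 :: real) = 1" using prob_space by simp_all
  qed
  have single: "integrable P (\<lambda>x. f (x i)) \<and> integral\<^sup>L P (\<lambda>x. f (x i)) = integral\<^sup>L (gaussian (w i)) f"
    if "integrable (gaussian (w i)) f" for f :: "real \<Rightarrow> real"
  proof -
    define F where "F k x = (if k = i then f x else 1)" for k x
    have F: "integrable (gaussian (w k)) (F k)" for k using that g1 by (cases "k = i") (simp_all add: F_def[abs_def])
    have eq: "f (x i) = (\<Prod>k\<in>I. F k (x k))" for x
      using I i by (simp add: F_def prod.If_cases Collect_conv_if Int_absorb1 prod.delta)
    have "(\<Prod>k\<in>I. integral\<^sup>L (gaussian (w k)) (F k)) = (\<Prod>k\<in>I. if k = i then integral\<^sup>L (gaussian (w i)) f else 1)"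
    proof (rule prod.cong[OF refl])
      fix k show "integral\<^sup>L (gaussian (w k)) (F k) = (if k = i then integral\<^sup>L (gaussian (w i)) f else 1)"
      proof (cases "k = i")
        case True
        then have "F k = f" by (auto simp: F_def)
        then show ?thesis using True by simp
      next
        case False
        then have "F k = (\<lambda>_. 1)" by (auto simp: F_def)
        then show ?thesis using False by (simp only: g1 if_False)
      qed
    qed
    then show ?thesis
      unfolding P_def eq using product_integrable_prod[OF I F] product_integral_prod[OF I F] I i by simp
  qed
  show "integrable P (\<lambda>x. x i)" "integral\<^sup>L P (\<lambda>x. x i) = w i"
    using single[OF gaussian_moments(1)] gaussian_moments(2) by auto
  have "integrable P (\<lambda>x. x i * x j) \<and> integral\<^sup>L P (\<lambda>x. x i * x j) = w i * w j + (if i = j then 1 else 0)"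
  proof (cases "i = j")
    case True
    then show ?thesis using single[OF gaussian_moments(3)] gaussian_moments(4)[of "w i"] by (simp add: power2_eq_square)
  next
    case False
    define F where "F k x = (if k = i \<or> k = j then x else 1)" for k and x :: real
    have F: "integrable (gaussian (w k)) (F k)" for k using gaussian_moments(1) g1 by (cases "k = i \<or> k = j") (auto simp: F_def[abs_def])
    have split: "(\<Prod>k\<in>I. h k) = h i * h j * (\<Prod>k\<in>I - {i, j}. h k)" for h :: "'i \<Rightarrow> real"
      using prod.subset_diff[of "{i, j}" I h] I i False by (simp add: mult_ac)
    have eq: "x i * x j = (\<Prod>k\<in>I. F k (x k))" for x by (subst split) (simp add: F_def)
    have "(\<Prod>k\<in>I. integral\<^sup>L (gaussian (w k)) (F k)) = w i * w j"
    proof -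
      have "integral\<^sup>L (gaussian (w k)) (F k) = (if k \<in> {i, j} then w k else 1)" for k
      proof (cases "k \<in> {i, j}")
        case True
        then have "F k = (\<lambda>x. x)" by (auto simp: F_def)
        then show ?thesis using True by (simp only: gaussian_moments if_True)
      next
        case False
        then have "F k = (\<lambda>_. 1)" by (auto simp: F_def)
        then show ?thesis using False by (simp only: g1 if_False)
      qed
      then show ?thesis by (subst split) simp
    qed
    then show ?thesis
      unfolding P_def eq using product_integrable_prod[OF I F] product_integral_prod[OF I F] False by simp
  qed
  then show "integrable P (\<lambda>x. x i * x j)" "integral\<^sup>L P (\<lambda>x. x i * x j) = w i * w j + (if i = j then 1 else 0)" by auto
qed

text \<open>Shift the Gaussian to be centred at \<open>\<theta>/(1 + \<theta>\<^sup>2 \<rho>) m\<close> and apply Jensen's inequality there.\<close>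
lemma gaussian_exponential_lower_bound:
  fixes m :: "'i \<Rightarrow> real" and R :: "'i \<Rightarrow> 'i \<Rightarrow> real"
  assumes I: "finite I" and \<rho>: "0 \<le> \<rho>"
    and tr: "(\<Sum>i\<in>I. R i i) \<le> \<kappa>" and op: "(\<Sum>i\<in>I. \<Sum>j\<in>I. m i * m j * R i j) \<le> \<rho> * (\<Sum>i\<in>I. (m i)\<^sup>2)"
  shows "ennreal (exp (\<theta>\<^sup>2 * (\<Sum>i\<in>I. (m i)\<^sup>2) / (2 * (1 + \<theta>\<^sup>2 * \<rho>)) - \<theta>\<^sup>2 * \<kappa> / 2))
    \<le> (\<integral>\<^sup>+x. ennreal (exp ((\<Sum>i\<in>I. \<theta> * x i * m i) - (\<Sum>i\<in>I. \<Sum>j\<in>I. (\<theta> * x i) * (\<theta> * x j) * R i j) / 2)) \<partial>PiM I (\<lambda>_. gaussian 0))"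
proof -
  \<comment> \<open>Centring at \<open>c * m\<close> makes the mean of the exponent at least
    \<open>S * (\<theta> * c - c^2 * (1 + \<theta>^2 * \<rho>) / 2) - \<theta>^2 * \<kappa> /
    2\<close>, where the share \<open>c^2 * S / 2\<close> is the relative entropy of the shift. This
    \<open>c\<close> is the maximiser.\<close>
  define c where "c = \<theta> / (1 + \<theta>\<^sup>2 * \<rho>)"
  define w where "w i = c * m i" for i
  define S where "S = (\<Sum>i\<in>I. (m i)\<^sup>2)"
  let ?r = "\<lambda>i x. ennreal (exp ((w i)\<^sup>2 / 2 - x * w i))"
  have dens: "density (gaussian (w i)) (?r i) = gaussian 0" for i
  proof -
    have "normal_density (w i) 1 x * exp ((w i)\<^sup>2 / 2 - x * w i) = normal_density 0 1 x" for x
      by (simp add: normal_density_def mult_exp_exp power2_eq_square algebra_simps add_divide_distrib diff_divide_distrib)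
    then show ?thesis by (simp add: density_density_eq ennreal_mult[symmetric])
  qed
  let ?P = "PiM I (\<lambda>i. gaussian (w i))"
  define g where "g x = (\<Sum>i\<in>I. \<theta> * x i * m i) - (\<Sum>i\<in>I. \<Sum>j\<in>I. (\<theta> * x i) * (\<theta> * x j) * R i j) / 2" for x :: "'i \<Rightarrow> real"
  define G where "G x = g x + (\<Sum>i\<in>I. (w i)\<^sup>2 / 2 - x i * w i)" for x :: "'i \<Rightarrow> real"
  have PP: "PiM I (\<lambda>_. gaussian 0) = density ?P (\<lambda>x. \<Prod>i\<in>I. ?r i (x i))"
    using PiM_density[of I "\<lambda>i. gaussian (w i)" ?r] I prob_space_gaussian by (simp add: dens)
  interpret P: prob_space ?P by (intro prob_space_PiM prob_space_gaussian)
  note mom = product_gaussian_moments[OF I, of _ _ w]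
  have comp[measurable]: "i \<in> I \<Longrightarrow> (\<lambda>x. x i) \<in> borel_measurable ?P" for i
    using measurable_component_singleton[of i I "\<lambda>i. gaussian (w i)"] by simp
  have gm[measurable]: "g \<in> borel_measurable ?P" unfolding g_def by measurable
  have "(\<integral>\<^sup>+x. ennreal (exp (g x)) \<partial>PiM I (\<lambda>_. gaussian 0)) = (\<integral>\<^sup>+x. (\<Prod>i\<in>I. ?r i (x i)) * ennreal (exp (g x)) \<partial>?P)"
    unfolding PP by (subst nn_integral_density) measurable
  also have "\<dots> = (\<integral>\<^sup>+x. ennreal (exp (G x)) \<partial>?P)"
    using I by (intro nn_integral_cong) (simp add: G_def prod_ennreal exp_add exp_sum ennreal_mult[symmetric] prod_nonneg mult_ac)
  finally have eq: "(\<integral>\<^sup>+x. ennreal (exp (g x)) \<partial>PiM I (\<lambda>_. gaussian 0)) = (\<integral>\<^sup>+x. ennreal (exp (G x)) \<partial>?P)" .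
  have int1: "integrable ?P (\<lambda>x. \<Sum>i\<in>I. \<theta> * x i * m i)" "integral\<^sup>L ?P (\<lambda>x. \<Sum>i\<in>I. \<theta> * x i * m i) = \<theta> * c * S"
    using mom(1,2) by (simp_all add: Bochner_Integration.integral_sum w_def S_def sum_distrib_left power2_eq_square mult_ac)
  have int2: "integrable ?P (\<lambda>x. \<Sum>i\<in>I. \<Sum>j\<in>I. (\<theta> * x i) * (\<theta> * x j) * R i j)"
    "integral\<^sup>L ?P (\<lambda>x. \<Sum>i\<in>I. \<Sum>j\<in>I. (\<theta> * x i) * (\<theta> * x j) * R i j)
      = \<theta>\<^sup>2 * c\<^sup>2 * (\<Sum>i\<in>I. \<Sum>j\<in>I. m i * m j * R i j) + \<theta>\<^sup>2 * (\<Sum>i\<in>I. R i i)"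
  proof -
    have e: "(\<theta> * x i) * (\<theta> * x j) * R i j = (\<theta>\<^sup>2 * R i j) * (x i * x j)" for x :: "'i \<Rightarrow> real" and i j
      by (simp add: power2_eq_square mult_ac)
    show "integrable ?P (\<lambda>x. \<Sum>i\<in>I. \<Sum>j\<in>I. (\<theta> * x i) * (\<theta> * x j) * R i j)"
      unfolding e using mom(3) by (intro Bochner_Integration.integrable_sum integrable_mult_right)
    have "integral\<^sup>L ?P (\<lambda>x. \<Sum>i\<in>I. \<Sum>j\<in>I. (\<theta> * x i) * (\<theta> * x j) * R i j)
        = (\<Sum>i\<in>I. \<Sum>j\<in>I. (\<theta>\<^sup>2 * R i j) * (w i * w j + (if i = j then 1 else 0)))"
      unfolding e using mom(3,4) by (simp add: Bochner_Integration.integral_sum Bochner_Integration.integrable_sum)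
    also have "\<dots> = (\<Sum>i\<in>I. \<Sum>j\<in>I. \<theta>\<^sup>2 * c\<^sup>2 * (m i * m j * R i j)) + (\<Sum>i\<in>I. \<Sum>j\<in>I. if i = j then \<theta>\<^sup>2 * R i j else 0)"
      by (simp add: sum.distrib[symmetric] w_def power2_eq_square)
        (intro sum.cong refl, simp add: algebra_simps power2_eq_square)
    also have "(\<Sum>i\<in>I. \<Sum>j\<in>I. if i = j then \<theta>\<^sup>2 * R i j else 0) = \<theta>\<^sup>2 * (\<Sum>i\<in>I. R i i)"
      using I by (simp add: sum_distrib_left)
    finally show "integral\<^sup>L ?P (\<lambda>x. \<Sum>i\<in>I. \<Sum>j\<in>I. (\<theta> * x i) * (\<theta> * x j) * R i j)
      = \<theta>\<^sup>2 * c\<^sup>2 * (\<Sum>i\<in>I. \<Sum>j\<in>I. m i * m j * R i j) + \<theta>\<^sup>2 * (\<Sum>i\<in>I. R i i)"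
      by (simp add: sum_distrib_left)
  qed
  have int3: "integrable ?P (\<lambda>x. \<Sum>i\<in>I. (w i)\<^sup>2 / 2 - x i * w i)" "integral\<^sup>L ?P (\<lambda>x. \<Sum>i\<in>I. (w i)\<^sup>2 / 2 - x i * w i) = - c\<^sup>2 * S / 2"
  proof -
    show "integrable ?P (\<lambda>x. \<Sum>i\<in>I. (w i)\<^sup>2 / 2 - x i * w i)"
      using mom(1) by (intro Bochner_Integration.integrable_sum Bochner_Integration.integrable_diff integrable_mult_left) auto
    have "integral\<^sup>L ?P (\<lambda>x. \<Sum>i\<in>I. (w i)\<^sup>2 / 2 - x i * w i) = (\<Sum>i\<in>I. (w i)\<^sup>2 / 2 - w i * w i)"
      using mom(1,2) P.prob_space by (simp add: Bochner_Integration.integral_sum)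
    also have "\<dots> = - c\<^sup>2 * S / 2"
      unfolding S_def sum_distrib_left sum_divide_distrib
      by (intro sum.cong refl) (simp add: w_def power2_eq_square field_simps)
    finally show "integral\<^sup>L ?P (\<lambda>x. \<Sum>i\<in>I. (w i)\<^sup>2 / 2 - x i * w i) = - c\<^sup>2 * S / 2" .
  qed
  have GI: "integrable ?P G" unfolding G_def g_def using int1 int2 int3 by simp
  have GE: "integral\<^sup>L ?P G = \<theta> * c * S - (\<theta>\<^sup>2 * c\<^sup>2 * (\<Sum>i\<in>I. \<Sum>j\<in>I. m i * m j * R i j) + \<theta>\<^sup>2 * (\<Sum>i\<in>I. R i i)) / 2 - c\<^sup>2 * S / 2"
    unfolding G_def g_def using int1 int2 int3 by simp
  have pos: "1 + \<theta>\<^sup>2 * \<rho> > 0" using \<rho> by (simp add: add_pos_nonneg)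
  have "\<theta>\<^sup>2 * S / (2 * (1 + \<theta>\<^sup>2 * \<rho>)) - \<theta>\<^sup>2 * \<kappa> / 2 = \<theta> * c * S - (\<theta>\<^sup>2 * c\<^sup>2 * (\<rho> * S) + \<theta>\<^sup>2 * \<kappa>) / 2 - c\<^sup>2 * S / 2"
  proof -
    have th: "c * (1 + \<theta>\<^sup>2 * \<rho>) = \<theta>" using pos by (simp add: c_def)
    have h1: "\<theta>\<^sup>2 * S / (2 * (1 + \<theta>\<^sup>2 * \<rho>)) = \<theta> * c * S / 2" by (simp add: c_def power2_eq_square)
    have "\<theta>\<^sup>2 * c\<^sup>2 * (\<rho> * S) + c\<^sup>2 * S = c * (c * (1 + \<theta>\<^sup>2 * \<rho>)) * S" by (simp add: power2_eq_square algebra_simps)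
    then have h2: "\<theta>\<^sup>2 * c\<^sup>2 * (\<rho> * S) + c\<^sup>2 * S = \<theta> * c * S" unfolding th by (simp only: mult.commute)
    have "a / 2 - k / 2 = a - (p + k) / 2 - q / 2" if "p + q = a" for a k p q :: real
      using that by (simp add: field_simps)
    from this[OF h2] show ?thesis unfolding h1 .
  qed
  also have "\<dots> \<le> integral\<^sup>L ?P G"
  proof -
    have "\<theta>\<^sup>2 * c\<^sup>2 * (\<Sum>i\<in>I. \<Sum>j\<in>I. m i * m j * R i j) \<le> \<theta>\<^sup>2 * c\<^sup>2 * (\<rho> * S)"
      using op by (intro mult_left_mono) (auto simp: S_def)
    moreover have "\<theta>\<^sup>2 * (\<Sum>i\<in>I. R i i) \<le> \<theta>\<^sup>2 * \<kappa>" using tr by (intro mult_left_mono) auto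
    ultimately show ?thesis unfolding GE by simp
  qed
  finally have "ennreal (exp (\<theta>\<^sup>2 * S / (2 * (1 + \<theta>\<^sup>2 * \<rho>)) - \<theta>\<^sup>2 * \<kappa> / 2)) \<le> ennreal (exp (integral\<^sup>L ?P G))"
    by (intro ennreal_leI) simp
  also have "\<dots> \<le> (\<integral>\<^sup>+x. ennreal (exp (G x)) \<partial>?P)" by (rule P.jensen_exp_nn_integral[OF GI])
  finally show ?thesis by (simp add: eq[symmetric] g_def S_def)
qed

text \<open>Method of mixtures: integrate the exponential inequality over a Gaussian random direction \<open>v\<close>.\<close>
lemma (in prob_space) gaussian_mixture:
  fixes m :: "'i \<Rightarrow> 'a \<Rightarrow> real" and R :: "'i \<Rightarrow> 'i \<Rightarrow> 'a \<Rightarrow> real"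
  assumes I: "finite I" and \<rho>: "0 \<le> \<rho>" and A[measurable]: "A \<in> events"
    and m: "\<And>i. i \<in> I \<Longrightarrow> m i \<in> borel_measurable M"
    and R: "\<And>i j. i \<in> I \<Longrightarrow> j \<in> I \<Longrightarrow> R i j \<in> borel_measurable M"
    and le: "\<And>v. (\<integral>\<^sup>+\<omega>. ennreal (exp ((\<Sum>i\<in>I. v i * m i \<omega>) - (\<Sum>i\<in>I. \<Sum>j\<in>I. v i * v j * R i j \<omega>) / 2)) \<partial>M) \<le> 1"
    and tr: "\<And>\<omega>. \<omega> \<in> A \<Longrightarrow> (\<Sum>i\<in>I. R i i \<omega>) \<le> \<kappa>"
    and op: "\<And>\<omega>. \<omega> \<in> A \<Longrightarrow> (\<Sum>i\<in>I. \<Sum>j\<in>I. m i \<omega> * m j \<omega> * R i j \<omega>) \<le> \<rho> * (\<Sum>i\<in>I. (m i \<omega>)\<^sup>2)"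
  shows "(\<integral>\<^sup>+\<omega>. ennreal (exp (\<theta>\<^sup>2 * (\<Sum>i\<in>I. (m i \<omega>)\<^sup>2) / (2 * (1 + \<theta>\<^sup>2 * \<rho>)))) * indicator A \<omega> \<partial>M) \<le> ennreal (exp (\<theta>\<^sup>2 * \<kappa> / 2))"
proof -
  let ?P = "PiM I (\<lambda>_. gaussian 0)"
  interpret P: prob_space ?P by (intro prob_space_PiM prob_space_gaussian)
  interpret pair_sigma_finite M ?P ..
  have comp[measurable]: "i \<in> I \<Longrightarrow> (\<lambda>x. x i) \<in> borel_measurable ?P" for i
    using measurable_component_singleton[of i I "\<lambda>_. gaussian 0"] by simp
  note m[measurable] R[measurable]
  define g where "g \<omega> x = (\<Sum>i\<in>I. \<theta> * x i * m i \<omega>) - (\<Sum>i\<in>I. \<Sum>j\<in>I. (\<theta> * x i) * (\<theta> * x j) * R i j \<omega>) / 2" for \<omega> and x :: "'i \<Rightarrow> real"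
  have gm[measurable]: "(\<lambda>(\<omega>, x). ennreal (exp (g \<omega> x))) \<in> borel_measurable (M \<Otimes>\<^sub>M ?P)"
    unfolding g_def by measurable
  have lower: "ennreal (exp (\<theta>\<^sup>2 * (\<Sum>i\<in>I. (m i \<omega>)\<^sup>2) / (2 * (1 + \<theta>\<^sup>2 * \<rho>)))) * indicator A \<omega>
      \<le> ennreal (exp (\<theta>\<^sup>2 * \<kappa> / 2)) * (\<integral>\<^sup>+x. ennreal (exp (g \<omega> x)) \<partial>?P)" for \<omega>
  proof (cases "\<omega> \<in> A")
    case True
    have "ennreal (exp (\<theta>\<^sup>2 * (\<Sum>i\<in>I. (m i \<omega>)\<^sup>2) / (2 * (1 + \<theta>\<^sup>2 * \<rho>))))
      = ennreal (exp (\<theta>\<^sup>2 * \<kappa> / 2)) * ennreal (exp (\<theta>\<^sup>2 * (\<Sum>i\<in>I. (m i \<omega>)\<^sup>2) / (2 * (1 + \<theta>\<^sup>2 * \<rho>)) - \<theta>\<^sup>2 * \<kappa> / 2))"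
      by (simp add: ennreal_mult[symmetric] exp_add[symmetric])
    also have "\<dots> \<le> ennreal (exp (\<theta>\<^sup>2 * \<kappa> / 2)) * (\<integral>\<^sup>+x. ennreal (exp (g \<omega> x)) \<partial>?P)"
      unfolding g_def
      by (intro mult_left_mono gaussian_exponential_lower_bound[OF I \<rho> tr[OF True] op[OF True]]) simp
    finally show ?thesis using True by simp
  qed simp
  have "(\<integral>\<^sup>+\<omega>. ennreal (exp (\<theta>\<^sup>2 * (\<Sum>i\<in>I. (m i \<omega>)\<^sup>2) / (2 * (1 + \<theta>\<^sup>2 * \<rho>)))) * indicator A \<omega> \<partial>M)
      \<le> (\<integral>\<^sup>+\<omega>. ennreal (exp (\<theta>\<^sup>2 * \<kappa> / 2)) * (\<integral>\<^sup>+x. ennreal (exp (g \<omega> x)) \<partial>?P) \<partial>M)"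
    by (rule nn_integral_mono) (rule lower)
  also have "\<dots> = ennreal (exp (\<theta>\<^sup>2 * \<kappa> / 2)) * (\<integral>\<^sup>+\<omega>. (\<integral>\<^sup>+x. ennreal (exp (g \<omega> x)) \<partial>?P) \<partial>M)"
    by (rule nn_integral_cmult) measurable
  \<comment> \<open>After the exchange the inner integral is the exponential inequality in the
    direction \<open>\<theta> * x\<close>, at most 1 for every \<open>x\<close>.\<close>
  also have "(\<integral>\<^sup>+\<omega>. (\<integral>\<^sup>+x. ennreal (exp (g \<omega> x)) \<partial>?P) \<partial>M) = (\<integral>\<^sup>+x. (\<integral>\<^sup>+\<omega>. ennreal (exp (g \<omega> x)) \<partial>M) \<partial>?P)"
    using Fubini'[OF gm] by simp
  also have "\<dots> \<le> (\<integral>\<^sup>+x. 1 \<partial>?P)"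
  proof (rule nn_integral_mono)
    fix x show "(\<integral>\<^sup>+\<omega>. ennreal (exp (g \<omega> x)) \<partial>M) \<le> 1"
      using le[of "\<lambda>i. \<theta> * x i"] by (simp add: g_def)
  qed
  also have "\<dots> = 1" using P.emeasure_space_1 by simp
  finally show ?thesis by (simp add: mult_left_mono)
qed

section \<open>Elementary integrands and their exponential supermartingale\<close>

lemma integrable_indicator_Ioc:
  fixes a b :: real
  shows "integrable lborel (indicat_real {a<..b})"
  by (cases "a \<le> b") (auto intro!: integrable_real_indicator simp: emeasure_lborel_Ioc)

text \<open>The value of the elementary process at \<open>g k\<close>, see
  \<open>elementary_process_coord\<close>. Working with coordinates keeps the basis out of the
  estimates.\<close>

definition coord :: "('a, 'h::real_vector) elementary \<Rightarrow> 'a \<Rightarrow> real \<Rightarrow> nat \<Rightarrow> 'h" where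
  "coord es \<omega> u k = (\<Sum>(a, b, A, k', h)\<leftarrow>es. (if k' = k then indicator {a<..b} u * indicator A \<omega> else 0) *\<^sub>R h)"

definition indices :: "('a, 'h) elementary \<Rightarrow> nat set" where
  "indices es = (\<lambda>(a, b, A, k, h). k) ` set es"

text \<open>The trace of the quadratic variation, as a real number. The estimates use it for finite
  \<open>N\<close> that contain all indices of the integrand.\<close>

definition quad :: "nat set \<Rightarrow> ('a, 'h::real_inner) elementary \<Rightarrow> 'a \<Rightarrow> real" where
  "quad N es \<omega> = (LINT u|lborel. (\<Sum>k\<in>N. (norm (coord es \<omega> u k))\<^sup>2))"

lemma coord_Nil [simp]: "coord [] \<omega> u k = 0"
  by (simp add: coord_def)

lemma coord_Cons: "coord ((a, b, A, k', h) # es) \<omega> u k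
    = (if k' = k then indicator {a<..b} u * indicator A \<omega> else 0) *\<^sub>R h + coord es \<omega> u k"
  by (simp add: coord_def)

lemma coord_append: "coord (es @ fs) \<omega> u k = coord es \<omega> u k + coord fs \<omega> u k"
  by (simp add: coord_def)

lemma elementary_integral_append:
  "elementary_integral \<beta> (es @ fs) \<omega> = elementary_integral \<beta> es \<omega> + elementary_integral \<beta> fs \<omega>"
  by (simp add: elementary_integral_def)

lemma elementary_integral_Nil [simp]: "elementary_integral \<beta> [] \<omega> = 0"
  by (simp add: elementary_integral_def)

lemma elementary_integral_Cons: "elementary_integral \<beta> ((a, b, A, k, h) # es) \<omega>
    = (indicator A \<omega> * (\<beta> k b \<omega> - \<beta> k a \<omega>)) *\<^sub>R h + elementary_integral \<beta> es \<omega>"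
  by (simp add: elementary_integral_def)

lemma indices_Nil [simp]: "indices [] = {}" and
  indices_Cons [simp]: "indices ((a, b, A, k, h) # es) = insert k (indices es)" and
  indices_append [simp]: "indices (es @ fs) = indices es \<union> indices fs" and
  finite_indices [simp]: "finite (indices es)"
  by (simp_all add: indices_def image_Un)

lemma coord_eq_0: "k \<notin> indices es \<Longrightarrow> coord es \<omega> u k = 0"
  by (induction es) (auto simp: coord_Cons)

lemma is_elementary_Nil [simp]: "is_elementary Fil J T []" and
  is_elementary_Cons: "is_elementary Fil J T ((a, b, A, k, h) # es) \<longleftrightarrow>
    0 \<le> a \<and> a \<le> b \<and> b \<le> T \<and> A \<in> sets (Fil a) \<and> k \<in> J \<and> is_elementary Fil J T es" and
  is_elementary_append: "is_elementary Fil J T (es @ fs) \<longleftrightarrow> is_elementary Fil J T es \<and> is_elementary Fil J T fs"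
  by (simp_all add: is_elementary_def ball_Un)

lemma is_elementary_indices: "is_elementary Fil J T es \<Longrightarrow> indices es \<subseteq> J"
  by (induction es) (auto simp: is_elementary_Cons)

lemma is_elementary_mono: "is_elementary Fil J T es \<Longrightarrow> T \<le> T' \<Longrightarrow> is_elementary Fil J T' es"
  by (induction es) (auto simp: is_elementary_Cons)

definition map_coeff :: "('h \<Rightarrow> 'k) \<Rightarrow> ('a, 'h) elementary \<Rightarrow> ('a, 'k) elementary" where
  "map_coeff f es = map (\<lambda>(a, b, A, k, h). (a, b, A, k, f h)) es"

lemma map_coeff_Nil [simp]: "map_coeff f [] = []" and
  map_coeff_Cons: "map_coeff f ((a, b, A, k, h) # es) = (a, b, A, k, f h) # map_coeff f es"
  by (simp_all add: map_coeff_def)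

lemma indices_map_coeff [simp]: "indices (map_coeff f es) = indices es"
  by (induction es) (auto simp: map_coeff_Cons)

lemma is_elementary_map_coeff [simp]: "is_elementary Fil J T (map_coeff f es) \<longleftrightarrow> is_elementary Fil J T es"
  by (induction es) (auto simp: map_coeff_Cons is_elementary_Cons)

lemma coord_map_coeff:
  assumes "linear f" shows "coord (map_coeff f es) \<omega> u k = f (coord es \<omega> u k)"
  by (induction es)
    (auto simp: map_coeff_Cons coord_Cons linear_0[OF assms] linear_add[OF assms] linear_scale[OF assms])

lemma elementary_integral_map_coeff:
  assumes "linear f" shows "elementary_integral \<beta> (map_coeff f es) \<omega> = f (elementary_integral \<beta> es \<omega>)"
  by (induction es)
    (auto simp: map_coeff_Cons elementary_integral_Cons linear_0[OF assms] linear_add[OF assms] linear_scale[OF assms])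

lemma coord_bound:
  fixes es :: "('a, 'h::real_normed_vector) elementary"
  assumes "is_elementary Fil J T es"
  obtains B where "0 \<le> B" "\<And>u k. norm (coord es \<omega> u k) \<le> B * indicator {0<..T} u"
proof -
  have "\<exists>B\<ge>0. \<forall>u k. norm (coord es \<omega> u k) \<le> B * indicator {0<..T} u" using assms
  proof (induction es)
    case (Cons e es)
    obtain a b A k' h where e: "e = (a, b, A, k', h)" by (cases e)
    obtain B where B: "B \<ge> 0" "\<And>u k. norm (coord es \<omega> u k) \<le> B * indicator {0<..T} u"
      using Cons by (auto simp: e is_elementary_Cons)
    have "norm (coord (e # es) \<omega> u k) \<le> (norm h + B) * indicator {0<..T} u" for u k
    proof -
      have "norm ((if k' = k then indicator {a<..b} u * indicator A \<omega> else 0) *\<^sub>R h) \<le> norm h * indicator {0<..T} u"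
        using Cons.prems by (auto simp: e is_elementary_Cons indicator_def)
      then show ?thesis
        unfolding e coord_Cons using B(2)[of u k] norm_triangle_ineq
        by (smt (verit) distrib_right)
    qed
    then show ?case using B(1) by (intro exI[of _ "norm h + B"]) auto
  qed (auto intro: exI[of _ 0])
  then show ?thesis using that by blast
qed

lemma coord_measurable:
  fixes es :: "('a, 'h::{real_normed_vector, second_countable_topology}) elementary"
  assumes "\<And>a b A k h. (a, b, A, k, h) \<in> set es \<Longrightarrow> A \<in> sets F"
  shows "(\<lambda>(\<omega>, u). coord es \<omega> u k) \<in> borel_measurable (F \<Otimes>\<^sub>M lborel)"
  using assms
proof (induction es)
  case (Cons e es)
  obtain a b A k' h where e: "e = (a, b, A, k', h)" by (cases e)
  have [measurable]: "A \<in> sets F" using Cons.prems[of a b A k' h] by (simp add: e)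
  have [measurable]: "(\<lambda>(\<omega>, u). coord es \<omega> u k) \<in> borel_measurable (F \<Otimes>\<^sub>M lborel)"
    using Cons.IH Cons.prems by (meson list.set_intros(2))
  show ?case
    unfolding e coord_Cons by measurable
qed simp

lemma coord_inner_integrable:
  fixes es fs :: "('a, 'h::{real_inner, second_countable_topology}) elementary"
  assumes "is_elementary Fil J T es" "is_elementary Fil J T fs"
  shows "integrable lborel (\<lambda>u. coord es \<omega> u k \<bullet> coord fs \<omega> u l)"
proof -
  have m: "(\<lambda>u. coord es \<omega> u k) \<in> borel_measurable borel" for k and es :: "('a, 'h) elementary"
  proof (induction es)
    case (Cons e es)
    obtain a b A k' h where e: "e = (a, b, A, k', h)" by (cases e)
    show ?case using Cons unfolding e coord_Cons by (intro borel_measurable_add) auto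
  qed simp
  obtain B where B: "0 \<le> B" "\<And>u k. norm (coord es \<omega> u k) \<le> B * indicator {0<..T} u"
    using coord_bound[OF assms(1)] by blast
  obtain C where C: "0 \<le> C" "\<And>u k. norm (coord fs \<omega> u k) \<le> C * indicator {0<..T} u"
    using coord_bound[OF assms(2)] by blast
  show ?thesis
  proof (rule Bochner_Integration.integrable_bound)
    show "integrable lborel (\<lambda>u. B * C * indicator {0<..T} u :: real)"
      by (intro integrable_mult_right integrable_indicator_Ioc)
    show "(\<lambda>u. coord es \<omega> u k \<bullet> coord fs \<omega> u l) \<in> borel_measurable lborel"
      using m by simp
    have "norm (coord es \<omega> u k \<bullet> coord fs \<omega> u l) \<le> norm (B * C * indicator {0<..T} u)" for u
    proof -
      have "norm (coord es \<omega> u k \<bullet> coord fs \<omega> u l) \<le> norm (coord es \<omega> u k) * norm (coord fs \<omega> u l)"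
        by (simp add: Cauchy_Schwarz_ineq2)
      also have "\<dots> \<le> (B * indicator {0<..T} u) * (C * indicator {0<..T} u)"
        using B C by (intro mult_mono) auto
      also have "\<dots> = B * C * indicator {0<..T} u" by (simp add: indicator_def)
      finally show ?thesis using B C by simp
    qed
    then show "AE u in lborel. norm (coord es \<omega> u k \<bullet> coord fs \<omega> u l) \<le> norm (B * C * indicator {0<..T} u)" by simp
  qed
qed

lemma coord_norm_sq_integrable:
  fixes es :: "('a, 'h::{real_inner, second_countable_topology}) elementary"
  assumes "is_elementary Fil J T es"
  shows "integrable lborel (\<lambda>u. (norm (coord es \<omega> u k))\<^sup>2)"
  using coord_inner_integrable[OF assms assms] by (simp add: power2_norm_eq_inner)

lemma quad_measurable:
  fixes es :: "('a, 'h::{real_inner, second_countable_topology}) elementary"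
  assumes "\<And>a b A k h. (a, b, A, k, h) \<in> set es \<Longrightarrow> A \<in> sets F"
  shows "quad N es \<in> borel_measurable F"
proof -
  have [measurable]: "(\<lambda>(\<omega>, u). coord es \<omega> u k) \<in> borel_measurable (F \<Otimes>\<^sub>M lborel)" for k
    using assms by (rule coord_measurable)
  have "(\<lambda>(\<omega>, u). \<Sum>k\<in>N. (norm (coord es \<omega> u k))\<^sup>2) \<in> borel_measurable (F \<Otimes>\<^sub>M lborel)"
    by measurable
  from sigma_finite_measure.borel_measurable_lebesgue_integral[OF sigma_finite_lborel this]
  show ?thesis unfolding quad_def .
qed

text \<open>Stops the integrand at time \<open>s\<close>. Entries that start at \<open>s\<close> or
  later are dropped, so that the result is again elementary up to \<open>s\<close>.\<close>

definition cut :: "real \<Rightarrow> ('a, 'h) elementary \<Rightarrow> ('a, 'h) elementary" where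
  "cut s es = map (\<lambda>(a, b, A, k, h). (a, min b s, A, k, h)) (filter (\<lambda>(a, b, A, k, h). a < s) es)"

text \<open>Meant for neighbouring endpoints \<open>p < s\<close>: then the part of the integrand on
  \<open>(p, s]\<close> consists of the entries whose interval covers it.\<close>

definition alive :: "real \<Rightarrow> real \<Rightarrow> ('a, 'h) elementary \<Rightarrow> ('a, 'h) elementary" where
  "alive p s es = map (\<lambda>(a, b, A, k, h). (p, s, A, k, h)) (filter (\<lambda>(a, b, A, k, h). a \<le> p \<and> s \<le> b) es)"

lemma cut_Nil [simp]: "cut s [] = []" and alive_Nil [simp]: "alive p s [] = []"
  by (simp_all add: cut_def alive_def)

lemma cut_Cons: "cut s ((a, b, A, k, h) # es) = (if a < s then [(a, min b s, A, k, h)] else []) @ cut s es"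
  by (simp add: cut_def)

lemma alive_Cons: "alive p s ((a, b, A, k, h) # es) = (if a \<le> p \<and> s \<le> b then [(p, s, A, k, h)] else []) @ alive p s es"
  by (simp add: alive_def)

lemma is_elementary_cut: "is_elementary Fil J T es \<Longrightarrow> is_elementary Fil J s (cut s es)"
  by (induction es) (auto simp: is_elementary_Cons cut_Cons)

lemma cut_full: "is_elementary Fil J T es \<Longrightarrow> T < s \<Longrightarrow> cut s es = es"
  by (induction es) (auto simp: is_elementary_Cons cut_Cons)

definition endpoints :: "('a, 'h) elementary \<Rightarrow> real set" where
  "endpoints es = (\<Union>(a, b, A, k, h)\<in>set es. {a, b})"

lemma endpoints_Cons: "endpoints ((a, b, A, k, h) # es) = {a, b} \<union> endpoints es"
  and finite_endpoints [simp]: "finite (endpoints es)"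
  by (auto simp: endpoints_def)

text \<open>As no endpoint lies strictly between \<open>p\<close> and \<open>s\<close>, each
  interval has ended by \<open>p\<close>, starts at \<open>s\<close> or later, or covers
  \<open>(p, s]\<close>. The cases below also separate \<open>a = p\<close>, for which the entry is
  absent from \<open>cut p\<close>.\<close>

lemma cut_step:
  assumes "is_elementary Fil J T es" "endpoints es \<inter> {p<..<s} = {}" "p < s"
  shows "elementary_integral \<beta> (cut s es) \<omega> = elementary_integral \<beta> (cut p es) \<omega> + elementary_integral \<beta> (alive p s es) \<omega>"
    and "coord (cut s es) \<omega> u k = coord (cut p es) \<omega> u k + coord (alive p s es) \<omega> u k"
proof -
  have "elementary_integral \<beta> (cut s es) \<omega> = elementary_integral \<beta> (cut p es) \<omega> + elementary_integral \<beta> (alive p s es) \<omega> \<and>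
    coord (cut s es) \<omega> u k = coord (cut p es) \<omega> u k + coord (alive p s es) \<omega> u k"
    using assms
  proof (induction es)
    case (Cons e es)
    obtain a b A k' h where e: "e = (a, b, A, k', h)" by (cases e)
    have IH: "elementary_integral \<beta> (cut s es) \<omega> = elementary_integral \<beta> (cut p es) \<omega> + elementary_integral \<beta> (alive p s es) \<omega>"
      "coord (cut s es) \<omega> u k = coord (cut p es) \<omega> u k + coord (alive p s es) \<omega> u k"
      using Cons by (auto simp: e is_elementary_Cons endpoints_Cons)
    have ab: "a \<le> p \<or> s \<le> a" "b \<le> p \<or> s \<le> b" "a \<le> b"
      using Cons.prems by (auto simp: e is_elementary_Cons endpoints_Cons)
    consider "s \<le> a" | "b \<le> p" "a < p" | "b \<le> p" "a = p" | "a \<le> p" "s \<le> b" "a < p" | "a = p" "s \<le> b"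
      using ab by linarith
    then show ?case
    proof cases
      case 1
      then show ?thesis using IH ab \<open>p < s\<close> by (auto simp: e cut_Cons alive_Cons)
    next
      case 2
      then show ?thesis using IH ab \<open>p < s\<close> by (auto simp: e cut_Cons alive_Cons elementary_integral_Cons coord_Cons min_def)
    next
      case 3
      then show ?thesis using IH ab \<open>p < s\<close> by (auto simp: e cut_Cons alive_Cons elementary_integral_Cons coord_Cons min_def)
    next
      case 4
      have "indicator {a<..s} u = (indicator {a<..p} u + indicator {p<..s} u :: real)"
        using 4 \<open>p < s\<close> by (auto simp: indicator_def)
      then show ?thesis using 4 IH ab \<open>p < s\<close>
        by (auto simp: e cut_Cons alive_Cons elementary_integral_Cons coord_Cons min_def algebra_simps)
    next
      case 5
      then show ?thesis using IH ab \<open>p < s\<close>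
        by (auto simp: e cut_Cons alive_Cons elementary_integral_Cons coord_Cons min_def)
    qed
  qed simp
  then show "elementary_integral \<beta> (cut s es) \<omega> = elementary_integral \<beta> (cut p es) \<omega> + elementary_integral \<beta> (alive p s es) \<omega>"
    and "coord (cut s es) \<omega> u k = coord (cut p es) \<omega> u k + coord (alive p s es) \<omega> u k" by auto
qed

text \<open>On \<open>(p, s]\<close> a real elementary integrand is constant in time; this is its
  coordinate \<open>k\<close> there. It is known at time \<open>p\<close>, see
  \<open>alive_coeff_simple\<close>.\<close>

definition alive_coeff :: "real \<Rightarrow> real \<Rightarrow> ('a, real) elementary \<Rightarrow> nat \<Rightarrow> 'a \<Rightarrow> real" where
  "alive_coeff p s es k \<omega> = (\<Sum>(a, b, A, k', h)\<leftarrow>es. if a \<le> p \<and> s \<le> b \<and> k' = k then indicator A \<omega> * h else 0)"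

lemma alive_coeff_Cons: "alive_coeff p s ((a, b, A, k', h) # es) k \<omega>
    = (if a \<le> p \<and> s \<le> b \<and> k' = k then indicator A \<omega> * h else 0) + alive_coeff p s es k \<omega>"
  and alive_coeff_Nil [simp]: "alive_coeff p s [] k \<omega> = 0"
  by (simp_all add: alive_coeff_def)

lemma coord_alive: "coord (alive p s es) \<omega> u k = indicator {p<..s} u * alive_coeff p s es k \<omega>"
proof (induction es)
  case (Cons e es)
  obtain a b A k' h where e: "e = (a, b, A, k', h)" by (cases e)
  show ?case using Cons by (auto simp: e alive_Cons coord_Cons alive_coeff_Cons algebra_simps)
qed simp

lemma elementary_integral_alive:
  assumes "finite N" "indices es \<subseteq> N"
  shows "elementary_integral \<beta> (alive p s es) \<omega> = (\<Sum>k\<in>N. alive_coeff p s es k \<omega> * (\<beta> k s \<omega> - \<beta> k p \<omega>))"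
  using assms(2)
proof (induction es)
  case (Cons e es)
  obtain a b A k' h where e: "e = (a, b, A, k', h)" by (cases e)
  have IH: "elementary_integral \<beta> (alive p s es) \<omega> = (\<Sum>k\<in>N. alive_coeff p s es k \<omega> * (\<beta> k s \<omega> - \<beta> k p \<omega>))"
    and k': "k' \<in> N" using Cons by (auto simp: e)
  have "(\<Sum>k\<in>N. alive_coeff p s (e # es) k \<omega> * (\<beta> k s \<omega> - \<beta> k p \<omega>))
      = (\<Sum>k\<in>N. if k' = k then (if a \<le> p \<and> s \<le> b then indicator A \<omega> * h * (\<beta> k s \<omega> - \<beta> k p \<omega>) else 0) else 0)
        + (\<Sum>k\<in>N. alive_coeff p s es k \<omega> * (\<beta> k s \<omega> - \<beta> k p \<omega>))"
    unfolding sum.distrib[symmetric] by (intro sum.cong refl) (auto simp: e alive_coeff_Cons algebra_simps)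
  also have "(\<Sum>k\<in>N. if k' = k then (if a \<le> p \<and> s \<le> b then indicator A \<omega> * h * (\<beta> k s \<omega> - \<beta> k p \<omega>) else 0) else 0)
      = (if a \<le> p \<and> s \<le> b then indicator A \<omega> * h * (\<beta> k' s \<omega> - \<beta> k' p \<omega>) else 0)"
    using k' assms(1) by simp
  finally show ?case using IH by (auto simp: e alive_Cons elementary_integral_Cons algebra_simps)
qed simp

context wiener_filtration
begin

lemma alive_coeff_simple:
  assumes "is_elementary Fil J T es" "0 \<le> p"
  shows "simple_function (Fil p) (alive_coeff p s es k)"
  using assms(1)
proof (induction es)
  case Nil
  then show ?case by (simp add: alive_coeff_def[abs_def])
next
  case (Cons e es)
  obtain a b A k' h where e: "e = (a, b, A, k', h)" by (cases e)
  have IH: "simple_function (Fil p) (alive_coeff p s es k)" using Cons by (auto simp: e is_elementary_Cons)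
  have A: "A \<in> sets (Fil a)" "0 \<le> a" using Cons.prems by (auto simp: e is_elementary_Cons)
  have "simple_function (Fil p) (\<lambda>\<omega>. (if a \<le> p \<and> s \<le> b \<and> k' = k then indicator A \<omega> * h else 0) + alive_coeff p s es k \<omega>)"
  proof (cases "a \<le> p \<and> s \<le> b \<and> k' = k")
    case True
    then have "A \<in> sets (Fil p)" using A sets_Fil_mono by blast
    then show ?thesis using True IH by (auto intro!: simple_function_add simple_function_mult)
  next
    case False
    then have "(\<lambda>\<omega>. (if a \<le> p \<and> s \<le> b \<and> k' = k then indicator A \<omega> * h else 0) + alive_coeff p s es k \<omega>) = alive_coeff p s es k"
      by auto
    then show ?thesis using IH by simp
  qed
  then show ?case by (simp add: e alive_coeff_Cons[abs_def])
qed

text \<open>Simple coefficients take finitely many values. On each of the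
  \<open>Fil p\<close>-measurable sets \<open>B w\<close> they are constants, and
  \<open>joint_increment_exponential\<close> applies there, with \<open>Y\<close> restricted to that
  set.\<close>

lemma conditional_exponential:
  fixes \<phi> :: "nat \<Rightarrow> 'a \<Rightarrow> real"
  assumes N: "finite N" "N \<subseteq> J" and ps: "0 \<le> p" "p < s"
    and \<phi>: "\<And>k. k \<in> N \<Longrightarrow> simple_function (Fil p) (\<phi> k)" and Y: "Y \<in> borel_measurable (Fil p)"
  shows "(\<integral>\<^sup>+\<omega>. Y \<omega> * ennreal (exp ((\<Sum>k\<in>N. \<phi> k \<omega> * (\<beta> k s \<omega> - \<beta> k p \<omega>)) - (\<Sum>k\<in>N. (\<phi> k \<omega>)\<^sup>2) * (s - p) / 2)) \<partial>M)
    \<le> (\<integral>\<^sup>+\<omega>. Y \<omega> \<partial>M)"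
proof -
  define W where "W = PiE N (\<lambda>k. \<phi> k ` space M)"
  have W: "finite W" unfolding W_def using \<phi> N space_Fil[OF ps(1)] by (auto intro!: finite_PiE simp: simple_function_def)
  define B where "B w = {\<omega>\<in>space M. \<forall>k\<in>N. \<phi> k \<omega> = w k}" for w
  have "\<phi> k \<in> borel_measurable (Fil p)" if "k \<in> N" for k using \<phi>[OF that] by (rule borel_measurable_simple_function)
  then have BF: "B w \<in> sets (Fil p)" for w
    unfolding B_def using N(1) space_Fil[OF ps(1), symmetric] by simp
  have BM[measurable]: "B w \<in> sets M" for w using BF sets_Fil ps by blast
  have YM[measurable]: "Y \<in> borel_measurable M" using Y ps measurable_Fil_M by blast
  have bm: "k \<in> N \<Longrightarrow> \<beta> k s \<in> borel_measurable M" "k \<in> N \<Longrightarrow> \<beta> k p \<in> borel_measurable M" for k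
    using N ps by (auto intro: beta_measurable)
  have one: "(\<Sum>w\<in>W. indicator (B w) \<omega> :: ennreal) = 1" if "\<omega> \<in> space M" for \<omega>
  proof -
    let ?w = "\<lambda>k\<in>N. \<phi> k \<omega>"
    have eq: "indicator (B w) \<omega> = (if w = ?w then 1 else 0 :: ennreal)" if "w \<in> W" for w
    proof (cases "w = ?w")
      case True
      then have "\<omega> \<in> B w" using \<open>\<omega> \<in> space M\<close> by (simp add: B_def)
      then show ?thesis using True by simp
    next
      case False
      have "\<omega> \<notin> B w"
      proof
        assume "\<omega> \<in> B w"
        then have "w = ?w" using that unfolding B_def W_def by (intro PiE_ext[of w N _ ?w]) auto
        then show False using False by contradiction
      qed
      then show ?thesis using False by simp
    qed
    have "(\<Sum>w\<in>W. indicator (B w) \<omega> :: ennreal) = (\<Sum>w\<in>W. if w = ?w then 1 else 0)" by (intro sum.cong refl eq)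
    also have "\<dots> = 1"
    proof -
      have "?w \<in> W" using \<open>\<omega> \<in> space M\<close> by (simp add: W_def)
      then show ?thesis using W by simp
    qed
    finally show ?thesis .
  qed
  define E where "E w \<omega> = ennreal (exp ((\<Sum>k\<in>N. w k * (\<beta> k s \<omega> - \<beta> k p \<omega>)) - (\<Sum>k\<in>N. (w k)\<^sup>2) * (s - p) / 2))" for w \<omega>
  have Em[measurable]: "E w \<in> borel_measurable M" for w
    unfolding E_def using bm by measurable
  have step: "(\<integral>\<^sup>+\<omega>. E w \<omega> * (Y \<omega> * indicator (B w) \<omega>) \<partial>M) \<le> 1 * (\<integral>\<^sup>+\<omega>. Y \<omega> * indicator (B w) \<omega> \<partial>M)" for w
  proof (rule nn_integral_subalgebra_le[OF subalg[OF ps(1)] Em])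
    fix A assume A: "A \<in> sets (Fil p)"
    have AM[measurable]: "A \<in> sets M" using A sets_Fil ps by blast
    let ?c = "(\<Sum>k\<in>N. (w k)\<^sup>2) * (s - p) / 2"
    have [measurable]: "(\<lambda>\<omega>. exp (\<Sum>k\<in>N. w k * (\<beta> k s \<omega> - \<beta> k p \<omega>))) \<in> borel_measurable M" using bm by measurable
    have "(\<integral>\<^sup>+\<omega>. E w \<omega> * indicator A \<omega> \<partial>M)
      = (\<integral>\<^sup>+\<omega>. ennreal (exp (- ?c)) * (ennreal (exp (\<Sum>k\<in>N. w k * (\<beta> k s \<omega> - \<beta> k p \<omega>))) * indicator A \<omega>) \<partial>M)"
      unfolding E_def
      by (intro nn_integral_cong) (simp add: mult.assoc[symmetric] ennreal_mult[symmetric] exp_add[symmetric])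
    also have "\<dots> = ennreal (exp (- ?c)) * (\<integral>\<^sup>+\<omega>. ennreal (exp (\<Sum>k\<in>N. w k * (\<beta> k s \<omega> - \<beta> k p \<omega>))) * indicator A \<omega> \<partial>M)"
      by (rule nn_integral_cmult) measurable
    also have "\<dots> \<le> ennreal (exp (- ?c)) * (ennreal (exp ?c) * emeasure M A)"
      by (intro mult_left_mono joint_increment_exponential[OF N ps A]) simp
    also have "\<dots> = 1 * emeasure M A"
      by (simp add: mult.assoc[symmetric] ennreal_mult[symmetric] exp_add[symmetric])
    finally show "(\<integral>\<^sup>+\<omega>. E w \<omega> * indicator A \<omega> \<partial>M) \<le> 1 * emeasure M A" .
  next
    show "(\<lambda>\<omega>. Y \<omega> * indicator (B w) \<omega>) \<in> borel_measurable (Fil p)" using Y BF by simp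
  qed
  have "(\<integral>\<^sup>+\<omega>. Y \<omega> * ennreal (exp ((\<Sum>k\<in>N. \<phi> k \<omega> * (\<beta> k s \<omega> - \<beta> k p \<omega>)) - (\<Sum>k\<in>N. (\<phi> k \<omega>)\<^sup>2) * (s - p) / 2)) \<partial>M)
      = (\<integral>\<^sup>+\<omega>. (\<Sum>w\<in>W. E w \<omega> * (Y \<omega> * indicator (B w) \<omega>)) \<partial>M)"
  proof (rule nn_integral_cong)
    fix \<omega> assume \<omega>: "\<omega> \<in> space M"
    let ?e = "ennreal (exp ((\<Sum>k\<in>N. \<phi> k \<omega> * (\<beta> k s \<omega> - \<beta> k p \<omega>)) - (\<Sum>k\<in>N. (\<phi> k \<omega>)\<^sup>2) * (s - p) / 2))"
    have "E w \<omega> * (Y \<omega> * indicator (B w) \<omega>) = Y \<omega> * ?e * indicator (B w) \<omega>" for w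
    proof (cases "\<omega> \<in> B w")
      case True
      then have "E w \<omega> = ?e" by (simp add: E_def B_def)
      then show ?thesis by (simp add: mult_ac)
    qed simp
    then have "(\<Sum>w\<in>W. E w \<omega> * (Y \<omega> * indicator (B w) \<omega>)) = Y \<omega> * ?e * (\<Sum>w\<in>W. indicator (B w) \<omega>)"
      by (simp add: sum_distrib_left)
    then show "Y \<omega> * ?e = (\<Sum>w\<in>W. E w \<omega> * (Y \<omega> * indicator (B w) \<omega>))" by (simp add: one[OF \<omega>])
  qed
  also have "\<dots> = (\<Sum>w\<in>W. \<integral>\<^sup>+\<omega>. E w \<omega> * (Y \<omega> * indicator (B w) \<omega>) \<partial>M)" by (rule nn_integral_sum) measurable
  also have "\<dots> \<le> (\<Sum>w\<in>W. \<integral>\<^sup>+\<omega>. Y \<omega> * indicator (B w) \<omega> \<partial>M)" using step by (intro sum_mono) simp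
  also have "\<dots> = (\<integral>\<^sup>+\<omega>. (\<Sum>w\<in>W. Y \<omega> * indicator (B w) \<omega>) \<partial>M)" by (rule nn_integral_sum[symmetric]) measurable
  also have "\<dots> = (\<integral>\<^sup>+\<omega>. Y \<omega> \<partial>M)"
    by (intro nn_integral_cong) (simp add: sum_distrib_left[symmetric] one)
  finally show ?thesis .
qed

lemma elementary_sets:
  assumes "is_elementary Fil J T es" "(a, b, A, k, h) \<in> set es" shows "A \<in> sets M" "A \<in> sets (Fil T)"
  using assms sets_Fil[of a A] sets_Fil_mono[of a T A] by (auto simp: is_elementary_def)

lemma elementary_integral_Fil:
  fixes es :: "('a, 'h::{real_normed_vector, second_countable_topology}) elementary"
  assumes "is_elementary Fil J T es"
  shows "elementary_integral \<beta> es \<in> borel_measurable (Fil T)"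
  using assms
proof (induction es)
  case Nil
  then show ?case by (simp add: elementary_integral_def[abs_def])
next
  case (Cons e es)
  obtain a b A k h where e: "e = (a, b, A, k, h)" by (cases e)
  have A: "A \<in> sets (Fil T)" using elementary_sets(2)[OF Cons.prems, of a b A k h] by (simp add: e)
  have b: "(\<lambda>\<omega>. \<beta> k b \<omega> - \<beta> k a \<omega>) \<in> borel_measurable (Fil T)"
    using Cons.prems by (intro increment_Fil) (auto simp: e is_elementary_Cons)
  have IH: "elementary_integral \<beta> es \<in> borel_measurable (Fil T)" using Cons by (auto simp: e is_elementary_Cons)
  show ?case unfolding e elementary_integral_Cons[abs_def]
    using A b IH by (intro borel_measurable_add borel_measurable_scaleR borel_measurable_times) auto
qed

lemma elementary_integral_measurable:
  fixes es :: "('a, 'h::{real_normed_vector, second_countable_topology}) elementary"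
  assumes "is_elementary Fil J T es" "0 \<le> T"
  shows "elementary_integral \<beta> es \<in> borel_measurable M"
  using measurable_Fil_M[OF assms(2) elementary_integral_Fil[OF assms(1)]] .

text \<open>Induction over the endpoints: between two consecutive ones the integrand is constant in time.\<close>
lemma elementary_exponential_cut:
  fixes es :: "('a, real) elementary"
  assumes es: "is_elementary Fil J T es" and N: "finite N" "N \<subseteq> J" "indices es \<subseteq> N" and s: "0 \<le> s"
  shows "(\<integral>\<^sup>+\<omega>. ennreal (exp (elementary_integral \<beta> (cut s es) \<omega> - quad N (cut s es) \<omega> / 2)) \<partial>M) \<le> 1"
  using s
proof (induction "card ((insert 0 (endpoints es)) \<inter> {..<s})" arbitrary: s rule: less_induct)
  case less
  show ?case
  proof (cases "s = 0")
    case True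
    have "is_elementary Fil J T es \<Longrightarrow> cut 0 es = []" by (induction es) (auto simp: is_elementary_Cons cut_Cons)
    then have "cut s es = []" using es True by simp
    then show ?thesis by (simp add: quad_def emeasure_space_1)
  next
    case False
    let ?P = "(insert 0 (endpoints es)) \<inter> {..<s}"
    have fin: "finite ?P" and ne: "0 \<in> ?P" using False less.prems by auto
    \<comment> \<open>The last endpoint before \<open>s\<close>; 0 is inserted so that there is one.
      Fewer endpoints precede \<open>p\<close>, which is what the induction counts.\<close>
    define p where "p = Max ?P"
    have pP: "p \<in> ?P" unfolding p_def using fin ne by (intro Max_in) auto
    have pmax: "q \<le> p" if "q \<in> ?P" for q unfolding p_def using that fin by simp
    have p: "0 \<le> p" "p < s" using pP pmax[OF ne] by auto
    have disj: "endpoints es \<inter> {p<..<s} = {}"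
    proof (rule ccontr)
      assume "endpoints es \<inter> {p<..<s} \<noteq> {}"
      then obtain q where "q \<in> endpoints es" "p < q" "q < s" by auto
      then show False using pmax[of q] by auto
    qed
    have "(insert 0 (endpoints es)) \<inter> {..<p} \<subset> ?P" using pP p by auto
    then have card: "card ((insert 0 (endpoints es)) \<inter> {..<p}) < card ?P" using fin by (rule psubset_card_mono[rotated])
    have esp: "is_elementary Fil J p (cut p es)" by (rule is_elementary_cut[OF es])
    \<comment> \<open>The part stopped at \<open>p\<close> vanishes on \<open>(p, s]\<close>, so the
      squares add without mixed terms.\<close>
    have quad_step: "quad N (cut s es) \<omega> = quad N (cut p es) \<omega> + (\<Sum>k\<in>N. (alive_coeff p s es k \<omega>)\<^sup>2) * (s - p)" for \<omega>
    proof -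
      obtain B where B: "\<And>u k. norm (coord (cut p es) \<omega> u k) \<le> B * indicator {0<..p} u" using coord_bound[OF esp] by metis
      have z: "coord (cut p es) \<omega> u k = 0" if "u \<in> {p<..s}" for u k using B[of u k] that by (simp add: indicator_def)
      have "(norm (coord (cut s es) \<omega> u k))\<^sup>2 = (norm (coord (cut p es) \<omega> u k))\<^sup>2 + indicator {p<..s} u * (alive_coeff p s es k \<omega>)\<^sup>2" for u k
        unfolding cut_step(2)[OF es disj p(2)] coord_alive using z[of u k] by (auto simp: indicator_def)
      then have "quad N (cut s es) \<omega> = (LINT u|lborel. (\<Sum>k\<in>N. (norm (coord (cut p es) \<omega> u k))\<^sup>2) + (\<Sum>k\<in>N. (alive_coeff p s es k \<omega>)\<^sup>2) * indicator {p<..s} u)"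
        unfolding quad_def by (simp add: sum.distrib sum_distrib_left mult.commute)
      also have "\<dots> = quad N (cut p es) \<omega> + (LINT u|lborel. (\<Sum>k\<in>N. (alive_coeff p s es k \<omega>)\<^sup>2) * indicator {p<..s} u)"
        unfolding quad_def using p
        by (intro Bochner_Integration.integral_add Bochner_Integration.integrable_sum coord_norm_sq_integrable[OF esp] integrable_mult_right integrable_indicator_Ioc)
      also have "(LINT u|lborel. (\<Sum>k\<in>N. (alive_coeff p s es k \<omega>)\<^sup>2) * indicator {p<..s} u) = (\<Sum>k\<in>N. (alive_coeff p s es k \<omega>)\<^sup>2) * (s - p)"
        using p by (simp add: measure_def emeasure_lborel_Ioc)
      finally show ?thesis .
    qed
    let ?Y = "\<lambda>\<omega>. ennreal (exp (elementary_integral \<beta> (cut p es) \<omega> - quad N (cut p es) \<omega> / 2))"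
    have Ym: "?Y \<in> borel_measurable (Fil p)"
    proof -
      have [measurable]: "elementary_integral \<beta> (cut p es) \<in> borel_measurable (Fil p)" by (rule elementary_integral_Fil[OF esp])
      have [measurable]: "quad N (cut p es) \<in> borel_measurable (Fil p)"
        using elementary_sets(2)[OF esp] by (intro quad_measurable) auto
      show ?thesis by measurable
    qed
    have "(\<integral>\<^sup>+\<omega>. ennreal (exp (elementary_integral \<beta> (cut s es) \<omega> - quad N (cut s es) \<omega> / 2)) \<partial>M)
      = (\<integral>\<^sup>+\<omega>. ?Y \<omega> * ennreal (exp ((\<Sum>k\<in>N. alive_coeff p s es k \<omega> * (\<beta> k s \<omega> - \<beta> k p \<omega>)) - (\<Sum>k\<in>N. (alive_coeff p s es k \<omega>)\<^sup>2) * (s - p) / 2)) \<partial>M)"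
      unfolding cut_step(1)[OF es disj p(2)] elementary_integral_alive[OF N(1,3)] quad_step
      by (intro nn_integral_cong) (simp add: ennreal_mult[symmetric] exp_add[symmetric] algebra_simps add_divide_distrib diff_divide_distrib)
    also have "\<dots> \<le> (\<integral>\<^sup>+\<omega>. ?Y \<omega> \<partial>M)"
      by (rule conditional_exponential[OF N(1,2) p alive_coeff_simple[OF es p(1)] Ym])
    also have "\<dots> \<le> 1" using less.hyps[OF card p(1)] .
    finally show ?thesis .
  qed
qed

lemma elementary_exponential:
  fixes es :: "('a, real) elementary"
  assumes es: "is_elementary Fil J T es" and T: "0 \<le> T" and N: "finite N" "N \<subseteq> J" "indices es \<subseteq> N"
  shows "(\<integral>\<^sup>+\<omega>. ennreal (exp (elementary_integral \<beta> es \<omega> - quad N es \<omega> / 2)) \<partial>M) \<le> 1"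
  using elementary_exponential_cut[OF es N, of "T + 1"] T by (simp add: cut_full[OF es])

end

section \<open>Tail bounds for Hilbert space valued elementary integrals\<close>

text \<open>Gram--Schmidt, one vector at a time. It provides finitely many coordinates for an
  integral with finitely many coefficient vectors.\<close>

lemma finite_orthonormal_span:
  fixes S :: "'h::real_inner set"
  assumes "finite S"
  obtains B where "finite B" "\<And>b c. b \<in> B \<Longrightarrow> c \<in> B \<Longrightarrow> b \<bullet> c = (if b = c then 1 else 0)" "S \<subseteq> span B"
proof -
  have "\<exists>B. finite B \<and> (\<forall>b\<in>B. \<forall>c\<in>B. b \<bullet> c = (if b = c then 1 else 0)) \<and> S \<subseteq> span B"
    using assms
  proof induction
    case (insert x S)
    then obtain B where B: "finite B" "\<And>b c. b \<in> B \<Longrightarrow> c \<in> B \<Longrightarrow> b \<bullet> c = (if b = c then 1 else 0)" "S \<subseteq> span B"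
      by blast
    define y where "y = x - (\<Sum>b\<in>B. (b \<bullet> x) *\<^sub>R b)"
    have sum_in: "(\<Sum>b\<in>B. (b \<bullet> x) *\<^sub>R b) \<in> span B" by (intro span_sum span_mul span_base)
    have orth: "c \<bullet> y = 0" if "c \<in> B" for c
    proof -
      have "c \<bullet> (\<Sum>b\<in>B. (b \<bullet> x) *\<^sub>R b) = (\<Sum>b\<in>B. if c = b then c \<bullet> x else 0)"
        unfolding inner_sum_right by (intro sum.cong refl) (simp add: B(2)[OF that])
      also have "\<dots> = c \<bullet> x" using B(1) that by simp
      finally show ?thesis by (simp add: y_def inner_diff_right)
    qed
    show ?case
    proof (cases "y = 0")
      case True
      then have "x \<in> span B" using sum_in by (simp add: y_def)
      then show ?thesis using B by blast
    next
      case False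
      define e where "e = y /\<^sub>R norm y"
      have e1: "e \<bullet> e = 1" using False by (simp add: e_def flip: power2_norm_eq_inner)
      have e0: "c \<bullet> e = 0" "e \<bullet> c = 0" if "c \<in> B" for c using orth[OF that] by (simp_all add: e_def inner_commute)
      have "x = norm y *\<^sub>R e + (\<Sum>b\<in>B. (b \<bullet> x) *\<^sub>R b)" using False by (simp add: e_def y_def)
      also have "\<dots> \<in> span (insert e B)"
        by (rule span_add[OF span_mul[OF span_base[OF insertI1]] subsetD[OF span_mono[OF subset_insertI] sum_in]])
      finally have "x \<in> span (insert e B)" .
      moreover have "S \<subseteq> span (insert e B)" using B(3) span_mono[of B "insert e B"] by auto
      moreover have "\<forall>b\<in>insert e B. \<forall>c\<in>insert e B. b \<bullet> c = (if b = c then 1 else 0)"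
        using B(2) e1 e0 by (metis insert_iff zero_neq_one)
      ultimately show ?thesis using B(1) by (intro exI[of _ "insert e B"]) auto
    qed
  qed (auto intro: exI[of _ "{}"])
  then show ?thesis using that by blast
qed

lemma orthonormal_expansion:
  fixes B :: "'h::real_inner set"
  assumes B: "finite B" "\<And>b c. b \<in> B \<Longrightarrow> c \<in> B \<Longrightarrow> b \<bullet> c = (if b = c then 1 else 0)" and x: "x \<in> span B"
  shows "x = (\<Sum>b\<in>B. (x \<bullet> b) *\<^sub>R b)" "(norm x)\<^sup>2 = (\<Sum>b\<in>B. (x \<bullet> b)\<^sup>2)"
proof -
  obtain c where c: "x = (\<Sum>b\<in>B. c b *\<^sub>R b)" using x span_finite[OF B(1)] by auto
  have ip: "x \<bullet> b = c b" if "b \<in> B" for b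
  proof -
    have "x \<bullet> b = (\<Sum>a\<in>B. if a = b then c a else 0)"
      unfolding c inner_sum_left using that by (intro sum.cong refl) (simp add: B(2))
    then show ?thesis using B(1) that by simp
  qed
  show 1: "x = (\<Sum>b\<in>B. (x \<bullet> b) *\<^sub>R b)" by (subst c) (simp add: ip)
  have "(norm x)\<^sup>2 = x \<bullet> (\<Sum>b\<in>B. (x \<bullet> b) *\<^sub>R b)" by (metis 1 power2_norm_eq_inner)
  then show "(norm x)\<^sup>2 = (\<Sum>b\<in>B. (x \<bullet> b)\<^sup>2)" by (simp add: inner_sum_right power2_eq_square)
qed

lemma sum_inner_quadratic:
  fixes x :: "'h::real_inner" and v :: "'h \<Rightarrow> real"
  shows "(\<Sum>b\<in>B. \<Sum>c\<in>B. v b * v c * ((x \<bullet> b) * (x \<bullet> c))) = (x \<bullet> (\<Sum>b\<in>B. v b *\<^sub>R b))\<^sup>2"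
  by (simp add: inner_sum_right power2_eq_square sum_product mult_ac)

context wiener_filtration
begin

text \<open>The coefficient vectors span a finite-dimensional space, in which \<open>R\<close> is
  the matrix of the quadratic variation. Each direction gives a real integrand, to which
  \<open>elementary_exponential\<close> applies. The trace of \<open>R\<close> is
  \<open>quad\<close>, and by Cauchy--Schwarz \<open>quad\<close> also bounds the quadratic form of
  \<open>R\<close>; hence the dimension does not enter the result.\<close>

lemma elementary_exp_square:
  fixes es :: "('a, 'h::{real_inner, second_countable_topology}) elementary"
  assumes es: "is_elementary Fil J T es" and T: "0 \<le> T" and N: "finite N" "N \<subseteq> J" "indices es \<subseteq> N" and \<kappa>: "0 < \<kappa>"
  shows "(\<integral>\<^sup>+\<omega>. ennreal (exp ((norm (elementary_integral \<beta> es \<omega>))\<^sup>2 / (4 * \<kappa>))) * indicator {\<omega>\<in>space M. quad N es \<omega> \<le> \<kappa>} \<omega> \<partial>M)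
    \<le> ennreal (exp (1/2))"
proof -
  let ?S = "(\<lambda>(a, b, A, k, h). h) ` set es"
  obtain B where B: "finite B" "\<And>b c. b \<in> B \<Longrightarrow> c \<in> B \<Longrightarrow> b \<bullet> c = (if b = c then 1 else 0)" "?S \<subseteq> span B"
    using finite_orthonormal_span[of ?S] by blast
  have coord_span: "coord fs \<omega> u k \<in> span B" and int_span: "elementary_integral \<beta> fs \<omega> \<in> span B"
    if "set fs \<subseteq> set es" for fs \<omega> u k
  proof (atomize (full), use that in \<open>induction fs\<close>)
    case (Cons e fs)
    obtain a b A k' h where e: "e = (a, b, A, k', h)" by (cases e)
    have "h \<in> ?S" using Cons.prems by (force simp: e)
    then have "h \<in> span B" using B(3) by auto
    then show ?case using Cons by (auto simp: e coord_Cons elementary_integral_Cons intro!: span_add span_mul span_zero)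
  qed (simp add: span_zero)
  let ?I = "elementary_integral \<beta> es"
  define R where "R b c \<omega> = (LINT u|lborel. (\<Sum>k\<in>N. (coord es \<omega> u k \<bullet> b) * (coord es \<omega> u k \<bullet> c)))" for b c \<omega>
  have Im[measurable]: "?I \<in> borel_measurable M" by (rule elementary_integral_measurable[OF es T])
  have cm[measurable]: "(\<lambda>(\<omega>, u). coord es \<omega> u k) \<in> borel_measurable (M \<Otimes>\<^sub>M lborel)" for k
    using elementary_sets(1)[OF es] by (intro coord_measurable) auto
  have Rm: "R b c \<in> borel_measurable M" for b c
  proof -
    have "(\<lambda>(\<omega>, u). \<Sum>k\<in>N. (coord es \<omega> u k \<bullet> b) * (coord es \<omega> u k \<bullet> c)) \<in> borel_measurable (M \<Otimes>\<^sub>M lborel)" by measurable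
    from sigma_finite_measure.borel_measurable_lebesgue_integral[OF sigma_finite_lborel this]
    show ?thesis unfolding R_def .
  qed
  have qm[measurable]: "quad N es \<in> borel_measurable M" using elementary_sets(1)[OF es] by (intro quad_measurable) auto
  have lin: "linear (\<lambda>h. h \<bullet> V)" for V :: 'h by (intro linearI) (simp_all add: inner_add_left)
  have integ: "integrable lborel (\<lambda>u. (coord es \<omega> u k \<bullet> b) * (coord es \<omega> u k \<bullet> c))" for \<omega> k b c
  proof -
    have e: "is_elementary Fil J T (map_coeff (\<lambda>h. h \<bullet> V) es)" for V :: 'h using es by simp
    show ?thesis using coord_inner_integrable[OF e e, of b \<omega> k c k] by (simp add: coord_map_coeff[OF lin])
  qed
  have Rquad: "(\<Sum>b\<in>B. \<Sum>c\<in>B. v b * v c * R b c \<omega>) = (LINT u|lborel. (\<Sum>k\<in>N. (coord es \<omega> u k \<bullet> (\<Sum>b\<in>B. v b *\<^sub>R b))\<^sup>2))" for v \<omega>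
  proof -
    have "(\<Sum>b\<in>B. \<Sum>c\<in>B. v b * v c * R b c \<omega>)
        = (LINT u|lborel. (\<Sum>b\<in>B. \<Sum>c\<in>B. v b * v c * (\<Sum>k\<in>N. (coord es \<omega> u k \<bullet> b) * (coord es \<omega> u k \<bullet> c))))"
      unfolding R_def using integ
      by (simp add: Bochner_Integration.integral_sum Bochner_Integration.integrable_sum)
    also have "\<dots> = (LINT u|lborel. (\<Sum>k\<in>N. (coord es \<omega> u k \<bullet> (\<Sum>b\<in>B. v b *\<^sub>R b))\<^sup>2))"
    proof (rule Bochner_Integration.integral_cong[OF refl])
      fix u
      have "(\<Sum>b\<in>B. \<Sum>c\<in>B. v b * v c * (\<Sum>k\<in>N. (coord es \<omega> u k \<bullet> b) * (coord es \<omega> u k \<bullet> c)))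
          = (\<Sum>b\<in>B. \<Sum>k\<in>N. \<Sum>c\<in>B. v b * v c * ((coord es \<omega> u k \<bullet> b) * (coord es \<omega> u k \<bullet> c)))"
        unfolding sum_distrib_left by (intro sum.cong refl sum.swap)
      also have "\<dots> = (\<Sum>k\<in>N. \<Sum>b\<in>B. \<Sum>c\<in>B. v b * v c * ((coord es \<omega> u k \<bullet> b) * (coord es \<omega> u k \<bullet> c)))"
        by (rule sum.swap)
      also have "\<dots> = (\<Sum>k\<in>N. (coord es \<omega> u k \<bullet> (\<Sum>b\<in>B. v b *\<^sub>R b))\<^sup>2)" by (simp only: sum_inner_quadratic)
      finally show "(\<Sum>b\<in>B. \<Sum>c\<in>B. v b * v c * (\<Sum>k\<in>N. (coord es \<omega> u k \<bullet> b) * (coord es \<omega> u k \<bullet> c)))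
          = (\<Sum>k\<in>N. (coord es \<omega> u k \<bullet> (\<Sum>b\<in>B. v b *\<^sub>R b))\<^sup>2)" .
    qed
    finally show ?thesis .
  qed
  have le: "(\<integral>\<^sup>+\<omega>. ennreal (exp ((\<Sum>b\<in>B. v b * (?I \<omega> \<bullet> b)) - (\<Sum>b\<in>B. \<Sum>c\<in>B. v b * v c * R b c \<omega>) / 2)) \<partial>M) \<le> 1" for v
  proof -
    let ?V = "\<Sum>b\<in>B. v b *\<^sub>R b"
    let ?fs = "map_coeff (\<lambda>h. h \<bullet> ?V) es"
    have "(\<integral>\<^sup>+\<omega>. ennreal (exp (elementary_integral \<beta> ?fs \<omega> - quad N ?fs \<omega> / 2)) \<partial>M) \<le> 1"
      using es T N by (intro elementary_exponential[of T]) auto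
    moreover have "elementary_integral \<beta> ?fs \<omega> = (\<Sum>b\<in>B. v b * (?I \<omega> \<bullet> b))" for \<omega>
      unfolding elementary_integral_map_coeff[OF lin] by (simp add: inner_sum_right)
    moreover have "quad N ?fs \<omega> = (\<Sum>b\<in>B. \<Sum>c\<in>B. v b * v c * R b c \<omega>)" for \<omega>
      unfolding quad_def coord_map_coeff[OF lin] Rquad by simp
    ultimately show ?thesis by simp
  qed
  have tr: "(\<Sum>b\<in>B. R b b \<omega>) = quad N es \<omega>" for \<omega>
  proof -
    have "(\<Sum>b\<in>B. R b b \<omega>) = (LINT u|lborel. (\<Sum>b\<in>B. \<Sum>k\<in>N. (coord es \<omega> u k \<bullet> b) * (coord es \<omega> u k \<bullet> b)))"
      unfolding R_def using integ by (simp add: Bochner_Integration.integral_sum Bochner_Integration.integrable_sum)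
    also have "\<dots> = quad N es \<omega>"
      unfolding quad_def
    proof (rule Bochner_Integration.integral_cong[OF refl])
      fix u
      show "(\<Sum>b\<in>B. \<Sum>k\<in>N. (coord es \<omega> u k \<bullet> b) * (coord es \<omega> u k \<bullet> b)) = (\<Sum>k\<in>N. (norm (coord es \<omega> u k))\<^sup>2)"
        by (subst sum.swap) (simp only: orthonormal_expansion(2)[OF B(1,2) coord_span[OF order_refl]] power2_eq_square[symmetric])
    qed
    finally show ?thesis .
  qed
  have op: "(\<Sum>b\<in>B. \<Sum>c\<in>B. (?I \<omega> \<bullet> b) * (?I \<omega> \<bullet> c) * R b c \<omega>) \<le> quad N es \<omega> * (\<Sum>b\<in>B. (?I \<omega> \<bullet> b)\<^sup>2)" for \<omega>
  proof -
    have "(\<Sum>b\<in>B. \<Sum>c\<in>B. (?I \<omega> \<bullet> b) * (?I \<omega> \<bullet> c) * R b c \<omega>) = (LINT u|lborel. (\<Sum>k\<in>N. (coord es \<omega> u k \<bullet> ?I \<omega>)\<^sup>2))"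
    proof -
      have "(\<Sum>b\<in>B. (?I \<omega> \<bullet> b) *\<^sub>R b) = ?I \<omega>"
        by (rule orthonormal_expansion(1)[OF B(1,2) int_span[OF order_refl], symmetric])
      then show ?thesis unfolding Rquad by simp
    qed
    also have "\<dots> \<le> (LINT u|lborel. (\<Sum>k\<in>N. (norm (coord es \<omega> u k))\<^sup>2) * (norm (?I \<omega>))\<^sup>2)"
    proof (rule integral_mono)
      show "integrable lborel (\<lambda>u. \<Sum>k\<in>N. (coord es \<omega> u k \<bullet> ?I \<omega>)\<^sup>2)"
        unfolding power2_eq_square by (intro Bochner_Integration.integrable_sum integ)
      show "integrable lborel (\<lambda>u. (\<Sum>k\<in>N. (norm (coord es \<omega> u k))\<^sup>2) * (norm (?I \<omega>))\<^sup>2)"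
        by (intro integrable_mult_left Bochner_Integration.integrable_sum coord_norm_sq_integrable[OF es])
      show "(\<Sum>k\<in>N. (coord es \<omega> u k \<bullet> ?I \<omega>)\<^sup>2) \<le> (\<Sum>k\<in>N. (norm (coord es \<omega> u k))\<^sup>2) * (norm (?I \<omega>))\<^sup>2" for u
        unfolding sum_distrib_right power2_norm_eq_inner by (intro sum_mono Cauchy_Schwarz_ineq)
    qed
    also have "\<dots> = quad N es \<omega> * (norm (?I \<omega>))\<^sup>2" by (simp add: quad_def)
    also have "(norm (?I \<omega>))\<^sup>2 = (\<Sum>b\<in>B. (?I \<omega> \<bullet> b)\<^sup>2)"
      by (rule orthonormal_expansion(2)[OF B(1,2) int_span[OF order_refl]])
    finally show ?thesis .
  qed
  let ?A = "{\<omega>\<in>space M. quad N es \<omega> \<le> \<kappa>}"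
  \<comment> \<open>With \<open>\<rho> = \<kappa>\<close> and
    \<open>\<theta>^2 = 1 / \<kappa>\<close> the exponent is the squared norm over
    \<open>4 * \<kappa>\<close> and the bound is \<open>exp (1/2)\<close>.\<close>
  have "(\<integral>\<^sup>+\<omega>. ennreal (exp ((1 / sqrt \<kappa>)\<^sup>2 * (\<Sum>b\<in>B. (?I \<omega> \<bullet> b)\<^sup>2) / (2 * (1 + (1 / sqrt \<kappa>)\<^sup>2 * \<kappa>)))) * indicator ?A \<omega> \<partial>M)
      \<le> ennreal (exp ((1 / sqrt \<kappa>)\<^sup>2 * \<kappa> / 2))"
  proof (rule gaussian_mixture[where R = R])
    show "finite B" "0 \<le> \<kappa>" using B \<kappa> by auto
    show "?A \<in> events" by measurable
    show "(\<lambda>\<omega>. ?I \<omega> \<bullet> b) \<in> borel_measurable M" for b by measurable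
    show "R b c \<in> borel_measurable M" for b c by (rule Rm)
    show "(\<integral>\<^sup>+\<omega>. ennreal (exp ((\<Sum>b\<in>B. v b * (?I \<omega> \<bullet> b)) - (\<Sum>b\<in>B. \<Sum>c\<in>B. v b * v c * R b c \<omega>) / 2)) \<partial>M) \<le> 1" for v by (rule le)
    fix \<omega> assume \<omega>: "\<omega> \<in> ?A"
    show "(\<Sum>b\<in>B. R b b \<omega>) \<le> \<kappa>" using \<omega> by (simp add: tr)
    show "(\<Sum>b\<in>B. \<Sum>c\<in>B. (?I \<omega> \<bullet> b) * (?I \<omega> \<bullet> c) * R b c \<omega>) \<le> \<kappa> * (\<Sum>b\<in>B. (?I \<omega> \<bullet> b)\<^sup>2)"
      using \<omega> by (intro order_trans[OF op] mult_right_mono sum_nonneg) auto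
  qed
  then show ?thesis
    using \<kappa> by (simp add: mult.commute[of 4 \<kappa>] power_divide orthonormal_expansion(2)[OF B(1,2) int_span[OF order_refl]])
qed

text \<open>Markov's inequality; the 2 is an upper bound for \<open>exp (1/2)\<close>.\<close>

lemma elementary_tail:
  fixes es :: "('a, 'h::{real_inner, second_countable_topology}) elementary"
  assumes es: "is_elementary Fil J T es" and T: "0 \<le> T" and N: "finite N" "N \<subseteq> J" "indices es \<subseteq> N"
    and \<kappa>: "0 < \<kappa>" and l: "0 \<le> l"
  shows "prob {\<omega>\<in>space M. l < norm (elementary_integral \<beta> es \<omega>) \<and> quad N es \<omega> \<le> \<kappa>} \<le> 2 * exp (- l\<^sup>2 / (4 * \<kappa>))"
proof -
  let ?I = "elementary_integral \<beta> es"
  have [measurable]: "?I \<in> borel_measurable M" by (rule elementary_integral_measurable[OF es T])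
  have [measurable]: "quad N es \<in> borel_measurable M" using elementary_sets(1)[OF es] by (intro quad_measurable) auto
  let ?E = "{\<omega>\<in>space M. l < norm (?I \<omega>) \<and> quad N es \<omega> \<le> \<kappa>}"
  let ?A = "{\<omega>\<in>space M. quad N es \<omega> \<le> \<kappa>}"
  have "ennreal (exp (l\<^sup>2 / (4 * \<kappa>)) * prob ?E) = ennreal (exp (l\<^sup>2 / (4 * \<kappa>))) * emeasure M ?E"
    by (simp add: ennreal_mult emeasure_eq_measure)
  also have "\<dots> = (\<integral>\<^sup>+\<omega>. ennreal (exp (l\<^sup>2 / (4 * \<kappa>))) * indicator ?E \<omega> \<partial>M)"
    by (rule nn_integral_cmult_indicator[symmetric]) measurable
  also have "\<dots> \<le> (\<integral>\<^sup>+\<omega>. ennreal (exp ((norm (?I \<omega>))\<^sup>2 / (4 * \<kappa>))) * indicator ?A \<omega> \<partial>M)"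
  proof (rule nn_integral_mono)
    fix \<omega>
    show "ennreal (exp (l\<^sup>2 / (4 * \<kappa>))) * indicator ?E \<omega> \<le> ennreal (exp ((norm (?I \<omega>))\<^sup>2 / (4 * \<kappa>))) * indicator ?A \<omega>"
    proof (cases "\<omega> \<in> ?E")
      case True
      then have "l\<^sup>2 \<le> (norm (?I \<omega>))\<^sup>2" using l by (intro power_mono) auto
      then have "exp (l\<^sup>2 / (4 * \<kappa>)) \<le> exp ((norm (?I \<omega>))\<^sup>2 / (4 * \<kappa>))" using \<kappa> by (simp add: divide_right_mono)
      then show ?thesis using True by (simp add: ennreal_leI)
    qed simp
  qed
  also have "\<dots> \<le> ennreal (exp (1/2))" by (rule elementary_exp_square[OF es T N \<kappa>])
  finally have "exp (l\<^sup>2 / (4 * \<kappa>)) * prob ?E \<le> exp (1/2)" by simp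
  also have "exp (1/2) \<le> (2::real)"
  proof -
    have "exp (1/2) \<le> (1 + 1/2 + (1/2)\<^sup>2 :: real)" by (rule exp_bound) auto
    then show ?thesis by (simp add: power2_eq_square)
  qed
  finally show ?thesis by (simp add: exp_minus field_simps)
qed

text \<open>The same mixture argument for the vector of all increments, whose covariance is a multiple of the identity.\<close>
lemma increments_exp_square:
  fixes m :: nat and \<theta> :: real and d :: "nat \<Rightarrow> nat \<Rightarrow> 'a \<Rightarrow> real"
  assumes N: "finite N" "N \<subseteq> J" and m: "0 < m"
  defines "d \<equiv> \<lambda>j k \<omega>. \<beta> k (real (Suc j) / m) \<omega> - \<beta> k (real j / m) \<omega>"
  shows "(\<integral>\<^sup>+\<omega>. ennreal (exp (\<theta>\<^sup>2 * (m * (\<Sum>j<m. \<Sum>k\<in>N. (d j k \<omega>)\<^sup>2)) / (2 * (1 + \<theta>\<^sup>2)))) \<partial>M)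
    \<le> ennreal (exp (\<theta>\<^sup>2 * (m * card N) / 2))"
proof -
  define I where "I = {..<m} \<times> N"
  \<comment> \<open>Scaled to unit variance, the increments have the identity as covariance, so
    \<open>\<rho> = 1\<close> and \<open>\<kappa>\<close> is their number \<open>m * card N\<close>.
    For large \<open>\<theta>\<close> the exponent approaches half the sum of squares, the sharp
    rate; the denominator \<open>4 * \<kappa>\<close> of \<open>elementary_exp_square\<close> would
    not give the right constant in front of \<open>r\<close>.\<close>
  define x where "x i \<omega> = sqrt m * d (fst i) (snd i) \<omega>" for i \<omega>
  define R where "R = (\<lambda>(i::nat \<times> nat) j (\<omega>::'a). if i = j then 1 else 0 :: real)"
  have fin: "finite I" using N by (simp add: I_def)
  have dm: "d j k \<in> borel_measurable M" if "k \<in> N" for j k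
    unfolding d_def using that N by (intro borel_measurable_diff beta_measurable) auto
  have Rsum: "(\<Sum>i\<in>I. \<Sum>j\<in>I. v i * v j * R i j \<omega>) = (\<Sum>i\<in>I. (v i)\<^sup>2)" for v \<omega>
  proof -
    have "(\<Sum>j\<in>I. v i * v j * R i j \<omega>) = (v i)\<^sup>2" if "i \<in> I" for i
    proof -
      have "(\<Sum>j\<in>I. v i * v j * R i j \<omega>) = (\<Sum>j\<in>I. if i = j then (v i)\<^sup>2 else 0)"
        by (intro sum.cong refl) (auto simp: R_def power2_eq_square)
      then show ?thesis using fin that by simp
    qed
    then show ?thesis by (intro sum.cong refl)
  qed
  have le: "(\<integral>\<^sup>+\<omega>. ennreal (exp ((\<Sum>i\<in>I. v i * x i \<omega>) - (\<Sum>i\<in>I. \<Sum>j\<in>I. v i * v j * R i j \<omega>) / 2)) \<partial>M) \<le> 1" for v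
  proof -
    define Y where "Y l \<omega> = ennreal (exp (\<Sum>j<l. (\<Sum>k\<in>N. v (j, k) * sqrt m * d j k \<omega>) - (\<Sum>k\<in>N. (v (j, k))\<^sup>2) / 2))" for l \<omega>
    have YF: "Y l \<in> borel_measurable (Fil (real l / m))" for l
    proof -
      have "d j k \<in> borel_measurable (Fil (real l / m))" if "k \<in> N" "j < l" for j k
        unfolding d_def using that N m by (intro increment_Fil) (auto simp: divide_right_mono)
      then have "(\<lambda>\<omega>. \<Sum>j<l. (\<Sum>k\<in>N. v (j, k) * sqrt m * d j k \<omega>) - (\<Sum>k\<in>N. (v (j, k))\<^sup>2) / 2) \<in> borel_measurable (Fil (real l / m))"
        by (intro borel_measurable_sum borel_measurable_diff borel_measurable_times) auto
      then show ?thesis unfolding Y_def by simp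
    qed
    have "(\<integral>\<^sup>+\<omega>. Y l \<omega> \<partial>M) \<le> 1" for l
    proof (induction l)
      case 0
      show ?case by (simp add: Y_def emeasure_space_1)
    next
      case (Suc l)
      have q: "(\<Sum>k\<in>N. (v (l, k) * sqrt m)\<^sup>2) * (real (Suc l) / m - real l / m) = (\<Sum>k\<in>N. (v (l, k))\<^sup>2)"
      proof -
        have "(\<Sum>k\<in>N. (v (l, k) * sqrt m)\<^sup>2) = m * (\<Sum>k\<in>N. (v (l, k))\<^sup>2)"
          by (simp add: power_mult_distrib sum_distrib_left mult.commute)
        moreover have "real (Suc l) / m - real l / m = 1 / m" by (simp add: diff_divide_distrib[symmetric])
        ultimately show ?thesis using m by simp
      qed
      have "(\<integral>\<^sup>+\<omega>. Y (Suc l) \<omega> \<partial>M) = (\<integral>\<^sup>+\<omega>. Y l \<omega> * ennreal (exp ((\<Sum>k\<in>N. v (l, k) * sqrt m * (\<beta> k (real (Suc l) / m) \<omega> - \<beta> k (real l / m) \<omega>))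
          - (\<Sum>k\<in>N. (v (l, k) * sqrt m)\<^sup>2) * (real (Suc l) / m - real l / m) / 2)) \<partial>M)"
        unfolding q by (intro nn_integral_cong) (simp add: Y_def d_def ennreal_mult[symmetric] exp_add[symmetric])
      also have "\<dots> \<le> (\<integral>\<^sup>+\<omega>. Y l \<omega> \<partial>M)"
        using m by (intro conditional_exponential[OF N] YF) (auto simp: divide_strict_right_mono)
      also have "\<dots> \<le> 1" by fact
      finally show ?case .
    qed
    moreover have "(\<Sum>i\<in>I. v i * x i \<omega>) - (\<Sum>i\<in>I. \<Sum>j\<in>I. v i * v j * R i j \<omega>) / 2
      = (\<Sum>j<m. (\<Sum>k\<in>N. v (j, k) * sqrt m * d j k \<omega>) - (\<Sum>k\<in>N. (v (j, k))\<^sup>2) / 2)" for \<omega>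
      unfolding Rsum
      by (simp add: I_def x_def sum.cartesian_product' sum_subtractf sum_divide_distrib mult.assoc)
    ultimately show ?thesis by (simp add: Y_def)
  qed
  have "(\<integral>\<^sup>+\<omega>. ennreal (exp (\<theta>\<^sup>2 * (\<Sum>i\<in>I. (x i \<omega>)\<^sup>2) / (2 * (1 + \<theta>\<^sup>2 * 1)))) * indicator (space M) \<omega> \<partial>M)
      \<le> ennreal (exp (\<theta>\<^sup>2 * (m * card N) / 2))"
  proof (rule gaussian_mixture[OF fin _ _ _ _ le])
    show "x i \<in> borel_measurable M" if "i \<in> I" for i unfolding x_def using that dm by (auto simp: I_def)
    show "R i j \<in> borel_measurable M" for i j by (simp add: R_def)
    show "(\<Sum>i\<in>I. R i i \<omega>) \<le> m * card N" for \<omega> by (simp add: R_def I_def card_cartesian_product)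
    show "(\<Sum>i\<in>I. \<Sum>j\<in>I. x i \<omega> * x j \<omega> * R i j \<omega>) \<le> 1 * (\<Sum>i\<in>I. (x i \<omega>)\<^sup>2)" for \<omega> unfolding Rsum by simp
  qed auto
  moreover have "(\<Sum>i\<in>I. (x i \<omega>)\<^sup>2) = m * (\<Sum>j<m. \<Sum>k\<in>N. (d j k \<omega>)\<^sup>2)" for \<omega>
    by (simp add: I_def x_def sum.cartesian_product' power_mult_distrib sum_distrib_left)
  ultimately have "(\<integral>\<^sup>+\<omega>. ennreal (exp (\<theta>\<^sup>2 * (m * (\<Sum>j<m. \<Sum>k\<in>N. (d j k \<omega>)\<^sup>2)) / (2 * (1 + \<theta>\<^sup>2)))) * indicator (space M) \<omega> \<partial>M)
    \<le> ennreal (exp (\<theta>\<^sup>2 * (m * card N) / 2))" by simp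
  then show ?thesis by (subst (asm) nn_integral_cong[of M _ "\<lambda>\<omega>. ennreal (exp (\<theta>\<^sup>2 * (m * (\<Sum>j<m. \<Sum>k\<in>N. (d j k \<omega>)\<^sup>2)) / (2 * (1 + \<theta>\<^sup>2))))"]) auto
qed

end

section \<open>Squared Hilbert--Schmidt norms and energies\<close>

text \<open>Integrands are represented by their coordinates \<open>\<Phi>(s) g\<^sub>k\<close>, the squared Hilbert--Schmidt norm by the
  sum over \<open>k \<in> J\<close>; in \<open>[0, \<infinity>]\<close> no summability conditions are needed.\<close>

definition hs_sq :: "nat set \<Rightarrow> (nat \<Rightarrow> 'h::real_normed_vector) \<Rightarrow> ennreal" where
  "hs_sq J v = (\<Sum>k. indicator J k * ennreal ((norm (v k))\<^sup>2))"

definition energy :: "nat set \<Rightarrow> ('a \<Rightarrow> real \<Rightarrow> nat \<Rightarrow> 'h::real_normed_vector) \<Rightarrow> 'a \<Rightarrow> ennreal" where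
  "energy J f \<omega> = (\<integral>\<^sup>+u. hs_sq J (f \<omega> u) \<partial>lborel)"

lemma hs_sq_mono:
  assumes "\<And>k. k \<in> J \<Longrightarrow> norm (v k) \<le> norm (w k)"
  shows "hs_sq J v \<le> hs_sq J w"
  unfolding hs_sq_def using assms
  by (intro suminf_le summableI) (auto simp: indicator_def intro!: ennreal_leI power_mono)

lemma hs_sq_cong: "(\<And>k. k \<in> J \<Longrightarrow> norm (v k) = norm (w k)) \<Longrightarrow> hs_sq J v = hs_sq J w"
  by (intro antisym hs_sq_mono) auto

lemma hs_sq_scale: "hs_sq J (\<lambda>k. c *\<^sub>R v k) = ennreal (c\<^sup>2) * hs_sq J v"
  unfolding hs_sq_def ennreal_suminf_cmult[symmetric]
  by (intro suminf_cong) (simp add: power_mult_distrib ennreal_mult mult_ac)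

lemma hs_sq_0 [simp]: "hs_sq J (\<lambda>k. 0) = 0"
  by (simp add: hs_sq_def)

text \<open>Young's inequality with a free weight: for small \<open>t\<close> the first summand is
  kept almost without loss, as the limit in \<open>ito_tail\<close> requires.\<close>

lemma norm_add_sq_le:
  fixes x y :: "'h::real_normed_vector"
  assumes t: "0 < t"
  shows "(norm (x + y))\<^sup>2 \<le> (1 + t) * (norm x)\<^sup>2 + (1 + 1 / t) * (norm y)\<^sup>2"
proof -
  have "(norm (x + y))\<^sup>2 \<le> (norm x + norm y)\<^sup>2" by (intro power_mono norm_triangle_ineq) auto
  also have "\<dots> = (norm x)\<^sup>2 + (norm y)\<^sup>2 + 2 * norm x * norm y" by (simp add: power2_sum)
  also have "2 * norm x * norm y \<le> t * (norm x)\<^sup>2 + (norm y)\<^sup>2 / t"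
  proof -
    have "0 \<le> (t * norm x - norm y)\<^sup>2" by simp
    then have "2 * norm x * norm y * t \<le> (t * (norm x)\<^sup>2 + (norm y)\<^sup>2 / t) * t"
      using t by (simp add: power2_diff power_mult_distrib power2_eq_square algebra_simps)
    then show ?thesis using t by (rule mult_right_le_imp_le)
  qed
  finally show ?thesis by (simp add: algebra_simps)
qed

lemma hs_sq_add:
  assumes t: "0 < t"
  shows "hs_sq J (\<lambda>k. v k + w k) \<le> ennreal (1 + t) * hs_sq J v + ennreal (1 + 1 / t) * hs_sq J w"
proof -
  have "hs_sq J (\<lambda>k. v k + w k) \<le> (\<Sum>k. ennreal (1 + t) * (indicator J k * ennreal ((norm (v k))\<^sup>2)) + ennreal (1 + 1 / t) * (indicator J k * ennreal ((norm (w k))\<^sup>2)))"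
    unfolding hs_sq_def
  proof (intro suminf_le summableI)
    fix k
    have "ennreal ((norm (v k + w k))\<^sup>2) \<le> ennreal (1 + t) * ennreal ((norm (v k))\<^sup>2) + ennreal (1 + 1 / t) * ennreal ((norm (w k))\<^sup>2)"
      using ennreal_leI[OF norm_add_sq_le[OF t, of "v k" "w k"]] t by (simp add: ennreal_mult)
    then show "indicator J k * ennreal ((norm (v k + w k))\<^sup>2)
      \<le> ennreal (1 + t) * (indicator J k * ennreal ((norm (v k))\<^sup>2)) + ennreal (1 + 1 / t) * (indicator J k * ennreal ((norm (w k))\<^sup>2))"
      by (simp add: indicator_def)
  qed
  also have "\<dots> = ennreal (1 + t) * hs_sq J v + ennreal (1 + 1 / t) * hs_sq J w"
    unfolding hs_sq_def ennreal_suminf_cmult[symmetric] by (intro suminf_add[symmetric] summableI)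
  finally show ?thesis .
qed

lemma hs_sq_add2: "hs_sq J (\<lambda>k. v k + w k) \<le> 2 * hs_sq J v + 2 * hs_sq J w"
  using hs_sq_add[of 1 J v w] by simp

lemma hs_sq_measurable:
  assumes "\<And>k. k \<in> J \<Longrightarrow> (\<lambda>x. v x k) \<in> borel_measurable N"
  shows "(\<lambda>x. hs_sq J (v x)) \<in> borel_measurable N"
proof -
  have "(\<lambda>x. indicator J k * ennreal ((norm (v x k))\<^sup>2)) \<in> borel_measurable N" for k
  proof (cases "k \<in> J")
    case True
    have [measurable]: "(\<lambda>x. v x k) \<in> borel_measurable N" using assms[OF True] .
    show ?thesis using True by simp
  qed simp
  then show ?thesis unfolding hs_sq_def by (intro borel_measurable_suminf_order)
qed

definition jointly_measurable :: "'a measure \<Rightarrow> nat set \<Rightarrow> ('a \<Rightarrow> real \<Rightarrow> nat \<Rightarrow> 'h::topological_space) \<Rightarrow> bool" where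
  "jointly_measurable M J f \<longleftrightarrow> (\<forall>k\<in>J. (\<lambda>(\<omega>, u). f \<omega> u k) \<in> borel_measurable (M \<Otimes>\<^sub>M lborel))"

lemma jointly_measurable_hs_sq:
  assumes "jointly_measurable M J f"
  shows "(\<lambda>(\<omega>, u). hs_sq J (f \<omega> u)) \<in> borel_measurable (M \<Otimes>\<^sub>M lborel)"
  using hs_sq_measurable[of J "\<lambda>(\<omega>, u). f \<omega> u" "M \<Otimes>\<^sub>M lborel"] assms
  by (simp add: jointly_measurable_def split_beta')

lemma energy_measurable:
  assumes "jointly_measurable M J f"
  shows "energy J f \<in> borel_measurable M"
  using sigma_finite_measure.borel_measurable_nn_integral[OF sigma_finite_lborel jointly_measurable_hs_sq[OF assms]]
  by (simp add: energy_def[abs_def])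

lemma hs_sq_section_measurable:
  assumes "jointly_measurable M J f" "\<omega> \<in> space M"
  shows "(\<lambda>u. hs_sq J (f \<omega> u)) \<in> borel_measurable lborel"
  using measurable_compose[OF measurable_Pair1'[OF assms(2)] jointly_measurable_hs_sq[OF assms(1)]] by simp

lemma energy_add:
  assumes f: "jointly_measurable M J f" and g: "jointly_measurable M J g" and \<omega>: "\<omega> \<in> space M" and t: "0 < t"
  shows "energy J (\<lambda>\<omega> u k. f \<omega> u k + g \<omega> u k) \<omega> \<le> ennreal (1 + t) * energy J f \<omega> + ennreal (1 + 1 / t) * energy J g \<omega>"
proof -
  note [measurable] = hs_sq_section_measurable[OF f \<omega>] hs_sq_section_measurable[OF g \<omega>]
  have "energy J (\<lambda>\<omega> u k. f \<omega> u k + g \<omega> u k) \<omega> \<le> (\<integral>\<^sup>+u. ennreal (1 + t) * hs_sq J (f \<omega> u) + ennreal (1 + 1 / t) * hs_sq J (g \<omega> u) \<partial>lborel)"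
    unfolding energy_def by (intro nn_integral_mono hs_sq_add t)
  also have "\<dots> = ennreal (1 + t) * energy J f \<omega> + ennreal (1 + 1 / t) * energy J g \<omega>"
    unfolding energy_def by (simp add: nn_integral_add nn_integral_cmult)
  finally show ?thesis .
qed

lemma energy_scale:
  assumes f: "jointly_measurable M J f" and \<omega>: "\<omega> \<in> space M"
  shows "energy J (\<lambda>\<omega> u k. c *\<^sub>R f \<omega> u k) \<omega> = ennreal (c\<^sup>2) * energy J f \<omega>"
  unfolding energy_def hs_sq_scale using hs_sq_section_measurable[OF f \<omega>] by (rule nn_integral_cmult)

lemma jointly_measurable_add:
  fixes f g :: "'a \<Rightarrow> real \<Rightarrow> nat \<Rightarrow> 'h::{real_normed_vector, second_countable_topology}"
  shows "jointly_measurable M J f \<Longrightarrow> jointly_measurable M J g \<Longrightarrow> jointly_measurable M J (\<lambda>\<omega> u k. f \<omega> u k + g \<omega> u k)"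
  unfolding jointly_measurable_def split_beta' by (intro ballI borel_measurable_add) auto

lemma jointly_measurable_scale:
  fixes f :: "'a \<Rightarrow> real \<Rightarrow> nat \<Rightarrow> 'h::{real_normed_vector, second_countable_topology}"
  shows "jointly_measurable M J f \<Longrightarrow> jointly_measurable M J (\<lambda>\<omega> u k. c *\<^sub>R f \<omega> u k)"
  unfolding jointly_measurable_def split_beta' by (intro ballI borel_measurable_scaleR) auto

lemma energy_coord:
  fixes es :: "('a, 'h::{real_inner, second_countable_topology}) elementary"
  assumes es: "is_elementary Fil J T es" and N: "finite N" "indices es \<subseteq> N" "N \<subseteq> J"
  shows "energy J (coord es) \<omega> = ennreal (quad N es \<omega>)"
proof -
  have "hs_sq J (coord es \<omega> u) = ennreal (\<Sum>k\<in>N. (norm (coord es \<omega> u k))\<^sup>2)" for u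
  proof -
    have "hs_sq J (coord es \<omega> u) = (\<Sum>k\<in>N. indicator J k * ennreal ((norm (coord es \<omega> u k))\<^sup>2))"
      unfolding hs_sq_def using N coord_eq_0[of _ es \<omega> u] by (intro suminf_finite) auto
    also have "\<dots> = (\<Sum>k\<in>N. ennreal ((norm (coord es \<omega> u k))\<^sup>2))"
      using N by (intro sum.cong refl) (auto simp: indicator_def)
    also have "\<dots> = ennreal (\<Sum>k\<in>N. (norm (coord es \<omega> u k))\<^sup>2)" by simp
    finally show ?thesis .
  qed
  then have "energy J (coord es) \<omega> = (\<integral>\<^sup>+u. ennreal (\<Sum>k\<in>N. (norm (coord es \<omega> u k))\<^sup>2) \<partial>lborel)"
    by (simp add: energy_def)
  also have "\<dots> = ennreal (quad N es \<omega>)"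
    unfolding quad_def
    by (intro nn_integral_eq_integral Bochner_Integration.integrable_sum coord_norm_sq_integrable[OF es] AE_I2 sum_nonneg) auto
  finally show ?thesis .
qed

text \<open>Links the unordered real sum behind \<open>hs_norm\<close> to a series in
  \<open>[0, \<infinity>]\<close>. Summability matters here, because \<open>infsum\<close> of a
  divergent family is 0.\<close>

lemma hs_sq_eq_hs_norm:
  assumes "hilbert_schmidt J g T"
  shows "hs_sq J (\<lambda>k. T (g k)) = ennreal ((hs_norm J g T)\<^sup>2)"
proof -
  let ?a = "\<lambda>k. (norm (T (g k)))\<^sup>2"
  have "(?a has_sum infsum ?a J) J" using assms by (simp add: hilbert_schmidt_def)
  then have "((\<lambda>k. indicator J k * ?a k) has_sum infsum ?a J) UNIV"
    by (rule has_sum_cong_neutral[THEN iffD1, rotated -1]) auto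
  then have "(\<lambda>k. indicator J k * ?a k) sums infsum ?a J" by (rule has_sum_imp_sums)
  moreover have "0 \<le> infsum ?a J" by (intro infsum_nonneg) auto
  ultimately have "(\<Sum>k. ennreal (indicator J k * ?a k)) = ennreal (infsum ?a J)"
    by (intro suminf_ennreal_eq) auto
  moreover have "ennreal (indicator J k * ?a k) = indicator J k * ennreal (?a k)" for k by (simp add: indicator_def)
  ultimately show ?thesis using \<open>0 \<le> infsum ?a J\<close> by (simp add: hs_sq_def hs_norm_def)
qed

lemma elementary_process_coord:
  fixes g :: "nat \<Rightarrow> 'u::real_inner"
  assumes "orthonormal_basis J g" "k \<in> J" "indices es \<subseteq> J"
  shows "elementary_process g es s \<omega> (g k) = coord es \<omega> s k"
  using assms(3)
proof (induction es)
  case Nil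
  then show ?case by (simp add: elementary_process_def)
next
  case (Cons e es)
  obtain a b A k' h where e: "e = (a, b, A, k', h)" by (cases e)
  have "g k' \<bullet> g k = (if k' = k then 1 else 0)" using assms Cons.prems by (auto simp: e orthonormal_basis_def)
  then show ?case using Cons
    by (auto simp: e elementary_process_def coord_Cons blinfun.add_left blinfun.scaleR_left)
qed

lemma elementary_process_hilbert_schmidt:
  fixes g :: "nat \<Rightarrow> 'u::real_inner"
  assumes "orthonormal_basis J g" "indices es \<subseteq> J"
  shows "hilbert_schmidt J g (elementary_process g es s \<omega>)"
proof -
  have "(\<lambda>k. (norm (elementary_process g es s \<omega> (g k)))\<^sup>2) summable_on (indices es \<inter> J)" by (intro summable_on_finite) simp
  moreover have "elementary_process g es s \<omega> (g k) = 0" if "k \<in> J - indices es" for k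
    using that elementary_process_coord[OF assms(1) _ assms(2), of k] coord_eq_0[of k es] by simp
  ultimately show ?thesis unfolding hilbert_schmidt_def
    by (subst summable_on_cong_neutral[where T = "indices es \<inter> J"]) auto
qed

lemma hilbert_schmidt_diff:
  fixes g :: "nat \<Rightarrow> 'u::real_inner" and A B :: "'u \<Rightarrow>\<^sub>L 'h::real_inner"
  assumes "hilbert_schmidt J g A" "hilbert_schmidt J g B"
  shows "hilbert_schmidt J g (A - B)"
  unfolding hilbert_schmidt_def
proof (rule summable_on_comparison_test)
  show "(\<lambda>k. 2 * (norm (A (g k)))\<^sup>2 + 2 * (norm (B (g k)))\<^sup>2) summable_on J"
    using assms unfolding hilbert_schmidt_def by (intro summable_on_add summable_on_cmult_right)
  show "(norm ((A - B) (g k)))\<^sup>2 \<le> 2 * (norm (A (g k)))\<^sup>2 + 2 * (norm (B (g k)))\<^sup>2" for k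
    using norm_add_sq_le[of 1 "A (g k)" "- B (g k)"] by (simp add: blinfun.diff_left)
qed auto

section \<open>The Ito integral as a limit in probability\<close>

context wiener_filtration
begin

definition tends_prob :: "(nat \<Rightarrow> 'a \<Rightarrow> ennreal) \<Rightarrow> bool" where
  "tends_prob X \<longleftrightarrow> (\<forall>\<eta>>0. (\<lambda>n. prob {\<omega>\<in>space M. ennreal \<eta> < X n \<omega>}) \<longlonglongrightarrow> 0)"

text \<open>The dominating variables have to be measurable: a set outside the \<sigma>-algebra has
  measure 0 by convention, so monotonicity of the measure needs a measurable larger event.\<close>

lemma tends_prob_mono2:
  assumes X: "tends_prob X" and Y: "tends_prob Y" and [measurable]: "\<And>n. X n \<in> borel_measurable M" "\<And>n. Y n \<in> borel_measurable M"
    and le: "\<And>n \<omega>. \<omega> \<in> space M \<Longrightarrow> Z n \<omega> \<le> ennreal c * X n \<omega> + ennreal c * Y n \<omega>" and c: "0 < c"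
  shows "tends_prob Z"
  unfolding tends_prob_def
proof (intro allI impI)
  fix \<eta> :: real assume \<eta>: "0 < \<eta>"
  let ?e = "\<eta> / (2 * c)"
  have e: "0 < ?e" using \<eta> c by simp
  have "(\<lambda>n. prob {\<omega>\<in>space M. ennreal ?e < X n \<omega>} + prob {\<omega>\<in>space M. ennreal ?e < Y n \<omega>}) \<longlonglongrightarrow> 0 + 0"
    using X Y e unfolding tends_prob_def by (intro tendsto_add) blast+
  then have lim: "(\<lambda>n. prob {\<omega>\<in>space M. ennreal ?e < X n \<omega>} + prob {\<omega>\<in>space M. ennreal ?e < Y n \<omega>}) \<longlonglongrightarrow> 0" by simp
  show "(\<lambda>n. prob {\<omega>\<in>space M. ennreal \<eta> < Z n \<omega>}) \<longlonglongrightarrow> 0"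
  proof (rule tendsto_sandwich[OF _ _ tendsto_const lim])
    show "\<forall>\<^sub>F n in sequentially. 0 \<le> prob {\<omega>\<in>space M. ennreal \<eta> < Z n \<omega>}" by simp
    show "\<forall>\<^sub>F n in sequentially. prob {\<omega>\<in>space M. ennreal \<eta> < Z n \<omega>}
        \<le> prob {\<omega>\<in>space M. ennreal ?e < X n \<omega>} + prob {\<omega>\<in>space M. ennreal ?e < Y n \<omega>}"
    proof (intro always_eventually allI)
      fix n
      have "prob {\<omega>\<in>space M. ennreal \<eta> < Z n \<omega>} \<le> prob ({\<omega>\<in>space M. ennreal ?e < X n \<omega>} \<union> {\<omega>\<in>space M. ennreal ?e < Y n \<omega>})"
      proof (intro finite_measure_mono subsetI)
        fix \<omega> assume \<omega>: "\<omega> \<in> {\<omega>\<in>space M. ennreal \<eta> < Z n \<omega>}"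
        show "\<omega> \<in> {\<omega>\<in>space M. ennreal ?e < X n \<omega>} \<union> {\<omega>\<in>space M. ennreal ?e < Y n \<omega>}"
        proof (rule ccontr)
          assume "\<not> ?thesis"
          then have "X n \<omega> \<le> ennreal ?e" "Y n \<omega> \<le> ennreal ?e" using \<omega> by auto
          then have "Z n \<omega> \<le> ennreal c * ennreal ?e + ennreal c * ennreal ?e"
            using \<omega> by (intro order_trans[OF le] add_mono mult_left_mono) auto
          also have "\<dots> = ennreal \<eta>" using c \<eta> by (simp add: ennreal_mult[symmetric] ennreal_plus[symmetric] del: ennreal_plus)
          finally show False using \<omega> by auto
        qed
      qed measurable
      also have "\<dots> \<le> prob {\<omega>\<in>space M. ennreal ?e < X n \<omega>} + prob {\<omega>\<in>space M. ennreal ?e < Y n \<omega>}"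
        by (intro measure_Un_le) measurable
      finally show "prob {\<omega>\<in>space M. ennreal \<eta> < Z n \<omega>}
        \<le> prob {\<omega>\<in>space M. ennreal ?e < X n \<omega>} + prob {\<omega>\<in>space M. ennreal ?e < Y n \<omega>}" .
    qed
  qed
qed

lemma tends_prob_mono:
  assumes "tends_prob X" "\<And>n. X n \<in> borel_measurable M"
    and "\<And>n \<omega>. \<omega> \<in> space M \<Longrightarrow> Z n \<omega> \<le> ennreal c * X n \<omega>" and "0 < c"
  shows "tends_prob Z"
  using assms by (intro tends_prob_mono2[of X X Z c]) (auto intro: order_trans add_increasing2)

text \<open>Dominated convergence for the indicators of the events.\<close>

lemma tends_prob_pointwise:
  assumes m: "\<And>n. X n \<in> borel_measurable M" and lim: "\<And>\<omega>. \<omega> \<in> space M \<Longrightarrow> (\<lambda>n. X n \<omega>) \<longlonglongrightarrow> 0"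
  shows "tends_prob X"
  unfolding tends_prob_def
proof (intro allI impI)
  fix \<eta> :: real assume \<eta>: "0 < \<eta>"
  note m[measurable]
  have "(\<lambda>n. \<integral>\<omega>. indicator {\<omega>\<in>space M. ennreal \<eta> < X n \<omega>} \<omega> \<partial>M) \<longlonglongrightarrow> (\<integral>\<omega>. (0 :: real) \<partial>M)"
  proof (rule integral_dominated_convergence[where w = "\<lambda>_. 1"])
    show "AE \<omega> in M. (\<lambda>n. indicator {\<omega>\<in>space M. ennreal \<eta> < X n \<omega>} \<omega> :: real) \<longlonglongrightarrow> 0"
    proof (rule AE_I2)
      fix \<omega> assume \<omega>: "\<omega> \<in> space M"
      have "\<forall>\<^sub>F n in sequentially. X n \<omega> < ennreal \<eta>"
        using lim[OF \<omega>] \<eta> by (intro order_tendstoD) auto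
      then have "\<forall>\<^sub>F n in sequentially. indicator {\<omega>\<in>space M. ennreal \<eta> < X n \<omega>} \<omega> = (0 :: real)"
        by eventually_elim (auto simp: indicator_def)
      then show "(\<lambda>n. indicator {\<omega>\<in>space M. ennreal \<eta> < X n \<omega>} \<omega> :: real) \<longlonglongrightarrow> 0" by (rule tendsto_eventually)
    qed
  qed (auto simp: indicator_def)
  then show "(\<lambda>n. prob {\<omega>\<in>space M. ennreal \<eta> < X n \<omega>}) \<longlonglongrightarrow> 0" by simp
qed

text \<open>The horizon is fixed at 1, and an integral over \<open>[0, t]\<close> carries a factor
  \<open>indicator {0..t}\<close> in its integrand. Integrals with different upper limits and
  different kernels can then be subtracted, which is how increments of the stochastic convolution
  become Ito integrals.\<close>

definition ito :: "('a \<Rightarrow> real \<Rightarrow> nat \<Rightarrow> 'h::{real_inner, second_countable_topology}) \<Rightarrow> ('a \<Rightarrow> 'h) \<Rightarrow> bool" where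
  "ito f Z \<longleftrightarrow> jointly_measurable M J f \<and> Z \<in> borel_measurable M \<and>
    (\<exists>es. (\<forall>n. is_elementary Fil J 1 (es n)) \<and>
      tends_prob (\<lambda>n. energy J (\<lambda>\<omega> u k. f \<omega> u k - coord (es n) \<omega> u k)) \<and>
      tends_prob (\<lambda>n \<omega>. ennreal (norm (Z \<omega> - elementary_integral \<beta> (es n) \<omega>))))"

lemma ito_jointly_measurable: "ito f Z \<Longrightarrow> jointly_measurable M J f"
  and ito_measurable: "ito f Z \<Longrightarrow> Z \<in> borel_measurable M"
  by (auto simp: ito_def)

lemma coord_jointly_measurable:
  fixes es :: "('a, 'h::{real_inner, second_countable_topology}) elementary"
  assumes "is_elementary Fil J T es" shows "jointly_measurable M J (coord es)"
  unfolding jointly_measurable_def using elementary_sets(1)[OF assms] by (intro ballI coord_measurable) auto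

lemma jointly_measurable_diff_coord:
  fixes es :: "('a, 'h::{real_inner, second_countable_topology}) elementary"
  assumes "jointly_measurable M J f" "is_elementary Fil J T es"
  shows "jointly_measurable M J (\<lambda>\<omega> u k. f \<omega> u k - coord es \<omega> u k)"
  using jointly_measurable_add[OF assms(1) jointly_measurable_scale[OF coord_jointly_measurable[OF assms(2)], of "-1"]] by simp

lemma ito_add:
  assumes f: "ito f Y" and g: "ito g Z"
  shows "ito (\<lambda>\<omega> u k. f \<omega> u k + g \<omega> u k) (\<lambda>\<omega>. Y \<omega> + Z \<omega>)"
proof -
  note fm = ito_jointly_measurable[OF f] and gm = ito_jointly_measurable[OF g]
  note [measurable] = ito_measurable[OF f] ito_measurable[OF g]
  obtain es where es: "\<And>n. is_elementary Fil J 1 (es n)" "tends_prob (\<lambda>n. energy J (\<lambda>\<omega> u k. f \<omega> u k - coord (es n) \<omega> u k))"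
    "tends_prob (\<lambda>n \<omega>. ennreal (norm (Y \<omega> - elementary_integral \<beta> (es n) \<omega>)))" using f unfolding ito_def by blast
  obtain fs where fs: "\<And>n. is_elementary Fil J 1 (fs n)" "tends_prob (\<lambda>n. energy J (\<lambda>\<omega> u k. g \<omega> u k - coord (fs n) \<omega> u k))"
    "tends_prob (\<lambda>n \<omega>. ennreal (norm (Z \<omega> - elementary_integral \<beta> (fs n) \<omega>)))" using g unfolding ito_def by blast
  have [measurable]: "elementary_integral \<beta> (es n) \<in> borel_measurable M" "elementary_integral \<beta> (fs n) \<in> borel_measurable M" for n
    using elementary_integral_measurable[OF es(1)] elementary_integral_measurable[OF fs(1)] by auto
  note m1 = jointly_measurable_diff_coord[OF fm es(1)] and m2 = jointly_measurable_diff_coord[OF gm fs(1)]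
  show ?thesis
    unfolding ito_def
  proof (intro conjI exI[of _ "\<lambda>n. es n @ fs n"] allI)
    show "jointly_measurable M J (\<lambda>\<omega> u k. f \<omega> u k + g \<omega> u k)" by (rule jointly_measurable_add[OF fm gm])
    show "(\<lambda>\<omega>. Y \<omega> + Z \<omega>) \<in> borel_measurable M" by measurable
    show "is_elementary Fil J 1 (es n @ fs n)" for n using es fs by (simp add: is_elementary_append)
    show "tends_prob (\<lambda>n. energy J (\<lambda>\<omega> u k. f \<omega> u k + g \<omega> u k - coord (es n @ fs n) \<omega> u k))"
    proof (rule tends_prob_mono2[OF es(2) fs(2) energy_measurable[OF m1] energy_measurable[OF m2], where c = 2])
      fix n \<omega> assume \<omega>: "\<omega> \<in> space M"
      have "energy J (\<lambda>\<omega> u k. f \<omega> u k + g \<omega> u k - coord (es n @ fs n) \<omega> u k) \<omega>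
        = energy J (\<lambda>\<omega> u k. (f \<omega> u k - coord (es n) \<omega> u k) + (g \<omega> u k - coord (fs n) \<omega> u k)) \<omega>"
        by (simp add: coord_append algebra_simps)
      also have "\<dots> \<le> ennreal 2 * energy J (\<lambda>\<omega> u k. f \<omega> u k - coord (es n) \<omega> u k) \<omega>
          + ennreal 2 * energy J (\<lambda>\<omega> u k. g \<omega> u k - coord (fs n) \<omega> u k) \<omega>"
        using energy_add[OF m1[of n] m2[of n] \<omega>, of 1] by simp
      finally show "energy J (\<lambda>\<omega> u k. f \<omega> u k + g \<omega> u k - coord (es n @ fs n) \<omega> u k) \<omega>
        \<le> ennreal 2 * energy J (\<lambda>\<omega> u k. f \<omega> u k - coord (es n) \<omega> u k) \<omega>
          + ennreal 2 * energy J (\<lambda>\<omega> u k. g \<omega> u k - coord (fs n) \<omega> u k) \<omega>" .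
    qed simp
    show "tends_prob (\<lambda>n \<omega>. ennreal (norm (Y \<omega> + Z \<omega> - elementary_integral \<beta> (es n @ fs n) \<omega>)))"
    proof (rule tends_prob_mono2[OF es(3) fs(3), where c = 1])
      fix n \<omega>
      have "norm (Y \<omega> + Z \<omega> - elementary_integral \<beta> (es n @ fs n) \<omega>)
        \<le> norm (Y \<omega> - elementary_integral \<beta> (es n) \<omega>) + norm (Z \<omega> - elementary_integral \<beta> (fs n) \<omega>)"
        unfolding elementary_integral_append by (rule order_trans[OF _ norm_triangle_ineq]) (simp add: algebra_simps)
      then show "ennreal (norm (Y \<omega> + Z \<omega> - elementary_integral \<beta> (es n @ fs n) \<omega>))
        \<le> ennreal 1 * ennreal (norm (Y \<omega> - elementary_integral \<beta> (es n) \<omega>)) + ennreal 1 * ennreal (norm (Z \<omega> - elementary_integral \<beta> (fs n) \<omega>))"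
        by (simp add: ennreal_plus[symmetric] ennreal_leI del: ennreal_plus)
    qed auto
  qed
qed

lemma ito_scale:
  assumes f: "ito f Y"
  shows "ito (\<lambda>\<omega> u k. c *\<^sub>R f \<omega> u k) (\<lambda>\<omega>. c *\<^sub>R Y \<omega>)"
proof -
  note fm = ito_jointly_measurable[OF f]
  note [measurable] = ito_measurable[OF f]
  obtain es where es: "\<And>n. is_elementary Fil J 1 (es n)" "tends_prob (\<lambda>n. energy J (\<lambda>\<omega> u k. f \<omega> u k - coord (es n) \<omega> u k))"
    "tends_prob (\<lambda>n \<omega>. ennreal (norm (Y \<omega> - elementary_integral \<beta> (es n) \<omega>)))" using f unfolding ito_def by blast
  have [measurable]: "elementary_integral \<beta> (es n) \<in> borel_measurable M" for n
    using elementary_integral_measurable[OF es(1)] by auto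
  note m1 = jointly_measurable_diff_coord[OF fm es(1)]
  have lin: "linear (\<lambda>h. c *\<^sub>R h)" for c :: real by (intro linearI) (simp_all add: scaleR_add_right)
  show ?thesis
    unfolding ito_def
  proof (intro conjI exI[of _ "\<lambda>n. map_coeff (\<lambda>h. c *\<^sub>R h) (es n)"] allI)
    show "jointly_measurable M J (\<lambda>\<omega> u k. c *\<^sub>R f \<omega> u k)" by (rule jointly_measurable_scale[OF fm])
    show "(\<lambda>\<omega>. c *\<^sub>R Y \<omega>) \<in> borel_measurable M" by measurable
    show "is_elementary Fil J 1 (map_coeff (\<lambda>h. c *\<^sub>R h) (es n))" for n using es by simp
    show "tends_prob (\<lambda>n. energy J (\<lambda>\<omega> u k. c *\<^sub>R f \<omega> u k - coord (map_coeff (\<lambda>h. c *\<^sub>R h) (es n)) \<omega> u k))"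
    proof (rule tends_prob_mono[OF es(2) energy_measurable[OF m1], where c = "c\<^sup>2 + 1"])
      fix n \<omega> assume \<omega>: "\<omega> \<in> space M"
      have "energy J (\<lambda>\<omega> u k. c *\<^sub>R f \<omega> u k - coord (map_coeff (\<lambda>h. c *\<^sub>R h) (es n)) \<omega> u k) \<omega>
        = energy J (\<lambda>\<omega> u k. c *\<^sub>R (f \<omega> u k - coord (es n) \<omega> u k)) \<omega>"
        by (simp add: coord_map_coeff[OF lin] scaleR_diff_right)
      also have "\<dots> = ennreal (c\<^sup>2) * energy J (\<lambda>\<omega> u k. f \<omega> u k - coord (es n) \<omega> u k) \<omega>" by (rule energy_scale[OF m1 \<omega>])
      also have "\<dots> \<le> ennreal (c\<^sup>2 + 1) * energy J (\<lambda>\<omega> u k. f \<omega> u k - coord (es n) \<omega> u k) \<omega>" by (intro mult_right_mono ennreal_leI) auto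
      finally show "energy J (\<lambda>\<omega> u k. c *\<^sub>R f \<omega> u k - coord (map_coeff (\<lambda>h. c *\<^sub>R h) (es n)) \<omega> u k) \<omega>
        \<le> ennreal (c\<^sup>2 + 1) * energy J (\<lambda>\<omega> u k. f \<omega> u k - coord (es n) \<omega> u k) \<omega>" .
    qed (simp add: add_nonneg_pos)
    show "tends_prob (\<lambda>n \<omega>. ennreal (norm (c *\<^sub>R Y \<omega> - elementary_integral \<beta> (map_coeff (\<lambda>h. c *\<^sub>R h) (es n)) \<omega>)))"
    proof (rule tends_prob_mono[OF es(3), where c = "\<bar>c\<bar> + 1"])
      fix n \<omega>
      have "norm (c *\<^sub>R Y \<omega> - elementary_integral \<beta> (map_coeff (\<lambda>h. c *\<^sub>R h) (es n)) \<omega>)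
        = \<bar>c\<bar> * norm (Y \<omega> - elementary_integral \<beta> (es n) \<omega>)"
        by (simp add: elementary_integral_map_coeff[OF lin] scaleR_diff_right[symmetric])
      also have "\<dots> \<le> (\<bar>c\<bar> + 1) * norm (Y \<omega> - elementary_integral \<beta> (es n) \<omega>)" by (intro mult_right_mono) auto
      finally have "ennreal (norm (c *\<^sub>R Y \<omega> - elementary_integral \<beta> (map_coeff (\<lambda>h. c *\<^sub>R h) (es n)) \<omega>))
        \<le> ennreal ((\<bar>c\<bar> + 1) * norm (Y \<omega> - elementary_integral \<beta> (es n) \<omega>))" by (rule ennreal_leI)
      also have "\<dots> = ennreal (\<bar>c\<bar> + 1) * ennreal (norm (Y \<omega> - elementary_integral \<beta> (es n) \<omega>))"
        by (rule ennreal_mult) auto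
      finally show "ennreal (norm (c *\<^sub>R Y \<omega> - elementary_integral \<beta> (map_coeff (\<lambda>h. c *\<^sub>R h) (es n)) \<omega>))
        \<le> ennreal (\<bar>c\<bar> + 1) * ennreal (norm (Y \<omega> - elementary_integral \<beta> (es n) \<omega>))" .
    qed (auto simp: add_nonneg_pos)
  qed
qed

lemma ito_diff:
  assumes "ito f Y" "ito g Z"
  shows "ito (\<lambda>\<omega> u k. f \<omega> u k - g \<omega> u k) (\<lambda>\<omega>. Y \<omega> - Z \<omega>)"
  using ito_add[OF assms(1) ito_scale[OF assms(2), of "-1"]] by simp

lemma ito_zero: "ito (\<lambda>\<omega> u k. 0) (\<lambda>\<omega>. 0)"
  unfolding ito_def
  by (intro conjI exI[of _ "\<lambda>n. []"]) (auto simp: jointly_measurable_def split_beta' energy_def tends_prob_def)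

lemma ito_sum:
  assumes "finite I" "\<And>i. i \<in> I \<Longrightarrow> ito (f i) (Z i)"
  shows "ito (\<lambda>\<omega> u k. \<Sum>i\<in>I. f i \<omega> u k) (\<lambda>\<omega>. \<Sum>i\<in>I. Z i \<omega>)"
  using assms by (induction I rule: finite_induct) (auto simp: ito_zero intro!: ito_add)


text \<open>No stopping time is needed: the bound on the energy is part of the event.\<close>
theorem ito_tail:
  assumes f: "ito f Z" and \<kappa>: "0 < \<kappa>" and l: "0 < l"
  shows "prob {\<omega>\<in>space M. l < norm (Z \<omega>) \<and> energy J f \<omega> \<le> ennreal \<kappa>} \<le> 2 * exp (- l\<^sup>2 / (4 * \<kappa>))"
proof -
  note fm = ito_jointly_measurable[OF f]
  note [measurable] = ito_measurable[OF f] energy_measurable[OF fm]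
  obtain es where es: "\<And>n. is_elementary Fil J 1 (es n)" "tends_prob (\<lambda>n. energy J (\<lambda>\<omega> u k. f \<omega> u k - coord (es n) \<omega> u k))"
    "tends_prob (\<lambda>n \<omega>. ennreal (norm (Z \<omega> - elementary_integral \<beta> (es n) \<omega>)))" using f unfolding ito_def by blast
  have [measurable]: "elementary_integral \<beta> (es n) \<in> borel_measurable M" for n
    using elementary_integral_measurable[OF es(1)] by auto
  note dm = jointly_measurable_diff_coord[OF fm es(1)]
  have dm': "jointly_measurable M J (\<lambda>\<omega> u k. coord (es n) \<omega> u k - f \<omega> u k)" for n
    using jointly_measurable_scale[OF dm[of n], of "-1"] by simp
  note [measurable] = energy_measurable[OF dm]
  define N where "N n = indices (es n)" for n
  have N: "finite (N n)" "N n \<subseteq> J" "indices (es n) \<subseteq> N n" for n using is_elementary_indices[OF es(1)] by (auto simp: N_def)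
  have [measurable]: "quad (N n) (es n) \<in> borel_measurable M" for n
    using elementary_sets(1)[OF es(1)] by (intro quad_measurable) auto
  let ?P = "prob {\<omega>\<in>space M. l < norm (Z \<omega>) \<and> energy J f \<omega> \<le> ennreal \<kappa>}"
  \<comment> \<open>The integral and its energy are compared with an elementary approximation. The
    threshold \<open>t^2\<close> for the energy of the difference balances the factor
    \<open>1 + 1 / t\<close>, which gives \<open>(1 + t) * \<kappa> + t^2 + t\<close>. First the
    index of the approximation tends to infinity, then \<open>t\<close> to 0.\<close>
  have approx: "?P \<le> 2 * exp (- (l - t)\<^sup>2 / (4 * ((1 + t) * \<kappa> + t\<^sup>2 + t)))" if t: "0 < t" "t < l" for t
  proof -
    let ?k = "(1 + t) * \<kappa> + t\<^sup>2 + t"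
    have k: "0 < ?k" using t \<kappa> by (simp add: add_pos_pos)
    let ?A = "\<lambda>n. {\<omega>\<in>space M. ennreal (t\<^sup>2) < energy J (\<lambda>\<omega> u k. f \<omega> u k - coord (es n) \<omega> u k) \<omega>}"
    let ?B = "\<lambda>n. {\<omega>\<in>space M. ennreal t < ennreal (norm (Z \<omega> - elementary_integral \<beta> (es n) \<omega>))}"
    let ?C = "\<lambda>n. {\<omega>\<in>space M. l - t < norm (elementary_integral \<beta> (es n) \<omega>) \<and> quad (N n) (es n) \<omega> \<le> ?k}"
    have le: "?P \<le> 2 * exp (- (l - t)\<^sup>2 / (4 * ?k)) + (prob (?A n) + prob (?B n))" for n
    proof -
      have "?P \<le> prob (?C n \<union> (?A n \<union> ?B n))"
      proof (intro finite_measure_mono subsetI)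
        fix \<omega> assume \<omega>: "\<omega> \<in> {\<omega>\<in>space M. l < norm (Z \<omega>) \<and> energy J f \<omega> \<le> ennreal \<kappa>}"
        show "\<omega> \<in> ?C n \<union> (?A n \<union> ?B n)"
        proof (cases "\<omega> \<in> ?A n \<union> ?B n")
          case False
          have sp: "\<omega> \<in> space M" using \<omega> by simp
          have e: "energy J (\<lambda>\<omega> u k. f \<omega> u k - coord (es n) \<omega> u k) \<omega> \<le> ennreal (t\<^sup>2)" using False sp by auto
          have b: "norm (Z \<omega> - elementary_integral \<beta> (es n) \<omega>) \<le> t" using False sp t by (auto simp: not_less)
          have "norm (Z \<omega>) \<le> norm (Z \<omega> - elementary_integral \<beta> (es n) \<omega>) + norm (elementary_integral \<beta> (es n) \<omega>)"
            by (metis diff_add_cancel norm_triangle_ineq)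
          then have c1: "l - t < norm (elementary_integral \<beta> (es n) \<omega>)" using b \<omega> by auto
          have sym: "energy J (\<lambda>\<omega> u k. coord (es n) \<omega> u k - f \<omega> u k) \<omega> = energy J (\<lambda>\<omega> u k. f \<omega> u k - coord (es n) \<omega> u k) \<omega>"
            unfolding energy_def by (intro nn_integral_cong hs_sq_cong norm_minus_commute)
          have "ennreal (quad (N n) (es n) \<omega>) = energy J (\<lambda>\<omega> u k. f \<omega> u k + (coord (es n) \<omega> u k - f \<omega> u k)) \<omega>"
            using energy_coord[OF es(1) N(1,3,2), of n \<omega>] by simp
          also have "\<dots> \<le> ennreal (1 + t) * energy J f \<omega> + ennreal (1 + 1 / t) * energy J (\<lambda>\<omega> u k. coord (es n) \<omega> u k - f \<omega> u k) \<omega>"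
            by (rule energy_add[OF fm dm' sp t(1)])
          also have "\<dots> \<le> ennreal (1 + t) * ennreal \<kappa> + ennreal (1 + 1 / t) * ennreal (t\<^sup>2)"
            unfolding sym using e \<omega> by (intro add_mono mult_left_mono) auto
          also have "\<dots> = ennreal ((1 + t) * \<kappa> + (1 + 1 / t) * t\<^sup>2)"
          proof -
            have "ennreal (1 + t) * ennreal \<kappa> = ennreal ((1 + t) * \<kappa>)"
              "ennreal (1 + 1 / t) * ennreal (t\<^sup>2) = ennreal ((1 + 1 / t) * t\<^sup>2)"
              using t \<kappa> by (intro ennreal_mult[symmetric]; simp)+
            moreover have "0 \<le> (1 + t) * \<kappa>" "0 \<le> (1 + 1 / t) * t\<^sup>2" using t \<kappa> by simp_all
            ultimately show ?thesis by (simp only: ennreal_plus)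
          qed
          also have "(1 + t) * \<kappa> + (1 + 1 / t) * t\<^sup>2 = ?k" using t by (simp add: power2_eq_square field_simps)
          finally have "quad (N n) (es n) \<omega> \<le> ?k" using k by simp
          then show ?thesis using c1 sp by simp
        qed simp
      qed measurable
      also have "\<dots> \<le> prob (?C n) + (prob (?A n) + prob (?B n))"
        by (intro order_trans[OF measure_Un_le] add_mono order_refl) measurable
      also have "\<dots> \<le> 2 * exp (- (l - t)\<^sup>2 / (4 * ?k)) + (prob (?A n) + prob (?B n))"
        using elementary_tail[OF es(1)[of n] _ N[of n] k, of "l - t"] t by simp
      finally show ?thesis .
    qed
    have "(\<lambda>n. 2 * exp (- (l - t)\<^sup>2 / (4 * ?k)) + (prob (?A n) + prob (?B n))) \<longlonglongrightarrow> 2 * exp (- (l - t)\<^sup>2 / (4 * ?k)) + (0 + 0)"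
      using es(2,3) t unfolding tends_prob_def by (intro tendsto_add tendsto_const) auto
    then show ?thesis using le by (intro LIMSEQ_le_const[of _ "2 * exp (- (l - t)\<^sup>2 / (4 * ?k))"]) auto
  qed
  have "((\<lambda>t. 2 * exp (- (l - t)\<^sup>2 / (4 * ((1 + t) * \<kappa> + t\<^sup>2 + t)))) \<longlongrightarrow> 2 * exp (- (l - 0)\<^sup>2 / (4 * ((1 + 0) * \<kappa> + 0\<^sup>2 + 0)))) (at_right 0)"
    using \<kappa> by (intro tendsto_intros) auto
  then have "((\<lambda>t. 2 * exp (- (l - t)\<^sup>2 / (4 * ((1 + t) * \<kappa> + t\<^sup>2 + t)))) \<longlongrightarrow> 2 * exp (- l\<^sup>2 / (4 * \<kappa>))) (at_right 0)" by simp
  moreover have "\<forall>\<^sub>F t in at_right 0. ?P \<le> 2 * exp (- (l - t)\<^sup>2 / (4 * ((1 + t) * \<kappa> + t\<^sup>2 + t)))"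
    using eventually_at_right_real[OF l] by eventually_elim (rule approx, auto)
  ultimately show ?thesis by (intro tendsto_lowerbound) auto
qed

text \<open>Measurability into the predictable \<sigma>-algebra is tested on its generating
  rectangles. Two maps \<open>h\<close> occur: the exchange of time and sample point, and the
  embedding at a fixed time.\<close>

lemma predictable_measurable_map:
  assumes "predictable M Fil T Y" and h: "h \<in> space N \<rightarrow> {0..T} \<times> space M"
    and zero: "\<And>A. A \<in> sets (Fil 0) \<Longrightarrow> h -` ({0} \<times> A) \<inter> space N \<in> sets N"
    and step: "\<And>s t A. 0 \<le> s \<Longrightarrow> s < t \<Longrightarrow> t \<le> T \<Longrightarrow> A \<in> sets (Fil s) \<Longrightarrow> h -` ({s<..t} \<times> A) \<inter> space N \<in> sets N"
  shows "(\<lambda>x. Y (fst (h x)) (snd (h x))) \<in> borel_measurable N"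
proof -
  let ?G = "{{0} \<times> A |A. A \<in> sets (Fil 0)} \<union> {{s<..t} \<times> A |s t A. 0 \<le> s \<and> s < t \<and> t \<le> T \<and> A \<in> sets (Fil s)}"
  have sp: "A \<subseteq> space M" if "0 \<le> s" "A \<in> sets (Fil s)" for s A
    using sets.sets_into_space[OF that(2)] space_Fil[OF that(1)] by simp
  have T: "0 \<le> T \<or> space N = {}" using h by fastforce
  have "h \<in> measurable N (predictable_sigma M Fil T)"
  proof (cases "space N = {}")
    case True
    then show ?thesis using measurable_empty_iff
      by (auto simp: measurable_def)
  next
    case False
    then have T: "0 \<le> T" using T by simp
    have G: "?G \<subseteq> Pow ({0..T} \<times> space M)"
    proof
      fix B assume "B \<in> ?G"
      then consider A where "B = {0} \<times> A" "A \<in> sets (Fil 0)"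
        | s t A where "B = {s<..t} \<times> A" "0 \<le> s" "s < t" "t \<le> T" "A \<in> sets (Fil s)" by blast
      then show "B \<in> Pow ({0..T} \<times> space M)"
      proof cases
        case 1 then show ?thesis using sp[of 0 A] T by auto
      next
        case 2 then show ?thesis using sp[of s A] by auto
      qed
    qed
    show ?thesis
      unfolding predictable_sigma_def
    proof (rule measurable_measure_of[OF G h])
      fix B assume "B \<in> ?G"
      then show "h -` B \<inter> space N \<in> sets N" using zero step by blast
    qed
  qed
  from measurable_compose[OF this assms(1)[unfolded predictable_def]] show ?thesis
    by (simp add: split_beta')
qed

lemma predictable_imp_measurable:
  fixes Y :: "real \<Rightarrow> 'a \<Rightarrow> 'h::{real_normed_vector, second_countable_topology}"
  assumes Y: "predictable M Fil T Y"
  shows "(\<lambda>(\<omega>, u). indicator {0..T} u *\<^sub>R Y u \<omega>) \<in> borel_measurable (M \<Otimes>\<^sub>M lborel)"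
proof -
  let ?\<Omega> = "space M \<times> {0..T}"
  let ?N = "restrict_space (M \<Otimes>\<^sub>M lborel) ?\<Omega>"
  have \<Omega>: "?\<Omega> \<inter> space (M \<Otimes>\<^sub>M lborel) \<in> sets (M \<Otimes>\<^sub>M lborel)" by simp
  have N: "?\<Omega> \<in> sets (M \<Otimes>\<^sub>M lborel)" by simp
  have spN: "space ?N = ?\<Omega>" by (auto simp: space_restrict_space space_pair_measure)
  have sub: "B \<in> sets ?N" if "B \<in> sets (M \<Otimes>\<^sub>M lborel)" "B \<subseteq> ?\<Omega>" for B
    using that by (auto simp: sets_restrict_space_iff[OF \<Omega>])
  have "(\<lambda>x. Y (fst (case x of (\<omega>, u) \<Rightarrow> (u, \<omega>))) (snd (case x of (\<omega>, u) \<Rightarrow> (u, \<omega>)))) \<in> borel_measurable ?N"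
  proof (rule predictable_measurable_map[OF Y])
    show "(\<lambda>(\<omega>, u). (u, \<omega>)) \<in> space ?N \<rightarrow> {0..T} \<times> space M" unfolding spN by auto
  next
    fix A assume A: "A \<in> sets (Fil 0)"
    have AM: "A \<in> sets M" using A sets_Fil by blast
    have "(\<lambda>(\<omega>, u). (u, \<omega>)) -` ({0} \<times> A) \<inter> ?\<Omega> = (A \<times> {0}) \<inter> ?\<Omega>" by auto
    moreover have "(A \<times> {0}) \<inter> ?\<Omega> \<in> sets (M \<Otimes>\<^sub>M lborel)" using AM by (intro sets.Int pair_measureI) auto
    ultimately show "(\<lambda>(\<omega>, u). (u, \<omega>)) -` ({0} \<times> A) \<inter> space ?N \<in> sets ?N" unfolding spN by (intro sub) auto
  next
    fix s t A assume A: "0 \<le> s" "A \<in> sets (Fil s)"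
    have AM: "A \<in> sets M" using A sets_Fil by blast
    have "(\<lambda>(\<omega>, u). (u, \<omega>)) -` ({s<..t} \<times> A) \<inter> ?\<Omega> = (A \<times> {s<..t}) \<inter> ?\<Omega>" by auto
    moreover have "(A \<times> {s<..t}) \<inter> ?\<Omega> \<in> sets (M \<Otimes>\<^sub>M lborel)" using AM by (intro sets.Int pair_measureI) auto
    ultimately show "(\<lambda>(\<omega>, u). (u, \<omega>)) -` ({s<..t} \<times> A) \<inter> space ?N \<in> sets ?N" unfolding spN by (intro sub) auto
  qed
  then have "(\<lambda>(\<omega>, u). Y u \<omega>) \<in> borel_measurable ?N" by (simp add: split_beta')
  then have m: "(\<lambda>x. indicator ?\<Omega> x *\<^sub>R (case x of (\<omega>, u) \<Rightarrow> Y u \<omega>)) \<in> borel_measurable (M \<Otimes>\<^sub>M lborel)"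
    using borel_measurable_restrict_space_iff[OF \<Omega>] by blast
  have "indicator ?\<Omega> x *\<^sub>R (case x of (\<omega>, u) \<Rightarrow> Y u \<omega>) = (case x of (\<omega>, u) \<Rightarrow> indicator {0..T} u *\<^sub>R Y u \<omega>)"
    if "x \<in> space (M \<Otimes>\<^sub>M lborel)" for x using that by (auto simp: space_pair_measure indicator_def)
  from measurable_cong[THEN iffD1, OF this m] show ?thesis .
qed

lemma predictable_section:
  fixes Y :: "real \<Rightarrow> 'a \<Rightarrow> 'h::topological_space"
  assumes Y: "predictable M Fil T Y" and t: "0 \<le> t" "t \<le> T"
  shows "Y t \<in> borel_measurable (Fil t)"
proof -
  have "(\<lambda>\<omega>. Y (fst (t, \<omega>)) (snd (t, \<omega>))) \<in> borel_measurable (Fil t)"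
  proof (rule predictable_measurable_map[OF Y])
    show "(\<lambda>\<omega>. (t, \<omega>)) \<in> space (Fil t) \<rightarrow> {0..T} \<times> space M" using t space_Fil[OF t(1)] by auto
  next
    fix A assume "A \<in> sets (Fil 0)"
    then have "A \<in> sets (Fil t)" using sets_Fil_mono[of 0 t A] t by simp
    moreover have "(\<lambda>\<omega>. (t, \<omega>)) -` ({0} \<times> A) \<inter> space (Fil t) = (if t = 0 then A \<inter> space (Fil t) else {})" by auto
    moreover have "A \<inter> space (Fil t) \<in> sets (Fil t)" using calculation(1) by (intro sets.Int) auto
    ultimately show "(\<lambda>\<omega>. (t, \<omega>)) -` ({0} \<times> A) \<inter> space (Fil t) \<in> sets (Fil t)"
      by (simp only: split: if_split) blast
  next
    fix s s' A assume A: "0 \<le> s" "A \<in> sets (Fil s)"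
    have "(\<lambda>\<omega>. (t, \<omega>)) -` ({s<..s'} \<times> A) \<inter> space (Fil t) = (if s < t \<and> t \<le> s' then A \<inter> space (Fil t) else {})" by auto
    then show "(\<lambda>\<omega>. (t, \<omega>)) -` ({s<..s'} \<times> A) \<inter> space (Fil t) \<in> sets (Fil t)"
      using sets_Fil_mono[of s t A] A by (cases "s < t \<and> t \<le> s'") (simp_all only: if_True if_False sets.empty_sets, simp add: sets.Int)
  qed
  then show ?thesis by simp
qed

text \<open>In coordinates the Hilbert--Schmidt distance to an elementary process becomes
  \<open>energy\<close>, pointwise in time. Outside \<open>[0, T]\<close> both integrands vanish, so
  the same approximations serve for the horizon 1.\<close>

lemma has_ito_integral_imp_ito:
  fixes g :: "nat \<Rightarrow> 'u::real_inner" and \<Phi> :: "real \<Rightarrow> 'a \<Rightarrow> 'u \<Rightarrow>\<^sub>L 'h::{real_inner, second_countable_topology}"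
  assumes basis: "orthonormal_basis J g" and T: "0 \<le> T" "T \<le> 1"
    and I: "has_ito_integral M Fil J g \<beta> T \<Phi> Z"
  shows "ito (\<lambda>\<omega> u k. indicator {0..T} u *\<^sub>R \<Phi> u \<omega> (g k)) Z"
proof -
  let ?f = "\<lambda>\<omega> u k. indicator {0..T} u *\<^sub>R \<Phi> u \<omega> (g k)"
  have jm: "jointly_measurable M J ?f"
    unfolding jointly_measurable_def using I by (intro ballI predictable_imp_measurable) (auto simp: has_ito_integral_def)
  have hs: "hilbert_schmidt J g (\<Phi> s \<omega>)" if "s \<in> {0..T}" "\<omega> \<in> space M" for s \<omega>
    using I that by (auto simp: has_ito_integral_def)
  obtain es where es: "\<And>n. is_elementary Fil J T (es n)"
    and e1: "\<And>\<eta>. \<eta> > 0 \<Longrightarrow> (\<lambda>n. measure M {\<omega>\<in>space M.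
            (\<integral>\<^sup>+s\<in>{0..T}. ennreal ((hs_norm J g (\<Phi> s \<omega> - elementary_process g (es n) s \<omega>))\<^sup>2) \<partial>lborel) > ennreal \<eta>}) \<longlonglongrightarrow> 0"
    and e2: "\<And>\<eta>. \<eta> > 0 \<Longrightarrow> (\<lambda>n. measure M {\<omega>\<in>space M. norm (Z \<omega> - elementary_integral \<beta> (es n) \<omega>) > \<eta>}) \<longlonglongrightarrow> 0"
    using I unfolding has_ito_integral_def by blast
  have J: "indices (es n) \<subseteq> J" for n by (rule is_elementary_indices[OF es])
  have en: "energy J (\<lambda>\<omega> u k. ?f \<omega> u k - coord (es n) \<omega> u k) \<omega>
      = (\<integral>\<^sup>+s\<in>{0..T}. ennreal ((hs_norm J g (\<Phi> s \<omega> - elementary_process g (es n) s \<omega>))\<^sup>2) \<partial>lborel)" if \<omega>: "\<omega> \<in> space M" for n \<omega>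
    unfolding energy_def
  proof (rule nn_integral_cong)
    fix u
    show "hs_sq J (\<lambda>k. ?f \<omega> u k - coord (es n) \<omega> u k)
      = ennreal ((hs_norm J g (\<Phi> u \<omega> - elementary_process g (es n) u \<omega>))\<^sup>2) * indicator {0..T} u"
    proof (cases "u \<in> {0..T}")
      case True
      have "hs_sq J (\<lambda>k. ?f \<omega> u k - coord (es n) \<omega> u k) = hs_sq J (\<lambda>k. (\<Phi> u \<omega> - elementary_process g (es n) u \<omega>) (g k))"
        using True elementary_process_coord[OF basis _ J] by (intro hs_sq_cong) (simp add: blinfun.diff_left)
      also have "\<dots> = ennreal ((hs_norm J g (\<Phi> u \<omega> - elementary_process g (es n) u \<omega>))\<^sup>2)"
        by (intro hs_sq_eq_hs_norm hilbert_schmidt_diff hs True \<omega> elementary_process_hilbert_schmidt basis J)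
      finally show ?thesis using True by simp
    next
      case False
      obtain B where "\<And>u k. norm (coord (es n) \<omega> u k) \<le> B * indicator {0<..T} u" using coord_bound[OF es] by metis
      then have "coord (es n) \<omega> u k = 0" for k using False by (metis (no_types, lifting) atLeastAtMost_iff greaterThanAtMost_iff indicator_simps(2) less_imp_le mult_zero_right norm_le_zero_iff)
      then show ?thesis using False by simp
    qed
  qed
  show ?thesis
    unfolding ito_def tends_prob_def
  proof (intro conjI exI[of _ es] allI impI)
    show "jointly_measurable M J ?f" by fact
    show "Z \<in> borel_measurable M" using I by (simp add: has_ito_integral_def)
    show "is_elementary Fil J 1 (es n)" for n by (rule is_elementary_mono[OF es T(2)])
    fix \<eta> :: real assume \<eta>: "0 < \<eta>"
    have "{\<omega>\<in>space M. ennreal \<eta> < energy J (\<lambda>\<omega> u k. ?f \<omega> u k - coord (es n) \<omega> u k) \<omega>}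
      = {\<omega>\<in>space M. (\<integral>\<^sup>+s\<in>{0..T}. ennreal ((hs_norm J g (\<Phi> s \<omega> - elementary_process g (es n) s \<omega>))\<^sup>2) \<partial>lborel) > ennreal \<eta>}" for n
      using en by auto
    then show "(\<lambda>n. prob {\<omega>\<in>space M. ennreal \<eta> < energy J (\<lambda>\<omega> u k. ?f \<omega> u k - coord (es n) \<omega> u k) \<omega>}) \<longlonglongrightarrow> 0"
      using e1[OF \<eta>] by simp
    show "(\<lambda>n. prob {\<omega>\<in>space M. ennreal \<eta> < ennreal (norm (Z \<omega> - elementary_integral \<beta> (es n) \<omega>))}) \<longlonglongrightarrow> 0"
      using e2[OF \<eta>] \<eta> by (simp add: ennreal_less_iff)
  qed
qed

text \<open>Simple \<open>Fil a\<close>-measurable functions converge to \<open>\<xi>\<close>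
  pointwise, and each of them is a finite list with one entry per value. In this way coefficients
  frozen at a grid point become Ito integrands.\<close>

lemma ito_rectangle:
  fixes \<xi> :: "'a \<Rightarrow> 'h::{real_inner, second_countable_topology}"
  assumes ab: "0 \<le> a" "a \<le> b" "b \<le> 1" and k0: "k0 \<in> J" and \<xi>: "\<xi> \<in> borel_measurable (Fil a)"
  shows "ito (\<lambda>\<omega> u k. (if k = k0 then indicator {a<..b} u else 0) *\<^sub>R \<xi> \<omega>) (\<lambda>\<omega>. (\<beta> k0 b \<omega> - \<beta> k0 a \<omega>) *\<^sub>R \<xi> \<omega>)"
proof -
  have \<xi>M[measurable]: "\<xi> \<in> borel_measurable M" using \<xi> ab measurable_Fil_M by blast
  have [measurable]: "\<beta> k0 b \<in> borel_measurable M" "\<beta> k0 a \<in> borel_measurable M" using ab k0 by (auto intro: beta_measurable)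
  obtain s where s: "\<And>i. simple_function (Fil a) (s i)" "\<And>\<omega>. \<omega> \<in> space (Fil a) \<Longrightarrow> (\<lambda>i. s i \<omega>) \<longlonglongrightarrow> \<xi> \<omega>"
    using borel_measurable_implies_sequence_metric[OF \<xi>, of 0] by blast
  have sp: "space (Fil a) = space M" using space_Fil ab by simp
  have sm[measurable]: "s i \<in> borel_measurable M" for i
    using borel_measurable_simple_function[OF s(1)] measurable_Fil_M[OF ab(1)] by blast
  \<comment> \<open>Enumerates the finite range of \<open>s i\<close> without repetition, because
    elementary integrands are lists.\<close>
  define xs where "xs i = (SOME l. distinct l \<and> set l = s i ` space M)" for i
  have xs: "distinct (xs i)" "set (xs i) = s i ` space M" for i
  proof -
    have "finite (s i ` space M)" using s(1)[of i] sp by (simp add: simple_function_def)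
    then have "\<exists>l. distinct l \<and> set l = s i ` space M" using finite_distinct_list by metis
    from someI_ex[OF this] show "distinct (xs i)" "set (xs i) = s i ` space M" unfolding xs_def by auto
  qed
  define es where "es i = map (\<lambda>h. (a, b, s i -` {h} \<inter> space M, k0, h)) (xs i)" for i
  have el: "is_elementary Fil J 1 (es i)" for i
    unfolding is_elementary_def es_def using ab k0 s(1)[of i] sp
    by (auto simp: xs simple_function_def)
  have list_sum: "(\<Sum>h\<leftarrow>xs i. (c * indicator (s i -` {h} \<inter> space M) \<omega>) *\<^sub>R h) = c *\<^sub>R s i \<omega>" if "\<omega> \<in> space M" for i \<omega> c
  proof -
    have "(\<Sum>h\<leftarrow>xs i. (c * indicator (s i -` {h} \<inter> space M) \<omega>) *\<^sub>R h) = (\<Sum>h\<in>s i ` space M. (c * indicator (s i -` {h} \<inter> space M) \<omega>) *\<^sub>R h)"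
      using sum_list_distinct_conv_sum_set[OF xs(1)] by (simp add: xs(2))
    also have "\<dots> = (\<Sum>h\<in>s i ` space M. if h = s i \<omega> then c *\<^sub>R h else 0)"
      using that by (intro sum.cong refl) auto
    also have "\<dots> = c *\<^sub>R s i \<omega>" using that xs(2)[of i] by (simp flip: xs(2)) (simp add: xs(2))
    finally show ?thesis .
  qed
  have coord_es: "coord (es i) \<omega> u k = (if k = k0 then indicator {a<..b} u else 0) *\<^sub>R s i \<omega>" if "\<omega> \<in> space M" for i \<omega> u k
    using list_sum[OF that, of "if k = k0 then indicator {a<..b} u else 0" i]
    by (simp add: coord_def es_def comp_def eq_commute[of k0 k] cong: map_cong) (auto simp: comp_def)
  have int_es: "elementary_integral \<beta> (es i) \<omega> = (\<beta> k0 b \<omega> - \<beta> k0 a \<omega>) *\<^sub>R s i \<omega>" if "\<omega> \<in> space M" for i \<omega>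
    using list_sum[OF that, of "\<beta> k0 b \<omega> - \<beta> k0 a \<omega>" i]
    by (simp add: elementary_integral_def es_def comp_def mult.commute)
  let ?f = "\<lambda>\<omega> u k. (if k = k0 then indicator {a<..b} u else 0) *\<^sub>R \<xi> \<omega>"
  have jm: "jointly_measurable M J ?f"
    unfolding jointly_measurable_def by (intro ballI) (simp add: split_beta')
  have e: "energy J (\<lambda>\<omega> u k. ?f \<omega> u k - coord (es i) \<omega> u k) \<omega> = ennreal ((b - a) * (norm (\<xi> \<omega> - s i \<omega>))\<^sup>2)" if "\<omega> \<in> space M" for i \<omega>
  proof -
    have "hs_sq J (\<lambda>k. ?f \<omega> u k - coord (es i) \<omega> u k) = ennreal ((norm (\<xi> \<omega> - s i \<omega>))\<^sup>2) * indicator {a<..b} u" for u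
    proof -
      have "hs_sq J (\<lambda>k. ?f \<omega> u k - coord (es i) \<omega> u k) = (\<Sum>k\<in>{k0}. indicator J k * ennreal ((norm (?f \<omega> u k - coord (es i) \<omega> u k))\<^sup>2))"
        unfolding hs_sq_def using coord_es[OF that] by (intro suminf_finite) auto
      also have "\<dots> = ennreal ((norm (\<xi> \<omega> - s i \<omega>))\<^sup>2) * indicator {a<..b} u"
        using k0 coord_es[OF that] by (simp add: scaleR_diff_right[symmetric] indicator_def)
      finally show ?thesis .
    qed
    then have "energy J (\<lambda>\<omega> u k. ?f \<omega> u k - coord (es i) \<omega> u k) \<omega>
        = (\<integral>\<^sup>+u. ennreal ((norm (\<xi> \<omega> - s i \<omega>))\<^sup>2) * indicator {a<..b} u \<partial>lborel)"
      by (simp only: energy_def)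
    also have "\<dots> = ennreal ((norm (\<xi> \<omega> - s i \<omega>))\<^sup>2) * ennreal (b - a)"
      using ab by (subst nn_integral_cmult_indicator) auto
    also have "\<dots> = ennreal ((b - a) * (norm (\<xi> \<omega> - s i \<omega>))\<^sup>2)"
      using ab by (simp add: ennreal_mult[symmetric] mult.commute)
    finally show ?thesis .
  qed
  show ?thesis
    unfolding ito_def
  proof (intro conjI exI[of _ es] allI jm el)
    show "(\<lambda>\<omega>. (\<beta> k0 b \<omega> - \<beta> k0 a \<omega>) *\<^sub>R \<xi> \<omega>) \<in> borel_measurable M" by measurable
    show "tends_prob (\<lambda>n. energy J (\<lambda>\<omega> u k. ?f \<omega> u k - coord (es n) \<omega> u k))"
    proof (rule tends_prob_pointwise)
      show "energy J (\<lambda>\<omega> u k. ?f \<omega> u k - coord (es n) \<omega> u k) \<in> borel_measurable M" for n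
        by (rule energy_measurable[OF jointly_measurable_diff_coord[OF jm el]])
      fix \<omega> assume \<omega>: "\<omega> \<in> space M"
      have "(\<lambda>n. ennreal ((b - a) * (norm (\<xi> \<omega> - s n \<omega>))\<^sup>2)) \<longlonglongrightarrow> ennreal ((b - a) * (norm (\<xi> \<omega> - \<xi> \<omega>))\<^sup>2)"
        using s(2)[of \<omega>] \<omega> sp by (intro tendsto_intros) auto
      then show "(\<lambda>n. energy J (\<lambda>\<omega> u k. ?f \<omega> u k - coord (es n) \<omega> u k) \<omega>) \<longlonglongrightarrow> 0" using e[OF \<omega>] by simp
    qed
    show "tends_prob (\<lambda>n \<omega>. ennreal (norm ((\<beta> k0 b \<omega> - \<beta> k0 a \<omega>) *\<^sub>R \<xi> \<omega> - elementary_integral \<beta> (es n) \<omega>)))"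
    proof (rule tends_prob_pointwise)
      have [measurable]: "elementary_integral \<beta> (es n) \<in> borel_measurable M" for n
        using elementary_integral_measurable[OF el] by simp
      show "(\<lambda>\<omega>. ennreal (norm ((\<beta> k0 b \<omega> - \<beta> k0 a \<omega>) *\<^sub>R \<xi> \<omega> - elementary_integral \<beta> (es n) \<omega>))) \<in> borel_measurable M" for n by measurable
      fix \<omega> assume \<omega>: "\<omega> \<in> space M"
      have "(\<lambda>n. ennreal (norm ((\<beta> k0 b \<omega> - \<beta> k0 a \<omega>) *\<^sub>R \<xi> \<omega> - (\<beta> k0 b \<omega> - \<beta> k0 a \<omega>) *\<^sub>R s n \<omega>)))
         \<longlonglongrightarrow> ennreal (norm ((\<beta> k0 b \<omega> - \<beta> k0 a \<omega>) *\<^sub>R \<xi> \<omega> - (\<beta> k0 b \<omega> - \<beta> k0 a \<omega>) *\<^sub>R \<xi> \<omega>))"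
        using s(2)[of \<omega>] \<omega> sp by (intro tendsto_intros) auto
      then show "(\<lambda>n. ennreal (norm ((\<beta> k0 b \<omega> - \<beta> k0 a \<omega>) *\<^sub>R \<xi> \<omega> - elementary_integral \<beta> (es n) \<omega>))) \<longlonglongrightarrow> 0"
        using int_es[OF \<omega>] by simp
    qed
  qed
qed

end

section \<open>Operator bounds and controlled paths\<close>

lemma norm_sum_orthonormal_sq:
  fixes g :: "nat \<Rightarrow> 'u::real_inner"
  assumes g: "orthonormal_basis J g" and F: "finite F" "F \<subseteq> J"
  shows "(norm (\<Sum>k\<in>F. a k *\<^sub>R g k))\<^sup>2 = (\<Sum>k\<in>F. (a k)\<^sup>2)"
proof -
  have "(norm (\<Sum>k\<in>F. a k *\<^sub>R g k))\<^sup>2 = (\<Sum>j\<in>F. \<Sum>k\<in>F. a j * (a k * (g j \<bullet> g k)))"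
    unfolding power2_norm_eq_inner inner_sum_left inner_sum_right by (subst sum.swap) (simp add: mult_ac)
  also have "\<dots> = (\<Sum>j\<in>F. \<Sum>k\<in>F. if j = k then (a j)\<^sup>2 else 0)"
  proof (intro sum.cong refl)
    fix j k assume "j \<in> F" "k \<in> F"
    then have "g j \<bullet> g k = (if j = k then 1 else 0)" using g F(2) unfolding orthonormal_basis_def by blast
    then show "a j * (a k * (g j \<bullet> g k)) = (if j = k then (a j)\<^sup>2 else 0)" by (simp add: power2_eq_square)
  qed
  also have "\<dots> = (\<Sum>k\<in>F. (a k)\<^sup>2)" using F(1) by simp
  finally show ?thesis .
qed

text \<open>Cauchy--Schwarz for vectors in the span of the basis; both sides are continuous and the
  span is dense.\<close>

lemma norm_le_hs_norm:
  fixes g :: "nat \<Rightarrow> 'u::real_inner" and T :: "'u \<Rightarrow>\<^sub>L 'h::real_inner"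
  assumes g: "orthonormal_basis J g" and T: "hilbert_schmidt J g T"
  shows "norm (T u) \<le> hs_norm J g T * norm u"
proof -
  have hs0: "0 \<le> hs_norm J g T" unfolding hs_norm_def by (intro real_sqrt_ge_zero infsum_nonneg) auto
  have span: "norm (T v) \<le> hs_norm J g T * norm v" if "v \<in> span (g ` J)" for v
  proof -
    \<comment> \<open>A vector of the span involves finitely many basis vectors, so some
      \<open>basis_projection\<close> fixes it.\<close>
    have "\<exists>n. v \<in> span (g ` (J \<inter> {..<n}))" using that
    proof (induction rule: span_induct_alt)
      case base
      show ?case by (simp add: span_zero)
    next
      case (step c x y)
      then obtain i n where i: "i \<in> J" "x = g i" and n: "y \<in> span (g ` (J \<inter> {..<n}))" by auto
      let ?n = "max n (Suc i)"
      have "y \<in> span (g ` (J \<inter> {..<?n}))" using n by (rule subsetD[OF span_mono, rotated]) auto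
      moreover have "x \<in> span (g ` (J \<inter> {..<?n}))" using i by (intro span_base) auto
      ultimately show ?case by (blast intro: span_add span_mul)
    qed
    then obtain n where n: "v \<in> span (g ` (J \<inter> {..<n}))" by blast
    let ?F = "J \<inter> {..<n}" and ?P = "basis_projection J g n v"
    have "v - ?P \<in> span (g ` ?F)" by (intro span_diff n basis_projection_in_span)
    from basis_projection_orthogonal[OF g this, of v] have P: "?P = v" by simp
    have v: "v = (\<Sum>k\<in>?F. (g k \<bullet> v) *\<^sub>R g k)" using P by (simp add: basis_projection_apply)
    have nv: "(norm v)\<^sup>2 = (\<Sum>k\<in>?F. (g k \<bullet> v)\<^sup>2)" by (subst v, rule norm_sum_orthonormal_sq[OF g]) auto
    have "norm (T v) = norm (\<Sum>k\<in>?F. (g k \<bullet> v) *\<^sub>R T (g k))"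
      by (subst v) (simp add: blinfun.sum_right blinfun.scaleR_right)
    also have "\<dots> \<le> (\<Sum>k\<in>?F. \<bar>g k \<bullet> v\<bar> * \<bar>norm (T (g k))\<bar>)" by (rule order_trans[OF norm_sum]) simp
    also have "\<dots> \<le> L2_set (\<lambda>k. g k \<bullet> v) ?F * L2_set (\<lambda>k. norm (T (g k))) ?F" by (rule L2_set_mult_ineq)
    also have "L2_set (\<lambda>k. g k \<bullet> v) ?F = norm v" unfolding L2_set_def nv[symmetric] by simp
    also have "L2_set (\<lambda>k. norm (T (g k))) ?F \<le> hs_norm J g T"
      unfolding L2_set_def hs_norm_def
      using T by (intro real_sqrt_le_mono finite_sum_le_infsum) (auto simp: hilbert_schmidt_def)
    finally show ?thesis by (simp add: mult.commute mult_right_mono)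
  qed
  have "closed {u. norm (T u) \<le> hs_norm J g T * norm u}" by (intro closed_Collect_le continuous_intros)
  then have "closure (span (g ` J)) \<subseteq> {u. norm (T u) \<le> hs_norm J g T * norm u}"
    using span by (intro closure_minimal) auto
  then show ?thesis using g by (auto simp: orthonormal_basis_def)
qed

lemma continuous_on_interval_bounded:
  fixes z :: "real \<Rightarrow> 'b::real_normed_vector"
  assumes "continuous_on {a..b} z"
  obtains D where "0 \<le> D" "\<And>s. s \<in> {a..b} \<Longrightarrow> norm (z s) \<le> D"
proof -
  have "bounded (z ` {a..b})" by (intro compact_imp_bounded compact_continuous_image assms compact_Icc)
  then obtain D where "\<forall>x\<in>z ` {a..b}. norm x \<le> D" unfolding bounded_iff by blast
  then show ?thesis by (intro that[of "max 0 D"]) (auto simp: le_max_iff_disj)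
qed

text \<open>The induction bounds the whole right-hand side of the hypothesis and not
  \<open>d\<close> itself; each step multiplies it by at most
  \<open>1 + a i \<le> exp (a i)\<close>.\<close>

lemma discrete_gronwall:
  fixes d a :: "nat \<Rightarrow> real"
  assumes "\<And>i. i \<le> n \<Longrightarrow> d i \<le> e + (\<Sum>j<i. a j * d j)" and a: "\<And>j. 0 \<le> a j" and e: "0 \<le> e"
  shows "i \<le> n \<Longrightarrow> d i \<le> e * exp (\<Sum>j<i. a j)"
proof -
  have key: "e + (\<Sum>j<i. a j * d j) \<le> e * exp (\<Sum>j<i. a j)" if "i \<le> n" for i
    using that
  proof (induction i)
    case (Suc i)
    define S where "S = e + (\<Sum>j<i. a j * d j)"
    have IH: "S \<le> e * exp (\<Sum>j<i. a j)" using Suc by (simp add: S_def)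
    have "a i * d i \<le> a i * (e * exp (\<Sum>j<i. a j))"
      using assms(1)[of i] Suc.prems IH a[of i] by (intro mult_left_mono) (auto simp: S_def)
    then have "e + (\<Sum>j<Suc i. a j * d j) \<le> (1 + a i) * (e * exp (\<Sum>j<i. a j))"
      using IH by (simp add: S_def algebra_simps)
    also have "\<dots> \<le> exp (a i) * (e * exp (\<Sum>j<i. a j))"
      using e by (intro mult_right_mono exp_ge_add_one_self) auto
    finally show ?case by (simp add: exp_add mult_ac)
  qed simp
  show "i \<le> n \<Longrightarrow> d i \<le> e * exp (\<Sum>j<i. a j)" using key assms(1) order_trans by blast
qed

text \<open>\<open>cfunspace\<close> consists of bounded continuous functions; on a compact interval
  boundedness is automatic.\<close>

lemma path_space_iff:
  fixes z :: "real \<Rightarrow> 'h::metric_space"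
  shows "z \<in> mspace path_space \<longleftrightarrow> z \<in> extensional {0..1} \<and> continuous_on {0..1} z"
proof -
  have "compactin (top_of_set {0..1::real}) (topspace (top_of_set {0..1::real}))" by simp
  from compactin_mspace_cfunspace[OF this, where m = "euclidean_metric :: 'h metric"]
  show ?thesis by (simp add: mtopology_of_def)
qed

text \<open>For deterministic controls the operator norm of \<open>G\<close> is enough; it is
  dominated by the Hilbert--Schmidt norm, see \<open>norm_le_hs_norm\<close>.\<close>

locale lipschitz_field =
  fixes G :: "'h::{real_inner, banach, second_countable_topology} \<Rightarrow> 'u::{real_inner, banach, second_countable_topology} \<Rightarrow>\<^sub>L 'h"
    and \<Lambda> :: real
  assumes \<Lambda>: "0 < \<Lambda>" and G_lip: "norm (G x - G y) \<le> \<Lambda> * norm (x - y)" and G_lin: "norm (G x) \<le> \<Lambda> * (1 + norm x)"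
begin

lemma G_lip_apply: "norm (G x u - G y u) \<le> \<Lambda> * norm (x - y) * norm u"
  using norm_blinfun[of "G x - G y" u] G_lip[of x y]
  by (simp add: blinfun.diff_left) (meson mult_right_mono norm_ge_zero order_trans)

lemma G_lin_apply: "norm (G x u) \<le> \<Lambda> * (1 + norm x) * norm u"
  using norm_blinfun[of "G x" u] G_lin[of x] by (meson mult_right_mono norm_ge_zero order_trans)

lemma G_continuous: "continuous_on UNIV G"
  by (rule continuous_on_subset[OF lipschitz_on_continuous_on[of \<Lambda> UNIV G]])
    (use G_lip \<Lambda> in \<open>auto simp: lipschitz_on_def dist_norm\<close>)

lemma G_apply_continuous: "continuous_on UNIV (\<lambda>p. G (fst p) (snd p))"
  by (intro continuous_intros continuous_on_compose2[OF G_continuous]) auto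

lemma G_apply_measurable:
  assumes "z \<in> borel_measurable M" "\<phi> \<in> borel_measurable M"
  shows "(\<lambda>s. G (z s) (\<phi> s)) \<in> borel_measurable M"
proof -
  have "(\<lambda>s. (z s, \<phi> s)) \<in> borel_measurable M" using assms by (rule borel_measurable_Pair)
  from borel_measurable_continuous_on[OF G_apply_continuous this] show ?thesis by simp
qed

lemma field_integrable:
  fixes a b :: real
  assumes z: "continuous_on {a..b} z" and \<phi>: "\<phi> \<in> borel_measurable borel" "\<And>s. norm (\<phi> s) \<le> B"
  shows "set_integrable lborel {a..b} (\<lambda>s. G (z s) (\<phi> s))"
proof -
  obtain D where D: "0 \<le> D" "\<And>s. s \<in> {a..b} \<Longrightarrow> norm (z s) \<le> D"
    using continuous_on_interval_bounded[OF z] by blast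
  define z' where "z' s = indicator {a..b} s *\<^sub>R z s" for s
  have z'm: "z' \<in> borel_measurable borel"
    unfolding z'_def using borel_measurable_continuous_on_indicator[OF _ z] by simp
  have eq: "indicator {a..b} s *\<^sub>R G (z s) (\<phi> s) = indicator {a..b} s *\<^sub>R G (z' s) (\<phi> s)" for s
    by (simp add: z'_def indicator_def)
  have B0: "0 \<le> B" using \<phi>(2)[of 0] norm_ge_zero order_trans by blast
  have "set_integrable lborel {a..b} (\<lambda>s. \<Lambda> * (1 + D) * B)" by (rule borel_integrable_atLeastAtMost') (rule continuous_on_const)
  then show ?thesis
    unfolding set_integrable_def
  proof (rule Bochner_Integration.integrable_bound)
    show "(\<lambda>s. indicator {a..b} s *\<^sub>R G (z s) (\<phi> s)) \<in> borel_measurable lborel"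
      unfolding eq using G_apply_measurable[OF z'm \<phi>(1)] by simp
    have "norm (G (z s) (\<phi> s)) \<le> \<Lambda> * (1 + D) * B" if "s \<in> {a..b}" for s
      using D(2)[OF that] D(1) \<phi>(2)[of s] \<Lambda> B0 by (intro order_trans[OF G_lin_apply] mult_mono mult_left_mono) auto
    then show "AE s in lborel. norm (indicator {a..b} s *\<^sub>R G (z s) (\<phi> s)) \<le> norm (indicator {a..b} s *\<^sub>R (\<Lambda> * (1 + D) * B))"
      by (intro AE_I2) (auto split: split_indicator intro: order_trans[OF _ abs_ge_self])
  qed
qed

lemma norm_field_integral_le:
  fixes a b :: real
  assumes z: "continuous_on {a..b} z" and \<phi>: "\<phi> \<in> borel_measurable borel" "\<And>s. norm (\<phi> s) \<le> B"
    and f: "set_integrable lborel {a..b} f" and le: "\<And>s. s \<in> {a..b} \<Longrightarrow> norm (G (z s) (\<phi> s) - c) \<le> f s"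
  shows "norm (LINT s:{a..b}|lborel. (G (z s) (\<phi> s) - c)) \<le> (LINT s:{a..b}|lborel. f s)"
proof -
  have c: "set_integrable lborel {a..b} (\<lambda>s. c)" by (rule borel_integrable_atLeastAtMost') (rule continuous_on_const)
  have "set_integrable lborel {a..b} (\<lambda>s. G (z s) (\<phi> s) - c)"
    by (intro set_integral_diff(1) field_integrable[OF z \<phi>] c)
  then show ?thesis
    unfolding set_lebesgue_integral_def set_integrable_def
    by (rule Bochner_Integration.integral_norm_bound_integral) (use f le in \<open>auto simp: set_integrable_def split: split_indicator\<close>)
qed

lemma set_integral_split:
  fixes f :: "real \<Rightarrow> 'b::{banach, second_countable_topology}"
  assumes "set_integrable lborel {a..c} f" "a \<le> b" "b \<le> c"
  shows "(LINT s:{a..c}|lborel. f s) = (LINT s:{a..b}|lborel. f s) + (LINT s:{b..c}|lborel. f s)"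
proof -
  have i: "set_integrable lborel {a..b} f" "set_integrable lborel {b..c} f"
    using assms by (auto intro: set_integrable_subset)
  have "(LINT s:{a..c}|lborel. f s) = (LINT s:{a..b} \<union> {b..c}|lborel. f s)"
    using assms by (simp add: ivl_disj_un)
  also have "\<dots> = (LINT s:{a..b}|lborel. f s) + (LINT s:{b..c}|lborel. f s)"
    using i AE_lborel_singleton[of b] by (intro set_integral_Un_AE) auto
  finally show ?thesis .
qed

text \<open>Picard iteration as a contraction for the weight \<open>exp (- 2 \<Lambda> B t)\<close>.\<close>
lemma skeleton_exists:
  fixes \<phi> :: "real \<Rightarrow> 'u"
  assumes \<phi>: "\<phi> \<in> borel_measurable borel" "\<And>s. norm (\<phi> s) \<le> B"
  obtains z where "continuous_on {0..1} z" "\<And>t. t \<in> {0..1} \<Longrightarrow> z t = x + (LINT s:{0..t}|lborel. G (z s) (\<phi> s))"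
proof -
  have B0: "0 \<le> B" using \<phi>(2)[of 0] norm_ge_zero order_trans by blast
  define L where "L = \<Lambda> * B + 1"
  have L: "L > 0" using \<Lambda> B0 by (simp add: L_def add_nonneg_pos)
  \<comment> \<open>Clamping time to [0, 1] makes paths bounded continuous functions on the whole
    line, a complete space in which the contraction principle is available. Fixed points carry the
    weight, and \<open>w\<close> removes it.\<close>
  define cl where "cl t = max 0 (min 1 t)" for t :: real
  have cl: "cl t \<in> {0..1}" "t \<in> {0..1} \<Longrightarrow> cl t = t" for t by (auto simp: cl_def)
  have clc: "continuous_on UNIV cl" unfolding cl_def by (intro continuous_intros)
  define w where "w v s = exp (2 * L * s) *\<^sub>R apply_bcontfun v s" for v :: "real \<Rightarrow>\<^sub>C 'h" and s
  have wc: "continuous_on S (w v)" for S v unfolding w_def by (intro continuous_intros continuous_on_apply_bcontfun)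
  define P where "P v t = exp (- 2 * L * cl t) *\<^sub>R (x + (LINT s:{0..cl t}|lborel. G (w v s) (\<phi> s)))" for v t
  have int: "set_integrable lborel {a..b} (\<lambda>s. G (w v s) (\<phi> s))" for a b v by (rule field_integrable[OF wc \<phi>])
  have Pc: "P v \<in> bcontfun" for v
  proof -
    let ?f = "\<lambda>s. G (w v s) (\<phi> s)"
    obtain D where D0: "0 \<le> D" and D: "\<And>s. s \<in> {0..1} \<Longrightarrow> norm (w v s) \<le> D"
      using continuous_on_interval_bounded[OF wc[of "{0..1}" v]] by blast
    define Q where "Q = \<Lambda> * (1 + D) * B"
    have Q: "norm (?f s) \<le> Q" if "s \<in> {0..1}" for s
      unfolding Q_def using D[OF that] \<phi>(2)[of s] \<Lambda> B0 D0 by (intro order_trans[OF G_lin_apply] mult_mono mult_left_mono) auto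
    have Q0: "0 \<le> Q" using \<Lambda> D0 B0 by (simp add: Q_def)
    have lip: "norm ((LINT s:{0..t}|lborel. ?f s) - (LINT s:{0..t'}|lborel. ?f s)) \<le> Q * (t - t')" if "0 \<le> t'" "t' \<le> t" "t \<le> 1" for t t'
    proof -
      have "(LINT s:{0..t}|lborel. ?f s) - (LINT s:{0..t'}|lborel. ?f s) = (LINT s:{t'..t}|lborel. ?f s)"
        using set_integral_split[OF int[of 0 t v] that(1,2)] by simp
      also have "norm \<dots> \<le> (LINT s:{t'..t}|lborel. Q)"
        using norm_field_integral_le[OF wc \<phi>, of t' t "\<lambda>_. Q" v 0] Q that by (simp add: set_integrable_def)
      also have "\<dots> = Q * (t - t')" using that by (simp add: set_lebesgue_integral_def)
      finally show ?thesis .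
    qed
    have "continuous_on {0..1} (\<lambda>t. LINT s:{0..t}|lborel. ?f s)"
    proof (rule lipschitz_on_continuous_on[of Q], rule lipschitz_onI)
      fix t t' :: real assume t: "t \<in> {0..1}" "t' \<in> {0..1}"
      show "dist (LINT s:{0..t}|lborel. ?f s) (LINT s:{0..t'}|lborel. ?f s) \<le> Q * dist t t'"
      proof (cases "t' \<le> t")
        case True
        then show ?thesis using lip[of t' t] t by (simp add: dist_norm dist_real_def)
      next
        case False
        then show ?thesis using lip[of t t'] t by (simp add: dist_norm norm_minus_commute)
      qed
    qed (rule Q0)
    then have "continuous_on UNIV (\<lambda>t. LINT s:{0..cl t}|lborel. ?f s)"
      by (rule continuous_on_compose2[OF _ clc]) (use cl in auto)
    then have c: "continuous_on UNIV (P v)" unfolding P_def by (intro continuous_intros clc)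
    have "bounded (range (P v))"
    proof -
      have "P v t = P v (cl t)" for t using cl by (simp add: P_def)
      then have "range (P v) \<subseteq> P v ` {0..1}" using cl(1) by (metis image_eqI image_subsetI)
      moreover have "compact (P v ` {0..1})" by (intro compact_continuous_image continuous_on_subset[OF c]) auto
      ultimately show ?thesis using compact_imp_bounded bounded_subset by blast
    qed
    with c show ?thesis by (simp add: bcontfun_def)
  qed
  define PP where "PP v = Bcontfun (P v)" for v
  have PP: "apply_bcontfun (PP v) = P v" for v unfolding PP_def by (rule Bcontfun_inverse[OF Pc])
  have contr: "dist (PP v) (PP v') \<le> 1/2 * dist v v'" for v v'
  proof (rule dist_bound)
    fix t
    let ?c = "cl t" and ?d = "dist v v'"
    have c: "0 \<le> ?c" using cl by auto
    have "dist (apply_bcontfun (PP v) t) (apply_bcontfun (PP v') t)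
        = exp (- 2 * L * ?c) * norm ((LINT s:{0..?c}|lborel. G (w v s) (\<phi> s)) - (LINT s:{0..?c}|lborel. G (w v' s) (\<phi> s)))"
      by (simp add: PP P_def dist_norm flip: scaleR_diff_right)
    also have "(LINT s:{0..?c}|lborel. G (w v s) (\<phi> s)) - (LINT s:{0..?c}|lborel. G (w v' s) (\<phi> s))
        = (LINT s:{0..?c}|lborel. G (w v s) (\<phi> s) - G (w v' s) (\<phi> s))"
      by (rule set_integral_diff(2)[symmetric]) (rule int)+
    also have "norm \<dots> \<le> (LINT s:{0..?c}|lborel. L * ?d * exp (2 * L * s))"
      unfolding set_lebesgue_integral_def
    proof (rule Bochner_Integration.integral_norm_bound_integral)
      show "integrable lborel (\<lambda>s. indicator {0..?c} s *\<^sub>R (G (w v s) (\<phi> s) - G (w v' s) (\<phi> s)))"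
        using set_integral_diff(1)[OF int int, of 0 ?c v v'] by (simp add: set_integrable_def)
      show "integrable lborel (\<lambda>s. indicator {0..?c} s *\<^sub>R (L * ?d * exp (2 * L * s)))"
        using borel_integrable_atLeastAtMost'[of 0 ?c "\<lambda>s. L * ?d * exp (2 * L * s)"]
        by (simp add: set_integrable_def continuous_intros)
      fix s
      have "norm (G (w v s) (\<phi> s) - G (w v' s) (\<phi> s)) \<le> \<Lambda> * norm (w v s - w v' s) * norm (\<phi> s)" by (rule G_lip_apply)
      also have "norm (w v s - w v' s) = exp (2 * L * s) * dist (apply_bcontfun v s) (apply_bcontfun v' s)"
        by (simp add: w_def dist_norm flip: scaleR_diff_right)
      also have "\<Lambda> * (exp (2 * L * s) * dist (apply_bcontfun v s) (apply_bcontfun v' s)) * norm (\<phi> s) \<le> \<Lambda> * (exp (2 * L * s) * ?d) * B"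
        using \<Lambda> B0 \<phi>(2) by (intro mult_mono mult_left_mono dist_bounded) auto
      also have "\<dots> \<le> L * ?d * exp (2 * L * s)"
        by (simp add: L_def algebra_simps)
      finally show "norm (indicator {0..?c} s *\<^sub>R (G (w v s) (\<phi> s) - G (w v' s) (\<phi> s))) \<le> indicator {0..?c} s *\<^sub>R (L * ?d * exp (2 * L * s))"
        by (simp add: indicator_def)
    qed
    also have "(LINT s:{0..?c}|lborel. L * ?d * exp (2 * L * s)) = ?d / 2 * exp (2 * L * ?c) - ?d / 2 * exp (2 * L * 0)"
    proof -
      have "((\<lambda>s. ?d / 2 * exp (2 * L * s)) has_real_derivative L * ?d * exp (2 * L * s)) (at s within {0..?c})" for s
        by (auto intro!: derivative_eq_intros)
      then have "(LBINT s. (L * ?d * exp (2 * L * s)) * indicator {0..?c} s) = ?d / 2 * exp (2 * L * ?c) - ?d / 2 * exp (2 * L * 0)"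
        using c by (intro integral_FTC_Icc_real) (auto intro!: derivative_eq_intros continuous_intros)
      then show ?thesis unfolding set_lebesgue_integral_def real_scaleR_def by (subst mult.commute)
    qed
    also have "\<dots> \<le> ?d / 2 * exp (2 * L * ?c)" by simp
    finally have "dist (apply_bcontfun (PP v) t) (apply_bcontfun (PP v') t) \<le> exp (- 2 * L * ?c) * (?d / 2 * exp (2 * L * ?c))"
      by simp
    also have "\<dots> = 1/2 * ?d" by (simp add: exp_minus)
    finally show "dist (apply_bcontfun (PP v) t) (apply_bcontfun (PP v') t) \<le> 1/2 * dist v v'" .
  qed
  have "\<exists>!v. PP v = v"
    by (rule banach_fix_type[where c = "1/2"]) (simp, simp, intro allI contr)
  then obtain v where v: "PP v = v" by blast
  show ?thesis
  proof (rule that[of "w v"])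
    show "continuous_on {0..1} (w v)" by (rule wc)
    fix t :: real assume t: "t \<in> {0..1}"
    have "apply_bcontfun v t = P v t" using PP[of v] v by simp
    then have "w v t = exp (2 * L * t) *\<^sub>R P v t" by (simp add: w_def)
    also have "\<dots> = x + (LINT s:{0..t}|lborel. G (w v s) (\<phi> s))"
      using cl(2)[OF t] by (simp add: P_def flip: exp_add)
    finally show "w v t = x + (LINT s:{0..t}|lborel. G (w v s) (\<phi> s))" .
  qed
qed


text \<open>The factor \<open>m\<close> makes the integral over the \<open>j\<close>-th grid
  interval equal to \<open>c j\<close>. The intervals are half-open, hence disjoint, and the control
  vanishes at time 0.\<close>

definition step_control :: "nat \<Rightarrow> (nat \<Rightarrow> 'u) \<Rightarrow> real \<Rightarrow> 'u" where
  "step_control m c s = (\<Sum>j<m. indicator {real j / m<..real (Suc j) / m} s *\<^sub>R (real m *\<^sub>R c j))"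

lemma step_control_eq:
  assumes j: "j < m" and s: "s \<in> {real j / m<..real (Suc j) / m}"
  shows "step_control m c s = real m *\<^sub>R c j"
proof -
  have "indicator {real i / m<..real (Suc i) / m} s = (if i = j then 1 else 0 :: real)" for i
  proof (cases "i = j")
    case False
    have "s \<notin> {real i / m<..real (Suc i) / m}"
    proof
      assume s': "s \<in> {real i / m<..real (Suc i) / m}"
      have "real i / m < real (Suc j) / m" "real j / m < real (Suc i) / m" using s s' by auto
      then have "i < Suc j" "j < Suc i" using j by (simp_all add: divide_less_cancel del: of_nat_Suc)
      then show False using False by simp
    qed
    then show ?thesis using False by simp
  qed (use s in simp)
  then have "step_control m c s = (\<Sum>i<m. if i = j then real m *\<^sub>R c i else 0)"
    unfolding step_control_def by (intro sum.cong refl) simp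
  then show ?thesis using j by simp
qed

lemma step_control_0: "s \<notin> {0<..1} \<Longrightarrow> step_control m c s = 0"
proof -
  assume s: "s \<notin> {0<..1}"
  have "s \<notin> {real j / m<..real (Suc j) / m}" if "j < m" for j
  proof
    assume "s \<in> {real j / m<..real (Suc j) / m}"
    moreover have "real (Suc j) / m \<le> 1" "0 \<le> real j / m" using that by simp_all
    ultimately have "s \<in> {0<..1}" unfolding greaterThanAtMost_iff by linarith
    then show False using s by contradiction
  qed
  then show ?thesis unfolding step_control_def by (intro sum.neutral) auto
qed

lemma step_control_measurable [measurable]: "step_control m c \<in> borel_measurable borel"
  unfolding step_control_def by measurable

lemma grid_interval_exists:
  fixes s :: real and m :: nat
  assumes s: "0 < s" "s \<le> 1" and m: "0 < m"
  obtains j where "j < m" "s \<in> {real j / m<..real (Suc j) / m}"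
proof -
  define j where "j = nat (\<lceil>s * m\<rceil> - 1)"
  have "0 < s * m" using s m by simp
  then have c: "1 \<le> \<lceil>s * m\<rceil>" by linarith
  have "s * m \<le> m" using s m by simp
  then have "\<lceil>s * m\<rceil> \<le> int m" by (simp add: ceiling_le_iff)
  then have j: "j < m" using c by (simp add: j_def nat_less_iff)
  have "real j = real_of_int \<lceil>s * m\<rceil> - 1" using c by (simp add: j_def)
  then have "real j < s * m" "s * m \<le> real (Suc j)" using ceiling_correct[of "s * m"] by auto
  then have "s \<in> {real j / m<..real (Suc j) / m}" using m by (simp add: divide_less_eq le_divide_eq)
  then show ?thesis using that j by blast
qed

lemma step_control_bounded: "\<exists>B. \<forall>s. norm (step_control m c s) \<le> B"
proof (intro exI allI)
  fix s
  have "norm (step_control m c s) \<le> (\<Sum>j<m. norm (indicator {real j / m<..real (Suc j) / m} s *\<^sub>R (real m *\<^sub>R c j)))"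
    unfolding step_control_def by (rule norm_sum)
  also have "\<dots> \<le> (\<Sum>j<m. real m * norm (c j))" by (intro sum_mono) (simp add: indicator_def)
  finally show "norm (step_control m c s) \<le> (\<Sum>j<m. real m * norm (c j))" .
qed

lemma step_control_energy:
  assumes m: "0 < m"
  shows "step_control m c \<in> L2_unit_interval"
    "(LINT s|lebesgue_on {0..1}. (norm (step_control m c s))\<^sup>2) = m * (\<Sum>j<m. (norm (c j))\<^sup>2)"
proof -
  let ?I = "\<lambda>j. {real j / m<..real (Suc j) / m}"
  have sq: "indicator {0..1} s * (norm (step_control m c s))\<^sup>2 = (\<Sum>j<m. (m * norm (c j))\<^sup>2 * indicator (?I j) s)" for s
  proof (cases "s \<in> {0<..1}")
    case True
    then obtain j where j: "j < m" "s \<in> ?I j" using grid_interval_exists[of s m] m by auto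
    have "indicator (?I i) s = (if i = j then 1 else 0 :: real)" for i
    proof (cases "i = j")
      case False
      have "s \<notin> ?I i"
      proof
        assume s': "s \<in> ?I i"
        have "real i / m < real (Suc j) / m" "real j / m < real (Suc i) / m" using j s' by auto
        then have "i < Suc j" "j < Suc i" using m by (simp_all add: divide_less_cancel del: of_nat_Suc)
        then show False using False by simp
      qed
      then show ?thesis using False by simp
    qed (use j in simp)
    then have "(\<Sum>i<m. (m * norm (c i))\<^sup>2 * indicator (?I i) s) = (\<Sum>i<m. if i = j then (m * norm (c i))\<^sup>2 else 0)"
      by (intro sum.cong refl) simp
    then show ?thesis using j True step_control_eq[OF j] by simp
  next
    case False
    have "s \<notin> ?I j" if "j < m" for j
    proof
      assume "s \<in> ?I j"
      moreover have "real (Suc j) / m \<le> 1" "0 \<le> real j / m" using that by simp_all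
      ultimately have "s \<in> {0<..1}" unfolding greaterThanAtMost_iff by linarith
      then show False using False by contradiction
    qed
    then have "(\<Sum>j<m. (m * norm (c j))\<^sup>2 * indicator (?I j) s) = 0" by (intro sum.neutral) auto
    then show ?thesis using False step_control_0[of s] by simp
  qed
  have int: "integrable lborel (\<lambda>s. \<Sum>j<m. (m * norm (c j))\<^sup>2 * indicator (?I j) s)"
    by (intro Bochner_Integration.integrable_sum integrable_mult_right integrable_indicator_Ioc)
  have mb: "(\<lambda>s. indicator {0..1} s * (norm (step_control m c s))\<^sup>2) \<in> borel_measurable lborel" by measurable
  \<comment> \<open>\<open>L2_unit_interval\<close> is formulated with Lebesgue measure. The control
    is Borel, so its integrals over the completion agree with those over
    \<open>lborel\<close>.\<close>
  have i1: "integrable lebesgue (\<lambda>s. indicator {0..1} s *\<^sub>R (norm (step_control m c s))\<^sup>2)"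
    using int mb by (simp add: integrable_completion sq)
  have "(LINT s|lborel. (\<Sum>j<m. (m * norm (c j))\<^sup>2 * indicator (?I j) s)) = (\<Sum>j<m. (m * norm (c j))\<^sup>2 * measure lborel (?I j))"
    using integrable_indicator_Ioc by (subst Bochner_Integration.integral_sum) auto
  also have "\<dots> = (\<Sum>j<m. m * (norm (c j))\<^sup>2)"
  proof (intro sum.cong refl)
    fix j
    have le: "real j / m \<le> real (Suc j) / m" by (simp add: divide_right_mono)
    have "measure lborel (?I j) = real (Suc j) / m - real j / m" using le by (simp add: measure_def)
    also have "\<dots> = 1 / m" by (simp add: diff_divide_distrib[symmetric])
    finally show "(m * norm (c j))\<^sup>2 * measure lborel (?I j) = m * (norm (c j))\<^sup>2"
      using m by (simp add: power2_eq_square)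
  qed
  finally have val: "(LINT s|lborel. (\<Sum>j<m. (m * norm (c j))\<^sup>2 * indicator (?I j) s)) = m * (\<Sum>j<m. (norm (c j))\<^sup>2)"
    by (simp add: sum_distrib_left)
  have "integrable (lebesgue_on {0..1}) (\<lambda>s. (norm (step_control m c s))\<^sup>2)"
    using i1 by (subst integrable_restrict_space) auto
  moreover have "step_control m c \<in> borel_measurable (lebesgue_on {0..1})"
    by (intro measurable_restrict_space1 measurable_completion) simp
  ultimately show "step_control m c \<in> L2_unit_interval" by (simp add: L2_unit_interval_def)
  have "(LINT s|lebesgue_on {0..1}. (norm (step_control m c s))\<^sup>2) = (LINT s|lebesgue. indicator {0..1} s *\<^sub>R (norm (step_control m c s))\<^sup>2)"
    by (subst integral_restrict_space) auto
  also have "\<dots> = (LINT s|lborel. indicator {0..1} s *\<^sub>R (norm (step_control m c s))\<^sup>2)"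
    using mb by (intro integral_completion) simp
  also have "\<dots> = (LINT s|lborel. (\<Sum>j<m. (m * norm (c j))\<^sup>2 * indicator (?I j) s))"
    by (simp only: real_scaleR_def sq)
  also note val
  finally show "(LINT s|lebesgue_on {0..1}. (norm (step_control m c s))\<^sup>2) = m * (\<Sum>j<m. (norm (c j))\<^sup>2)" .
qed

text \<open>On one grid interval the maximum \<open>D\<close> of the norm satisfies
  \<open>(1 + D) * (1 - b) \<le> 1 + norm (z (real j / m))\<close> with
  \<open>b = \<Lambda> * norm (c j) \<le> 1/2\<close>, and
  \<open>1 / (1 - b) \<le> 1 + 2 * b \<le> exp (2 * b)\<close>; this is the origin of the 2 in
  \<open>R0\<close>. The last property is the local error of the Euler scheme, quadratic in
  \<open>c j\<close>.\<close>

lemma step_skeleton: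
  fixes c :: "nat \<Rightarrow> 'u" and m :: nat and x :: 'h
  assumes m: "0 < m" and small: "\<And>j. j < m \<Longrightarrow> \<Lambda> * norm (c j) \<le> 1/2"
  defines "R0 \<equiv> (1 + norm x) * exp (2 * \<Lambda> * (\<Sum>j<m. norm (c j))) - 1"
  obtains z where "is_skeleton G x (step_control m c) z" "z 0 = x" "\<And>t. t \<in> {0..1} \<Longrightarrow> norm (z t) \<le> R0"
    "\<And>j t. j < m \<Longrightarrow> t \<in> {real j / m..real (Suc j) / m} \<Longrightarrow> norm (z t - z (real j / m)) \<le> \<Lambda> * (1 + R0) * norm (c j)"
    "\<And>j. j < m \<Longrightarrow> norm (z (real (Suc j) / m) - z (real j / m) - G (z (real j / m)) (c j)) \<le> \<Lambda> * (\<Lambda> * (1 + R0) * norm (c j)) * norm (c j)"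
proof -
  let ?\<phi> = "step_control m c" and ?t = "\<lambda>j. real j / m"
  obtain B where B: "\<And>s. norm (?\<phi> s) \<le> B" using step_control_bounded by blast
  have \<phi>m: "?\<phi> \<in> borel_measurable borel" by simp
  obtain z0 where z0: "continuous_on {0..1} z0" "\<And>t. t \<in> {0..1} \<Longrightarrow> z0 t = x + (LINT s:{0..t}|lborel. G (z0 s) (?\<phi> s))"
    using skeleton_exists[OF \<phi>m B, of x] by blast
  define z where "z = restrict z0 {0..1}"
  have zc: "continuous_on {0..1} z" by (rule continuous_on_eq[OF z0(1)]) (simp add: z_def)
  have zint: "set_integrable lborel {a..b} (\<lambda>s. G (z s) (?\<phi> s))" if "0 \<le> a" "b \<le> 1" for a b
    using that by (intro field_integrable[OF _ \<phi>m B] continuous_on_subset[OF zc]) auto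
  have zeq: "z t = x + (LINT s:{0..t}|lborel. G (z s) (?\<phi> s))" if "t \<in> {0..1}" for t
  proof -
    have "(LINT s:{0..t}|lborel. G (z0 s) (?\<phi> s)) = (LINT s:{0..t}|lborel. G (z s) (?\<phi> s))"
      using that by (intro set_lebesgue_integral_cong) (auto simp: z_def)
    then show ?thesis using z0(2)[OF that] that by (simp add: z_def)
  qed
  have tj: "?t j \<in> {0..1}" if "j \<le> m" for j using that m by simp
  have t01: "0 \<le> ?t j \<and> ?t j \<le> t \<and> 0 \<le> t \<and> t \<le> 1" if "j < m" "t \<in> {?t j..?t (Suc j)}" for j t
  proof -
    have "0 \<le> ?t j" "?t (Suc j) \<le> 1" using tj[of j] tj[of "Suc j"] that(1) by (simp_all del: of_nat_Suc)
    then show ?thesis using that(2) unfolding atLeastAtMost_iff by linarith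
  qed
  have tsuc: "?t j \<le> ?t (Suc j)" for j by (simp add: divide_right_mono)
  have len: "?t (Suc j) - ?t j = 1 / m" for j by (simp add: diff_divide_distrib[symmetric])
  \<comment> \<open>On the grid interval the control is the constant \<open>m *\<^sub>R c j\<close>
    except at the left endpoint, a null set.\<close>
  have incr: "z t = z (?t j) + (LINT s:{?t j..t}|lborel. G (z s) (real m *\<^sub>R c j))" if j: "j < m" and t: "t \<in> {?t j..?t (Suc j)}" for j t
  proof -
    have t1: "t \<in> {0..1}" "0 \<le> ?t j" "?t j \<le> t" using t01[OF j t] by simp_all
    have "z t - z (?t j) = (LINT s:{?t j..t}|lborel. G (z s) (?\<phi> s))"
      using set_integral_split[OF zint[of 0 t], of "?t j"] t1 zeq[OF t1(1)] zeq[OF tj[OF less_imp_le[OF j]]] by simp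
    also have "\<dots> = (LINT s:{?t j..t}|lborel. G (z s) (real m *\<^sub>R c j))"
      unfolding set_lebesgue_integral_def
    proof (rule integral_cong_AE)
      show "(\<lambda>s. indicator {?t j..t} s *\<^sub>R G (z s) (?\<phi> s)) \<in> borel_measurable lborel"
        using zint[of "?t j" t] t1 unfolding set_integrable_def by auto
      show "(\<lambda>s. indicator {?t j..t} s *\<^sub>R G (z s) (real m *\<^sub>R c j)) \<in> borel_measurable lborel"
        using field_integrable[of "?t j" t z "\<lambda>_. real m *\<^sub>R c j" "norm (real m *\<^sub>R c j)"] t1 continuous_on_subset[OF zc, of "{?t j..t}"]
        unfolding set_integrable_def by auto
      show "AE s in lborel. indicator {?t j..t} s *\<^sub>R G (z s) (?\<phi> s) = indicator {?t j..t} s *\<^sub>R G (z s) (real m *\<^sub>R c j)"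
        using AE_lborel_singleton[of "?t j"]
      proof eventually_elim
        case (elim s)
        show ?case
        proof (cases "s \<in> {?t j..t}")
          case True
          then have "s \<in> {?t j<..?t (Suc j)}" using elim t by auto
          then show ?thesis using step_control_eq[OF j] by simp
        qed simp
      qed
    qed
    finally show ?thesis by (simp add: algebra_simps)
  qed
  have cst: "set_integrable lborel {a..b} (\<lambda>s. v)" for a b :: real and v :: real
    by (rule borel_integrable_atLeastAtMost') (rule continuous_on_const)
  \<comment> \<open>One estimate for three purposes: with \<open>v = 0\<close> it gives growth and
    modulus, with \<open>v\<close> the field frozen at the left endpoint it gives the Euler
    error.\<close>
  have bnd: "norm ((LINT s:{?t j..t}|lborel. G (z s) (real m *\<^sub>R c j)) - w) \<le> q * norm (c j)"
    if j: "j < m" and t: "t \<in> {?t j..?t (Suc j)}" and q: "0 \<le> q"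
      and w: "w = (t - ?t j) *\<^sub>R v" and le: "\<And>s. s \<in> {?t j..t} \<Longrightarrow> norm (G (z s) (real m *\<^sub>R c j) - v) \<le> q * (real m * norm (c j))" for j and t q :: real and v w :: 'h
  proof -
    have t1: "0 \<le> ?t j" "t \<le> 1" "?t j \<le> t" using t01[OF j t] by simp_all
    have zc': "continuous_on {?t j..t} z" by (rule continuous_on_subset[OF zc]) (use t1 in auto)
    have cm: "(\<lambda>_. real m *\<^sub>R c j) \<in> borel_measurable borel" by simp
    have fi: "set_integrable lborel {?t j..t} (\<lambda>s. G (z s) (real m *\<^sub>R c j))" by (rule field_integrable[OF zc' cm order_refl])
    have vi: "set_integrable lborel {?t j..t} (\<lambda>s. v)" by (rule borel_integrable_atLeastAtMost') (rule continuous_on_const)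
    have "(LINT s:{?t j..t}|lborel. v) = w" using t1 w by (simp add: set_lebesgue_integral_def)
    then have "(LINT s:{?t j..t}|lborel. G (z s) (real m *\<^sub>R c j)) - w = (LINT s:{?t j..t}|lborel. (G (z s) (real m *\<^sub>R c j) - v))"
      using set_integral_diff(2)[OF fi vi] by simp
    also have "norm \<dots> \<le> (LINT s:{?t j..t}|lborel. q * (real m * norm (c j)))"
      by (rule norm_field_integral_le[OF zc' cm order_refl cst le])
    also have "\<dots> = (t - ?t j) * (q * (real m * norm (c j)))" using t1 by (simp add: set_lebesgue_integral_def)
    also have "\<dots> \<le> (1 / m) * (q * (real m * norm (c j)))"
      using t len[of j] q by (intro mult_right_mono) auto
    also have "\<dots> = q * norm (c j)" using m by simp
    finally show ?thesis .
  qed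
  have Gm: "norm (G y (real m *\<^sub>R c j)) \<le> \<Lambda> * (1 + D) * (real m * norm (c j))" if "norm y \<le> D" for y :: 'h and D :: real and j
  proof -
    have "0 \<le> D" using that norm_ge_zero order_trans by blast
    then show ?thesis using that \<Lambda> by (intro order_trans[OF G_lin_apply]) (auto intro!: mult_mono mult_left_mono)
  qed
  have step: "1 + norm (z t) \<le> (1 + norm (z (?t j))) * exp (2 * \<Lambda> * norm (c j))"
    if j: "j < m" and t: "t \<in> {?t j..?t (Suc j)}" for j t
  proof -
    have sub: "{?t j..?t (Suc j)} \<subseteq> {0..1}" using t01[OF j] by (auto simp del: of_nat_Suc)
    have "continuous_on {?t j..?t (Suc j)} (\<lambda>s. norm (z s))" by (intro continuous_intros continuous_on_subset[OF zc sub])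
    then obtain t' where t': "t' \<in> {?t j..?t (Suc j)}" "\<And>s. s \<in> {?t j..?t (Suc j)} \<Longrightarrow> norm (z s) \<le> norm (z t')"
      using continuous_attains_sup[of "{?t j..?t (Suc j)}" "\<lambda>s. norm (z s)"] tsuc[of j] by auto
    define D where "D = norm (z t')"
    have D: "norm (z s) \<le> D" if "s \<in> {?t j..?t (Suc j)}" for s using t'(2)[OF that] by (simp add: D_def)
    have D0: "0 \<le> D" by (simp add: D_def)
    have "norm ((LINT s:{?t j..t'}|lborel. G (z s) (real m *\<^sub>R c j)) - 0) \<le> (\<Lambda> * (1 + D)) * norm (c j)"
      using t'(1) \<Lambda> D0 by (intro bnd[OF j t'(1), where v = 0]) (auto intro!: Gm D)
    then have "D \<le> norm (z (?t j)) + \<Lambda> * (1 + D) * norm (c j)"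
      unfolding D_def using incr[OF j t'(1)] norm_triangle_ineq[of "z (?t j)" "LINT s:{?t j..t'}|lborel. G (z s) (real m *\<^sub>R c j)"] by simp
    define b where "b = \<Lambda> * norm (c j)"
    have b: "0 \<le> b" "b \<le> 1/2" using small[OF j] \<Lambda> by (auto simp: b_def)
    have "D \<le> norm (z (?t j)) + (1 + D) * b" using \<open>D \<le> _\<close> by (simp add: b_def mult_ac)
    then have "(1 + D) * (1 - b) \<le> 1 + norm (z (?t j))" by (simp add: algebra_simps)
    moreover have "1 \<le> (1 - b) * (1 + 2 * b)"
    proof -
      have "b * (2 * b) \<le> b * 1" using b by (intro mult_left_mono) auto
      then show ?thesis by (simp add: algebra_simps)
    qed
    ultimately have "(1 + D) * 1 \<le> (1 + norm (z (?t j))) * (1 + 2 * b)"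
    proof -
      assume a1: "(1 + D) * (1 - b) \<le> 1 + norm (z (?t j))" and a2: "1 \<le> (1 - b) * (1 + 2 * b)"
      have "(1 + D) * 1 \<le> (1 + D) * ((1 - b) * (1 + 2 * b))" using a2 D0 by (intro mult_left_mono) auto
      also have "\<dots> = ((1 + D) * (1 - b)) * (1 + 2 * b)" by simp
      also have "\<dots> \<le> (1 + norm (z (?t j))) * (1 + 2 * b)" using a1 b by (intro mult_right_mono) auto
      finally show ?thesis .
    qed
    also have "\<dots> \<le> (1 + norm (z (?t j))) * exp (2 * b)" by (intro mult_left_mono exp_ge_add_one_self) auto
    finally show ?thesis using D[OF t] by (simp add: b_def mult.assoc)
  qed
  have z_0: "z 0 = x"
  proof -
    have "(LINT s:{0..0}|lborel. G (z s) (?\<phi> s)) = 0"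
      unfolding set_lebesgue_integral_def
      by (intro integral_eq_zero_AE AE_I2) (auto split: split_indicator simp: step_control_0)
    then show ?thesis using zeq[of 0] by simp
  qed
  have grid: "1 + norm (z (?t i)) \<le> (1 + norm x) * exp (2 * \<Lambda> * (\<Sum>j<i. norm (c j)))" if "i \<le> m" for i
    using that
  proof (induction i)
    case 0 then show ?case by (simp add: z_0)
  next
    case (Suc i)
    have "1 + norm (z (?t (Suc i))) \<le> (1 + norm (z (?t i))) * exp (2 * \<Lambda> * norm (c i))"
      using step[of i "?t (Suc i)"] Suc.prems tsuc[of i] by simp
    also have "\<dots> \<le> (1 + norm x) * exp (2 * \<Lambda> * (\<Sum>j<i. norm (c j))) * exp (2 * \<Lambda> * norm (c i))"
      using Suc by (intro mult_right_mono) auto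
    also have "\<dots> = (1 + norm x) * exp (2 * \<Lambda> * (\<Sum>j<Suc i. norm (c j)))"
      by (simp add: exp_add[symmetric] algebra_simps)
    finally show ?case .
  qed
  have bound_step: "norm (z t) \<le> R0" if j: "j < m" and t: "t \<in> {?t j..?t (Suc j)}" for j t
  proof -
    have "1 + norm (z t) \<le> (1 + norm (z (?t j))) * exp (2 * \<Lambda> * norm (c j))" by (rule step[OF j t])
    also have "\<dots> \<le> (1 + norm x) * exp (2 * \<Lambda> * (\<Sum>i<j. norm (c i))) * exp (2 * \<Lambda> * norm (c j))"
      using grid[of j] j by (intro mult_right_mono) auto
    also have "\<dots> = (1 + norm x) * exp (2 * \<Lambda> * (\<Sum>i<Suc j. norm (c i)))"
      by (simp add: exp_add[symmetric] algebra_simps)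
    also have "\<dots> \<le> (1 + norm x) * exp (2 * \<Lambda> * (\<Sum>i<m. norm (c i)))"
      using \<Lambda> j by (intro mult_left_mono iffD2[OF exp_le_cancel_iff] sum_mono2) auto
    finally show ?thesis by (simp add: R0_def)
  qed
  have bound: "norm (z t) \<le> R0" if t: "t \<in> {0..1}" for t
  proof (cases "t = 0")
    case True
    then show ?thesis using bound_step[of 0 0] m by simp
  next
    case False
    then obtain j where "j < m" "t \<in> {?t j<..?t (Suc j)}" using grid_interval_exists[of t m] m t by auto
    then show ?thesis using bound_step[of j t] by auto
  qed
  have "norm (z 0) \<le> R0" by (rule bound) simp
  then have R0: "0 \<le> R0" using norm_ge_zero[of "z 0"] by linarith
  have modulus: "norm (z t - z (?t j)) \<le> \<Lambda> * (1 + R0) * norm (c j)" if j: "j < m" and t: "t \<in> {?t j..?t (Suc j)}" for j t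
  proof -
    have "norm ((LINT s:{?t j..t}|lborel. G (z s) (real m *\<^sub>R c j)) - 0) \<le> (\<Lambda> * (1 + R0)) * norm (c j)"
    proof (rule bnd[OF j t, where v = 0])
      fix s assume s: "s \<in> {?t j..t}"
      have "norm (z s) \<le> R0" using bound_step[OF j, of s] s t by auto
      then show "norm (G (z s) (real m *\<^sub>R c j) - 0) \<le> \<Lambda> * (1 + R0) * (real m * norm (c j))" using Gm by simp
    qed (use \<Lambda> R0 in auto)
    then show ?thesis using incr[OF j t] by simp
  qed
  have euler: "norm (z (?t (Suc j)) - z (?t j) - G (z (?t j)) (c j)) \<le> \<Lambda> * (\<Lambda> * (1 + R0) * norm (c j)) * norm (c j)" if j: "j < m" for j
  proof -
    have t: "?t (Suc j) \<in> {?t j..?t (Suc j)}" using tsuc[of j] by auto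
    have "norm ((LINT s:{?t j..?t (Suc j)}|lborel. G (z s) (real m *\<^sub>R c j)) - G (z (?t j)) (c j)) \<le> (\<Lambda> * (\<Lambda> * (1 + R0) * norm (c j))) * norm (c j)"
    proof (rule bnd[OF j t, where v = "G (z (?t j)) (real m *\<^sub>R c j)"])
      show "G (z (?t j)) (c j) = (?t (Suc j) - ?t j) *\<^sub>R G (z (?t j)) (real m *\<^sub>R c j)"
        unfolding len using m by (simp add: blinfun.scaleR_right)
      fix s assume s: "s \<in> {?t j..?t (Suc j)}"
      show "norm (G (z s) (real m *\<^sub>R c j) - G (z (?t j)) (real m *\<^sub>R c j)) \<le> \<Lambda> * (\<Lambda> * (1 + R0) * norm (c j)) * (real m * norm (c j))"
      proof -
        have "\<Lambda> * norm (z s - z (?t j)) * norm (real m *\<^sub>R c j) \<le> \<Lambda> * (\<Lambda> * (1 + R0) * norm (c j)) * norm (real m *\<^sub>R c j)"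
          by (rule mult_right_mono[OF mult_left_mono[OF modulus[OF j s]]]) (use \<Lambda> in simp_all)
        then show ?thesis using order_trans[OF G_lip_apply] by simp
      qed
    qed (use \<Lambda> R0 in auto)
    then show ?thesis using incr[OF j t] by simp
  qed
  have "is_skeleton G x ?\<phi> z"
    unfolding is_skeleton_def
  proof (intro conjI ballI)
    show "z \<in> mspace path_space" unfolding path_space_iff by (rule conjI[OF _ zc]) (simp add: z_def)
    fix t :: real assume t: "t \<in> {0..1}"
    have "(LINT s:{0..t}|lebesgue. G (z s) (?\<phi> s)) = (LINT s:{0..t}|lborel. G (z s) (?\<phi> s))"
      unfolding set_lebesgue_integral_def
      using zint[of 0 t] t by (intro integral_completion) (auto simp: set_integrable_def)
    then show "z t = x + (LINT s:{0..t}|lebesgue. G (z s) (?\<phi> s))" using zeq[OF t] by simp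
  qed
  then show ?thesis using that z_0 bound modulus euler by blast
qed


fun euler :: "(nat \<Rightarrow> 'u) \<Rightarrow> 'h \<Rightarrow> nat \<Rightarrow> 'h" where
  "euler c x 0 = x"
| "euler c x (Suc j) = euler c x j + G (euler c x j) (c j)"

text \<open>\<open>E j\<close> contains all values of the scheme after \<open>j\<close> steps and is
  a continuous image of the previous set times the compact set of controls. The resulting
  \<open>W\<close> depends on the number of steps and on the control set, but not on \<epsilon>, so
  that \<open>semigroup_uniform_on_compact\<close> can be applied to it.\<close>

lemma euler_increments_compact:
  assumes K: "compact K" and U: "compact U"
  obtains W where "compact W" "\<And>x c j. x \<in> K \<Longrightarrow> (\<And>i. i < m \<Longrightarrow> c i \<in> U) \<Longrightarrow> j < m \<Longrightarrow> G (euler c x j) (c j) \<in> W"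
proof -
  define E where "E = rec_nat K (\<lambda>_ A. (\<lambda>p. fst p + G (fst p) (snd p)) ` (A \<times> U))"
  have E: "E 0 = K" "E (Suc j) = (\<lambda>p. fst p + G (fst p) (snd p)) ` (E j \<times> U)" for j by (simp_all add: E_def)
  have cE: "compact (E j)" for j
  proof (induction j)
    case 0 then show ?case using K by (simp add: E)
  next
    case (Suc j)
    then show ?case unfolding E
      by (intro compact_continuous_image compact_Times U continuous_on_add continuous_on_fst continuous_on_id
          continuous_on_subset[OF G_apply_continuous]) auto
  qed
  define W where "W = (\<Union>j<m. (\<lambda>p. G (fst p) (snd p)) ` (E j \<times> U))"
  have cW: "compact W" unfolding W_def
    by (intro compact_UN finite_lessThan compact_continuous_image compact_Times U cE continuous_on_subset[OF G_apply_continuous]) auto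
  have inE: "euler c x j \<in> E j" if "x \<in> K" "\<And>i. i < m \<Longrightarrow> c i \<in> U" "j \<le> m" for c x j
    using that(3)
  proof (induction j)
    case 0 then show ?case using that by (simp add: E)
  next
    case (Suc j)
    then have "euler c x j \<in> E j" "c j \<in> U" using that(2)[of j] by simp_all
    then have "(euler c x j, c j) \<in> E j \<times> U" by simp
    then show ?case unfolding E euler.simps by (rule rev_image_eqI) simp
  qed
  have "G (euler c x j) (c j) \<in> W" if "x \<in> K" "\<And>i. i < m \<Longrightarrow> c i \<in> U" "j < m" for c x j
  proof -
    have "euler c x j \<in> E j" by (rule inE[OF that(1)]) (use that(2,3) in simp_all)
    then have "(euler c x j, c j) \<in> E j \<times> U" using that(2)[OF that(3)] by simp
    then have "G (euler c x j) (c j) \<in> (\<lambda>p. G (fst p) (snd p)) ` (E j \<times> U)" by (rule rev_image_eqI) simp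
    then show ?thesis using that(3) unfolding W_def by blast
  qed
  with cW show ?thesis using that by blast
qed

end

text \<open>Control increments of bounded energy lie in such a box; its compactness is what keeps
  the Euler scheme in a compact set.\<close>

lemma compact_coefficient_box:
  fixes g :: "'i \<Rightarrow> 'u::real_normed_vector"
  assumes "finite F"
  shows "compact {\<Sum>k\<in>F. a k *\<^sub>R g k |a. \<forall>k\<in>F. \<bar>a k\<bar> \<le> \<rho>}"
  using assms
proof induction
  case empty
  then show ?case by simp
next
  case (insert i F)
  let ?C = "{\<Sum>k\<in>F. a k *\<^sub>R g k |a. \<forall>k\<in>F. \<bar>a k\<bar> \<le> \<rho>}"
  have "{\<Sum>k\<in>insert i F. a k *\<^sub>R g k |a. \<forall>k\<in>insert i F. \<bar>a k\<bar> \<le> \<rho>} = (\<lambda>p. fst p *\<^sub>R g i + snd p) ` ({-\<rho>..\<rho>} \<times> ?C)"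
  proof (intro equalityI subsetI)
    fix v assume "v \<in> {\<Sum>k\<in>insert i F. a k *\<^sub>R g k |a. \<forall>k\<in>insert i F. \<bar>a k\<bar> \<le> \<rho>}"
    then obtain a where a: "v = (\<Sum>k\<in>insert i F. a k *\<^sub>R g k)" "\<forall>k\<in>insert i F. \<bar>a k\<bar> \<le> \<rho>" by blast
    have "(a i, \<Sum>k\<in>F. a k *\<^sub>R g k) \<in> {-\<rho>..\<rho>} \<times> ?C" using a(2) by (auto simp: abs_le_iff)
    then show "v \<in> (\<lambda>p. fst p *\<^sub>R g i + snd p) ` ({-\<rho>..\<rho>} \<times> ?C)"
      by (rule rev_image_eqI) (use a(1) insert in simp)
  next
    fix v assume "v \<in> (\<lambda>p. fst p *\<^sub>R g i + snd p) ` ({-\<rho>..\<rho>} \<times> ?C)"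
    then obtain t a where a: "v = t *\<^sub>R g i + (\<Sum>k\<in>F. a k *\<^sub>R g k)" "\<bar>t\<bar> \<le> \<rho>" "\<forall>k\<in>F. \<bar>a k\<bar> \<le> \<rho>"
      by (auto simp: abs_le_iff)
    define b where "b = a(i := t)"
    have "(\<Sum>k\<in>F. b k *\<^sub>R g k) = (\<Sum>k\<in>F. a k *\<^sub>R g k)" using insert(2) by (intro sum.cong refl) (auto simp: b_def)
    then have "v = (\<Sum>k\<in>insert i F. b k *\<^sub>R g k)" using a(1) insert by (simp add: b_def)
    moreover have "\<forall>k\<in>insert i F. \<bar>b k\<bar> \<le> \<rho>" using a by (simp add: b_def)
    ultimately show "v \<in> {\<Sum>k\<in>insert i F. a k *\<^sub>R g k |a. \<forall>k\<in>insert i F. \<bar>a k\<bar> \<le> \<rho>}" by blast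
  qed
  moreover have "compact ((\<lambda>p. fst p *\<^sub>R g i + snd p) ` ({-\<rho>..\<rho>} \<times> ?C))"
    using insert by (intro compact_continuous_image compact_Times continuous_intros) auto
  ultimately show ?case by simp
qed

lemma norm_decompose4:
  fixes a b c d x :: "'b::real_normed_vector"
  assumes "x = a + b + c - d" shows "norm x \<le> norm a + norm b + norm c + norm d"
  using norm_triangle_ineq4[of "a + b + c" d] norm_triangle_ineq[of "a + b" c] norm_triangle_ineq[of a b] assms by simp

lemma norm_decompose3:
  fixes a b c x :: "'b::real_normed_vector"
  assumes "x = a - b + c" shows "norm x \<le> norm a + norm b + norm c"
  using norm_triangle_ineq[of "a - b" c] norm_triangle_ineq4[of a b] assms by simp

section \<open>Comparison of solution and skeleton on the grid\<close>

context lipschitz_field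
begin

text \<open>Here \<open>Y\<close> is the solution on the grid and \<open>S'\<close> the semigroup on the fast time scale. The error \<open>e\<^sub>3\<close>
  of replacing \<open>S'\<close> by the identity is only needed along the Euler scheme.\<close>
lemma grid_comparison:
  fixes c :: "nat \<Rightarrow> 'u" and Y :: "nat \<Rightarrow> 'h" and z :: "real \<Rightarrow> 'h" and S' :: "nat \<Rightarrow> nat \<Rightarrow> 'h \<Rightarrow>\<^sub>L 'h"
    and C s em e e3 :: real and m n :: nat and t :: "nat \<Rightarrow> real" and x :: 'h
  assumes C: "1 \<le> C" "\<And>i j. norm (S' i j) \<le> C"
    and s: "(\<Sum>j<m. norm (c j)) \<le> s" and em: "0 \<le> em"
    and z0: "t 0 = 0" "z 0 = x" and z: "\<And>j. j < m \<Longrightarrow> norm (z (t (Suc j)) - z (t j) - G (z (t j)) (c j)) \<le> \<Lambda> * em * norm (c j)"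
    and e3: "0 \<le> e3" "\<And>i j. j < i \<Longrightarrow> i \<le> m \<Longrightarrow> norm (S' i j (G (euler c x j) (c j)) - G (euler c x j) (c j)) \<le> e3"
    and n: "n \<le> m" and e: "\<And>i. i \<le> n \<Longrightarrow> norm (Y i - x - (\<Sum>j<i. S' i j (G (Y j) (c j)))) \<le> e"
    and i: "i \<le> n"
  shows "norm (Y i - z (t i)) \<le> (e + real m * e3 + \<Lambda> * em * s + (C + 1) * \<Lambda> * s * (\<Lambda> * em * s * exp (\<Lambda> * s))) * exp (C * \<Lambda> * s)"
proof -
  define r where "r j = z (t (Suc j)) - z (t j) - G (z (t j)) (c j)" for j
  have r: "norm (r j) \<le> \<Lambda> * em * norm (c j)" if "j < m" for j using z[OF that] by (simp add: r_def)
  have s0: "0 \<le> s" using s by (rule order_trans[rotated]) (simp add: sum_nonneg)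
  have part: "(\<Sum>j<i. norm (c j)) \<le> s" if "i \<le> m" for i
    by (rule order_trans[OF sum_mono2 s]) (use that in auto)
  have rsum: "norm (\<Sum>j<i. r j) \<le> \<Lambda> * em * s" if "i \<le> m" for i
  proof -
    have "norm (\<Sum>j<i. r j) \<le> (\<Sum>j<i. \<Lambda> * em * norm (c j))" using r that by (intro sum_norm_le) auto
    also have "\<dots> = \<Lambda> * em * (\<Sum>j<i. norm (c j))" by (simp add: sum_distrib_left)
    also have "\<dots> \<le> \<Lambda> * em * s" using \<Lambda> em part[OF that] by (intro mult_left_mono) auto
    finally show ?thesis .
  qed
  have zsum: "z (t i) = x + (\<Sum>j<i. G (z (t j)) (c j) + r j)" for i
    by (induction i) (simp_all add: z0 r_def algebra_simps)
  have ysum: "euler c x i = x + (\<Sum>j<i. G (euler c x j) (c j))" for i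
    by (induction i) (simp_all add: algebra_simps)
  \<comment> \<open>First the skeleton is compared with the Euler scheme. No semigroup occurs in
    either, so the local errors \<open>r\<close> and Gronwall's inequality suffice.\<close>
  define d where "d j = norm (z (t j) - euler c x j)" for j
  have d: "d i \<le> \<Lambda> * em * s * exp (\<Lambda> * s)" if "i \<le> m" for i
  proof -
    have "d i \<le> \<Lambda> * em * s * exp (\<Sum>j<i. \<Lambda> * norm (c j))"
    proof (rule discrete_gronwall[of m d "\<Lambda> * em * s" "\<lambda>j. \<Lambda> * norm (c j)", OF _ _ _ that])
      fix i assume i: "i \<le> m"
      have "z (t i) - euler c x i = (\<Sum>j<i. G (z (t j)) (c j) - G (euler c x j) (c j)) + (\<Sum>j<i. r j)"
        unfolding zsum[of i] ysum[of i] by (simp add: sum.distrib sum_subtractf)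
      then have "d i \<le> norm (\<Sum>j<i. G (z (t j)) (c j) - G (euler c x j) (c j)) + norm (\<Sum>j<i. r j)"
        unfolding d_def by (simp add: norm_triangle_ineq)
      also have "\<dots> \<le> (\<Sum>j<i. \<Lambda> * norm (c j) * d j) + \<Lambda> * em * s"
      proof (intro add_mono sum_norm_le rsum i)
        fix j
        show "norm (G (z (t j)) (c j) - G (euler c x j) (c j)) \<le> \<Lambda> * norm (c j) * d j"
          using G_lip_apply[of "z (t j)" "c j" "euler c x j"] by (simp add: d_def mult_ac)
      qed
      finally show "d i \<le> \<Lambda> * em * s + (\<Sum>j<i. \<Lambda> * norm (c j) * d j)" by simp
    qed (use \<Lambda> em s0 in auto)
    also have "(\<Sum>j<i. \<Lambda> * norm (c j)) = \<Lambda> * (\<Sum>j<i. norm (c j))" by (simp add: sum_distrib_left)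
    also have "\<Lambda> * em * s * exp (\<Lambda> * (\<Sum>j<i. norm (c j))) \<le> \<Lambda> * em * s * exp (\<Lambda> * s)"
      using \<Lambda> em s0 part[OF that] by (intro mult_left_mono) auto
    finally show ?thesis .
  qed
  define dd where "dd = \<Lambda> * em * s * exp (\<Lambda> * s)"
  have dd0: "0 \<le> dd" using \<Lambda> em s0 by (simp add: dd_def)
  define E where "E = e + real m * e3 + \<Lambda> * em * s + (C + 1) * \<Lambda> * s * dd"
  have e0: "0 \<le> e" using e[of 0] norm_ge_zero order_trans by blast
  have E0: "0 \<le> E" using e0 e3(1) \<Lambda> em s0 dd0 C by (simp add: E_def)
  define D where "D i = norm (Y i - z (t i))" for i
  have "D i \<le> E * exp (\<Sum>j<i. C * \<Lambda> * norm (c j))"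
  proof (rule discrete_gronwall[of n D E "\<lambda>j. C * \<Lambda> * norm (c j)", OF _ _ _ i])
    fix i assume i: "i \<le> n"
    then have im: "i \<le> m" using n by simp
    \<comment> \<open>Together with the local errors \<open>r\<close> there are four parts: the
      residual of the mild equation, a Lipschitz part that is fed to Gronwall, and semigroup minus
      identity along the skeleton.\<close>
    let ?a = "Y i - x - (\<Sum>j<i. S' i j (G (Y j) (c j)))"
    let ?b = "\<Sum>j<i. S' i j (G (Y j) (c j) - G (z (t j)) (c j))"
    let ?c = "\<Sum>j<i. S' i j (G (z (t j)) (c j)) - G (z (t j)) (c j)"
    have "Y i - z (t i) = ?a + ?b + ?c - (\<Sum>j<i. r j)"
      unfolding zsum[of i] by (simp add: sum.distrib sum_subtractf blinfun.diff_right)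
    then have "D i \<le> norm ?a + norm ?b + norm ?c + norm (\<Sum>j<i. r j)"
      unfolding D_def
      by (rule norm_decompose4)
    also have "norm ?a \<le> e" by (rule e[OF i])
    also have "norm ?b \<le> (\<Sum>j<i. C * \<Lambda> * norm (c j) * D j)"
    proof (rule sum_norm_le)
      fix j
      have "norm (S' i j (G (Y j) (c j) - G (z (t j)) (c j))) \<le> norm (S' i j) * norm (G (Y j) (c j) - G (z (t j)) (c j))"
        by (rule norm_blinfun)
      also have "\<dots> \<le> C * (\<Lambda> * norm (Y j - z (t j)) * norm (c j))"
        using C G_lip_apply[of "Y j" "c j" "z (t j)"] by (intro mult_mono) auto
      finally show "norm (S' i j (G (Y j) (c j) - G (z (t j)) (c j))) \<le> C * \<Lambda> * norm (c j) * D j" by (simp add: D_def mult_ac)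
    qed
    also have "norm ?c \<le> (\<Sum>j<i. (C + 1) * \<Lambda> * dd * norm (c j) + e3)"
    proof (rule sum_norm_le)
      fix j assume j: "j \<in> {..<i}"
      \<comment> \<open>The skeleton increment is exchanged for the Euler increment, to which
        \<open>e3\<close> applies. The exchange costs \<open>C + 1\<close> times a multiple of the
        distance \<open>dd\<close> found above.\<close>
      let ?v = "G (z (t j)) (c j) - G (euler c x j) (c j)" and ?y = "G (euler c x j) (c j)"
      have v: "norm ?v \<le> \<Lambda> * dd * norm (c j)"
        using d[of j] j im \<Lambda> by (intro order_trans[OF G_lip_apply] mult_right_mono mult_left_mono) (auto simp: d_def dd_def)
      have "S' i j (G (z (t j)) (c j)) - G (z (t j)) (c j) = S' i j ?v - ?v + (S' i j ?y - ?y)"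
        by (simp add: blinfun.diff_right)
      then have "norm (S' i j (G (z (t j)) (c j)) - G (z (t j)) (c j)) \<le> norm (S' i j ?v) + norm ?v + norm (S' i j ?y - ?y)"
        by (rule norm_decompose3)
      also have "norm (S' i j ?v) \<le> C * norm ?v"
        using norm_blinfun[of "S' i j" ?v] C(2)[of i j] by (meson mult_right_mono norm_ge_zero order_trans)
      also have "norm (S' i j ?y - ?y) \<le> e3" using e3(2)[of j i] j im by simp
      also have "C * norm ?v + norm ?v + e3 \<le> (C + 1) * (\<Lambda> * dd * norm (c j)) + e3"
        using mult_left_mono[OF v, of "C + 1"] C by (simp add: algebra_simps)
      finally show "norm (S' i j (G (z (t j)) (c j)) - G (z (t j)) (c j)) \<le> (C + 1) * \<Lambda> * dd * norm (c j) + e3" by (simp add: mult_ac)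
    qed
    also have "(\<Sum>j<i. (C + 1) * \<Lambda> * dd * norm (c j) + e3) \<le> (C + 1) * \<Lambda> * s * dd + real m * e3"
    proof -
      have "(\<Sum>j<i. (C + 1) * \<Lambda> * dd * norm (c j) + e3) = (C + 1) * \<Lambda> * dd * (\<Sum>j<i. norm (c j)) + real i * e3"
        by (simp add: sum.distrib sum_distrib_left)
      also have "\<dots> \<le> (C + 1) * \<Lambda> * dd * s + real m * e3"
        using C \<Lambda> dd0 part[OF im] e3(1) im by (intro add_mono mult_left_mono mult_right_mono) auto
      finally show ?thesis by (simp add: mult_ac)
    qed
    also have "norm (\<Sum>j<i. r j) \<le> \<Lambda> * em * s" by (rule rsum[OF im])
    finally show "D i \<le> E + (\<Sum>j<i. C * \<Lambda> * norm (c j) * D j)" by (simp add: E_def)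
  qed (use C \<Lambda> E0 in auto)
  also have "(\<Sum>j<i. C * \<Lambda> * norm (c j)) = C * \<Lambda> * (\<Sum>j<i. norm (c j))" by (simp add: sum_distrib_left)
  also have "E * exp (C * \<Lambda> * (\<Sum>j<i. norm (c j))) \<le> E * exp (C * \<Lambda> * s)"
    using E0 C \<Lambda> part[of i] i n by (intro mult_left_mono) auto
  finally show ?thesis by (simp add: D_def E_def dd_def)
qed

end

section \<open>From dyadic times to whole paths\<close>

text \<open>The parent of \<open>k\<close> one level up is \<open>k div 2\<close>: an even
  \<open>k\<close> is the same time, an odd one adds a single increment of its level. Parents are
  never later, so all increments used end by time \<open>T\<close>.\<close>

lemma dyadic_chain:
  fixes N :: "real \<Rightarrow> 'h::real_normed_vector" and b :: "nat \<Rightarrow> real"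
  assumes inc: "\<And>q k. p < q \<Longrightarrow> k < 2 ^ q \<Longrightarrow> real (Suc k) / 2 ^ q \<le> T \<Longrightarrow> norm (N (real (Suc k) / 2 ^ q) - N (real k / 2 ^ q)) \<le> b q"
    and b: "\<And>q. 0 \<le> b q"
  shows "k \<le> 2 ^ (p + n) \<Longrightarrow> real k / 2 ^ (p + n) \<le> T \<Longrightarrow>
    norm (N (real k / 2 ^ (p + n)) - N (real (k div 2 ^ n) / 2 ^ p)) \<le> (\<Sum>i<n. b (p + Suc i))"
proof (induction n arbitrary: k)
  case 0
  then show ?case by simp
next
  case (Suc n)
  define l where "l = k div 2"
  have half: "real (2 * l) / 2 ^ (p + Suc n) = real l / 2 ^ (p + n)" by simp
  have l: "l \<le> 2 ^ (p + n)" using Suc.prems(1) by (simp add: l_def)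
  have le: "real (2 * l) / 2 ^ (p + Suc n) \<le> real k / 2 ^ (p + Suc n)" by (intro divide_right_mono) (auto simp: l_def)
  have IH: "norm (N (real (2 * l) / 2 ^ (p + Suc n)) - N (real (k div 2 ^ Suc n) / 2 ^ p)) \<le> (\<Sum>i<n. b (p + Suc i))"
    using Suc.IH[OF l] le Suc.prems(2) unfolding half by (simp add: l_def div_mult2_eq)
  have "norm (N (real k / 2 ^ (p + Suc n)) - N (real (2 * l) / 2 ^ (p + Suc n))) \<le> b (p + Suc n)"
  proof (cases "even k")
    case True
    then have "2 * l = k" by (simp add: l_def)
    then show ?thesis using b by simp
  next
    case False
    then have k: "k = Suc (2 * l)" by (simp add: l_def odd_two_times_div_two_succ)
    show ?thesis using inc[of "p + Suc n" "2 * l"] Suc.prems unfolding k by simp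
  qed
  then show ?case using IH norm_triangle_ineq[of "N (real k / 2 ^ (p + Suc n)) - N (real (2 * l) / 2 ^ (p + Suc n))"
      "N (real (2 * l) / 2 ^ (p + Suc n)) - N (real (k div 2 ^ Suc n) / 2 ^ p)"] by simp
qed

text \<open>A first exit argument for one fixed path, in place of a stopping time. Up to the first
  time at which the norm reaches \<open>R0 + \<delta>\<close> the path is within
  \<open>\<delta>' < \<delta>\<close> of one in the ball of radius \<open>R0\<close>, so this level
  is never reached.\<close>

lemma localisation:
  fixes X z :: "real \<Rightarrow> 'h::real_normed_vector"
  assumes X: "continuous_on {0..1} X" and z: "\<And>t. t \<in> {0..1} \<Longrightarrow> norm (z t) \<le> R0" and X0: "norm (X 0) \<le> R0 + \<delta>"
    and close: "\<And>T. T \<in> {0..1} \<Longrightarrow> (\<And>u. u \<in> {0..T} \<Longrightarrow> norm (X u) \<le> R0 + \<delta>) \<Longrightarrow> norm (X T - z T) \<le> \<delta>'"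
    and \<delta>': "\<delta>' < \<delta>" and T: "T \<in> {0..1}"
  shows "norm (X T - z T) \<le> \<delta>'"
proof -
  define A where "A = {t \<in> {0..1}. R0 + \<delta> \<le> norm (X t)}"
  have cX: "continuous_on {0..1} (\<lambda>t. norm (X t))" by (intro continuous_intros X)
  have "A = {}"
  proof (rule ccontr)
    assume "A \<noteq> {}"
    have "A = {0..1} \<inter> (\<lambda>t. norm (X t)) -` {R0 + \<delta>..}" by (auto simp: A_def)
    then have "closed A" using continuous_closed_preimage[OF cX closed_real_atLeastAtMost closed_atLeast] by simp
    moreover have "bounded A" by (rule bounded_subset[of "{0..1}"]) (auto simp: A_def)
    ultimately have "compact A" by (simp add: compact_eq_bounded_closed)
    then obtain t where t: "t \<in> A" "\<And>u. u \<in> A \<Longrightarrow> t \<le> u" using compact_attains_inf[of A] \<open>A \<noteq> {}\<close> by blast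
    have t01: "0 \<le> t" "t \<le> 1" using t by (auto simp: A_def)
    have "continuous_on {0..t} (\<lambda>t. norm (X t))" by (rule continuous_on_subset[OF cX]) (use t01 in auto)
    then obtain s where s: "0 \<le> s" "s \<le> t" "norm (X s) = R0 + \<delta>"
      using IVT'[of "\<lambda>t. norm (X t)" 0 "R0 + \<delta>" t] X0 t t01 by (auto simp: A_def)
    then have "s \<in> A" using t01 by (simp add: A_def)
    then have st: "s = t" using t(2)[of s] s by simp
    have "norm (X u) \<le> R0 + \<delta>" if "u \<in> {0..t}" for u
    proof (cases "u = t")
      case False
      then have "u \<notin> A" using t(2)[of u] that by auto
      then show ?thesis using that t01 by (auto simp: A_def)
    qed (use s st in simp)
    then have "norm (X t - z t) \<le> \<delta>'" using close[of t] t01 by simp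
    then have "norm (X t) < R0 + \<delta>" using z[of t] t01 \<delta>' norm_triangle_sub[of "X t" "z t"] by simp
    then show False using s st by simp
  qed
  have "norm (X u) \<le> R0 + \<delta>" if "u \<in> {0..T}" for u
  proof -
    have "u \<notin> A" using \<open>A = {}\<close> by simp
    then show ?thesis using that T by (simp add: A_def)
  qed
  then show ?thesis using close[OF T] by blast
qed

text \<open>Rounding down to dyadic times stays in the same grid interval and below
  \<open>T\<close>, where \<open>dy\<close> applies, and continuity passes to the limit. The right
  endpoint belongs to the next interval under rounding and is therefore approached from the
  left.\<close>

lemma modulus_from_dyadic:
  fixes X :: "real \<Rightarrow> 'h::real_normed_vector"
  assumes X: "continuous_on {0..1} X" and T: "T \<le> 1" and j: "j < 2 ^ p"
    and dy: "\<And>n k. k \<le> 2 ^ (p + n) \<Longrightarrow> real k / 2 ^ (p + n) \<le> T \<Longrightarrow> k div 2 ^ n = j \<Longrightarrow> norm (X (real k / 2 ^ (p + n)) - X (real j / 2 ^ p)) \<le> b"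
    and u: "u \<in> {real j / 2 ^ p..real (Suc j) / 2 ^ p}" "u \<le> T"
  shows "norm (X u - X (real j / 2 ^ p)) \<le> b"
proof -
  let ?a = "real j / 2 ^ p"
  have open_case: "norm (X u - X ?a) \<le> b" if u: "?a \<le> u" "u < real (Suc j) / 2 ^ p" "u \<le> T" for u
  proof -
    have u01: "0 \<le> u" "u \<le> 1" using u T order_trans[of 0 ?a u] by auto
    define k where "k n = nat \<lfloor>u * 2 ^ (p + n)\<rfloor>" for n
    have kr: "real (k n) = real_of_int \<lfloor>u * 2 ^ (p + n)\<rfloor>" for n using u01 by (simp add: k_def)
    have k1: "real (k n) \<le> u * 2 ^ (p + n)" "u * 2 ^ (p + n) < real (k n) + 1" for n unfolding kr by linarith+
    have d1: "real (k n) / 2 ^ (p + n) \<le> u" for n using k1(1)[of n] by (simp add: divide_le_eq)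
    have d2: "u - 1 / 2 ^ n \<le> real (k n) / 2 ^ (p + n)" for n
    proof -
      have "u < (real (k n) + 1) / 2 ^ (p + n)" using k1(2)[of n] by (simp add: less_divide_eq)
      also have "\<dots> = real (k n) / 2 ^ (p + n) + 1 / 2 ^ (p + n)" by (rule add_divide_distrib)
      also have "\<dots> \<le> real (k n) / 2 ^ (p + n) + 1 / 2 ^ n" by (intro add_left_mono divide_left_mono) (auto simp: power_increasing)
      finally show ?thesis by simp
    qed
    have kj: "k n div 2 ^ n = j" for n
    proof -
      have "real j * 2 ^ n \<le> u * 2 ^ (p + n)" using u(1) by (simp add: power_add divide_le_eq)
      then have "real (j * 2 ^ n) < real (k n) + 1" using k1(2)[of n] by simp
      then have a: "j * 2 ^ n \<le> k n" by linarith
      have "u * 2 ^ p < real (Suc j)" using u(2) by (simp add: less_divide_eq)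
      then have "u * 2 ^ p * 2 ^ n < real (Suc j) * 2 ^ n" by (intro mult_strict_right_mono) auto
      moreover have "u * 2 ^ (p + n) = u * 2 ^ p * 2 ^ n" by (simp add: power_add)
      ultimately have "real (k n) < real (Suc j) * 2 ^ n" using k1(1)[of n] by linarith
      also have "\<dots> = real (Suc j * 2 ^ n)" by (simp only: of_nat_mult of_nat_power of_nat_numeral)
      finally have "real (k n) < real (Suc j * 2 ^ n)" .
      then have b: "k n < Suc j * 2 ^ n" by (simp only: of_nat_less_iff)
      show ?thesis using a b by (intro div_nat_eqI) (auto simp: mult.commute)
    qed
    have kle: "k n \<le> 2 ^ (p + n)" for n
    proof -
      have "u * 2 ^ (p + n) \<le> 1 * 2 ^ (p + n)" by (rule mult_right_mono[OF u01(2)]) simp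
      then have "real (k n) \<le> (2 :: real) ^ (p + n)" using k1(1)[of n] unfolding mult_1 by (rule order_trans[rotated])
      then have "real (k n) \<le> real (2 ^ (p + n))" by (simp only: of_nat_power of_nat_numeral)
      then show ?thesis by (simp only: of_nat_le_iff)
    qed
    have lim: "(\<lambda>n. real (k n) / 2 ^ (p + n)) \<longlonglongrightarrow> u"
    proof (rule tendsto_sandwich[OF _ _ _ tendsto_const])
      show "\<forall>\<^sub>F n in sequentially. u - 1 / 2 ^ n \<le> real (k n) / 2 ^ (p + n)" using d2 by simp
      show "\<forall>\<^sub>F n in sequentially. real (k n) / 2 ^ (p + n) \<le> u" using d1 by simp
      have "(\<lambda>n. u - (1/2) ^ n) \<longlonglongrightarrow> u - 0" by (intro tendsto_intros LIMSEQ_power_zero) auto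
      then show "(\<lambda>n. u - 1 / 2 ^ n) \<longlonglongrightarrow> u" by (simp add: power_divide)
    qed
    have "(\<lambda>n. X (real (k n) / 2 ^ (p + n))) \<longlonglongrightarrow> X u"
    proof (rule continuous_on_tendsto_compose[OF X lim])
      have "real (k n) / 2 ^ (p + n) \<in> {0..1}" for n
        unfolding atLeastAtMost_iff by (rule conjI[OF _ order_trans[OF d1 u01(2)]]) simp
      then show "\<forall>\<^sub>F n in sequentially. real (k n) / 2 ^ (p + n) \<in> {0..1}" by (intro always_eventually allI)
    qed (use u01 in simp)
    then have "(\<lambda>n. norm (X (real (k n) / 2 ^ (p + n)) - X ?a)) \<longlonglongrightarrow> norm (X u - X ?a)" by (intro tendsto_intros)
    moreover have "norm (X (real (k n) / 2 ^ (p + n)) - X ?a) \<le> b" for n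
      using dy[OF kle _ kj, of n] d1[of n] u(3) by linarith
    ultimately show ?thesis by (intro LIMSEQ_le_const2) auto
  qed
  show ?thesis
  proof (cases "u < real (Suc j) / 2 ^ p")
    case True
    then show ?thesis using open_case[of u] u by simp
  next
    case False
    have lt: "?a < u" using False u(1) by (metis atLeastAtMost_iff divide_strict_right_mono lessI less_le_trans not_less of_nat_less_iff zero_less_numeral zero_less_power)
    define v where "v n = u - (u - ?a) / real (Suc n)" for n
    have v: "?a \<le> v n" "v n < u" for n
    proof -
      have "(u - ?a) / real (Suc n) \<le> u - ?a" using lt by (simp add: divide_le_eq mult_left_mono)
      then show "?a \<le> v n" by (simp add: v_def)
      show "v n < u" using lt by (simp add: v_def)
    qed
    have "(\<lambda>n. u - (u - ?a) * inverse (real (Suc n))) \<longlonglongrightarrow> u - (u - ?a) * 0" by (intro tendsto_intros LIMSEQ_inverse_real_of_nat)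
    then have lim: "v \<longlonglongrightarrow> u" by (simp add: v_def[abs_def] divide_inverse)
    have a0: "0 \<le> ?a" by simp
    have "(\<lambda>n. X (v n)) \<longlonglongrightarrow> X u"
    proof (rule continuous_on_tendsto_compose[OF X lim])
      show "u \<in> {0..1}" using u T a0 unfolding atLeastAtMost_iff by linarith
      have "v n \<in> {0..1}" for n using v[of n] u T a0 unfolding atLeastAtMost_iff by linarith
      then show "\<forall>\<^sub>F n in sequentially. v n \<in> {0..1}" by simp
    qed
    then have "(\<lambda>n. norm (X (v n) - X ?a)) \<longlonglongrightarrow> norm (X u - X ?a)" by (intro tendsto_intros)
    moreover have "norm (X (v n) - X ?a) \<le> b" for n
      using open_case[of "v n"] v[of n] u by simp
    ultimately show ?thesis by (intro LIMSEQ_le_const2) auto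
  qed
qed

text \<open>The bound \<open>C1 * sqrt (\<sigma> / \<tau>)\<close> on squared semigroup increments
  is singular at \<open>\<tau> = 0\<close> but integrable in time. What remains is the factor
  \<open>sqrt \<rho>\<close>, the Hoelder modulus of the energy.\<close>

lemma nn_integral_inverse_sqrt:
  fixes s :: real
  assumes s: "0 \<le> s" and \<rho>: "0 \<le> \<rho>"
  shows "(\<integral>\<^sup>+u. ennreal (sqrt (\<rho> / (s - u))) * indicator {0..s} u \<partial>lborel) = ennreal (2 * sqrt \<rho> * sqrt s)"
proof -
  have "(\<integral>\<^sup>+u. ennreal (sqrt (\<rho> / (s - u))) * indicator {0..s} u \<partial>lborel)
      = (\<integral>\<^sup>+v. ennreal (sqrt (\<rho> / v)) * indicator {0..s} v \<partial>lborel)"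
    by (subst nn_integral_real_affine[where c = "-1" and t = s]) (auto intro!: nn_integral_cong split: split_indicator)
  also have "\<dots> = (\<integral>\<^sup>+v. ennreal (sqrt \<rho>) * ennreal (indicator {0..s} v * (v powr (-1/2))) \<partial>lborel)"
    by (intro nn_integral_cong)
      (auto split: split_indicator simp: \<rho> ennreal_mult[symmetric] real_sqrt_divide powr_minus_divide powr_half_sqrt)
  also have "\<dots> = ennreal (sqrt \<rho>) * (\<integral>\<^sup>+v. ennreal (indicator {0..s} v * (v powr (-1/2))) \<partial>lborel)"
    by (rule nn_integral_cmult) measurable
  also have "(\<integral>\<^sup>+v. ennreal (indicator {0..s} v * (v powr (-1/2))) \<partial>lborel) = ennreal (2 * sqrt s)"
  proof -
    have "((\<lambda>x. x powr (-1/2)) has_integral (s powr (-1/2 + 1) / (-1/2 + 1))) {0..s}"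
      by (rule has_integral_powr_from_0) (use s in auto)
    then have "((\<lambda>x. x powr (-1/2)) has_integral (2 * sqrt s)) {0..s}" using s by (simp add: powr_half_sqrt mult.commute)
    then have "((\<lambda>x. if x \<in> {0..s} then x powr (-1/2) else 0) has_integral (2 * sqrt s)) UNIV"
      by (simp only: has_integral_restrict_UNIV)
    then have "(\<integral>\<^sup>+x. ennreal (if x \<in> {0..s} then x powr (-1/2) else 0) \<partial>lborel) = ennreal (2 * sqrt s)"
      by (intro nn_integral_has_integral_lborel) auto
    moreover have "(if x \<in> {0..s} then x powr (-1/2) else 0) = indicator {0..s} x * x powr (-1/2)" for x :: real by simp
    ultimately show ?thesis by simp
  qed
  finally show ?thesis using \<rho> s by (simp add: ennreal_mult[symmetric] mult_ac)
qed

lemma hs_sq_compose: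
  fixes A :: "'h::real_inner \<Rightarrow>\<^sub>L 'k::real_inner"
  shows "hs_sq J (\<lambda>k. A (v k)) \<le> ennreal ((norm A)\<^sup>2) * hs_sq J v"
  unfolding hs_sq_scale[symmetric] by (rule hs_sq_mono) (simp add: norm_blinfun)

lemma grid_indicator:
  fixes m :: nat
  assumes m: "0 < m" and s: "s \<in> {real j / m<..real (Suc j) / m}"
  shows "indicator {real i / m<..real (Suc i) / m} s = (if i = j then 1 else 0 :: real)"
proof (cases "i = j")
  case False
  have "s \<notin> {real i / m<..real (Suc i) / m}"
  proof
    assume s': "s \<in> {real i / m<..real (Suc i) / m}"
    have "real i / m < real (Suc j) / m" "real j / m < real (Suc i) / m" using s s' by auto
    then have "i < Suc j" "j < Suc i" using m by (simp_all add: divide_less_cancel del: of_nat_Suc)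
    then show False using False by simp
  qed
  then show ?thesis using False by simp
qed (use s in simp)

section \<open>Energy and drift estimates for the mild equation\<close>

text \<open>\<open>C\<close> and \<open>C1\<close> are the constants of
  \<open>semigroup_bounded_unit_interval\<close> and \<open>semigroup_increment_bound\<close>; (A2)
  enters through the second.\<close>

locale spde = wiener_filtration M Fil J \<beta>
  for M :: "'a measure" and Fil :: "real \<Rightarrow> 'a measure" and J :: "nat set" and \<beta> :: "nat \<Rightarrow> real \<Rightarrow> 'a \<Rightarrow> real" +
  fixes g :: "nat \<Rightarrow> 'u::{real_inner, banach, second_countable_topology}"
    and S :: "real \<Rightarrow> 'h::{real_inner, banach, second_countable_topology} \<Rightarrow>\<^sub>L 'h"
    and F :: "real \<Rightarrow> 'h \<Rightarrow> 'h" and G :: "'h \<Rightarrow> 'u \<Rightarrow>\<^sub>L 'h" and \<nu> :: "real \<Rightarrow> real" and \<Lambda> :: real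
    and X :: "real \<Rightarrow> 'h \<Rightarrow> real \<Rightarrow> 'a \<Rightarrow> 'h" and C C1 :: real
  assumes basis: "orthonormal_basis J g"
    and semigroup: "strongly_continuous_semigroup S"
    and nu: "\<nu> \<in> L2_unit_interval"
    and Lambda: "\<Lambda> > 0"
    and F_growth: "t \<in> {0..1} \<Longrightarrow> norm (F t x) \<le> \<nu> t * (1 + norm x)"
    and G_hilbert_schmidt: "hilbert_schmidt J g (G x)"
    and G_Lipschitz: "hs_norm J g (G x - G y) \<le> \<Lambda> * norm (x - y)"
    and G_growth: "hs_norm J g (G x) \<le> \<Lambda> * (1 + norm x)"
    and X_solution: "\<epsilon> \<in> {0<..1} \<Longrightarrow> small_time_mild_solution M Fil J g \<beta> S F G \<epsilon> x (X \<epsilon> x)"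
    and A1: "R > 0 \<Longrightarrow> (\<lambda>n. SUP h\<in>ball 0 R. hs_norm J g (G h o\<^sub>L (id_blinfun - basis_projection J g n))) \<longlonglongrightarrow> 0"
    and C: "1 \<le> C" "0 \<le> t \<Longrightarrow> t \<le> 1 \<Longrightarrow> norm (S t) \<le> C"
    and C1: "0 < C1" "0 < \<tau> \<Longrightarrow> 0 \<le> \<sigma> \<Longrightarrow> \<tau> + \<sigma> \<le> 1 \<Longrightarrow> (norm (S (\<tau> + \<sigma>) - S \<tau>))\<^sup>2 \<le> C1 * sqrt (\<sigma> / \<tau>)"
begin

sublocale lipschitz_field G \<Lambda>
proof
  fix x y
  show "0 < \<Lambda>" by (rule Lambda)
  have hs: "norm T \<le> hs_norm J g T" if "hilbert_schmidt J g T" for T :: "'u \<Rightarrow>\<^sub>L 'h"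
  proof (rule norm_blinfun_bound)
    show "0 \<le> hs_norm J g T" unfolding hs_norm_def by (intro real_sqrt_ge_zero infsum_nonneg) auto
    show "norm (T u) \<le> hs_norm J g T * norm u" for u by (rule norm_le_hs_norm[OF basis that])
  qed
  show "norm (G x - G y) \<le> \<Lambda> * norm (x - y)"
    by (rule order_trans[OF hs[OF hilbert_schmidt_diff[OF G_hilbert_schmidt G_hilbert_schmidt]] G_Lipschitz])
  show "norm (G x) \<le> \<Lambda> * (1 + norm x)" by (rule order_trans[OF hs[OF G_hilbert_schmidt] G_growth])
qed

lemma hs_norm_nonneg: "0 \<le> hs_norm J g T"
  unfolding hs_norm_def by (intro real_sqrt_ge_zero infsum_nonneg) auto

lemma hs_G: "norm h \<le> R \<Longrightarrow> hs_sq J (\<lambda>k. G h (g k)) \<le> ennreal ((\<Lambda> * (1 + R))\<^sup>2)"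
proof -
  assume "norm h \<le> R"
  then have "\<Lambda> * (1 + norm h) \<le> \<Lambda> * (1 + R)" using Lambda by (intro mult_left_mono) auto
  then show ?thesis
    unfolding hs_sq_eq_hs_norm[OF G_hilbert_schmidt]
    using G_growth[of h] hs_norm_nonneg by (intro ennreal_leI power_mono) auto
qed

lemma hs_G_diff: "norm (h - h') \<le> d \<Longrightarrow> hs_sq J (\<lambda>k. (G h - G h') (g k)) \<le> ennreal ((\<Lambda> * d)\<^sup>2)"
proof -
  assume "norm (h - h') \<le> d"
  then have "\<Lambda> * norm (h - h') \<le> \<Lambda> * d" using Lambda by (intro mult_left_mono) auto
  then show ?thesis
    unfolding hs_sq_eq_hs_norm[OF hilbert_schmidt_diff[OF G_hilbert_schmidt G_hilbert_schmidt]]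
    using G_Lipschitz[of h h'] hs_norm_nonneg by (intro ennreal_leI power_mono) auto
qed

lemma basis_tail:
  assumes k: "k \<in> J"
  shows "(G h o\<^sub>L (id_blinfun - basis_projection J g n)) (g k) = (if k < n then 0 else G h (g k))"
proof -
  have "basis_projection J g n (g k) = (\<Sum>j\<in>J \<inter> {..<n}. if j = k then g k else 0)"
    unfolding basis_projection_apply
  proof (intro sum.cong refl)
    fix j assume "j \<in> J \<inter> {..<n}"
    then have "g j \<bullet> g k = (if j = k then 1 else 0)" using basis k unfolding orthonormal_basis_def by blast
    then show "(g j \<bullet> g k) *\<^sub>R g j = (if j = k then g k else 0)" by simp
  qed
  also have "\<dots> = (if k < n then g k else 0)" using k by simp
  finally show ?thesis by (simp add: blinfun.diff_left)
qed

text \<open>(A1) is about a real supremum, which bounds its members only if the set is bounded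
  above; the growth condition on \<open>G\<close> provides this.\<close>

lemma uniform_tail:
  assumes R: "0 < R" and \<rho>: "0 < \<rho>"
  obtains n where "\<And>h. norm h < R \<Longrightarrow> hs_sq J (\<lambda>k. if k < n then 0 else G h (g k)) \<le> ennreal (\<rho>\<^sup>2)"
proof -
  let ?T = "\<lambda>h n. G h o\<^sub>L (id_blinfun - basis_projection J g n)"
  have hs: "hilbert_schmidt J g (?T h n)" for h :: "'h" and n :: nat
    unfolding hilbert_schmidt_def
  proof (rule summable_on_comparison_test)
    show "(\<lambda>k. (norm (G h (g k)))\<^sup>2) summable_on J" using G_hilbert_schmidt by (simp add: hilbert_schmidt_def)
    show "(norm (?T h n (g k)))\<^sup>2 \<le> (norm (G h (g k)))\<^sup>2" if "k \<in> J" for k unfolding basis_tail[OF that] by simp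
  qed auto
  have eq: "hs_sq J (\<lambda>k. if k < n then 0 else G h (g k)) = ennreal ((hs_norm J g (?T h n))\<^sup>2)" for h :: "'h" and n :: nat
    unfolding hs_sq_eq_hs_norm[OF hs, symmetric] by (rule hs_sq_cong) (simp only: basis_tail)
  have le: "hs_norm J g (?T h n) \<le> \<Lambda> * (1 + R)" if "h \<in> ball 0 R" for h :: "'h" and n :: nat
  proof -
    have "ennreal ((hs_norm J g (?T h n))\<^sup>2) \<le> hs_sq J (\<lambda>k. G h (g k))"
      unfolding eq[symmetric] by (rule hs_sq_mono) simp
    also have "\<dots> \<le> ennreal ((\<Lambda> * (1 + R))\<^sup>2)" using that by (intro hs_G) simp
    finally have "(hs_norm J g (?T h n))\<^sup>2 \<le> (\<Lambda> * (1 + R))\<^sup>2" by simp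
    then show ?thesis by (rule power2_le_imp_le) (use Lambda R in simp)
  qed
  have "\<forall>\<^sub>F n in sequentially. (SUP h\<in>ball 0 R. hs_norm J g (?T h n)) < \<rho>"
    using A1[OF R] \<rho> by (rule order_tendstoD)
  then obtain n where n: "(SUP h\<in>ball 0 R. hs_norm J g (?T h n)) < \<rho>" by (auto simp: eventually_sequentially)
  show ?thesis
  proof (rule that[of n])
    fix h :: "'h" assume "norm h < R"
    then have h: "h \<in> ball 0 R" by simp
    have "bdd_above ((\<lambda>h. hs_norm J g (?T h n)) ` ball 0 R)" using le by (intro bdd_aboveI2[where M = "\<Lambda> * (1 + R)"])
    then have "hs_norm J g (?T h n) \<le> (SUP h\<in>ball 0 R. hs_norm J g (?T h n))" using h by (intro cSUP_upper)
    then show "hs_sq J (\<lambda>k. if k < n then 0 else G h (g k)) \<le> ennreal (\<rho>\<^sup>2)"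
      unfolding eq using n hs_norm_nonneg by (intro ennreal_leI power_mono) auto
  qed
qed

definition conv :: "real \<Rightarrow> 'h \<Rightarrow> real \<Rightarrow> 'a \<Rightarrow> real \<Rightarrow> nat \<Rightarrow> 'h" where
  "conv \<epsilon> x t \<omega> u k = indicator {0..t} u *\<^sub>R S (\<epsilon> * (t - u)) (G (X \<epsilon> x u \<omega>) (g k))"

definition drift :: "real \<Rightarrow> 'h \<Rightarrow> real \<Rightarrow> 'a \<Rightarrow> 'h" where
  "drift \<epsilon> x t \<omega> = \<epsilon> *\<^sub>R (LINT u:{0..t}|lborel. S (\<epsilon> * (t - u)) (F (\<epsilon> * u) (X \<epsilon> x u \<omega>)))"

text \<open>The integrals are chosen separately for each \<open>t\<close>, hence without regularity
  in \<open>t\<close>. Below, \<open>Z\<close> is evaluated at dyadic times, and continuity is taken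
  from \<open>X\<close>.\<close>

lemma convolution_exists:
  assumes \<epsilon>: "\<epsilon> \<in> {0<..1}"
  obtains Z where "\<And>t. t \<in> {0..1} \<Longrightarrow> ito (conv \<epsilon> x t) (Z t)"
    "\<And>t. t \<in> {0..1} \<Longrightarrow> AE \<omega> in M. X \<epsilon> x t \<omega> = S (\<epsilon> * t) x + drift \<epsilon> x t \<omega> + sqrt \<epsilon> *\<^sub>R Z t \<omega>"
proof -
  note sol = X_solution[OF \<epsilon>, of x, unfolded small_time_mild_solution_def]
  have "\<exists>I. ito (conv \<epsilon> x t) I \<and> (AE \<omega> in M. X \<epsilon> x t \<omega> = S (\<epsilon> * t) x + drift \<epsilon> x t \<omega> + sqrt \<epsilon> *\<^sub>R I \<omega>)"
    if t: "t \<in> {0..1}" for t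
  proof -
    obtain I where I: "has_ito_integral M Fil J g \<beta> t (\<lambda>u \<omega>. S (\<epsilon> * (t - u)) o\<^sub>L G (X \<epsilon> x u \<omega>)) I"
      "AE \<omega> in M. X \<epsilon> x t \<omega> = S (\<epsilon> * t) x + \<epsilon> *\<^sub>R (LINT u:{0..t}|lborel. S (\<epsilon> * (t - u)) (F (\<epsilon> * u) (X \<epsilon> x u \<omega>))) + sqrt \<epsilon> *\<^sub>R I \<omega>"
      using sol t by blast
    have "ito (conv \<epsilon> x t) I"
      using has_ito_integral_imp_ito[OF basis _ _ I(1)] t by (simp add: conv_def[abs_def])
    then show ?thesis using I(2) unfolding drift_def by blast
  qed
  then show ?thesis using that by metis
qed

lemma X_continuous: "\<epsilon> \<in> {0<..1} \<Longrightarrow> \<omega> \<in> space M \<Longrightarrow> continuous_on {0..1} (\<lambda>t. X \<epsilon> x t \<omega>)"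
  using X_solution by (simp add: small_time_mild_solution_def)

lemma X_Fil: "\<epsilon> \<in> {0<..1} \<Longrightarrow> 0 \<le> t \<Longrightarrow> t \<le> 1 \<Longrightarrow> X \<epsilon> x t \<in> borel_measurable (Fil t)"
  using X_solution[of \<epsilon> x] predictable_section[of 1 "X \<epsilon> x" t] by (simp add: small_time_mild_solution_def)

text \<open>For \<open>u\<close> between \<open>s\<close> and \<open>t\<close> the kernel is bounded
  by \<open>C\<close>. For \<open>u < s\<close> the bound on semigroup increments contains the ratio
  of \<open>\<epsilon> * (t - s)\<close> and \<open>\<epsilon> * (s - u)\<close>, in which
  \<epsilon> cancels; hence the modulus is uniform in \<epsilon>.\<close>

lemma energy_increment:
  assumes \<epsilon>: "\<epsilon> \<in> {0<..1}" and st: "0 \<le> s" "s \<le> t" "t \<le> 1" and R: "\<And>u. u \<in> {0..t} \<Longrightarrow> norm (X \<epsilon> x u \<omega>) \<le> R"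
  shows "energy J (\<lambda>\<omega> u k. conv \<epsilon> x t \<omega> u k - conv \<epsilon> x s \<omega> u k) \<omega>
    \<le> ennreal ((\<Lambda> * (1 + R))\<^sup>2 * (C\<^sup>2 + 2 * C1) * sqrt (t - s))"
proof -
  define B where "B = (\<Lambda> * (1 + R))\<^sup>2"
  have B: "0 \<le> B" by (simp add: B_def)
  have eS: "norm (S (\<epsilon> * v)) \<le> C" if "0 \<le> v" "v \<le> 1" for v
    using that \<epsilon> mult_le_one[of \<epsilon> v] by (intro C(2)) auto
  let ?b = "\<lambda>u. ennreal (C\<^sup>2 * B) * indicator {s..t} u + ennreal (C1 * B) * (ennreal (sqrt ((t - s) / (s - u))) * indicator {0..s} u)"
  have pt: "hs_sq J (\<lambda>k. conv \<epsilon> x t \<omega> u k - conv \<epsilon> x s \<omega> u k) \<le> ?b u" if "u \<noteq> s" for u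
  proof -
    consider "u < 0 \<or> t < u" | "s < u" "u \<le> t" | "0 \<le> u" "u < s" using \<open>u \<noteq> s\<close> by linarith
    then show ?thesis
    proof cases
      case 1
      then have "(\<lambda>k. conv \<epsilon> x t \<omega> u k - conv \<epsilon> x s \<omega> u k) = (\<lambda>k. 0)" using st by (auto simp: conv_def)
      then show ?thesis by simp
    next
      case 2
      have "hs_sq J (\<lambda>k. conv \<epsilon> x t \<omega> u k - conv \<epsilon> x s \<omega> u k) = hs_sq J (\<lambda>k. S (\<epsilon> * (t - u)) (G (X \<epsilon> x u \<omega>) (g k)))"
        using 2 st by (simp add: conv_def)
      also have "\<dots> \<le> ennreal ((norm (S (\<epsilon> * (t - u))))\<^sup>2) * hs_sq J (\<lambda>k. G (X \<epsilon> x u \<omega>) (g k))" by (rule hs_sq_compose)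
      also have "\<dots> \<le> ennreal (C\<^sup>2) * ennreal B"
        using 2 st eS[of "t - u"] unfolding B_def by (intro mult_mono ennreal_leI power_mono hs_G R) auto
      finally show ?thesis using 2 st B by (simp add: ennreal_mult)
    next
      case 3
      have "hs_sq J (\<lambda>k. conv \<epsilon> x t \<omega> u k - conv \<epsilon> x s \<omega> u k)
          = hs_sq J (\<lambda>k. (S (\<epsilon> * (t - u)) - S (\<epsilon> * (s - u))) (G (X \<epsilon> x u \<omega>) (g k)))"
        using 3 st by (simp add: conv_def blinfun.diff_left)
      also have "\<dots> \<le> ennreal ((norm (S (\<epsilon> * (t - u)) - S (\<epsilon> * (s - u))))\<^sup>2) * hs_sq J (\<lambda>k. G (X \<epsilon> x u \<omega>) (g k))" by (rule hs_sq_compose)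
      also have "\<dots> \<le> ennreal (C1 * sqrt ((t - s) / (s - u))) * ennreal B"
      proof (intro mult_mono ennreal_leI)
        have "\<epsilon> * (s - u) + \<epsilon> * (t - s) \<le> 1" using \<epsilon> 3 st mult_le_one[of \<epsilon> "t - u"] by (simp add: algebra_simps)
        then have "(norm (S (\<epsilon> * (s - u) + \<epsilon> * (t - s)) - S (\<epsilon> * (s - u))))\<^sup>2 \<le> C1 * sqrt (\<epsilon> * (t - s) / (\<epsilon> * (s - u)))"
          using \<epsilon> 3 st by (intro C1(2)) auto
        moreover have "\<epsilon> * (s - u) + \<epsilon> * (t - s) = \<epsilon> * (t - u)" by (simp add: algebra_simps)
        moreover have "\<epsilon> * (t - s) / (\<epsilon> * (s - u)) = (t - s) / (s - u)" using \<epsilon> by simp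
        ultimately show "(norm (S (\<epsilon> * (t - u)) - S (\<epsilon> * (s - u))))\<^sup>2 \<le> C1 * sqrt ((t - s) / (s - u))" by simp
        show "hs_sq J (\<lambda>k. G (X \<epsilon> x u \<omega>) (g k)) \<le> ennreal B" unfolding B_def using 3 st by (intro hs_G R) auto
      qed auto
      also have "\<dots> = ennreal (C1 * B) * ennreal (sqrt ((t - s) / (s - u)))"
        using 3 st B C1(1) by (simp add: ennreal_mult[symmetric] mult_ac)
      finally show ?thesis using 3 st by simp
    qed
  qed
  have "energy J (\<lambda>\<omega> u k. conv \<epsilon> x t \<omega> u k - conv \<epsilon> x s \<omega> u k) \<omega> \<le> (\<integral>\<^sup>+u. ?b u \<partial>lborel)"
    unfolding energy_def using AE_lborel_singleton[of s] by (intro nn_integral_mono_AE) (auto elim!: eventually_mono intro: pt)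
  also have "\<dots> = (\<integral>\<^sup>+u. ennreal (C\<^sup>2 * B) * indicator {s..t} u \<partial>lborel)
      + (\<integral>\<^sup>+u. ennreal (C1 * B) * (ennreal (sqrt ((t - s) / (s - u))) * indicator {0..s} u) \<partial>lborel)"
    by (rule nn_integral_add) measurable
  also have "(\<integral>\<^sup>+u. ennreal (C\<^sup>2 * B) * indicator {s..t} u \<partial>lborel) = ennreal (C\<^sup>2 * B) * ennreal (t - s)"
    using st by (simp add: nn_integral_cmult_indicator)
  also have "(\<integral>\<^sup>+u. ennreal (C1 * B) * (ennreal (sqrt ((t - s) / (s - u))) * indicator {0..s} u) \<partial>lborel)
      = ennreal (C1 * B) * (\<integral>\<^sup>+u. ennreal (sqrt ((t - s) / (s - u))) * indicator {0..s} u \<partial>lborel)"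
    by (rule nn_integral_cmult) measurable
  also have "(\<integral>\<^sup>+u. ennreal (sqrt ((t - s) / (s - u))) * indicator {0..s} u \<partial>lborel) = ennreal (2 * sqrt (t - s) * sqrt s)"
    using st by (intro nn_integral_inverse_sqrt) auto
  also have "ennreal (C\<^sup>2 * B) * ennreal (t - s) + ennreal (C1 * B) * ennreal (2 * sqrt (t - s) * sqrt s)
      = ennreal (C\<^sup>2 * B * (t - s) + C1 * B * (2 * sqrt (t - s) * sqrt s))"
  proof -
    have n: "0 \<le> C\<^sup>2 * B" "0 \<le> t - s" "0 \<le> C1 * B" "0 \<le> 2 * sqrt (t - s) * sqrt s" using B C1(1) st by simp_all
    show ?thesis by (simp only: n mult_nonneg_nonneg ennreal_mult[symmetric] ennreal_plus[symmetric])
  qed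
  also have "\<dots> \<le> ennreal (B * (C\<^sup>2 + 2 * C1) * sqrt (t - s))"
  proof (rule ennreal_leI)
    have d: "t - s \<le> sqrt (t - s)" using st real_sqrt_le_mono[of "(t - s)\<^sup>2" "t - s"] by (simp add: power2_eq_square mult_left_le)
    have "C\<^sup>2 * B * (t - s) \<le> C\<^sup>2 * B * sqrt (t - s)" using d B by (intro mult_left_mono) auto
    moreover have "C1 * B * (2 * sqrt (t - s) * sqrt s) \<le> C1 * B * (2 * sqrt (t - s) * 1)"
      using st B C1(1) by (intro mult_left_mono) auto
    ultimately show "C\<^sup>2 * B * (t - s) + C1 * B * (2 * sqrt (t - s) * sqrt s) \<le> B * (C\<^sup>2 + 2 * C1) * sqrt (t - s)"
      by (simp add: algebra_simps)
  qed
  finally show ?thesis by (simp add: B_def)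
qed

text \<open>Solution and semigroup are frozen at the left ends of the grid intervals, and the
  coordinates below \<open>n\<close> are kept. The integral \<open>grid_sum\<close> is thus a finite
  expression in the Brownian increments that also define the control.\<close>

definition grid_term :: "real \<Rightarrow> 'h \<Rightarrow> nat \<Rightarrow> nat \<Rightarrow> nat \<Rightarrow> 'a \<Rightarrow> real \<Rightarrow> nat \<Rightarrow> 'h" where
  "grid_term \<epsilon> x m n i \<omega> u k = (\<Sum>j<i. \<Sum>l\<in>J \<inter> {..<n}. (if k = l then indicator {real j / m<..real (Suc j) / m} u else 0)
     *\<^sub>R S (\<epsilon> * (real i / m - real j / m)) (G (X \<epsilon> x (real j / m) \<omega>) (g l)))"

definition grid_sum :: "real \<Rightarrow> 'h \<Rightarrow> nat \<Rightarrow> nat \<Rightarrow> nat \<Rightarrow> 'a \<Rightarrow> 'h" where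
  "grid_sum \<epsilon> x m n i \<omega> = (\<Sum>j<i. \<Sum>l\<in>J \<inter> {..<n}. (\<beta> l (real (Suc j) / m) \<omega> - \<beta> l (real j / m) \<omega>)
     *\<^sub>R S (\<epsilon> * (real i / m - real j / m)) (G (X \<epsilon> x (real j / m) \<omega>) (g l)))"

lemma ito_grid:
  assumes \<epsilon>: "\<epsilon> \<in> {0<..1}" and i: "i \<le> m" and m: "0 < m"
  shows "ito (grid_term \<epsilon> x m n i) (grid_sum \<epsilon> x m n i)"
  unfolding grid_term_def[abs_def] grid_sum_def[abs_def]
proof (intro ito_sum ito_rectangle)
  fix j l assume j: "j \<in> {..<i}" and l: "l \<in> J \<inter> {..<n}"
  show "0 \<le> real j / m" "real j / m \<le> real (Suc j) / m" "l \<in> J" using l by (auto simp: divide_right_mono)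
  show "real (Suc j) / m \<le> 1" using j i m by simp
  have "real j / m \<le> 1" using j i m by simp
  then have Xm: "X \<epsilon> x (real j / m) \<in> borel_measurable (Fil (real j / m))" by (intro X_Fil \<epsilon>) auto
  have "continuous_on UNIV (\<lambda>y. S (\<epsilon> * (real i / m - real j / m)) (G y (g l)))"
    by (intro continuous_intros G_continuous)
  from borel_measurable_continuous_on[OF this Xm]
  show "(\<lambda>\<omega>. S (\<epsilon> * (real i / m - real j / m)) (G (X \<epsilon> x (real j / m) \<omega>) (g l))) \<in> borel_measurable (Fil (real j / m))" .
qed auto

text \<open>The error splits into \<open>?p\<close>, where the solution moves within a grid
  interval, \<open>?q\<close>, where the semigroup does, and \<open>?r\<close>, the coordinates from
  \<open>n\<close> on, which (A1) makes small. Two uses of \<open>hs_sq_add2\<close> give the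
  weights 2, 4 and 4, the first rounded up to 4; the singularity in \<open>?q\<close> is integrated
  by \<open>nn_integral_inverse_sqrt\<close>.\<close>

lemma energy_grid:
  assumes \<epsilon>: "\<epsilon> \<in> {0<..1}" and i: "i \<le> m" and m: "0 < m"
    and R: "\<And>u. u \<in> {0..real i / m} \<Longrightarrow> norm (X \<epsilon> x u \<omega>) \<le> R"
    and md: "\<And>j u. j < i \<Longrightarrow> u \<in> {real j / m..real (Suc j) / m} \<Longrightarrow> norm (X \<epsilon> x u \<omega> - X \<epsilon> x (real j / m) \<omega>) \<le> md"
    and tail: "\<And>h. norm h \<le> R \<Longrightarrow> hs_sq J (\<lambda>k. if k < n then 0 else G h (g k)) \<le> ennreal (\<rho>\<^sup>2)"
  shows "energy J (\<lambda>\<omega> u k. conv \<epsilon> x (real i / m) \<omega> u k - grid_term \<epsilon> x m n i \<omega> u k) \<omega>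
    \<le> ennreal (4 * C\<^sup>2 * (\<Lambda> * md)\<^sup>2 + 4 * C\<^sup>2 * \<rho>\<^sup>2 + 8 * C1 * (\<Lambda> * (1 + R))\<^sup>2 * sqrt (1 / real m))"
proof -
  define B where "B = (\<Lambda> * (1 + R))\<^sup>2"
  define A where "A = 4 * C\<^sup>2 * (\<Lambda> * md)\<^sup>2 + 4 * C\<^sup>2 * \<rho>\<^sup>2"
  have B: "0 \<le> B" and A: "0 \<le> A" by (simp_all add: B_def A_def)
  let ?t = "real i / m"
  have t1: "0 \<le> ?t" "?t \<le> 1" using i m by simp_all
  have eS: "norm (S (\<epsilon> * v)) \<le> C" if "0 \<le> v" "v \<le> 1" for v
    using that \<epsilon> mult_le_one[of \<epsilon> v] by (intro C(2)) auto
  let ?b = "\<lambda>u. ennreal A * indicator {0..?t} u + ennreal (4 * C1 * B) * (ennreal (sqrt ((1 / real m) / (?t - u))) * indicator {0..?t} u)"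
  \<comment> \<open>At \<open>u = ?t\<close> the semigroup estimate is singular, and
    \<open>u = 0\<close> is missed by the half-open grid intervals; both points are null
    sets.\<close>
  have pt: "hs_sq J (\<lambda>k. conv \<epsilon> x ?t \<omega> u k - grid_term \<epsilon> x m n i \<omega> u k) \<le> ?b u" if u: "u \<noteq> ?t" "u \<noteq> 0" for u
  proof (cases "0 < u \<and> u < ?t")
    case False
    have "grid_term \<epsilon> x m n i \<omega> u k = 0" for k
      unfolding grid_term_def
    proof (intro sum.neutral ballI)
      fix j l assume j: "j \<in> {..<i}"
      have "0 \<le> real j / m" "real (Suc j) / m \<le> ?t" using j m by (auto simp: divide_right_mono simp del: of_nat_Suc)
      then have "u \<notin> {real j / m<..real (Suc j) / m}" using False u unfolding greaterThanAtMost_iff by linarith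
      then show "(if k = l then indicator {real j / m<..real (Suc j) / m} u else 0)
          *\<^sub>R S (\<epsilon> * (?t - real j / m)) (G (X \<epsilon> x (real j / m) \<omega>) (g l)) = 0" by simp
    qed
    moreover have "conv \<epsilon> x ?t \<omega> u k = 0" for k using False u by (auto simp: conv_def indicator_def)
    ultimately show ?thesis by simp
  next
    case True
    then obtain j where j: "j < m" "u \<in> {real j / m<..real (Suc j) / m}" using grid_interval_exists[of u m] t1 m by auto
    have "real j / m < real i / m" using j(2) True by auto
    then have ji: "j < i" using m by (simp add: divide_less_cancel)
    let ?a = "real j / m" and ?u = "X \<epsilon> x u \<omega>" and ?j = "X \<epsilon> x (real j / m) \<omega>"
    let ?S1 = "S (\<epsilon> * (?t - u))" and ?S2 = "S (\<epsilon> * (?t - ?a))"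
    have a: "0 \<le> ?a" "?a < u" "u - ?a \<le> 1 / real m" using j(2) by (auto simp: add_divide_distrib)
    have gt: "grid_term \<epsilon> x m n i \<omega> u k = (if k < n then ?S2 (G ?j (g k)) else 0)" if k: "k \<in> J" for k
    proof -
      have "grid_term \<epsilon> x m n i \<omega> u k = (\<Sum>j'<i. \<Sum>l\<in>J \<inter> {..<n}. if k = l then (if j' = j then ?S2 (G ?j (g k)) else 0) else 0)"
        unfolding grid_term_def by (intro sum.cong refl) (use grid_indicator[OF m j(2)] in auto)
      also have "\<dots> = (\<Sum>j'<i. if k < n then (if j' = j then ?S2 (G ?j (g k)) else 0) else 0)"
        using k by (intro sum.cong refl) simp
      also have "\<dots> = (if k < n then ?S2 (G ?j (g k)) else 0)" using ji by simp
      finally show ?thesis .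
    qed
    let ?p = "\<lambda>k. ?S1 ((G ?u - G ?j) (g k))" and ?q = "\<lambda>k. (?S1 - ?S2) (G ?j (g k))"
      and ?r = "\<lambda>k. ?S2 (if k < n then 0 else G ?j (g k))"
    have tu: "?t - u \<le> 1" "?t - ?a \<le> 1" using a True t1 by linarith+
    have Rj: "norm ?j \<le> R" "norm ?u \<le> R" using a True by (auto intro!: R)
    have p: "hs_sq J ?p \<le> ennreal (C\<^sup>2) * ennreal ((\<Lambda> * md)\<^sup>2)"
      using tu(1) True eS[of "?t - u"] j(2) md[OF ji, of u]
      by (intro order_trans[OF hs_sq_compose[where A = ?S1]] mult_mono ennreal_leI power_mono hs_G_diff) auto
    have r: "hs_sq J ?r \<le> ennreal (C\<^sup>2) * ennreal (\<rho>\<^sup>2)"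
      using tu(2) True a eS[of "?t - ?a"]
      by (intro order_trans[OF hs_sq_compose[where A = ?S2]] mult_mono ennreal_leI power_mono tail Rj) auto
    have q: "hs_sq J ?q \<le> ennreal (C1 * sqrt ((1 / real m) / (?t - u))) * ennreal B"
    proof (intro order_trans[OF hs_sq_compose[where A = "?S1 - ?S2"]] mult_mono ennreal_leI)
      have "\<epsilon> * (?t - u) + \<epsilon> * (u - ?a) = \<epsilon> * (?t - ?a)" by (simp add: algebra_simps)
      moreover have "\<epsilon> * (?t - ?a) \<le> 1" by (rule mult_le_one) (use \<epsilon> a True tu in auto)
      ultimately have "\<epsilon> * (?t - u) + \<epsilon> * (u - ?a) \<le> 1" by (simp only:)
      then have "(norm (S (\<epsilon> * (?t - u) + \<epsilon> * (u - ?a)) - ?S1))\<^sup>2 \<le> C1 * sqrt (\<epsilon> * (u - ?a) / (\<epsilon> * (?t - u)))"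
        using \<epsilon> a True by (intro C1(2)) auto
      moreover have "\<epsilon> * (?t - u) + \<epsilon> * (u - ?a) = \<epsilon> * (?t - ?a)" by (simp add: algebra_simps)
      moreover have "\<epsilon> * (u - ?a) / (\<epsilon> * (?t - u)) = (u - ?a) / (?t - u)" using \<epsilon> by simp
      ultimately have "(norm (?S2 - ?S1))\<^sup>2 \<le> C1 * sqrt ((u - ?a) / (?t - u))" by (simp only:)
      also have "\<dots> \<le> C1 * sqrt ((1 / real m) / (?t - u))"
        using a(3) True C1(1) by (intro mult_left_mono real_sqrt_le_mono divide_right_mono) auto
      finally show "(norm (?S1 - ?S2))\<^sup>2 \<le> C1 * sqrt ((1 / real m) / (?t - u))" by (simp only: norm_minus_commute)
      show "hs_sq J (\<lambda>k. G ?j (g k)) \<le> ennreal B" unfolding B_def by (intro hs_G Rj)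
    qed auto
    have "hs_sq J (\<lambda>k. conv \<epsilon> x ?t \<omega> u k - grid_term \<epsilon> x m n i \<omega> u k) = hs_sq J (\<lambda>k. ?p k + (?q k + ?r k))"
    proof (rule hs_sq_cong)
      fix k assume k: "k \<in> J"
      have "conv \<epsilon> x ?t \<omega> u k - grid_term \<epsilon> x m n i \<omega> u k = ?p k + (?q k + ?r k)"
        unfolding gt[OF k] using True by (simp add: conv_def blinfun.diff_left blinfun.diff_right)
      then show "norm (conv \<epsilon> x ?t \<omega> u k - grid_term \<epsilon> x m n i \<omega> u k) = norm (?p k + (?q k + ?r k))" by simp
    qed
    also have "\<dots> \<le> 2 * hs_sq J ?p + 2 * hs_sq J (\<lambda>k. ?q k + ?r k)" by (rule hs_sq_add2)
    also have "\<dots> \<le> 2 * hs_sq J ?p + 2 * (2 * hs_sq J ?q + 2 * hs_sq J ?r)"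
      by (intro add_left_mono mult_left_mono hs_sq_add2) simp
    also have "\<dots> \<le> 4 * (ennreal (C\<^sup>2) * ennreal ((\<Lambda> * md)\<^sup>2)) + 2 * (2 * (ennreal (C1 * sqrt ((1 / real m) / (?t - u))) * ennreal B)
        + 2 * (ennreal (C\<^sup>2) * ennreal (\<rho>\<^sup>2)))"
      by (intro add_mono mult_mono p q r) auto
    also have "\<dots> = ennreal (4 * (C\<^sup>2 * (\<Lambda> * md)\<^sup>2) + 2 * (2 * (C1 * sqrt ((1 / real m) / (?t - u)) * B) + 2 * (C\<^sup>2 * \<rho>\<^sup>2)))"
    proof -
      have n: "0 \<le> C1 * sqrt ((1 / real m) / (?t - u))" "0 \<le> C\<^sup>2" "0 \<le> (\<Lambda> * md)\<^sup>2" "0 \<le> \<rho>\<^sup>2" "(0 :: real) \<le> 4" "(0 :: real) \<le> 2"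
        using True C1(1) by simp_all
      have e: "4 = ennreal 4" "2 = ennreal 2" by simp_all
      show ?thesis unfolding e by (simp only: n B mult_nonneg_nonneg add_nonneg_nonneg ennreal_mult[symmetric] ennreal_plus[symmetric])
    qed
    also have "\<dots> = ennreal (A + 4 * C1 * B * sqrt ((1 / real m) / (?t - u)))" by (simp add: A_def algebra_simps)
    also have "\<dots> = ennreal A + ennreal (4 * C1 * B) * ennreal (sqrt ((1 / real m) / (?t - u)))"
    proof -
      have n: "0 \<le> 4 * C1 * B" "0 \<le> sqrt ((1 / real m) / (?t - u))" using True C1(1) B by simp_all
      show ?thesis by (simp only: n A mult_nonneg_nonneg ennreal_mult ennreal_plus)
    qed
    finally show ?thesis using True by simp
  qed
  have "energy J (\<lambda>\<omega> u k. conv \<epsilon> x ?t \<omega> u k - grid_term \<epsilon> x m n i \<omega> u k) \<omega> \<le> (\<integral>\<^sup>+u. ?b u \<partial>lborel)"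
    unfolding energy_def
  proof (rule nn_integral_mono_AE)
    show "AE u in lborel. hs_sq J (\<lambda>k. conv \<epsilon> x ?t \<omega> u k - grid_term \<epsilon> x m n i \<omega> u k) \<le> ?b u"
      using AE_lborel_singleton[of ?t] AE_lborel_singleton[of 0] by eventually_elim (rule pt)
  qed
  also have "\<dots> = (\<integral>\<^sup>+u. ennreal A * indicator {0..?t} u \<partial>lborel)
      + (\<integral>\<^sup>+u. ennreal (4 * C1 * B) * (ennreal (sqrt ((1 / real m) / (?t - u))) * indicator {0..?t} u) \<partial>lborel)"
    by (rule nn_integral_add) measurable
  also have "(\<integral>\<^sup>+u. ennreal A * indicator {0..?t} u \<partial>lborel) = ennreal A * ennreal ?t"
    using t1 by (simp add: nn_integral_cmult_indicator)
  also have "(\<integral>\<^sup>+u. ennreal (4 * C1 * B) * (ennreal (sqrt ((1 / real m) / (?t - u))) * indicator {0..?t} u) \<partial>lborel)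
      = ennreal (4 * C1 * B) * (\<integral>\<^sup>+u. ennreal (sqrt ((1 / real m) / (?t - u))) * indicator {0..?t} u \<partial>lborel)"
    by (rule nn_integral_cmult) measurable
  also have "(\<integral>\<^sup>+u. ennreal (sqrt ((1 / real m) / (?t - u))) * indicator {0..?t} u \<partial>lborel) = ennreal (2 * sqrt (1 / real m) * sqrt ?t)"
    using t1 by (intro nn_integral_inverse_sqrt) auto
  also have "ennreal A * ennreal ?t + ennreal (4 * C1 * B) * ennreal (2 * sqrt (1 / real m) * sqrt ?t)
      = ennreal (A * ?t + 4 * C1 * B * (2 * sqrt (1 / real m) * sqrt ?t))"
  proof -
    have n: "0 \<le> 4 * C1 * B" "0 \<le> 2 * sqrt (1 / real m) * sqrt ?t" using t1 C1(1) B by simp_all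
    show ?thesis by (simp only: n A t1 mult_nonneg_nonneg ennreal_mult[symmetric] ennreal_plus[symmetric])
  qed
  also have "\<dots> \<le> ennreal (A + 8 * C1 * B * sqrt (1 / real m))"
  proof (rule ennreal_leI)
    have "A * ?t \<le> A * 1" using A t1 by (intro mult_left_mono) auto
    moreover have "4 * C1 * B * (2 * sqrt (1 / real m) * sqrt ?t) \<le> 4 * C1 * B * (2 * sqrt (1 / real m) * 1)"
      using t1 C1(1) B by (intro mult_left_mono) auto
    ultimately show "A * ?t + 4 * C1 * B * (2 * sqrt (1 / real m) * sqrt ?t) \<le> A + 8 * C1 * B * sqrt (1 / real m)" by simp
  qed
  finally show ?thesis by (simp add: A_def B_def)
qed

lemma nu_integrable: "\<nu> integrable_on {0..1}"
proof -
  have fm: "finite_measure (lebesgue_on {0..1::real})" by (rule finite_measureI) (simp add: emeasure_restrict_space)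
  have m: "\<nu> \<in> borel_measurable (lebesgue_on {0..1})" and i: "integrable (lebesgue_on {0..1}) (\<lambda>t. (\<nu> t)\<^sup>2)"
    using nu unfolding L2_unit_interval_def by simp_all
  have "integrable (lebesgue_on {0..1}) \<nu>" by (rule finite_measure.square_integrable_imp_integrable[OF fm m i])
  then show ?thesis by (rule integrable_on_lebesgue_on) simp
qed

lemma nu_nonneg: "t \<in> {0..1} \<Longrightarrow> 0 \<le> \<nu> t"
  using order_trans[OF norm_ge_zero F_growth[of t 0]] by simp

text \<open>Substituting \<open>\<epsilon> * u\<close> turns \<open>\<epsilon>\<close> times the
  integral of \<open>\<nu> (\<epsilon> * u)\<close> over [0, 1] into the integral of
  \<open>\<nu>\<close> over \<open>[0, \<epsilon>]\<close>. So the drift vanishes with \<epsilon>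
  although \<open>\<nu>\<close> may be unbounded.\<close>

lemma drift_bound:
  assumes \<epsilon>: "\<epsilon> \<in> {0<..1}" and t: "t \<in> {0..1}" and R: "\<And>u. u \<in> {0..t} \<Longrightarrow> norm (X \<epsilon> x u \<omega>) \<le> R"
  shows "norm (drift \<epsilon> x t \<omega>) \<le> C * (1 + R) * integral {0..\<epsilon>} \<nu>"
proof -
  let ?f = "\<lambda>u. S (\<epsilon> * (t - u)) (F (\<epsilon> * u) (X \<epsilon> x u \<omega>))"
  have R0: "0 \<le> R" by (rule order_trans[OF norm_ge_zero R[of 0]]) (use t in simp)
  have nui: "\<nu> integrable_on {0..\<epsilon>}" by (rule integrable_on_subinterval[OF nu_integrable]) (use \<epsilon> in auto)
  have "((\<lambda>u. \<nu> (\<epsilon> * u)) has_integral (1 / \<bar>\<epsilon>\<bar>) *\<^sub>R integral {0..\<epsilon>} \<nu>) ((\<lambda>u. u / \<epsilon>) ` {0..\<epsilon>})"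
    using has_integral_stretch_real[OF integrable_integral[OF nui], of \<epsilon>] \<epsilon> by simp
  moreover have "(\<lambda>u. u / \<epsilon>) ` {0..\<epsilon>} = {0..1}"
  proof (intro equalityI subsetI)
    fix u assume "u \<in> {0..1::real}"
    then show "u \<in> (\<lambda>u. u / \<epsilon>) ` {0..\<epsilon>}" using \<epsilon> by (intro image_eqI[of _ _ "\<epsilon> * u"]) (auto simp: mult_left_le)
  qed (use \<epsilon> in auto)
  ultimately have str: "((\<lambda>u. \<nu> (\<epsilon> * u)) has_integral integral {0..\<epsilon>} \<nu> / \<epsilon>) {0..1}" using \<epsilon> by simp
  have eu: "\<epsilon> * u \<in> {0..1}" if "u \<in> {0..1}" for u using that \<epsilon> mult_le_one[of \<epsilon> u] by simp
  have pt: "norm (?f u) \<le> C * (1 + R) * \<nu> (\<epsilon> * u)" if u: "u \<in> {0..t}" for u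
  proof -
    have u1: "u \<in> {0..1}" using u t by auto
    have "norm (?f u) \<le> norm (S (\<epsilon> * (t - u))) * norm (F (\<epsilon> * u) (X \<epsilon> x u \<omega>))" by (rule norm_blinfun)
    also have "\<dots> \<le> C * (\<nu> (\<epsilon> * u) * (1 + R))"
    proof (intro mult_mono)
      show "norm (S (\<epsilon> * (t - u))) \<le> C" using u t \<epsilon> mult_le_one[of \<epsilon> "t - u"] by (intro C(2)) auto
      have "norm (F (\<epsilon> * u) (X \<epsilon> x u \<omega>)) \<le> \<nu> (\<epsilon> * u) * (1 + norm (X \<epsilon> x u \<omega>))" by (rule F_growth[OF eu[OF u1]])
      also have "\<dots> \<le> \<nu> (\<epsilon> * u) * (1 + R)" using R[OF u] nu_nonneg[OF eu[OF u1]] by (intro mult_left_mono) auto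
      finally show "norm (F (\<epsilon> * u) (X \<epsilon> x u \<omega>)) \<le> \<nu> (\<epsilon> * u) * (1 + R)" .
    qed (use C in auto)
    finally show ?thesis by (simp add: mult_ac)
  qed
  have main: "norm (LINT u:{0..t}|lborel. ?f u) \<le> C * (1 + R) * (integral {0..\<epsilon>} \<nu> / \<epsilon>)"
  proof (cases "set_integrable lborel {0..t} ?f")
    case True
    have "norm (LINT u:{0..t}|lborel. ?f u) \<le> (LINT u:{0..t}|lborel. norm (?f u))"
      by (rule set_integral_norm_bound[OF True])
    also have "\<dots> = integral {0..t} (\<lambda>u. norm (?f u))"
      by (rule set_borel_integral_eq_integral(2)[OF set_integrable_norm[OF True]])
    also have "\<dots> \<le> integral {0..t} (\<lambda>u. C * (1 + R) * \<nu> (\<epsilon> * u))"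
    proof (rule integral_le)
      show "(\<lambda>u. norm (?f u)) integrable_on {0..t}" by (rule set_borel_integral_eq_integral(1)[OF set_integrable_norm[OF True]])
      have "(\<lambda>u. \<nu> (\<epsilon> * u)) integrable_on {0..t}"
        by (rule integrable_on_subinterval[OF has_integral_integrable[OF str]]) (use t in auto)
      then show "(\<lambda>u. C * (1 + R) * \<nu> (\<epsilon> * u)) integrable_on {0..t}" by (rule integrable_on_mult_right)
    qed (rule pt)
    also have "\<dots> = C * (1 + R) * integral {0..t} (\<lambda>u. \<nu> (\<epsilon> * u))" by simp
    also have "integral {0..t} (\<lambda>u. \<nu> (\<epsilon> * u)) \<le> integral {0..1} (\<lambda>u. \<nu> (\<epsilon> * u))"
      using t eu nu_nonneg has_integral_integrable[OF str]
      by (intro integral_subset_le integrable_on_subinterval[OF has_integral_integrable[OF str]]) auto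
    also have "integral {0..1} (\<lambda>u. \<nu> (\<epsilon> * u)) = integral {0..\<epsilon>} \<nu> / \<epsilon>" by (rule integral_unique[OF str])
    finally show ?thesis using C R0 by (simp add: mult_left_mono)
  next
    \<comment> \<open>A Bochner integral that does not exist has the value 0, and the bound is then
      trivial.\<close>
    case False
    then have "(LINT u:{0..t}|lborel. ?f u) = 0"
      unfolding set_lebesgue_integral_def set_integrable_def by (rule not_integrable_integral_eq)
    moreover have "0 \<le> integral {0..\<epsilon>} \<nu>" using \<epsilon> nu_nonneg by (intro integral_nonneg nui) auto
    ultimately show ?thesis using \<epsilon> C R0 by simp
  qed
  have "norm (drift \<epsilon> x t \<omega>) = \<epsilon> * norm (LINT u:{0..t}|lborel. ?f u)" using \<epsilon> by (simp add: drift_def)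
  also have "\<dots> \<le> \<epsilon> * (C * (1 + R) * (integral {0..\<epsilon>} \<nu> / \<epsilon>))" using \<epsilon> by (intro mult_left_mono main) auto
  finally show ?thesis using \<epsilon> by simp
qed

lemma nu_integral_small:
  assumes "0 < e"
  obtains d where "0 < d" "d \<le> 1" "\<And>\<epsilon>. 0 < \<epsilon> \<Longrightarrow> \<epsilon> \<le> d \<Longrightarrow> integral {0..\<epsilon>} \<nu> < e"
proof -
  have "continuous_on {0..1} (\<lambda>t. integral {0..t} \<nu>)" by (rule indefinite_integral_continuous_1[OF nu_integrable])
  then obtain d where d: "0 < d" "\<And>t. t \<in> {0..1} \<Longrightarrow> dist t 0 < d \<Longrightarrow> dist (integral {0..t} \<nu>) (integral {0..0} \<nu>) < e"
    unfolding continuous_on_iff using assms by (metis atLeastAtMost_iff order_refl zero_le_one)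
  show ?thesis
  proof (rule that[of "min 1 (d / 2)"])
    fix \<epsilon> assume "0 < \<epsilon>" "\<epsilon> \<le> min 1 (d / 2)"
    then have "dist (integral {0..\<epsilon>} \<nu>) (integral {0..0} \<nu>) < e" using d by (intro d(2)) (auto simp: dist_real_def)
    then show "integral {0..\<epsilon>} \<nu> < e" by (simp add: dist_real_def)
  qed (use d in auto)
qed

end

section \<open>Probabilities of the exceptional events\<close>

context spde
begin

lemma tail_event:
  assumes f: "ito f Y" and \<kappa>: "0 < \<kappa>" and a: "0 < a" and \<epsilon>: "0 < \<epsilon>"
  shows "{\<omega>\<in>space M. a < sqrt \<epsilon> * norm (Y \<omega>) \<and> energy J f \<omega> \<le> ennreal \<kappa>} \<in> sets M"
    and "prob {\<omega>\<in>space M. a < sqrt \<epsilon> * norm (Y \<omega>) \<and> energy J f \<omega> \<le> ennreal \<kappa>} \<le> 2 * exp (- (a\<^sup>2 / (4 * \<kappa>)) / \<epsilon>)"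
proof -
  note [measurable] = ito_measurable[OF f] energy_measurable[OF ito_jointly_measurable[OF f]]
  show "{\<omega>\<in>space M. a < sqrt \<epsilon> * norm (Y \<omega>) \<and> energy J f \<omega> \<le> ennreal \<kappa>} \<in> sets M" by measurable
  have "{\<omega>\<in>space M. a < sqrt \<epsilon> * norm (Y \<omega>) \<and> energy J f \<omega> \<le> ennreal \<kappa>}
      = {\<omega>\<in>space M. a / sqrt \<epsilon> < norm (Y \<omega>) \<and> energy J f \<omega> \<le> ennreal \<kappa>}"
    using \<epsilon> by (simp add: pos_divide_less_eq mult.commute)
  moreover have "(a / sqrt \<epsilon>)\<^sup>2 = a\<^sup>2 / \<epsilon>" using \<epsilon> by (simp add: power_divide)
  ultimately show "prob {\<omega>\<in>space M. a < sqrt \<epsilon> * norm (Y \<omega>) \<and> energy J f \<omega> \<le> ennreal \<kappa>} \<le> 2 * exp (- (a\<^sup>2 / (4 * \<kappa>)) / \<epsilon>)"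
    using ito_tail[OF f \<kappa>, of "a / sqrt \<epsilon>"] a \<epsilon> by (simp add: field_simps)
qed

text \<open>At level \<open>q\<close> the squared threshold over four times the energy level is
  \<open>r * (81/100 * sqrt 2)^q\<close>, at least \<open>r * (1 + q/10)\<close> by Bernoulli, since
  0.81 times 1.4 exceeds 1.1. The base 9/10 is large enough for this growth and still gives summable
  thresholds. By \<open>small\<close> an event of level \<open>q\<close> carries a factor
  \<open>(1/4)^q\<close> against \<open>2^q\<close> intervals; with the 2 of the tail bound the
  levels sum up to 4.\<close>

lemma increment_events:
  assumes Z: "\<And>t. t \<in> {0..1} \<Longrightarrow> ito (conv \<epsilon> x t) (Z t)" and \<epsilon>: "0 < \<epsilon>" and r: "0 < r" and B: "0 < B"
    and l: "0 < l" "l\<^sup>2 = 4 * B * r" and small: "exp (- r / (10 * \<epsilon>)) \<le> 1 / 4"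
  defines "A \<equiv> \<lambda>q k. {\<omega>\<in>space M. l * (9/10) ^ q < sqrt \<epsilon> * norm (Z (real (Suc k) / 2 ^ q) \<omega> - Z (real k / 2 ^ q) \<omega>) \<and>
      energy J (\<lambda>\<omega> u j. conv \<epsilon> x (real (Suc k) / 2 ^ q) \<omega> u j - conv \<epsilon> x (real k / 2 ^ q) \<omega> u j) \<omega>
        \<le> ennreal (B * sqrt (1 / 2 ^ q))}"
  shows "(\<Union>q. \<Union>k<2 ^ q. A q k) \<in> sets M" "prob (\<Union>q. \<Union>k<2 ^ q. A q k) \<le> 4 * exp (- r / \<epsilon>)"
proof -
  have in01: "real k / 2 ^ q \<in> {0..1}" if "k \<le> 2 ^ q" for k q :: nat
  proof -
    have "real k \<le> 2 ^ q" using that by (metis numeral_power_le_of_nat_cancel_iff of_nat_le_iff of_nat_numeral of_nat_power)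
    then show ?thesis by simp
  qed
  have A: "A q k \<in> sets M" "prob (A q k) \<le> 2 * exp (- r / \<epsilon>) * (1 / 4) ^ q" if k: "k < 2 ^ q" for q k
  proof -
    have it: "ito (\<lambda>\<omega> u j. conv \<epsilon> x (real (Suc k) / 2 ^ q) \<omega> u j - conv \<epsilon> x (real k / 2 ^ q) \<omega> u j)
        (\<lambda>\<omega>. Z (real (Suc k) / 2 ^ q) \<omega> - Z (real k / 2 ^ q) \<omega>)"
      by (intro ito_diff Z in01) (use k in auto)
    have pos: "0 < B * sqrt (1 / 2 ^ q)" "0 < l * (9/10) ^ q" using B l by simp_all
    show "A q k \<in> sets M" unfolding A_def by (rule tail_event(1)[OF it pos \<epsilon>])
    have "prob (A q k) \<le> 2 * exp (- ((l * (9/10) ^ q)\<^sup>2 / (4 * (B * sqrt (1 / 2 ^ q)))) / \<epsilon>)"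
      unfolding A_def by (rule tail_event(2)[OF it pos \<epsilon>])
    also have "(l * (9/10) ^ q)\<^sup>2 / (4 * (B * sqrt (1 / 2 ^ q))) = r * (81/100 * sqrt 2) ^ q"
    proof -
      have "((9/10 :: real) ^ q)\<^sup>2 = (81/100) ^ q" by (simp add: power2_eq_square power_mult_distrib[symmetric])
      then have "(l * (9/10) ^ q)\<^sup>2 = 4 * B * r * (81/100) ^ q" by (simp only: power_mult_distrib l(2))
      moreover have "sqrt (1 / 2 ^ q) = 1 / sqrt 2 ^ q" by (simp add: real_sqrt_divide real_sqrt_power)
      moreover have "4 * B * r * a / (4 * (B * (1 / b))) = r * (a * b)" for a b using B by simp
      ultimately show ?thesis by (simp only: power_mult_distrib)
    qed
    also have "2 * exp (- (r * (81/100 * sqrt 2) ^ q) / \<epsilon>) \<le> 2 * exp (- (r * (1 + real q * (1/10))) / \<epsilon>)"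
    proof -
      have "(1.4 :: real) \<le> sqrt 2" by (rule real_le_rsqrt) (simp add: power2_eq_square)
      then have "1 + 1/10 \<le> 81/100 * sqrt 2" by simp
      then have "(1 + 1/10) ^ q \<le> (81/100 * sqrt 2) ^ q" by (rule power_mono) simp
      then have "1 + real q * (1/10) \<le> (81/100 * sqrt 2) ^ q" using Bernoulli_inequality[of "1/10 :: real" q] by simp
      then have "r * (1 + real q * (1/10)) \<le> r * (81/100 * sqrt 2) ^ q" using r by (intro mult_left_mono) auto
      then show ?thesis using \<epsilon> by (simp add: divide_right_mono)
    qed
    also have "exp (- (r * (1 + real q * (1/10))) / \<epsilon>) = exp (- r / \<epsilon>) * exp (- r / (10 * \<epsilon>)) ^ q"
      using \<epsilon> by (simp add: exp_of_nat_mult[symmetric] exp_add[symmetric] field_simps)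
    also have "2 * (exp (- r / \<epsilon>) * exp (- r / (10 * \<epsilon>)) ^ q) \<le> 2 * (exp (- r / \<epsilon>) * (1 / 4) ^ q)"
      using small by (intro mult_left_mono power_mono) auto
    finally show "prob (A q k) \<le> 2 * exp (- r / \<epsilon>) * (1 / 4) ^ q" by simp
  qed
  have Bq: "(\<Union>k<2 ^ q. A q k) \<in> sets M" for q by (intro sets.finite_UN A) auto
  have q: "prob (\<Union>k<2 ^ q. A q k) \<le> 2 * exp (- r / \<epsilon>) * (1 / 2) ^ q" for q
  proof -
    have "prob (\<Union>k<2 ^ q. A q k) \<le> (\<Sum>k<2 ^ q. prob (A q k))" by (intro finite_measure_subadditive_finite) (auto intro: A)
    also have "\<dots> \<le> (\<Sum>k<(2::nat) ^ q. 2 * exp (- r / \<epsilon>) * (1 / 4) ^ q)" by (intro sum_mono A) simp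
    also have "\<dots> = 2 * exp (- r / \<epsilon>) * (2 ^ q * (1 / 4) ^ q)" by simp
    also have "2 ^ q * (1 / 4) ^ q = (1 / 2 :: real) ^ q" by (simp add: power_mult_distrib[symmetric])
    finally show ?thesis .
  qed
  have sg: "summable (\<lambda>q. 2 * exp (- r / \<epsilon>) * (1 / 2 :: real) ^ q)" by (intro summable_mult summable_geometric) simp
  have sm: "summable (\<lambda>q. prob (\<Union>k<2 ^ q. A q k))" by (rule summable_comparison_test'[OF sg, of 0]) (simp only: real_norm_def abs_of_nonneg[OF measure_nonneg] q)
  show "(\<Union>q. \<Union>k<2 ^ q. A q k) \<in> sets M" by (intro sets.countable_UN) (use Bq in auto)
  have "prob (\<Union>q. \<Union>k<2 ^ q. A q k) \<le> (\<Sum>q. prob (\<Union>k<2 ^ q. A q k))"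
    by (rule finite_measure_subadditive_countably) (use Bq sm in auto)
  also have "\<dots> \<le> (\<Sum>q. 2 * exp (- r / \<epsilon>) * (1 / 2) ^ q)" by (rule suminf_le[OF q sm sg])
  also have "\<dots> = 4 * exp (- r / \<epsilon>)" by (subst suminf_mult) (simp_all add: suminf_geometric summable_geometric)
  finally show "prob (\<Union>q. \<Union>k<2 ^ q. A q k) \<le> 4 * exp (- r / \<epsilon>)" .
qed

text \<open>The energy level \<open>\<eta>^2 / (4 * r)\<close> is the one for which the tail
  exponent is exactly \<open>r / \<epsilon>\<close>.\<close>

lemma grid_events:
  fixes m n :: nat
  assumes Z: "\<And>t. t \<in> {0..1} \<Longrightarrow> ito (conv \<epsilon> x t) (Z t)" and \<epsilon>: "\<epsilon> \<in> {0<..1}" and r: "0 < r" and \<eta>: "0 < \<eta>" and m: "0 < m"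
  defines "A \<equiv> \<lambda>i. {\<omega>\<in>space M. \<eta> < sqrt \<epsilon> * norm (Z (real i / real m) \<omega> - grid_sum \<epsilon> x m n i \<omega>) \<and>
      energy J (\<lambda>\<omega> u j. conv \<epsilon> x (real i / real m) \<omega> u j - grid_term \<epsilon> x m n i \<omega> u j) \<omega> \<le> ennreal (\<eta>\<^sup>2 / (4 * r))}"
  shows "(\<Union>i\<le>m. A i) \<in> sets M" "prob (\<Union>i\<le>m. A i) \<le> 2 * (real m + 1) * exp (- r / \<epsilon>)"
proof -
  have A: "A i \<in> sets M" "prob (A i) \<le> 2 * exp (- r / \<epsilon>)" if i: "i \<le> m" for i
  proof -
    have it: "ito (\<lambda>\<omega> u j. conv \<epsilon> x (real i / real m) \<omega> u j - grid_term \<epsilon> x m n i \<omega> u j)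
        (\<lambda>\<omega>. Z (real i / real m) \<omega> - grid_sum \<epsilon> x m n i \<omega>)"
      by (intro ito_diff Z ito_grid \<epsilon> i m) (use i m in simp)
    have pos: "0 < \<eta>\<^sup>2 / (4 * r)" "0 < \<epsilon>" using \<eta> r \<epsilon> by simp_all
    show "A i \<in> sets M" unfolding A_def by (rule tail_event(1)[OF it pos(1) \<eta> pos(2)])
    have "\<eta>\<^sup>2 / (4 * (\<eta>\<^sup>2 / (4 * r))) = r" using \<eta> by simp
    then show "prob (A i) \<le> 2 * exp (- r / \<epsilon>)" unfolding A_def using tail_event(2)[OF it pos(1) \<eta> pos(2)] by simp
  qed
  show "(\<Union>i\<le>m. A i) \<in> sets M" by (intro sets.finite_UN A) auto
  have "prob (\<Union>i\<le>m. A i) \<le> (\<Sum>i\<le>m. prob (A i))" by (intro finite_measure_subadditive_finite) (auto intro: A)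
  also have "\<dots> \<le> (\<Sum>i\<le>m. 2 * exp (- r / \<epsilon>))" by (intro sum_mono A) simp
  finally show "prob (\<Union>i\<le>m. A i) \<le> 2 * (real m + 1) * exp (- r / \<epsilon>)" by (simp add: algebra_simps)
qed

text \<open>Exponential Markov inequality with weight
  \<open>c = \<theta>^2 / (2 * (1 + \<theta>^2))\<close>. For
  \<open>\<theta>^2 = 2 * r / \<gamma>\<close> one has \<open>2 * r * c = 2 * r^2 / (\<gamma> + 2 *
  r) \<ge> r - \<gamma> / 2\<close>, so half of \<gamma> pays for \<open>c < 1/2\<close>. The
  prefactor depends on \<open>m\<close> and \<open>n\<close> but not on \<epsilon>.\<close>

lemma control_event:
  fixes m n :: nat and r \<gamma> \<epsilon> :: real
  assumes \<epsilon>: "0 < \<epsilon>" and r: "0 < r" and \<gamma>: "0 < \<gamma>" and m: "0 < m"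
  defines "A \<equiv> {\<omega>\<in>space M. 2 * r < real m * (\<Sum>j<m. \<Sum>k\<in>J \<inter> {..<n}. (sqrt \<epsilon> * (\<beta> k (real (Suc j) / m) \<omega> - \<beta> k (real j / m) \<omega>))\<^sup>2)}"
  shows "A \<in> sets M" "prob A \<le> exp (r * real m * card (J \<inter> {..<n}) / \<gamma>) * exp ((- r + \<gamma> / 2) / \<epsilon>)"
proof -
  let ?N = "J \<inter> {..<n}"
  define Y where "Y \<omega> = real m * (\<Sum>j<m. \<Sum>k\<in>?N. (\<beta> k (real (Suc j) / m) \<omega> - \<beta> k (real j / m) \<omega>)\<^sup>2)" for \<omega>
  have bm: "\<beta> k t \<in> borel_measurable M" if "k \<in> ?N" "0 \<le> t" for k t using that by (intro beta_measurable) auto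
  have [measurable]: "Y \<in> borel_measurable M" unfolding Y_def[abs_def]
    by (intro borel_measurable_times borel_measurable_sum borel_measurable_power borel_measurable_diff borel_measurable_const bm) auto
  have eqY: "real m * (\<Sum>j<m. \<Sum>k\<in>?N. (sqrt \<epsilon> * (\<beta> k (real (Suc j) / m) \<omega> - \<beta> k (real j / m) \<omega>))\<^sup>2) = \<epsilon> * Y \<omega>" for \<omega>
    using \<epsilon> unfolding Y_def by (simp only: power_mult_distrib real_sqrt_pow2 less_imp_le sum_distrib_left[symmetric] mult.left_commute)
  have A: "A = {\<omega>\<in>space M. 2 * r / \<epsilon> < Y \<omega>}" unfolding A_def eqY using \<epsilon> by (simp add: pos_divide_less_eq mult.commute)
  show "A \<in> sets M" unfolding A by measurable
  define \<theta> where "\<theta> = sqrt (2 * r / \<gamma>)"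
  have \<theta>: "\<theta>\<^sup>2 = 2 * r / \<gamma>" using r \<gamma> by (simp add: \<theta>_def)
  define c where "c = \<theta>\<^sup>2 / (2 * (1 + \<theta>\<^sup>2))"
  have c: "c = r / (\<gamma> + 2 * r)" using r \<gamma> by (simp add: c_def \<theta> divide_simps)
  have c0: "0 < c" using r \<gamma> by (simp add: c)
  have "emeasure M A \<le> emeasure M {\<omega>\<in>space M. 1 \<le> ennreal (exp (- (c * (2 * r / \<epsilon>)))) * ennreal (exp (c * Y \<omega>))}"
  proof (rule emeasure_mono)
    show "A \<subseteq> {\<omega>\<in>space M. 1 \<le> ennreal (exp (- (c * (2 * r / \<epsilon>)))) * ennreal (exp (c * Y \<omega>))}"
    proof
      fix \<omega> assume "\<omega> \<in> A"
      then have \<omega>: "\<omega> \<in> space M" "2 * r / \<epsilon> < Y \<omega>" unfolding A by auto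
      then have "c * (2 * r / \<epsilon>) \<le> c * Y \<omega>" using c0 by (intro mult_left_mono) auto
      then have "1 \<le> exp (- (c * (2 * r / \<epsilon>))) * exp (c * Y \<omega>)" unfolding exp_add[symmetric] by (intro one_le_exp_iff[THEN iffD2]) linarith
      then have "1 \<le> ennreal (exp (- (c * (2 * r / \<epsilon>))) * exp (c * Y \<omega>))" by (simp only: ennreal_ge_1)
      then show "\<omega> \<in> {\<omega>\<in>space M. 1 \<le> ennreal (exp (- (c * (2 * r / \<epsilon>)))) * ennreal (exp (c * Y \<omega>))}"
        using \<omega>(1) by (simp add: ennreal_mult)
    qed
  qed measurable
  also have "\<dots> \<le> ennreal (exp (- (c * (2 * r / \<epsilon>)))) * (\<integral>\<^sup>+\<omega>. ennreal (exp (c * Y \<omega>)) * indicator (space M) \<omega> \<partial>M)"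
    by (rule nn_integral_Markov_inequality) measurable
  also have "(\<integral>\<^sup>+\<omega>. ennreal (exp (c * Y \<omega>)) * indicator (space M) \<omega> \<partial>M) = (\<integral>\<^sup>+\<omega>. ennreal (exp (c * Y \<omega>)) \<partial>M)"
    by (rule nn_integral_cong) simp
  also have "ennreal (exp (- (c * (2 * r / \<epsilon>)))) * (\<integral>\<^sup>+\<omega>. ennreal (exp (c * Y \<omega>)) \<partial>M)
      \<le> ennreal (exp (- (c * (2 * r / \<epsilon>)))) * ennreal (exp (\<theta>\<^sup>2 * (real m * card ?N) / 2))"
    using increments_exp_square[of ?N m \<theta>] m by (intro mult_left_mono) (simp_all add: c_def Y_def)
  also have "ennreal (exp (- (c * (2 * r / \<epsilon>)))) * ennreal (exp (\<theta>\<^sup>2 * (real m * card ?N) / 2))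
      = ennreal (exp (- (c * (2 * r / \<epsilon>))) * exp (\<theta>\<^sup>2 * (real m * card ?N) / 2))" by (simp add: ennreal_mult)
  finally have "prob A \<le> exp (- (c * (2 * r / \<epsilon>))) * exp (\<theta>\<^sup>2 * (real m * card ?N) / 2)" by (simp add: emeasure_eq_measure)
  also have "\<theta>\<^sup>2 * (real m * card ?N) / 2 = r * real m * card ?N / \<gamma>" by (simp add: \<theta>)
  also have "- (c * (2 * r / \<epsilon>)) \<le> (- r + \<gamma> / 2) / \<epsilon>"
  proof -
    have "(r - \<gamma> / 2) * (\<gamma> + 2 * r) \<le> 2 * r * r" using \<gamma> r by (simp add: algebra_simps)
    then have "r - \<gamma> / 2 \<le> c * (2 * r)" using \<gamma> r by (simp add: c pos_le_divide_eq)
    then show ?thesis using divide_right_mono[of "r - \<gamma> / 2" "c * (2 * r)" \<epsilon>] \<epsilon> by (simp add: diff_divide_distrib)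
  qed
  finally show "prob A \<le> exp (r * real m * card ?N / \<gamma>) * exp ((- r + \<gamma> / 2) / \<epsilon>)" by (simp add: mult.commute)
qed

end

section \<open>The estimate along a single path outside the exceptional events\<close>

text \<open>The pointwise distance \<open>\<delta> / 2\<close> leaves room for the strict inequality
  of the ball after the supremum is taken.\<close>

lemma neighbourhood_of_sublevelI:
  fixes X z :: "real \<Rightarrow> 'h::{real_inner, banach, second_countable_topology}"
  assumes z: "z \<in> rate_sublevel G x r" and X: "continuous_on {0..1} X"
    and close: "\<And>t. t \<in> {0..1} \<Longrightarrow> norm (X t - z t) \<le> \<delta> / 2" and \<delta>: "0 < \<delta>"
  shows "(\<lambda>t\<in>{0..1}. X t) \<in> neighbourhood_of path_space (rate_sublevel G x r) \<delta>"
proof -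
  have zp: "z \<in> mspace path_space" using z by (simp only: rate_sublevel_def mem_Collect_eq)
  have Xp: "(\<lambda>t\<in>{0..1}. X t) \<in> mspace path_space"
    unfolding path_space_iff using X continuous_on_cong[of "{0..1}" "{0..1}" "restrict X {0..1}" X] by simp
  have "mdist path_space z (\<lambda>t\<in>{0..1}. X t) \<le> \<delta> / 2"
    by (rule mdist_cfunspace_le) (use \<delta> close in \<open>auto simp: dist_norm norm_minus_commute\<close>)
  then have "mdist path_space z (\<lambda>t\<in>{0..1}. X t) < \<delta>" using \<delta> by simp
  then have "(\<lambda>t\<in>{0..1}. X t) \<in> mball_of path_space z \<delta>"
    using zp Xp unfolding in_mball_of by simp
  then show ?thesis using z unfolding neighbourhood_of_def by blast
qed

text \<open>Keeps the chaining sum below 9, whatever the number of levels.\<close>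

lemma sum_powers_nine_tenths: "(\<Sum>i<n. (9/10::real) ^ Suc i) = 9 * (1 - (9/10) ^ n)"
  by (induction n) (simp_all add: algebra_simps)

context spde
begin

text \<open>Everything concerns one fixed \<open>\<omega>\<close>. The events enter as implications
  from small energy to small integral. Their premises are verified up to \<open>T\<close> as long as
  the solution stays in the ball of radius \<open>R\<close>: first those of \<open>inc\<close>,
  which yield the modulus \<open>mo\<close>, then, with this modulus, those of \<open>grid\<close>.
  Finally \<open>localisation\<close> removes the ball.\<close>

lemma path_near_sublevel:
  fixes m p n :: nat and x :: 'h and k0 l \<kappa> \<eta> \<rho> e1 e2 e3 mo r \<delta> \<epsilon> s R0 R em :: real
    and Z :: "real \<Rightarrow> 'a \<Rightarrow> 'h" and W :: "'h set"
  assumes s: "s = sqrt (2 * r)" and R0: "R0 = (1 + k0) * exp (2 * \<Lambda> * s) - 1" and R: "R = R0 + \<delta>"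
    and em: "em = \<Lambda> * (1 + R0) * sqrt (2 * r / real m)"
    and \<epsilon>: "\<epsilon> \<in> {0<..1}" and \<omega>: "\<omega> \<in> space M" and x: "norm x \<le> k0" and r: "0 < r" and \<delta>: "0 < \<delta>" and mp: "real m = 2 ^ p"
    and l: "0 \<le> l" and \<eta>: "\<eta> \<le> \<delta>"
    and mild: "\<And>q k. k \<le> 2 ^ q \<Longrightarrow> X \<epsilon> x (real k / 2 ^ q) \<omega>
      = S (\<epsilon> * (real k / 2 ^ q)) x + drift \<epsilon> x (real k / 2 ^ q) \<omega> + sqrt \<epsilon> *\<^sub>R Z (real k / 2 ^ q) \<omega>"
    and ctrl: "real m * (\<Sum>j<m. \<Sum>k\<in>J \<inter> {..<n}. (sqrt \<epsilon> * (\<beta> k (real (Suc j) / m) \<omega> - \<beta> k (real j / m) \<omega>))\<^sup>2) \<le> 2 * r"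
    and inc: "\<And>q k. k < 2 ^ q \<Longrightarrow> energy J (\<lambda>\<omega> u j. conv \<epsilon> x (real (Suc k) / 2 ^ q) \<omega> u j - conv \<epsilon> x (real k / 2 ^ q) \<omega> u j) \<omega>
        \<le> ennreal ((\<Lambda> * (1 + R))\<^sup>2 * (C\<^sup>2 + 2 * C1) * sqrt (1 / 2 ^ q))
      \<Longrightarrow> sqrt \<epsilon> * norm (Z (real (Suc k) / 2 ^ q) \<omega> - Z (real k / 2 ^ q) \<omega>) \<le> l * (9/10) ^ q"
    and grid: "\<And>i. i \<le> m \<Longrightarrow> energy J (\<lambda>\<omega> u j. conv \<epsilon> x (real i / real m) \<omega> u j - grid_term \<epsilon> x m n i \<omega> u j) \<omega> \<le> ennreal \<kappa>
      \<Longrightarrow> sqrt \<epsilon> * norm (Z (real i / real m) \<omega> - grid_sum \<epsilon> x m n i \<omega>) \<le> \<eta>"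
    and e1: "\<And>v. 0 \<le> v \<Longrightarrow> v \<le> \<epsilon> \<Longrightarrow> norm (S v x - x) \<le> e1"
    and e2: "C * (1 + R) * integral {0..\<epsilon>} \<nu> \<le> e2"
    and mo: "2 * e1 + 2 * e2 + 9 * l * (9/10) ^ p \<le> mo"
    and tail: "\<And>h. norm h \<le> R \<Longrightarrow> hs_sq J (\<lambda>k. if k < n then 0 else G h (g k)) \<le> ennreal (\<rho>\<^sup>2)"
    and \<kappa>: "4 * C\<^sup>2 * (\<Lambda> * mo)\<^sup>2 + 4 * C\<^sup>2 * \<rho>\<^sup>2 + 8 * C1 * (\<Lambda> * (1 + R))\<^sup>2 * sqrt (1 / real m) \<le> \<kappa>"
    and small: "\<Lambda> * sqrt (2 * r / real m) \<le> 1/2"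
    and e3: "0 \<le> e3" "\<And>v y. 0 \<le> v \<Longrightarrow> v \<le> \<epsilon> \<Longrightarrow> y \<in> W \<Longrightarrow> norm (S v y - y) \<le> e3"
    and W: "\<And>c j. (\<And>i. i < m \<Longrightarrow> c i \<in> {\<Sum>k\<in>J \<inter> {..<n}. a k *\<^sub>R g k |a. \<forall>k\<in>J \<inter> {..<n}. \<bar>a k\<bar> \<le> s}) \<Longrightarrow> j < m \<Longrightarrow> G (euler c x j) (c j) \<in> W"
    and total: "mo + em + ((e1 + e2 + \<eta>) + real m * e3 + \<Lambda> * em * s + (C + 1) * \<Lambda> * s * (\<Lambda> * em * s * exp (\<Lambda> * s))) * exp (C * \<Lambda> * s) \<le> \<delta> / 2"
  shows "(\<lambda>t\<in>{0..1}. X \<epsilon> x t \<omega>) \<in> neighbourhood_of path_space (rate_sublevel G x r) \<delta>"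
proof -
  let ?N = "J \<inter> {..<n}"
  define d where "d j k = sqrt \<epsilon> * (\<beta> k (real (Suc j) / m) \<omega> - \<beta> k (real j / m) \<omega>)" for j k
  \<comment> \<open>The noise increment of the first \<open>n\<close> coordinates over the
    \<open>j\<close>-th interval. With it \<open>sqrt \<epsilon> *\<^sub>R grid_sum\<close> is the
    discrete convolution of the semigroup with the increments \<open>G (X) (c j)\<close>.\<close>
  define c where "c j = (\<Sum>k\<in>?N. d j k *\<^sub>R g k)" for j
  have m0: "0 < m"
  proof (rule ccontr)
    assume "\<not> 0 < m" then show False using mp by simp
  qed
  have s0: "0 \<le> s" using r by (simp add: s)
  have k0: "0 \<le> k0" using x norm_ge_zero order_trans by blast
  have csq: "(norm (c j))\<^sup>2 = (\<Sum>k\<in>?N. (d j k)\<^sup>2)" for j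
    unfolding c_def by (rule norm_sum_orthonormal_sq[OF basis]) auto
  have ctrl': "real m * (\<Sum>j<m. (norm (c j))\<^sup>2) \<le> 2 * r" using ctrl by (simp only: csq d_def)
  have cj2: "(norm (c j))\<^sup>2 \<le> 2 * r / real m" if "j < m" for j
  proof -
    have "(norm (c j))\<^sup>2 \<le> (\<Sum>j<m. (norm (c j))\<^sup>2)" using that by (intro member_le_sum) auto
    also have "\<dots> \<le> 2 * r / real m" using ctrl' m0 by (simp add: pos_le_divide_eq mult.commute)
    finally show ?thesis .
  qed
  have cj: "norm (c j) \<le> sqrt (2 * r / real m)" if "j < m" for j using cj2[OF that] by (rule real_le_rsqrt)
  \<comment> \<open>Cauchy--Schwarz over the \<open>m\<close> intervals: the sum of the norms stays
    below \<open>sqrt (2 * r)\<close> whatever the mesh. Hence neither \<open>R0\<close> nor the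
    Gronwall factor depends on \<open>m\<close>.\<close>
  have cs: "(\<Sum>j<m. norm (c j)) \<le> s"
    unfolding s
  proof (rule real_le_rsqrt)
    have "(\<Sum>j<m. norm (c j))\<^sup>2 \<le> (\<Sum>j<m. (norm (c j))\<^sup>2) * card {..<m}" by (rule sum_squared_le_sum_of_squares)
    then show "(\<Sum>j<m. norm (c j))\<^sup>2 \<le> 2 * r" using ctrl' by (simp add: mult.commute)
  qed
  have cU: "c j \<in> {\<Sum>k\<in>?N. a k *\<^sub>R g k |a. \<forall>k\<in>?N. \<bar>a k\<bar> \<le> s}" if j: "j < m" for j
  proof -
    have "\<bar>d j k\<bar> \<le> s" if k: "k \<in> ?N" for k
      unfolding s
    proof (rule real_le_rsqrt)
      have "\<bar>d j k\<bar>\<^sup>2 \<le> (\<Sum>k\<in>?N. (d j k)\<^sup>2)" unfolding power2_abs by (rule member_le_sum[OF k]) auto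
      also have "\<dots> \<le> 2 * r / real m" using cj2[OF j] by (simp only: csq)
      also have "\<dots> \<le> 2 * r" using m0 r by (simp add: divide_le_eq)
      finally show "\<bar>d j k\<bar>\<^sup>2 \<le> 2 * r" .
    qed
    then show ?thesis unfolding c_def by blast
  qed
  have small': "\<Lambda> * norm (c j) \<le> 1/2" if "j < m" for j
    by (rule order_trans[OF mult_left_mono[OF cj[OF that]] small]) (use Lambda in simp)
  obtain z where z: "is_skeleton G x (step_control m c) z" "z 0 = x"
    and zb': "\<And>t. t \<in> {0..1} \<Longrightarrow> norm (z t) \<le> (1 + norm x) * exp (2 * \<Lambda> * (\<Sum>j<m. norm (c j))) - 1"
    and zm': "\<And>j t. j < m \<Longrightarrow> t \<in> {real j / m..real (Suc j) / m} \<Longrightarrow> norm (z t - z (real j / m)) \<le> \<Lambda> * (1 + ((1 + norm x) * exp (2 * \<Lambda> * (\<Sum>j<m. norm (c j))) - 1)) * norm (c j)"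
    and zs': "\<And>j. j < m \<Longrightarrow> norm (z (real (Suc j) / m) - z (real j / m) - G (z (real j / m)) (c j)) \<le> \<Lambda> * (\<Lambda> * (1 + ((1 + norm x) * exp (2 * \<Lambda> * (\<Sum>j<m. norm (c j))) - 1)) * norm (c j)) * norm (c j)"
    using step_skeleton[where c = c and x = x and m = m, OF m0 small'] by blast
  have Rle: "(1 + norm x) * exp (2 * \<Lambda> * (\<Sum>j<m. norm (c j))) - 1 \<le> R0"
    unfolding R0 using x cs Lambda k0 by (intro diff_right_mono mult_mono) auto
  have R00: "0 \<le> R0" "k0 \<le> R0"
  proof -
    define w where "w = (1 + k0) * exp (2 * \<Lambda> * s)"
    have "(1 + k0) * 1 \<le> w" unfolding w_def using k0 Lambda s0 by (intro mult_left_mono) auto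
    moreover have "R0 = w - 1" by (simp add: R0 w_def)
    ultimately show "k0 \<le> R0" by simp
    then show "0 \<le> R0" using k0 by simp
  qed
  have em0: "0 \<le> em" using R00 Lambda r by (simp add: em)
  have zb: "norm (z t) \<le> R0" if "t \<in> {0..1}" for t using zb'[OF that] Rle by simp
  have emj: "\<Lambda> * (1 + ((1 + norm x) * exp (2 * \<Lambda> * (\<Sum>j<m. norm (c j))) - 1)) * norm (c j) \<le> em" if "j < m" for j
    unfolding em using Rle cj[OF that] Lambda R00 by (intro mult_mono) auto
  have zm: "norm (z t - z (real j / m)) \<le> em" if "j < m" "t \<in> {real j / m..real (Suc j) / m}" for j t
    using zm'[OF that] emj[OF that(1)] by simp
  have zs: "norm (z (real (Suc j) / m) - z (real j / m) - G (z (real j / m)) (c j)) \<le> \<Lambda> * em * norm (c j)" if "j < m" for j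
    using emj[OF that] Lambda by (intro order_trans[OF zs'[OF that]] mult_right_mono mult_left_mono) auto
  \<comment> \<open>Any admissible control bounds the infimum in the rate function; by
    \<open>ctrl\<close> this one has half energy at most \<open>r\<close>.\<close>
  have zI: "z \<in> rate_sublevel G x r"
    unfolding rate_sublevel_def mem_Collect_eq
  proof
    show "z \<in> mspace path_space" using z(1) unfolding is_skeleton_def by blast
    have "rate_function G x z \<le> ereal (1/2) * ereal (LINT s|lebesgue_on {0..1}. (norm (step_control m c s))\<^sup>2)"
      unfolding rate_function_def
      by (rule ereal_mult_left_mono[OF Inf_lower]) (use z(1) step_control_energy(1)[OF m0] in auto)
    also have "\<dots> = ereal (1/2 * (real m * (\<Sum>j<m. (norm (c j))\<^sup>2)))" by (simp add: step_control_energy(2)[OF m0])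
    also have "\<dots> \<le> ereal r" using ctrl' by simp
    finally show "rate_function G x z \<le> ereal r" .
  qed
  have sg: "norm (S (\<epsilon> * v) x - x) \<le> e1" if "v \<in> {0..1}" for v
    by (rule e1) (use that \<epsilon> in \<open>auto simp: mult_left_le\<close>)
  have e10: "0 \<le> e1" by (rule order_trans[OF norm_ge_zero sg[of 0]]) simp
  have \<eta>0: "0 \<le> sqrt \<epsilon>" using \<epsilon> by simp
  have tp: "real k / 2 ^ q \<in> {0..1}" if "k \<le> 2 ^ q" for k q :: nat
  proof -
    have "real k \<le> real (2 ^ q)" using that by (simp only: of_nat_le_iff)
    then show ?thesis by simp
  qed
  have le_p: "i \<le> 2 ^ p" if "i \<le> m" for i
  proof -
    have "real i \<le> real m" using that by simp
    also have "\<dots> = real (2 ^ p)" by (simp add: mp)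
    finally show ?thesis by (simp only: of_nat_le_iff)
  qed
  have gridt: "real i / m \<in> {0..1}" if "i \<le> m" for i using that m0 by simp
  have gmild: "X \<epsilon> x (real i / m) \<omega> = S (\<epsilon> * (real i / m)) x + drift \<epsilon> x (real i / m) \<omega> + sqrt \<epsilon> *\<^sub>R Z (real i / m) \<omega>" if "i \<le> m" for i
    using mild[OF le_p[OF that]] by (simp only: mp)
  have close: "norm (X \<epsilon> x T \<omega> - z T) \<le> \<delta> / 2" if T: "T \<in> {0..1}" and RT: "\<And>u. u \<in> {0..T} \<Longrightarrow> norm (X \<epsilon> x u \<omega>) \<le> R0 + \<delta>" for T
  proof -
    have T1: "T \<le> 1" using T by simp
    have dr: "norm (drift \<epsilon> x v \<omega>) \<le> e2" if "v \<in> {0..T}" for v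
      by (rule order_trans[OF drift_bound[OF \<epsilon>] e2]) (use that T RT R in auto)
    have e20: "0 \<le> e2" by (rule order_trans[OF norm_ge_zero dr[of 0]]) (use T in simp)
    have noise: "norm (sqrt \<epsilon> *\<^sub>R Z (real k / 2 ^ (p + n')) \<omega> - sqrt \<epsilon> *\<^sub>R Z (real (k div 2 ^ n') / 2 ^ p) \<omega>) \<le> 9 * l * (9/10) ^ p"
      if k: "k \<le> 2 ^ (p + n')" "real k / 2 ^ (p + n') \<le> T" for k n'
    proof -
      have "norm (sqrt \<epsilon> *\<^sub>R Z (real k / 2 ^ (p + n')) \<omega> - sqrt \<epsilon> *\<^sub>R Z (real (k div 2 ^ n') / 2 ^ p) \<omega>) \<le> (\<Sum>i<n'. l * (9/10) ^ (p + Suc i))"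
      proof (rule dyadic_chain[where N = "\<lambda>v. sqrt \<epsilon> *\<^sub>R Z v \<omega>" and b = "\<lambda>q. l * (9/10) ^ q" and T = T, OF _ _ k])
        fix q k assume q: "k < 2 ^ q" "real (Suc k) / 2 ^ q \<le> T"
        have diff: "real (Suc k) / 2 ^ q - real k / 2 ^ q = 1 / 2 ^ q" by (simp add: diff_divide_distrib[symmetric])
        have "energy J (\<lambda>\<omega> u j. conv \<epsilon> x (real (Suc k) / 2 ^ q) \<omega> u j - conv \<epsilon> x (real k / 2 ^ q) \<omega> u j) \<omega>
            \<le> ennreal ((\<Lambda> * (1 + R))\<^sup>2 * (C\<^sup>2 + 2 * C1) * sqrt (real (Suc k) / 2 ^ q - real k / 2 ^ q))"
        proof (rule energy_increment[OF \<epsilon>])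
          show "real (Suc k) / 2 ^ q \<le> 1" using q(2) T1 by linarith
          show "norm (X \<epsilon> x u \<omega>) \<le> R" if "u \<in> {0..real (Suc k) / 2 ^ q}" for u
            unfolding R by (rule RT) (use that q(2) in simp)
        qed (auto simp: divide_right_mono)
        from inc[OF q(1) this[unfolded diff]]
        show "norm (sqrt \<epsilon> *\<^sub>R Z (real (Suc k) / 2 ^ q) \<omega> - sqrt \<epsilon> *\<^sub>R Z (real k / 2 ^ q) \<omega>) \<le> l * (9/10) ^ q"
          using \<eta>0 by (simp add: scaleR_diff_right[symmetric])
      qed (use l in simp)
      also have "\<dots> = l * (9/10) ^ p * (\<Sum>i<n'. (9/10) ^ Suc i)" by (simp add: sum_distrib_left power_add mult_ac)
      also have "\<dots> \<le> l * (9/10) ^ p * 9" unfolding sum_powers_nine_tenths using l by (intro mult_left_mono) auto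
      finally show ?thesis by (simp add: mult_ac)
    qed
    have modulus: "norm (X \<epsilon> x u \<omega> - X \<epsilon> x (real j / m) \<omega>) \<le> mo" if j: "j < m" and u: "u \<in> {real j / m..real (Suc j) / m}" "u \<le> T" for j u
      unfolding mp
    proof (rule modulus_from_dyadic[OF X_continuous[OF \<epsilon> \<omega>] T1])
      show "j < 2 ^ p" using le_p[of "Suc j"] j by simp
      show "u \<in> {real j / 2 ^ p..real (Suc j) / 2 ^ p}" using u(1) unfolding mp .
      fix n' k assume k: "k \<le> 2 ^ (p + n')" "real k / 2 ^ (p + n') \<le> T" and kj: "k div 2 ^ n' = j"
      let ?t = "real k / 2 ^ (p + n')" and ?a = "real j / 2 ^ p"
      have "j * 2 ^ n' \<le> k" unfolding kj[symmetric] by simp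
      then have "real (j * 2 ^ n') \<le> real k" by (simp only: of_nat_le_iff)
      then have at: "?a \<le> ?t" by (simp add: power_add pos_le_divide_eq pos_divide_le_eq)
      have a0: "0 \<le> ?a" by simp
      have tT: "?t \<in> {0..T}" "?a \<in> {0..T}" using at k(2) a0 unfolding atLeastAtMost_iff by linarith+
      have t1: "?t \<in> {0..1}" "?a \<in> {0..1}" using tT T1 unfolding atLeastAtMost_iff by linarith+
      have jp: "j \<le> 2 ^ p" using le_p[of j] j by simp
      have "X \<epsilon> x ?t \<omega> - X \<epsilon> x ?a \<omega> = ((S (\<epsilon> * ?t) x - x) - (S (\<epsilon> * ?a) x - x)) + (drift \<epsilon> x ?t \<omega> - drift \<epsilon> x ?a \<omega>) + (sqrt \<epsilon> *\<^sub>R Z ?t \<omega> - sqrt \<epsilon> *\<^sub>R Z ?a \<omega>)"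
        unfolding mild[OF k(1)] mild[OF jp] by (simp add: algebra_simps)
      also have "norm \<dots> \<le> (norm (S (\<epsilon> * ?t) x - x) + norm (S (\<epsilon> * ?a) x - x)) + (norm (drift \<epsilon> x ?t \<omega>) + norm (drift \<epsilon> x ?a \<omega>)) + norm (sqrt \<epsilon> *\<^sub>R Z ?t \<omega> - sqrt \<epsilon> *\<^sub>R Z ?a \<omega>)"
        by (intro norm_triangle_mono norm_triangle_ineq4 order_refl)
      also have "\<dots> \<le> (e1 + e1) + (e2 + e2) + 9 * l * (9/10) ^ p"
        using noise[OF k] unfolding kj by (intro add_mono sg dr t1 tT)
      also have "\<dots> \<le> mo" using mo by simp
      finally show "norm (X \<epsilon> x ?t \<omega> - X \<epsilon> x ?a \<omega>) \<le> mo" .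
    qed (rule u(2))
    obtain j where j: "j < m" "T \<in> {real j / m..real (Suc j) / m}"
    proof (cases "T = 0")
      case True
      then show ?thesis using that[of 0] m0 by simp
    next
      case False
      then show ?thesis using grid_interval_exists[of T m] T m0 that by (metis atLeastAtMost_iff greaterThanAtMost_iff less_eq_real_def)
    qed
    \<comment> \<open>Extended by 0 outside \<open>j \<le> i \<le> m\<close>, so that the bound
      \<open>C\<close> holds for all indices, as \<open>grid_comparison\<close> demands.\<close>
    let ?S = "\<lambda>i j. if j \<le> i \<and> i \<le> m then S (\<epsilon> * (real i / m - real j / m)) else 0"
    have eS: "\<epsilon> * (real i / m - real j / m) \<le> \<epsilon>" "0 \<le> \<epsilon> * (real i / m - real j / m)" if "j \<le> i" "i \<le> m" for i j
    proof -
      have "real j / m \<le> real i / m" "real i / m \<le> 1" "0 \<le> real j / m" using that m0 by (auto simp: divide_right_mono)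
      then have "real i / m - real j / m \<le> 1" "0 \<le> real i / m - real j / m" by linarith+
      then show "\<epsilon> * (real i / m - real j / m) \<le> \<epsilon>" "0 \<le> \<epsilon> * (real i / m - real j / m)" using \<epsilon> by (auto simp: mult_left_le)
    qed
    have jT: "real j / m \<le> T" using j(2) by simp
    have "norm (X \<epsilon> x (real j / m) \<omega> - z (real j / m)) \<le> ((e1 + e2 + \<eta>) + real m * e3 + \<Lambda> * em * s + (C + 1) * \<Lambda> * s * (\<Lambda> * em * s * exp (\<Lambda> * s))) * exp (C * \<Lambda> * s)"
    proof (rule grid_comparison[where c = c and Y = "\<lambda>i. X \<epsilon> x (real i / m) \<omega>" and z = z and S' = ?S and t = "\<lambda>j. real j / m" and m = m and n = j and x = x,
          OF C(1) _ cs em0 _ z(2) zs e3(1) _ _ _ order_refl])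
      show "norm (?S i j) \<le> C" for i j
      proof (cases "j \<le> i \<and> i \<le> m")
        case True
        then have "norm (S (\<epsilon> * (real i / m - real j / m))) \<le> C" using \<epsilon> by (intro C(2) eS(2) order_trans[OF eS(1)]) auto
        then show ?thesis using True by simp
      next
        case False
        then show ?thesis using C(1) by (simp only: if_False norm_zero)
      qed
      show "norm (?S i j (G (euler c x j) (c j)) - G (euler c x j) (c j)) \<le> e3" if "j < i" "i \<le> m" for i j
      proof -
        have "G (euler c x j) (c j) \<in> W"
        proof (rule W)
          show "c i \<in> {\<Sum>k\<in>?N. a k *\<^sub>R g k |a. \<forall>k\<in>?N. \<bar>a k\<bar> \<le> s}" if "i < m" for i by (rule cU[OF that])
          show "j < m" using that by simp
        qed
        moreover have "j \<le> i" using that by simp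
        ultimately have "norm (S (\<epsilon> * (real i / m - real j / m)) (G (euler c x j) (c j)) - G (euler c x j) (c j)) \<le> e3"
          using that(2) by (intro e3(2) eS)
        then show ?thesis using that by simp
      qed
      show "j \<le> m" using j by simp
      fix i assume i: "i \<le> j"
      then have im: "i \<le> m" using j by simp
      have "real i / m \<le> real j / m" using i by (intro divide_right_mono) auto
      then have iT: "real i / m \<le> T" using jT by linarith
      have "energy J (\<lambda>\<omega> u k. conv \<epsilon> x (real i / m) \<omega> u k - grid_term \<epsilon> x m n i \<omega> u k) \<omega>
          \<le> ennreal (4 * C\<^sup>2 * (\<Lambda> * mo)\<^sup>2 + 4 * C\<^sup>2 * \<rho>\<^sup>2 + 8 * C1 * (\<Lambda> * (1 + R))\<^sup>2 * sqrt (1 / real m))"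
      proof (rule energy_grid[OF \<epsilon> im m0 _ _ tail])
        show "norm (X \<epsilon> x u \<omega>) \<le> R" if "u \<in> {0..real i / m}" for u unfolding R by (rule RT) (use that iT in simp)
        fix j' u assume j': "j' < i" "u \<in> {real j' / m..real (Suc j') / m}"
        have "real (Suc j') / m \<le> real i / m" using j'(1) by (intro divide_right_mono) auto
        then have "u \<le> T" using j'(2) iT unfolding atLeastAtMost_iff by linarith
        then show "norm (X \<epsilon> x u \<omega> - X \<epsilon> x (real j' / m) \<omega>) \<le> mo" using j' im by (intro modulus) auto
      qed
      then have "energy J (\<lambda>\<omega> u k. conv \<epsilon> x (real i / m) \<omega> u k - grid_term \<epsilon> x m n i \<omega> u k) \<omega> \<le> ennreal \<kappa>"
        by (rule order_trans[OF _ ennreal_leI[OF \<kappa>]])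
      from grid[OF im this] have ge: "norm (sqrt \<epsilon> *\<^sub>R Z (real i / m) \<omega> - sqrt \<epsilon> *\<^sub>R grid_sum \<epsilon> x m n i \<omega>) \<le> \<eta>"
        using \<eta>0 by (simp add: scaleR_diff_right[symmetric])
      have sum_eq: "(\<Sum>j<i. ?S i j (G (X \<epsilon> x (real j / m) \<omega>) (c j))) = sqrt \<epsilon> *\<^sub>R grid_sum \<epsilon> x m n i \<omega>"
        unfolding grid_sum_def scaleR_sum_right
      proof (intro sum.cong refl)
        fix j assume "j \<in> {..<i}"
        then have "?S i j = S (\<epsilon> * (real i / m - real j / m))" using im by simp
        then show "?S i j (G (X \<epsilon> x (real j / m) \<omega>) (c j)) = (\<Sum>k\<in>?N. sqrt \<epsilon> *\<^sub>R (\<beta> k (real (Suc j) / m) \<omega> - \<beta> k (real j / m) \<omega>)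
            *\<^sub>R S (\<epsilon> * (real i / m - real j / m)) (G (X \<epsilon> x (real j / m) \<omega>) (g k)))"
          by (simp only: c_def d_def blinfun.sum_right blinfun.scaleR_right scaleR_scaleR)
      qed
      have "X \<epsilon> x (real i / m) \<omega> - x - (\<Sum>j<i. ?S i j (G (X \<epsilon> x (real j / m) \<omega>) (c j)))
          = (S (\<epsilon> * (real i / m)) x - x) + drift \<epsilon> x (real i / m) \<omega> + (sqrt \<epsilon> *\<^sub>R Z (real i / m) \<omega> - sqrt \<epsilon> *\<^sub>R grid_sum \<epsilon> x m n i \<omega>)"
        unfolding sum_eq gmild[OF im] by (simp add: algebra_simps)
      also have "norm \<dots> \<le> e1 + e2 + \<eta>"
        by (intro norm_triangle_mono sg dr ge gridt im) (use iT in simp)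
      finally show "norm (X \<epsilon> x (real i / m) \<omega> - x - (\<Sum>j<i. ?S i j (G (X \<epsilon> x (real j / m) \<omega>) (c j)))) \<le> e1 + e2 + \<eta>" .
    qed simp_all
    moreover have "norm (X \<epsilon> x T \<omega> - X \<epsilon> x (real j / m) \<omega>) \<le> mo" by (rule modulus[OF j order_refl])
    moreover have "norm (z T - z (real j / m)) \<le> em" by (rule zm[OF j])
    moreover have "norm (X \<epsilon> x T \<omega> - z T) \<le> norm (X \<epsilon> x T \<omega> - X \<epsilon> x (real j / m) \<omega>) + norm (X \<epsilon> x (real j / m) \<omega> - z (real j / m)) + norm (z T - z (real j / m))"
      using norm_decompose4[of "X \<epsilon> x T \<omega> - z T" "X \<epsilon> x T \<omega> - X \<epsilon> x (real j / m) \<omega>" "X \<epsilon> x (real j / m) \<omega> - z (real j / m)" 0 "z T - z (real j / m)"] by simp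
    ultimately show ?thesis using total by linarith
  qed
  \<comment> \<open>\<open>Z 0\<close> is determined only up to null sets, so the mild equation at
    time 0 does not give the initial value at once. The grid condition for \<open>i = 0\<close>,
    where the energy is 0, bounds the discrepancy by \<open>\<eta> \<le> \<delta>\<close>.\<close>
  have X0: "norm (X \<epsilon> x 0 \<omega>) \<le> R0 + \<delta>"
  proof -
    have "energy J (\<lambda>\<omega> u k. conv \<epsilon> x (real 0 / m) \<omega> u k - grid_term \<epsilon> x m n 0 \<omega> u k) \<omega> = (\<integral>\<^sup>+u. 0 \<partial>(lborel :: real measure))"
      unfolding energy_def
    proof (rule nn_integral_cong_AE)
      show "AE u in lborel. hs_sq J (\<lambda>k. conv \<epsilon> x (real 0 / m) \<omega> u k - grid_term \<epsilon> x m n 0 \<omega> u k) = 0"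
        using AE_lborel_singleton[of 0] by eventually_elim (simp add: conv_def grid_term_def indicator_def)
    qed
    then have Z0: "sqrt \<epsilon> * norm (Z 0 \<omega>) \<le> \<eta>" using grid[of 0] by (simp add: grid_sum_def)
    have "(LINT u:{0..0}|lborel. S (\<epsilon> * (0 - u)) (F (\<epsilon> * u) (X \<epsilon> x u \<omega>))) = 0"
      unfolding set_lebesgue_integral_def
    proof (rule integral_eq_zero_AE)
      show "AE u in lborel. indicat_real {0..0} u *\<^sub>R S (\<epsilon> * (0 - u)) (F (\<epsilon> * u) (X \<epsilon> x u \<omega>)) = 0"
        using AE_lborel_singleton[of 0] by eventually_elim (simp add: indicator_def)
    qed
    then have "drift \<epsilon> x 0 \<omega> = 0" by (simp only: drift_def scaleR_zero_right)
    moreover have "S 0 = id_blinfun" using semigroup by (simp add: strongly_continuous_semigroup_def)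
    ultimately have "X \<epsilon> x 0 \<omega> = x + sqrt \<epsilon> *\<^sub>R Z 0 \<omega>" using mild[of 0 0] by simp
    then have "norm (X \<epsilon> x 0 \<omega>) \<le> norm x + sqrt \<epsilon> * norm (Z 0 \<omega>)" using norm_triangle_ineq[of x "sqrt \<epsilon> *\<^sub>R Z 0 \<omega>"] \<eta>0 by simp
    then show ?thesis using Z0 x R00 \<eta> by simp
  qed
  have "norm (X \<epsilon> x t \<omega> - z t) \<le> \<delta> / 2" if "t \<in> {0..1}" for t
    by (rule localisation[OF X_continuous[OF \<epsilon> \<omega>] zb X0 close _ that]) (use \<delta> in auto)
  then show ?thesis by (rule neighbourhood_of_sublevelI[OF zI X_continuous[OF \<epsilon> \<omega>] _ \<delta>])
qed

end

section \<open>Choice of the constants and conclusion\<close>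

context spde
begin

text \<open>The order of the choices matters. Radii and tolerances depend on the data alone; then
  comes the mesh through \<open>p\<close>, then \<open>n\<close> by (A1), then the compact set
  \<open>W\<close>, and only then \<epsilon>, so small that semigroup, drift and prefactors are
  under control.\<close>

theorem upper_bound:
  fixes K :: "'h set" and r \<delta> \<gamma> :: real
  assumes K: "compact K" and r: "0 < r" and \<delta>: "0 < \<delta>" and \<gamma>: "0 < \<gamma>"
  shows "\<exists>\<epsilon>\<^sub>0\<in>{0<..1}. \<forall>x\<in>K. \<forall>\<epsilon>\<in>{0<..\<epsilon>\<^sub>0}.
    prob {\<omega>\<in>space M. (\<lambda>t\<in>{0..1}. X \<epsilon> x t \<omega>) \<notin> neighbourhood_of path_space (rate_sublevel G x r) \<delta>} \<le> exp ((- r + \<gamma>) / \<epsilon>)"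
proof -
  obtain k0 where k0: "0 < k0" "\<And>x. x \<in> K \<Longrightarrow> norm x \<le> k0"
    using compact_imp_bounded[OF K] unfolding bounded_pos by blast
  define s where "s = sqrt (2 * r)"
  define R0 where "R0 = (1 + k0) * exp (2 * \<Lambda> * s) - 1"
  define R where "R = R0 + \<delta>"
  define B where "B = (\<Lambda> * (1 + R))\<^sup>2 * (C\<^sup>2 + 2 * C1)"
  define l where "l = sqrt (4 * B * r)"
  \<comment> \<open>The Gronwall factor of \<open>grid_comparison\<close>. The tolerances
    \<open>\<eta>\<close> and \<open>e3\<close> are divided by it in advance, and \<open>e\<close>
    is bounded accordingly.\<close>
  define Q where "Q = exp (C * \<Lambda> * s)"
  define \<eta> where "\<eta> = \<delta> / (16 * Q)"
  define \<kappa> where "\<kappa> = \<eta>\<^sup>2 / (4 * r)"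
  \<comment> \<open>Half of \<open>\<kappa>\<close> is reserved for the coordinates from
    \<open>n\<close> on, the other half for the mesh.\<close>
  define \<rho> where "\<rho> = sqrt (\<kappa> / (8 * C\<^sup>2))"
  have s0: "0 \<le> s" using r by (simp add: s_def)
  have R0: "0 < R0"
  proof -
    define w where "w = (1 + k0) * exp (2 * \<Lambda> * s)"
    have "(1 + k0) * 1 \<le> w" unfolding w_def using k0(1) Lambda s0 by (intro mult_left_mono) auto
    moreover have "R0 = w - 1" by (simp add: R0_def w_def)
    ultimately show ?thesis using k0(1) by simp
  qed
  then have Rpos: "0 < R" using \<delta> by (simp add: R_def)
  have B: "0 < B" unfolding B_def using Lambda Rpos C(1) C1(1) by (intro mult_pos_pos zero_less_power add_pos_pos) auto
  have l: "0 < l" "l\<^sup>2 = 4 * B * r" using B r by (simp_all add: l_def)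
  have Q: "1 \<le> Q" using C(1) Lambda s0 by (simp add: Q_def)
  have \<eta>: "0 < \<eta>" using \<delta> Q by (simp add: \<eta>_def)
  have \<eta>Q: "\<eta> * Q = \<delta> / 16" using Q by (simp add: \<eta>_def)
  have \<eta>\<delta>: "\<eta> \<le> \<delta>" using mult_left_mono[OF Q, of \<eta>] \<eta> \<eta>Q \<delta> by simp
  have \<kappa>: "0 < \<kappa>" using \<eta> r by (simp add: \<kappa>_def)
  have \<rho>: "0 < \<rho>" "4 * C\<^sup>2 * \<rho>\<^sup>2 = \<kappa> / 2" using \<kappa> C(1) by (simp_all add: \<rho>_def)
  \<comment> \<open>Chaining takes 9 of the 10; the rest is room for \<open>4 * e\<close>, the
    movement of the semigroup orbit and of the drift.\<close>
  define mo where "mo p = 10 * l * (9/10) ^ p" for p :: nat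
  define em where "em p = \<Lambda> * (1 + R0) * sqrt (2 * r / 2 ^ p)" for p :: nat
  have h0: "(\<lambda>p. sqrt (a / 2 ^ p)) \<longlonglongrightarrow> 0" for a :: real
  proof -
    have "(\<lambda>p. (1/2 :: real) ^ p) \<longlonglongrightarrow> 0" by (rule LIMSEQ_power_zero) simp
    then have "(\<lambda>p. sqrt (a * (1/2) ^ p)) \<longlonglongrightarrow> sqrt (a * 0)" by (intro tendsto_real_sqrt tendsto_mult tendsto_const)
    then show ?thesis by (simp add: power_one_over)
  qed
  have mo0: "mo \<longlonglongrightarrow> 0"
  proof -
    have "(\<lambda>p. (9/10 :: real) ^ p) \<longlonglongrightarrow> 0" by (rule LIMSEQ_power_zero) simp
    then have "(\<lambda>p. 10 * l * (9/10) ^ p) \<longlonglongrightarrow> 10 * l * 0" by (rule tendsto_mult[OF tendsto_const])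
    then show ?thesis by (simp add: mo_def[abs_def])
  qed
  have em0: "em \<longlonglongrightarrow> 0"
  proof -
    have "(\<lambda>p. \<Lambda> * (1 + R0) * sqrt (2 * r / 2 ^ p)) \<longlonglongrightarrow> \<Lambda> * (1 + R0) * 0" by (rule tendsto_mult[OF tendsto_const h0])
    then show ?thesis by (simp add: em_def[abs_def])
  qed
  let ?t = "\<lambda>p. mo p + em p + (\<Lambda> * em p * s + (C + 1) * \<Lambda> * s * (\<Lambda> * em p * s * exp (\<Lambda> * s))) * Q"
  let ?k = "\<lambda>p. 4 * C\<^sup>2 * (\<Lambda> * mo p)\<^sup>2 + 8 * C1 * (\<Lambda> * (1 + R))\<^sup>2 * sqrt (1 / 2 ^ p)"
  let ?s = "\<lambda>p. \<Lambda> * sqrt (2 * r / 2 ^ p)"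
  have "?t \<longlonglongrightarrow> 0 + 0 + (\<Lambda> * 0 * s + (C + 1) * \<Lambda> * s * (\<Lambda> * 0 * s * exp (\<Lambda> * s))) * Q"
    by (intro tendsto_add tendsto_mult tendsto_const mo0 em0)
  then have t0: "?t \<longlonglongrightarrow> 0" by simp
  have "?k \<longlonglongrightarrow> 4 * C\<^sup>2 * (\<Lambda> * 0)\<^sup>2 + 8 * C1 * (\<Lambda> * (1 + R))\<^sup>2 * 0"
    by (intro tendsto_add tendsto_power tendsto_mult tendsto_const mo0 h0)
  then have kt0: "?k \<longlonglongrightarrow> 0" by simp
  have "?s \<longlonglongrightarrow> \<Lambda> * 0" by (intro tendsto_mult tendsto_const h0)
  then have st0: "?s \<longlonglongrightarrow> 0" by simp
  \<comment> \<open>The final distance \<open>\<delta> / 2\<close> is eight sixteenths of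
    \<open>\<delta>\<close>: five for the terms that depend on the mesh alone, and one each for
    \<open>2 * e * Q\<close>, \<open>\<eta> * Q\<close> and \<open>real m * e3 * Q\<close>.\<close>
  have "\<forall>\<^sub>F p in sequentially. ?t p < 5 * \<delta> / 16 \<and> ?k p < \<kappa> / 2 \<and> ?s p < 1 / 2"
    using \<delta> \<kappa> by (intro eventually_conj order_tendstoD(2)[OF t0] order_tendstoD(2)[OF kt0] order_tendstoD(2)[OF st0]) auto
  then obtain p where p: "?t p < 5 * \<delta> / 16" "?k p < \<kappa> / 2" "?s p < 1 / 2"
    unfolding eventually_sequentially by blast
  define m where "m = (2 :: nat) ^ p"
  have mp: "real m = 2 ^ p" and m0: "0 < m" by (simp_all add: m_def)
  \<comment> \<open>The radius is \<open>R + 1\<close> because \<open>uniform_tail\<close> covers an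
    open ball, while the closed ball of radius \<open>R\<close> is needed.\<close>
  obtain n where n: "\<And>h. norm h < R + 1 \<Longrightarrow> hs_sq J (\<lambda>k. if k < n then 0 else G h (g k)) \<le> ennreal (\<rho>\<^sup>2)"
    using uniform_tail[of "R + 1" \<rho>] Rpos \<rho>(1) by auto
  let ?N = "J \<inter> {..<n}"
  let ?U = "{\<Sum>k\<in>?N. a k *\<^sub>R g k |a. \<forall>k\<in>?N. \<bar>a k\<bar> \<le> s}"
  have U: "compact ?U" by (rule compact_coefficient_box) simp
  obtain W where W: "compact W"
    "\<And>x c j. x \<in> K \<Longrightarrow> (\<And>i. i < m \<Longrightarrow> c i \<in> ?U) \<Longrightarrow> j < m \<Longrightarrow> G (euler c x j) (c j) \<in> W"
  proof (rule euler_increments_compact[OF K U, where m = m])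
    fix W assume W: "compact W"
      "\<And>x c j. x \<in> K \<Longrightarrow> (\<And>i. i < m \<Longrightarrow> c i \<in> ?U) \<Longrightarrow> j < m \<Longrightarrow> G (euler c x j) (c j) \<in> W"
    show thesis
    proof (rule that[OF W(1)])
      fix x and c :: "nat \<Rightarrow> 'u" and j assume "x \<in> K" "\<And>i. i < m \<Longrightarrow> c i \<in> ?U" "j < m"
      then show "G (euler c x j) (c j) \<in> W" by (rule W(2))
    qed
  qed
  define e where "e = min (l * (9/10) ^ p / 4) (\<delta> / (32 * Q))"
  define e3 where "e3 = \<delta> / (16 * Q * real m)"
  have e: "0 < e" "4 * e \<le> l * (9/10) ^ p" using l \<delta> Q by (simp_all add: e_def)
  have eQ: "e * Q \<le> \<delta> / 32" using mult_right_mono[of e "\<delta> / (32 * Q)" Q] Q by (simp add: e_def)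
  have e3: "0 < e3" using \<delta> Q m0 by (simp add: e3_def)
  have e3Q: "real m * e3 * Q = \<delta> / 16" using Q m0 by (simp add: e3_def)
  obtain d1 where d1: "0 < d1" "d1 \<le> 1" "\<And>v x. 0 \<le> v \<Longrightarrow> v \<le> d1 \<Longrightarrow> x \<in> K \<Longrightarrow> norm (S v x - x) < e"
    using semigroup_uniform_on_compact[OF semigroup K e(1)] by blast
  obtain d2 where d2: "0 < d2" "d2 \<le> 1" "\<And>v x. 0 \<le> v \<Longrightarrow> v \<le> d2 \<Longrightarrow> x \<in> W \<Longrightarrow> norm (S v x - x) < e3"
    using semigroup_uniform_on_compact[OF semigroup W(1) e3] by blast
  have CR: "0 < C * (1 + R)" using C(1) Rpos by simp
  obtain d3 where d3: "0 < d3" "\<And>\<epsilon>. 0 < \<epsilon> \<Longrightarrow> \<epsilon> \<le> d3 \<Longrightarrow> integral {0..\<epsilon>} \<nu> < e / (C * (1 + R))"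
    using nu_integral_small[OF divide_pos_pos[OF e(1) CR]] by blast
  \<comment> \<open>The sum of the prefactors of the three events. \<open>\<epsilon>0\<close> makes
    it at most \<open>exp (\<gamma> / 2 / \<epsilon>)\<close>, which uses the second half of
    \<gamma>.\<close>
  define c0 where "c0 = 4 + 2 * (real m + 1) + exp (r * real m * card ?N / \<gamma>)"
  have c0: "1 < c0" unfolding c0_def by (rule less_le_trans[of _ 4]) simp_all
  define \<epsilon>0 where "\<epsilon>0 = min d1 (min d2 (min d3 (min (r / (10 * ln 4)) (\<gamma> / (2 * ln c0)))))"
  have \<epsilon>0: "\<epsilon>0 \<in> {0<..1}" using d1 d2 d3 r \<gamma> c0 by (simp add: \<epsilon>0_def min_le_iff_disj)
  have "prob {\<omega>\<in>space M. (\<lambda>t\<in>{0..1}. X \<epsilon> x t \<omega>) \<notin> neighbourhood_of path_space (rate_sublevel G x r) \<delta>} \<le> exp ((- r + \<gamma>) / \<epsilon>)"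
    if x: "x \<in> K" and \<epsilon>\<epsilon>0: "\<epsilon> \<in> {0<..\<epsilon>0}" for x \<epsilon>
  proof -
    have \<epsilon>: "\<epsilon> \<in> {0<..1}" and \<epsilon>p: "0 < \<epsilon>" using \<epsilon>\<epsilon>0 \<epsilon>0 by auto
    have le: "\<epsilon> \<le> d1" "\<epsilon> \<le> d2" "\<epsilon> \<le> d3" "\<epsilon> \<le> r / (10 * ln 4)" "\<epsilon> \<le> \<gamma> / (2 * ln c0)" using \<epsilon>\<epsilon>0 by (simp_all add: \<epsilon>0_def)
    have small: "exp (- r / (10 * \<epsilon>)) \<le> 1 / 4"
    proof -
      have "ln 4 \<le> r / (10 * \<epsilon>)" using le(4) \<epsilon>p by (simp add: pos_le_divide_eq mult_ac)
      then have "exp (- r / (10 * \<epsilon>)) \<le> exp (- ln 4)" by simp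
      then show ?thesis by (simp add: exp_minus)
    qed
    have c0\<epsilon>: "c0 \<le> exp (\<gamma> / 2 / \<epsilon>)"
    proof -
      have "0 < ln c0" using c0 by simp
      then have "ln c0 \<le> \<gamma> / 2 / \<epsilon>" using le(5) \<epsilon>p by (simp add: pos_le_divide_eq mult_ac)
      then have "exp (ln c0) \<le> exp (\<gamma> / 2 / \<epsilon>)" by (simp only: exp_le_cancel_iff)
      then show ?thesis using c0 by simp
    qed
    obtain Z where Z: "\<And>t. t \<in> {0..1} \<Longrightarrow> ito (conv \<epsilon> x t) (Z t)"
      and Zm: "\<And>t. t \<in> {0..1} \<Longrightarrow> AE \<omega> in M. X \<epsilon> x t \<omega> = S (\<epsilon> * t) x + drift \<epsilon> x t \<omega> + sqrt \<epsilon> *\<^sub>R Z t \<omega>"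
      using convolution_exists[OF \<epsilon>, of x] by blast
    let ?mild = "\<lambda>t \<omega>. X \<epsilon> x t \<omega> = S (\<epsilon> * t) x + drift \<epsilon> x t \<omega> + sqrt \<epsilon> *\<^sub>R Z t \<omega>"
    \<comment> \<open>The dyadic times are countable, so one null set serves for all of
      them.\<close>
    have "AE \<omega> in M. \<forall>q k :: nat. k \<le> 2 ^ q \<longrightarrow> ?mild (real k / 2 ^ q) \<omega>"
      unfolding AE_all_countable
    proof (intro allI)
      fix q k :: nat
      show "AE \<omega> in M. k \<le> 2 ^ q \<longrightarrow> ?mild (real k / 2 ^ q) \<omega>"
      proof (cases "k \<le> 2 ^ q")
        case True
        then have "real k \<le> real (2 ^ q)" by (simp only: of_nat_le_iff)
        then have "real k / 2 ^ q \<in> {0..1}" by simp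
        from Zm[OF this] show ?thesis by eventually_elim simp
      qed simp
    qed
    then obtain N0 where N0: "N0 \<in> null_sets M" "{\<omega>\<in>space M. \<not> (\<forall>q k :: nat. k \<le> 2 ^ q \<longrightarrow> ?mild (real k / 2 ^ q) \<omega>)} \<subseteq> N0"
      unfolding eventually_ae_filter by blast
    define B1 where "B1 = (\<Union>q. \<Union>k<2 ^ q. {\<omega>\<in>space M. l * (9/10) ^ q < sqrt \<epsilon> * norm (Z (real (Suc k) / 2 ^ q) \<omega> - Z (real k / 2 ^ q) \<omega>) \<and>
      energy J (\<lambda>\<omega> u j. conv \<epsilon> x (real (Suc k) / 2 ^ q) \<omega> u j - conv \<epsilon> x (real k / 2 ^ q) \<omega> u j) \<omega> \<le> ennreal (B * sqrt (1 / 2 ^ q))})"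
    define B2 where "B2 = (\<Union>i\<le>m. {\<omega>\<in>space M. \<eta> < sqrt \<epsilon> * norm (Z (real i / real m) \<omega> - grid_sum \<epsilon> x m n i \<omega>) \<and>
      energy J (\<lambda>\<omega> u j. conv \<epsilon> x (real i / real m) \<omega> u j - grid_term \<epsilon> x m n i \<omega> u j) \<omega> \<le> ennreal (\<eta>\<^sup>2 / (4 * r))})"
    define B3 where "B3 = {\<omega>\<in>space M. 2 * r < real m * (\<Sum>j<m. \<Sum>k\<in>?N. (sqrt \<epsilon> * (\<beta> k (real (Suc j) / m) \<omega> - \<beta> k (real j / m) \<omega>))\<^sup>2)}"
    have B1: "B1 \<in> sets M" "prob B1 \<le> 4 * exp (- r / \<epsilon>)"
      unfolding B1_def by (rule increment_events[OF Z \<epsilon>p r B l small], assumption)+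
    have B2: "B2 \<in> sets M" "prob B2 \<le> 2 * (real m + 1) * exp (- r / \<epsilon>)"
      unfolding B2_def by (rule grid_events[OF Z \<epsilon> r \<eta> m0], assumption)+
    have B3: "B3 \<in> sets M" "prob B3 \<le> exp (r * real m * card ?N / \<gamma>) * exp ((- r + \<gamma> / 2) / \<epsilon>)"
      unfolding B3_def by (rule control_event[OF \<epsilon>p r \<gamma> m0])+
    have good: "(\<lambda>t\<in>{0..1}. X \<epsilon> x t \<omega>) \<in> neighbourhood_of path_space (rate_sublevel G x r) \<delta>"
      if \<omega>: "\<omega> \<in> space M" and not: "\<omega> \<notin> N0" "\<omega> \<notin> B1" "\<omega> \<notin> B2" "\<omega> \<notin> B3" for \<omega>
    proof (rule path_near_sublevel[where m = m and p = p and n = n and ?k0.0 = k0 and l = l and \<kappa> = \<kappa> and \<eta> = \<eta> and \<rho> = \<rho> and ?e1.0 = e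
          and ?e2.0 = e and ?e3.0 = e3 and mo = "mo p" and em = "em p" and s = s and ?R0.0 = R0 and R = R and Z = Z and W = W,
          OF s_def R0_def R_def _ \<epsilon> \<omega> k0(2)[OF x] r \<delta> mp less_imp_le[OF l(1)] \<eta>\<delta>])
      show "em p = \<Lambda> * (1 + R0) * sqrt (2 * r / real m)" by (simp add: em_def mp)
      show "?mild (real k / 2 ^ q) \<omega>" if "k \<le> 2 ^ q" for q k using N0(2) not(1) \<omega> that by blast
      show "real m * (\<Sum>j<m. \<Sum>k\<in>?N. (sqrt \<epsilon> * (\<beta> k (real (Suc j) / m) \<omega> - \<beta> k (real j / m) \<omega>))\<^sup>2) \<le> 2 * r"
        using not(4) \<omega> unfolding B3_def mem_Collect_eq by linarith
      show "sqrt \<epsilon> * norm (Z (real (Suc k) / 2 ^ q) \<omega> - Z (real k / 2 ^ q) \<omega>) \<le> l * (9/10) ^ q"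
        if "k < 2 ^ q" "energy J (\<lambda>\<omega> u j. conv \<epsilon> x (real (Suc k) / 2 ^ q) \<omega> u j - conv \<epsilon> x (real k / 2 ^ q) \<omega> u j) \<omega>
          \<le> ennreal ((\<Lambda> * (1 + R))\<^sup>2 * (C\<^sup>2 + 2 * C1) * sqrt (1 / 2 ^ q))" for q k
        using not(2) \<omega> that unfolding B1_def B_def UN_iff mem_Collect_eq by (meson UNIV_I lessThan_iff not_less)
      show "sqrt \<epsilon> * norm (Z (real i / real m) \<omega> - grid_sum \<epsilon> x m n i \<omega>) \<le> \<eta>"
        if "i \<le> m" "energy J (\<lambda>\<omega> u j. conv \<epsilon> x (real i / real m) \<omega> u j - grid_term \<epsilon> x m n i \<omega> u j) \<omega> \<le> ennreal \<kappa>" for i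
        using not(3) \<omega> that unfolding B2_def \<kappa>_def UN_iff mem_Collect_eq by (meson atMost_iff not_less)
      show "norm (S v x - x) \<le> e" if "0 \<le> v" "v \<le> \<epsilon>" for v using d1(3)[of v x] that le(1) x by simp
      show "C * (1 + R) * integral {0..\<epsilon>} \<nu> \<le> e" using d3(2)[OF \<epsilon>p le(3)] CR by (simp add: pos_less_divide_eq mult.commute)
      show "2 * e + 2 * e + 9 * l * (9/10) ^ p \<le> mo p" using e(2) by (simp add: mo_def)
      show "hs_sq J (\<lambda>k. if k < n then 0 else G h (g k)) \<le> ennreal (\<rho>\<^sup>2)" if "norm h \<le> R" for h by (rule n) (use that in simp)
      show "4 * C\<^sup>2 * (\<Lambda> * mo p)\<^sup>2 + 4 * C\<^sup>2 * \<rho>\<^sup>2 + 8 * C1 * (\<Lambda> * (1 + R))\<^sup>2 * sqrt (1 / real m) \<le> \<kappa>"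
        using p(2) unfolding \<rho>(2) mp by linarith
      show "\<Lambda> * sqrt (2 * r / real m) \<le> 1 / 2" using p(3) unfolding mp by linarith
      show "0 \<le> e3" using e3 by simp
      show "norm (S v y - y) \<le> e3" if "0 \<le> v" "v \<le> \<epsilon>" "y \<in> W" for v y using d2(3)[of v y] that le(2) by simp
      show "G (euler c x j) (c j) \<in> W" if "\<And>i. i < m \<Longrightarrow> c i \<in> ?U" "j < m" for c j by (rule W(2)[OF x that])
      have "((e + e + \<eta>) + real m * e3 + \<Lambda> * em p * s + (C + 1) * \<Lambda> * s * (\<Lambda> * em p * s * exp (\<Lambda> * s))) * Q
          = e * Q + e * Q + \<eta> * Q + real m * e3 * Q + (\<Lambda> * em p * s + (C + 1) * \<Lambda> * s * (\<Lambda> * em p * s * exp (\<Lambda> * s))) * Q"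
        by (simp only: distrib_right add.assoc)
      then show "mo p + em p + ((e + e + \<eta>) + real m * e3 + \<Lambda> * em p * s + (C + 1) * \<Lambda> * s * (\<Lambda> * em p * s * exp (\<Lambda> * s))) * exp (C * \<Lambda> * s) \<le> \<delta> / 2"
        unfolding Q_def[symmetric] using p(1) eQ \<eta>Q e3Q by linarith
    qed
    have sets: "N0 \<in> sets M" "prob N0 = 0" using N0(1) by (auto simp: null_sets_def measure_def)
    let ?A = "{\<omega>\<in>space M. (\<lambda>t\<in>{0..1}. X \<epsilon> x t \<omega>) \<notin> neighbourhood_of path_space (rate_sublevel G x r) \<delta>}"
    have sub: "?A \<subseteq> N0 \<union> (B1 \<union> (B2 \<union> B3))" using good by blast
    \<comment> \<open>A set outside the \<sigma>-algebra has measure 0 by convention, so in that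
      case the estimate is trivial.\<close>
    have "prob ?A \<le> prob (N0 \<union> (B1 \<union> (B2 \<union> B3)))"
    proof (cases "?A \<in> sets M")
      case True
      show ?thesis by (rule finite_measure_mono[OF sub]) (use sets B1 B2 B3 in auto)
    qed (simp add: measure_notin_sets)
    also have "\<dots> \<le> prob N0 + (prob B1 + (prob B2 + prob B3))"
      using sets B1(1) B2(1) B3(1)
      by (meson add_left_mono measure_Un_le order_trans sets.Un)
    also have "\<dots> \<le> (4 + 2 * (real m + 1)) * exp (- r / \<epsilon>) + exp (r * real m * card ?N / \<gamma>) * exp ((- r + \<gamma> / 2) / \<epsilon>)"
      using sets(2) B1(2) B2(2) B3(2) by (simp add: distrib_right)
    also have "\<dots> \<le> c0 * exp ((- r + \<gamma> / 2) / \<epsilon>)"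
    proof -
      have "- r / \<epsilon> \<le> (- r + \<gamma> / 2) / \<epsilon>" using \<epsilon>p \<gamma> by (intro divide_right_mono) auto
      then have "(4 + 2 * (real m + 1)) * exp (- r / \<epsilon>) \<le> (4 + 2 * (real m + 1)) * exp ((- r + \<gamma> / 2) / \<epsilon>)" by (intro mult_left_mono) auto
      then show ?thesis unfolding c0_def distrib_right[of "4 + 2 * (real m + 1)"] by linarith
    qed
    also have "\<dots> \<le> exp (\<gamma> / 2 / \<epsilon>) * exp ((- r + \<gamma> / 2) / \<epsilon>)" using c0\<epsilon> by (intro mult_right_mono) auto
    also have "\<dots> = exp ((- r + \<gamma>) / \<epsilon>)" unfolding exp_add[symmetric] add_divide_distrib[symmetric] by simp
    finally show ?thesis .
  qed
  then show ?thesis using \<epsilon>0 by blast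
qed

end
theorem theorem3:
  fixes M :: "'a measure"
    and Fil :: "real \<Rightarrow> 'a measure"
    and J :: "nat set"
    and g :: "nat \<Rightarrow> 'u::{real_inner, banach, second_countable_topology}"
    and \<beta> :: "nat \<Rightarrow> real \<Rightarrow> 'a \<Rightarrow> real"
    and S :: "real \<Rightarrow> 'h::{real_inner, banach, second_countable_topology} \<Rightarrow>\<^sub>L 'h"
    and F :: "real \<Rightarrow> 'h \<Rightarrow> 'h"
    and G :: "'h \<Rightarrow> 'u \<Rightarrow>\<^sub>L 'h"
    and \<nu> :: "real \<Rightarrow> real"
    and \<Lambda> :: real
    and X :: "real \<Rightarrow> 'h \<Rightarrow> real \<Rightarrow> 'a \<Rightarrow> 'h"
    and K :: "'h set"
    and r \<delta> \<gamma> :: real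
  assumes prob: "prob_space M"
    and filtration: "usual_filtration M Fil"
    and basis: "orthonormal_basis J g"
    and noise: "independent_brownian_motions M Fil J \<beta>"
    and semigroup: "strongly_continuous_semigroup S"
    and F_measurable: "(\<lambda>(t, x). F t x) \<in> borel_measurable (restrict_space borel ({0..1} \<times> UNIV))"
    and nu: "\<nu> \<in> L2_unit_interval"
    and Lambda: "\<Lambda> > 0"
    and F_Lipschitz: "\<forall>t\<in>{0..1}. \<forall>x y. norm (F t x - F t y) \<le> \<nu> t * norm (x - y)"
    and F_growth: "\<forall>t\<in>{0..1}. \<forall>x. norm (F t x) \<le> \<nu> t * (1 + norm x)"
    and G_hilbert_schmidt: "\<forall>x. hilbert_schmidt J g (G x)"
    and G_Lipschitz: "\<forall>x y. hs_norm J g (G x - G y) \<le> \<Lambda> * norm (x - y)"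
    and G_growth: "\<forall>x. hs_norm J g (G x) \<le> \<Lambda> * (1 + norm x)"
    and X_solution: "\<forall>\<epsilon>\<in>{0<..1}. \<forall>x. small_time_mild_solution M Fil J g \<beta> S F G \<epsilon> x (X \<epsilon> x)"
    and A1: "\<forall>R>0. (\<lambda>n. SUP h\<in>ball 0 R. hs_norm J g (G h o\<^sub>L (id_blinfun - basis_projection J g n)))
               \<longlonglongrightarrow> 0"
    and A2: "\<forall>a\<in>{0<..1}. uniformly_equicontinuous_on {a..1} {\<lambda>t. S (\<epsilon> * t) |\<epsilon>. \<epsilon> \<in> {0<..1}}"
    and K: "compact K"
    and r: "r > 0" and delta: "\<delta> > 0" and gamma: "\<gamma> > 0"
  shows "\<exists>\<epsilon>\<^sub>0\<in>{0<..1}. \<forall>x\<in>K. \<forall>\<epsilon>\<in>{0<..\<epsilon>\<^sub>0}.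
           measure M {\<omega>\<in>space M. (\<lambda>t\<in>{0..1}. X \<epsilon> x t \<omega>) \<notin>
               neighbourhood_of path_space (rate_sublevel G x r) \<delta>}
             \<le> exp ((- r + \<gamma>) / \<epsilon>)"
proof -
  obtain C where C: "C \<ge> 1" "\<And>t. 0 \<le> t \<Longrightarrow> t \<le> 1 \<Longrightarrow> norm (S t) \<le> C"
    using semigroup_bounded_unit_interval[OF semigroup] by blast
  obtain C1 where C1: "C1 > 0" "\<And>\<tau> \<sigma>. 0 < \<tau> \<Longrightarrow> 0 \<le> \<sigma> \<Longrightarrow> \<tau> + \<sigma> \<le> 1 \<Longrightarrow> (norm (S (\<tau> + \<sigma>) - S \<tau>))\<^sup>2 \<le> C1 * sqrt (\<sigma> / \<tau>)"
    using semigroup_increment_bound[OF semigroup A2] by blast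
  interpret prob_space M by (rule prob)
  interpret spde M Fil J \<beta> g S F G \<nu> \<Lambda> X C C1
    by unfold_locales
      (use filtration noise basis semigroup nu Lambda F_growth G_hilbert_schmidt G_Lipschitz G_growth X_solution A1 C C1 in blast)+
  show ?thesis by (rule upper_bound[OF K r delta gamma])
qed

end
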